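(* Let $n\in\{2,3\}$ and let $\Omega\subset\mathbb{R}^n$ be a bounded domain which supports the Hardy inequality, with Hardy constant $H_\Omega<\infty$. (a) $\Omega$ supports the Friedrichs-Velte inequality, and simultaneously the Babuška-Aziz inequality for the divergence, if and only if $\Omega$ supports the improved Poincaré inequality (for the gradient). Moreover, $$\frac14\,\Gamma_\Omega\le P_\Omega\le H_\Omega\,(1+\Gamma_\Omega).$$ (b) If $n=3$, then $\Omega$ supports the second Friedrichs-Velte inequality, and simultaneously the Babuška-Aziz inequality for the rotation, if and only if $\Omega$ supports the improved Poincaré inequality for the rotation. Moreover, $$\frac14\,\tilde\Gamma_\Omega\le \tilde P_\Omega\le H_\Omega\,(1+\tilde\Gamma_\Omega).$$
   Context: Functions are real-valued, $\|\cdot\|$ is the $L_2(\Omega)$ norm (of scalar or vector functions), $f_\Omega=\frac1{|\Omega|}\int_\Omega f$, $|f|_1=\|\nabla f\|$ on $H_0^1(\Omega)$ (and on vector fields with components there), and $d_\Omega(x)=\mathrm{dist}(x,\partial\Omega)$. $\mathrm{rot}$ denotes the curl in $\mathbb{R}^3$. Derivatives are in the distributional sense. In each case "supports" means that a finite constant with the stated property exists, and the named constant of the domain is the least such constant. Conjugate harmonic functions: for $n=2$, scalar functions $u,v$ with $\nabla u=\nabla^{\bot}v$, where $\nabla^\bot=(\partial_2,-\partial_1)$; for $n=3$, a scalar function $u$ and a vector field $v$ with $\mathrm{rot}\,v=\nabla u$ and $\mathrm{div}\,v=0$. Hardy inequality (constant $H_\Omega$): $\int_\Omega \frac{|u|^2}{d_\Omega^2}\le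 H\int_\Omega|\nabla u|^2$ for every $u\in H_0^1(\Omega)^n$. Friedrichs-Velte inequality (constant $\Gamma_\Omega$): $\|u\|^2\le\Gamma\|v\|^2$ for every pair of square integrable conjugate harmonic functions $u,v$ on $\Omega$ with $u_\Omega=0$. Second Friedrichs-Velte inequality ($n=3$, constant $\tilde\Gamma_\Omega$): $\|v\|^2\le\tilde\Gamma\|u\|^2$ for every pair of square integrable conjugate harmonic functions $u,v$ on $\Omega$ such that $v$ belongs to the orthogonal complement in $L_2(\Omega)^3$ of the kernel of $\mathrm{rot}$, i.e. of $\{w\in L_2(\Omega)^3:\mathrm{rot}\,w=0\}$. Babuška-Aziz inequality for the divergence: there is a constant $C$ such that for every $u\in L_2(\Omega)$ with $u_\Omega=0$ there is $v\in H_0^1(\Omega)^n$ with $\mathrm{div}\,v=u$ and $|v|_1^2\le C\|u\|^2$. Babuška-Aziz inequality for the rotation ($n=3$): there is a constant $\tilde C$ such that $|v|_1^2\le\tilde C\|\mathrm{rot}\,v\|^2$ for every $v$ in the orthogonal complement of the kernel of $\mathrm{rot}$ in $H_0^1(\Omega)^3$ (orthogonality with respect to the inner product inducing $|\cdot|_1$). Improved Poincaré inequality (constant $P_\Omega$): $\|u-u_\Omega\|^2\le P\|d_\Omega\nabla u\|^2$ for every $u\in L_{1,loc}(\Omega)$ with $d_\Omega\nabla u\in L_2(\Omega)^n$ (it being part of the inequality that $u$ is integrable, so that $u_\Omega$ is meaningful). Improved Poincaré inequality for the rotation ($n=3$, constant $\tilde P_\Omega$): $\|v\|^2\le\tilde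 P\|d_\Omega\,\mathrm{rot}\,v\|^2$ for every $v$ in the orthogonal complement in $L_2(\Omega)^3$ of the kernel of $\mathrm{rot}$ (the right-hand side being $+\infty$ if $d_\Omega\,\mathrm{rot}\,v\notin L_2(\Omega)^3$). *)

theory Defs
  imports "HOL-Analysis.Analysis"
begin

section \<open>Domains and square integrable functions\<close>

definition bounded_domain :: "'a::euclidean_space set \<Rightarrow> bool" where
  "bounded_domain \<Omega> \<longleftrightarrow> open \<Omega> \<and> connected \<Omega> \<and> \<Omega> \<noteq> {} \<and> bounded \<Omega>"

definition bdist :: "'a::euclidean_space set \<Rightarrow> 'a \<Rightarrow> real" where
  "bdist \<Omega> x = infdist x (frontier \<Omega>)"

text \<open>Elements of function spaces are represented by functions on the whole space; only their
  values on \<open>\<Omega>\<close> matter, and only up to null sets.\<close>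

definition locally_integrable ::
  "'a::euclidean_space set \<Rightarrow> ('a \<Rightarrow> 'b::euclidean_space) \<Rightarrow> bool" where
  "locally_integrable \<Omega> f \<longleftrightarrow>
     (\<forall>K. compact K \<and> K \<subseteq> \<Omega> \<longrightarrow> integrable (lebesgue_on K) f)"

definition L2 :: "'a::euclidean_space set \<Rightarrow> ('a \<Rightarrow> 'b::euclidean_space) set" where
  "L2 \<Omega> = {f. f \<in> borel_measurable (lebesgue_on \<Omega>) \<and>
              integrable (lebesgue_on \<Omega>) (\<lambda>x. (norm (f x))\<^sup>2)}"

definition l2_inner ::
  "'a::euclidean_space set \<Rightarrow> ('a \<Rightarrow> 'b::euclidean_space) \<Rightarrow> ('a \<Rightarrow> 'b) \<Rightarrow> real" where
  "l2_inner \<Omega> f g = (\<integral>x. f x \<bullet> g x \<partial>lebesgue_on \<Omega>)"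

definition l2_norm ::
  "'a::euclidean_space set \<Rightarrow> ('a \<Rightarrow> 'b::euclidean_space) \<Rightarrow> real" where
  "l2_norm \<Omega> f = sqrt (\<integral>x. (norm (f x))\<^sup>2 \<partial>lebesgue_on \<Omega>)"

definition mean :: "'a::euclidean_space set \<Rightarrow> ('a \<Rightarrow> real) \<Rightarrow> real" where
  "mean \<Omega> u = (\<integral>x. u x \<partial>lebesgue_on \<Omega>) / measure lebesgue \<Omega>"


section \<open>Test functions and distributional derivatives\<close>

definition pd :: "'n::finite \<Rightarrow> (real^'n \<Rightarrow> real) \<Rightarrow> real^'n \<Rightarrow> real" where
  "pd i f x = frechet_derivative f (at x) (axis i 1)"

primrec C_k :: "nat \<Rightarrow> (real^'n \<Rightarrow> real) \<Rightarrow> bool" where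
  "C_k 0 f \<longleftrightarrow> continuous_on UNIV f"
| "C_k (Suc k) f \<longleftrightarrow> (\<forall>x. f differentiable (at x)) \<and> (\<forall>i. C_k k (pd i f))"

definition test_functions :: "(real^'n) set \<Rightarrow> (real^'n \<Rightarrow> real) set" where
  "test_functions \<Omega> = {\<phi>. (\<forall>k. C_k k \<phi>) \<and>
     compact (closure {x. \<phi> x \<noteq> 0}) \<and> closure {x. \<phi> x \<noteq> 0} \<subseteq> \<Omega>}"

text \<open>A (vector valued) distribution on \<open>\<Omega>\<close> is represented by a functional
  of which only the restriction to \<open>test_functions \<Omega>\<close> matters.\<close>

definition distr_eq ::
  "(real^'n) set \<Rightarrow> ((real^'n \<Rightarrow> real) \<Rightarrow> 'b) \<Rightarrow> ((real^'n \<Rightarrow> real) \<Rightarrow> 'b) \<Rightarrow> bool" where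
  "distr_eq \<Omega> F G \<longleftrightarrow> (\<forall>\<phi>\<in>test_functions \<Omega>. F \<phi> = G \<phi>)"

definition distr_pd ::
  "(real^'n) set \<Rightarrow> 'n \<Rightarrow> (real^'n \<Rightarrow> real) \<Rightarrow> (real^'n \<Rightarrow> real) \<Rightarrow> real" where
  "distr_pd \<Omega> i u \<phi> = - (\<integral>x. u x * pd i \<phi> x \<partial>lebesgue_on \<Omega>)"

definition distr_grad ::
  "(real^'n) set \<Rightarrow> (real^'n \<Rightarrow> real) \<Rightarrow> (real^'n \<Rightarrow> real) \<Rightarrow> real^'n" where
  "distr_grad \<Omega> u \<phi> = (\<chi> i. distr_pd \<Omega> i u \<phi>)"

definition distr_div ::
  "(real^'n) set \<Rightarrow> (real^'n \<Rightarrow> real^'n) \<Rightarrow> (real^'n \<Rightarrow> real) \<Rightarrow> real" where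
  "distr_div \<Omega> v \<phi> = (\<Sum>i\<in>UNIV. distr_pd \<Omega> i (\<lambda>x. v x $ i) \<phi>)"

definition distr_grad_perp ::
  "(real^2) set \<Rightarrow> (real^2 \<Rightarrow> real) \<Rightarrow> (real^2 \<Rightarrow> real) \<Rightarrow> real^2" where
  "distr_grad_perp \<Omega> v \<phi> = vector [distr_pd \<Omega> 2 v \<phi>, - distr_pd \<Omega> 1 v \<phi>]"

definition distr_rot ::
  "(real^3) set \<Rightarrow> (real^3 \<Rightarrow> real^3) \<Rightarrow> (real^3 \<Rightarrow> real) \<Rightarrow> real^3" where
  "distr_rot \<Omega> v \<phi> = vector
     [distr_pd \<Omega> 2 (\<lambda>x. v x $ 3) \<phi> - distr_pd \<Omega> 3 (\<lambda>x. v x $ 2) \<phi>,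
      distr_pd \<Omega> 3 (\<lambda>x. v x $ 1) \<phi> - distr_pd \<Omega> 1 (\<lambda>x. v x $ 3) \<phi>,
      distr_pd \<Omega> 1 (\<lambda>x. v x $ 2) \<phi> - distr_pd \<Omega> 2 (\<lambda>x. v x $ 1) \<phi>]"

text \<open>The distribution \<open>F\<close> is (given by) the locally integrable function \<open>f\<close>.\<close>

definition is_function ::
  "(real^'n) set \<Rightarrow> ((real^'n \<Rightarrow> real) \<Rightarrow> 'b) \<Rightarrow> (real^'n \<Rightarrow> 'b::euclidean_space) \<Rightarrow> bool" where
  "is_function \<Omega> F f \<longleftrightarrow> locally_integrable \<Omega> f \<and>
     distr_eq \<Omega> F (\<lambda>\<phi>. \<integral>x. \<phi> x *\<^sub>R f x \<partial>lebesgue_on \<Omega>)"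

text \<open>The gradient and the rotation as functions. If the distributional derivative is a locally
  integrable function, the chosen representative is unique up to null sets; otherwise the value is
  meaningless. Both are used below for functions in \<open>H1\<close> only.\<close>

definition wgrad :: "(real^'n) set \<Rightarrow> (real^'n \<Rightarrow> real) \<Rightarrow> real^'n \<Rightarrow> real^'n" where
  "wgrad \<Omega> u = (SOME g. is_function \<Omega> (distr_grad \<Omega> u) g)"

definition wrot :: "(real^3) set \<Rightarrow> (real^3 \<Rightarrow> real^3) \<Rightarrow> real^3 \<Rightarrow> real^3" where
  "wrot \<Omega> v = (SOME r. is_function \<Omega> (distr_rot \<Omega> v) r)"


section \<open>Sobolev spaces\<close>

definition H1 :: "(real^'n) set \<Rightarrow> (real^'n \<Rightarrow> real) set" where
  "H1 \<Omega> = {u \<in> L2 \<Omega>. \<exists>g\<in>L2 \<Omega>. is_function \<Omega> (distr_grad \<Omega> u) g}"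

text \<open>The closure of the test functions in \<open>H1\<close>.\<close>

definition H10 :: "(real^'n) set \<Rightarrow> (real^'n \<Rightarrow> real) set" where
  "H10 \<Omega> = {u \<in> H1 \<Omega>. \<exists>\<phi>::nat \<Rightarrow> real^'n \<Rightarrow> real. (\<forall>k. \<phi> k \<in> test_functions \<Omega>) \<and>
     (\<lambda>k. l2_norm \<Omega> (\<lambda>x. u x - \<phi> k x)) \<longlonglongrightarrow> 0 \<and>
     (\<lambda>k. l2_norm \<Omega> (\<lambda>x. wgrad \<Omega> u x - (\<chi> i. pd i (\<phi> k) x))) \<longlonglongrightarrow> 0}"

definition H10_vec :: "(real^'n) set \<Rightarrow> (real^'n \<Rightarrow> real^'n) set" where
  "H10_vec \<Omega> = {v. \<forall>i. (\<lambda>x. v x $ i) \<in> H10 \<Omega>}"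

definition h1_inner ::
  "(real^'n) set \<Rightarrow> (real^'n \<Rightarrow> real^'n) \<Rightarrow> (real^'n \<Rightarrow> real^'n) \<Rightarrow> real" where
  "h1_inner \<Omega> v w =
     (\<Sum>i\<in>UNIV. l2_inner \<Omega> (wgrad \<Omega> (\<lambda>x. v x $ i)) (wgrad \<Omega> (\<lambda>x. w x $ i)))"

definition h1_norm :: "(real^'n) set \<Rightarrow> (real^'n \<Rightarrow> real^'n) \<Rightarrow> real" where
  "h1_norm \<Omega> v = sqrt (\<Sum>i\<in>UNIV. (l2_norm \<Omega> (wgrad \<Omega> (\<lambda>x. v x $ i)))\<^sup>2)"

definition ker_rot :: "(real^3) set \<Rightarrow> (real^3 \<Rightarrow> real^3) set" where
  "ker_rot \<Omega> = {w. distr_eq \<Omega> (distr_rot \<Omega> w) (\<lambda>\<phi>. 0)}"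

definition L2_ker_rot_orth :: "(real^3) set \<Rightarrow> (real^3 \<Rightarrow> real^3) set" where
  "L2_ker_rot_orth \<Omega> = {v \<in> L2 \<Omega>. \<forall>w \<in> L2 \<Omega> \<inter> ker_rot \<Omega>. l2_inner \<Omega> v w = 0}"

definition H10_ker_rot_orth :: "(real^3) set \<Rightarrow> (real^3 \<Rightarrow> real^3) set" where
  "H10_ker_rot_orth \<Omega> = {v \<in> H10_vec \<Omega>. \<forall>w \<in> H10_vec \<Omega> \<inter> ker_rot \<Omega>. h1_inner \<Omega> v w = 0}"


section \<open>Conjugate harmonic functions\<close>

definition conj_harmonic2 ::
  "(real^2) set \<Rightarrow> (real^2 \<Rightarrow> real) \<Rightarrow> (real^2 \<Rightarrow> real) \<Rightarrow> bool" where
  "conj_harmonic2 \<Omega> u v \<longleftrightarrow> distr_eq \<Omega> (distr_grad \<Omega> u) (distr_grad_perp \<Omega> v)"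

definition conj_harmonic3 ::
  "(real^3) set \<Rightarrow> (real^3 \<Rightarrow> real) \<Rightarrow> (real^3 \<Rightarrow> real^3) \<Rightarrow> bool" where
  "conj_harmonic3 \<Omega> u v \<longleftrightarrow>
     distr_eq \<Omega> (distr_rot \<Omega> v) (distr_grad \<Omega> u) \<and> distr_eq \<Omega> (distr_div \<Omega> v) (\<lambda>\<phi>. 0)"


section \<open>The inequalities\<close>

text \<open>Each inequality is a predicate on its constant. Since non-integrable functions have Bochner
  integral zero, square integrability is stated wherever it is part of the inequality.\<close>

definition supports :: "(real \<Rightarrow> bool) \<Rightarrow> bool" where
  "supports I \<longleftrightarrow> (\<exists>C. I C)"

definition least_constant :: "(real \<Rightarrow> bool) \<Rightarrow> real" where
  "least_constant I = (LEAST C. I C)"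

definition hardy :: "(real^'n) set \<Rightarrow> real \<Rightarrow> bool" where
  "hardy \<Omega> H \<longleftrightarrow> (\<forall>u \<in> H10_vec \<Omega>.
     (\<lambda>x. u x /\<^sub>R bdist \<Omega> x) \<in> L2 \<Omega> \<and>
     (l2_norm \<Omega> (\<lambda>x. u x /\<^sub>R bdist \<Omega> x))\<^sup>2 \<le> H * (h1_norm \<Omega> u)\<^sup>2)"

text \<open>The first argument is the notion of conjugate harmonic functions,
  \<open>conj_harmonic2\<close> or \<open>conj_harmonic3\<close> according to the dimension.\<close>

definition friedrichs_velte ::
  "((real^'n) set \<Rightarrow> (real^'n \<Rightarrow> real) \<Rightarrow> (real^'n \<Rightarrow> 'b::euclidean_space) \<Rightarrow> bool) \<Rightarrow>
     (real^'n) set \<Rightarrow> real \<Rightarrow> bool" where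
  "friedrichs_velte conj_harmonic \<Omega> \<Gamma> \<longleftrightarrow>
     (\<forall>u \<in> L2 \<Omega>. \<forall>v \<in> L2 \<Omega>. conj_harmonic \<Omega> u v \<and> mean \<Omega> u = 0 \<longrightarrow>
        (l2_norm \<Omega> u)\<^sup>2 \<le> \<Gamma> * (l2_norm \<Omega> v)\<^sup>2)"

definition friedrichs_velte_second :: "(real^3) set \<Rightarrow> real \<Rightarrow> bool" where
  "friedrichs_velte_second \<Omega> \<Gamma> \<longleftrightarrow>
     (\<forall>u \<in> L2 \<Omega>. \<forall>v \<in> L2_ker_rot_orth \<Omega>. conj_harmonic3 \<Omega> u v \<longrightarrow>
        (l2_norm \<Omega> v)\<^sup>2 \<le> \<Gamma> * (l2_norm \<Omega> u)\<^sup>2)"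

definition babuska_aziz_div :: "(real^'n) set \<Rightarrow> real \<Rightarrow> bool" where
  "babuska_aziz_div \<Omega> C \<longleftrightarrow>
     (\<forall>u \<in> L2 \<Omega>. mean \<Omega> u = 0 \<longrightarrow>
        (\<exists>v \<in> H10_vec \<Omega>. is_function \<Omega> (distr_div \<Omega> v) u \<and>
           (h1_norm \<Omega> v)\<^sup>2 \<le> C * (l2_norm \<Omega> u)\<^sup>2))"

definition babuska_aziz_rot :: "(real^3) set \<Rightarrow> real \<Rightarrow> bool" where
  "babuska_aziz_rot \<Omega> C \<longleftrightarrow>
     (\<forall>v \<in> H10_ker_rot_orth \<Omega>. (h1_norm \<Omega> v)\<^sup>2 \<le> C * (l2_norm \<Omega> (wrot \<Omega> v))\<^sup>2)"

definition improved_poincare :: "(real^'n) set \<Rightarrow> real \<Rightarrow> bool" where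
  "improved_poincare \<Omega> P \<longleftrightarrow>
     (\<forall>u g. locally_integrable \<Omega> u \<and> is_function \<Omega> (distr_grad \<Omega> u) g \<and>
        (\<lambda>x. bdist \<Omega> x *\<^sub>R g x) \<in> L2 \<Omega> \<longrightarrow>
        integrable (lebesgue_on \<Omega>) u \<and> (\<lambda>x. u x - mean \<Omega> u) \<in> L2 \<Omega> \<and>
        (l2_norm \<Omega> (\<lambda>x. u x - mean \<Omega> u))\<^sup>2 \<le> P * (l2_norm \<Omega> (\<lambda>x. bdist \<Omega> x *\<^sub>R g x))\<^sup>2)"

definition improved_poincare_rot :: "(real^3) set \<Rightarrow> real \<Rightarrow> bool" where
  "improved_poincare_rot \<Omega> P \<longleftrightarrow>
     (\<forall>v \<in> L2_ker_rot_orth \<Omega>. \<forall>r. is_function \<Omega> (distr_rot \<Omega> v) r \<and>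
        (\<lambda>x. bdist \<Omega> x *\<^sub>R r x) \<in> L2 \<Omega> \<longrightarrow>
        (l2_norm \<Omega> v)\<^sup>2 \<le> P * (l2_norm \<Omega> (\<lambda>x. bdist \<Omega> x *\<^sub>R r x))\<^sup>2)"

end

theory Submission
  imports Defs "HOL-Computational_Algebra.Polynomial"
begin

text \<open>Let \<open>t\<close> and \<open>s\<close> be the trace and the (normalized) antisymmetric part of a matrix, in one of the
  two orders. On the closure of the Jacobians of test fields, \<open>|G|\<^sup>2 = |t G|\<^sup>2 + |s G|\<^sup>2\<close>, and conjugate
  harmonic functions are the pairs with \<open>\<langle>u, t (jac \<Psi>)\<rangle> = \<langle>v, s (jac \<Psi>)\<rangle>\<close> for all test fields \<open>\<Psi>\<close>.
  By the Riesz representation theorem, the estimate \<open>|u|\<^sup>2 \<le> \<Gamma> |v|\<^sup>2\<close> for conjugate pairs makes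
  \<open>t G = f\<close> solvable with \<open>|G|\<^sup>2 \<le> (1 + \<Gamma>) |f|\<^sup>2\<close>, which is the Babuska-Aziz inequality; conversely
  such a solution bounds \<open>|u|\<^sup>2 = \<langle>u, t G\<rangle> = \<langle>v, s G\<rangle>\<close>. Testing \<open>\<nabla>u\<close> with the solution and applying
  Hardy's inequality to it gives the improved Poincare inequality with constant \<open>H (1 + \<Gamma>)\<close>. In the other
  direction, a Caccioppoli estimate with cutoffs close to the distance \<open>d\<close> to the boundary gives
  \<open>|d \<nabla>u| \<le> 2 |v|\<close> and \<open>|d \<nabla>u| \<le> 2 |u|\<close> for conjugate pairs, hence the factor 4.\<close>

section \<open>Semi-inner products on spaces of functions\<close>

lemma quadratic_nonneg_discriminant:
  fixes a b c :: real
  assumes "\<And>t. 0 \<le> a + 2 * t * c + t\<^sup>2 * b" and "0 \<le> b"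
  shows "c\<^sup>2 \<le> a * b"
proof (cases "b = 0")
  case True
  have "c = 0"
  proof (rule ccontr)
    assume "c \<noteq> 0"
    then have "a + 2 * (- (a + 1) / (2 * c)) * c = -1"
      by (simp add: field_simps)
    then show False
      using assms(1)[of "- (a + 1) / (2 * c)"] True by simp
  qed
  then show ?thesis using True by simp
next
  case False
  then have "b > 0" using assms(2) by simp
  moreover have "a + 2 * (- c / b) * c + (- c / b)\<^sup>2 * b = a - c\<^sup>2 / b"
    using False by (simp add: field_simps power2_eq_square)
  ultimately have "0 \<le> a - c\<^sup>2 / b"
    using assms(1)[of "- c / b"] by simp
  then show ?thesis using \<open>b > 0\<close> by (simp add: field_simps)
qed

locale semi_inner =
  fixes S :: "('a \<Rightarrow> 'b::real_vector) set"
    and B :: "('a \<Rightarrow> 'b) \<Rightarrow> ('a \<Rightarrow> 'b) \<Rightarrow> real"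
  assumes nonempty: "S \<noteq> {}"
    and comb: "\<And>a b f g. f \<in> S \<Longrightarrow> g \<in> S \<Longrightarrow> (\<lambda>x. a *\<^sub>R f x + b *\<^sub>R g x) \<in> S"
    and B_sym: "\<And>f g. f \<in> S \<Longrightarrow> g \<in> S \<Longrightarrow> B f g = B g f"
    and B_comb: "\<And>a b f g h. f \<in> S \<Longrightarrow> g \<in> S \<Longrightarrow> h \<in> S \<Longrightarrow>
      B (\<lambda>x. a *\<^sub>R f x + b *\<^sub>R g x) h = a * B f h + b * B g h"
    and B_nonneg: "\<And>f. f \<in> S \<Longrightarrow> 0 \<le> B f f"
begin

lemma B_comb_right:
  assumes "f \<in> S" "g \<in> S" "h \<in> S"
  shows "B h (\<lambda>x. a *\<^sub>R f x + b *\<^sub>R g x) = a * B h f + b * B h g"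
  using B_comb[OF assms, of a b] B_sym comb assms by simp

lemma B_comb_square:
  assumes "f \<in> S" "g \<in> S"
  shows "B (\<lambda>x. a *\<^sub>R f x + b *\<^sub>R g x) (\<lambda>x. a *\<^sub>R f x + b *\<^sub>R g x)
    = a\<^sup>2 * B f f + 2 * a * b * B f g + b\<^sup>2 * B g g"
  using assms B_sym[OF assms]
  by (simp add: B_comb B_comb_right comb algebra_simps power2_eq_square)

lemma cauchy_schwarz:
  assumes "f \<in> S" "g \<in> S"
  shows "(B f g)\<^sup>2 \<le> B f f * B g g"
proof (rule quadratic_nonneg_discriminant)
  fix t
  show "0 \<le> B f f + 2 * t * B f g + t\<^sup>2 * B g g"
    using B_nonneg[OF comb[OF assms, of 1 t]] B_comb_square[OF assms, of 1 t] by simp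
qed (rule B_nonneg[OF assms(2)])

lemma diff_mem: "f \<in> S \<Longrightarrow> g \<in> S \<Longrightarrow> (\<lambda>x. f x - g x) \<in> S"
  using comb[of f g 1 "-1"] by simp

lemma scale_mem: "f \<in> S \<Longrightarrow> (\<lambda>x. a *\<^sub>R f x) \<in> S"
  using comb[of f f a 0] by simp

lemma B_diff: "f \<in> S \<Longrightarrow> g \<in> S \<Longrightarrow> h \<in> S \<Longrightarrow> B (\<lambda>x. f x - g x) h = B f h - B g h"
  using B_comb[of f g h 1 "-1"] by simp

lemma B_diff_square:
  "f \<in> S \<Longrightarrow> g \<in> S \<Longrightarrow> B (\<lambda>x. f x - g x) (\<lambda>x. f x - g x) = B f f - 2 * B f g + B g g"
  using B_comb_square[of f g 1 "-1"] by simp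

text \<open>The Riesz representation theorem without completeness: a minimizing sequence of
  \<open>B f f - 2 * l f\<close> is a Cauchy sequence that represents the functional in the limit.\<close>

lemma riesz_sequence:
  assumes lin: "\<And>a b f g. f \<in> S \<Longrightarrow> g \<in> S \<Longrightarrow>
      l (\<lambda>x. a *\<^sub>R f x + b *\<^sub>R g x) = a * l f + b * l g"
    and bnd: "\<And>f. f \<in> S \<Longrightarrow> (l f)\<^sup>2 \<le> M * B f f"
  obtains s :: "nat \<Rightarrow> 'a \<Rightarrow> 'b" where "\<forall>k. s k \<in> S"
    "\<forall>e>0. \<exists>N. \<forall>m\<ge>N. \<forall>n\<ge>N. B (\<lambda>x. s m x - s n x) (\<lambda>x. s m x - s n x) < e"
    "\<forall>f\<in>S. (\<lambda>k. B (s k) f) \<longlonglongrightarrow> l f"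
proof -
  define J where "J f = B f f - 2 * l f" for f
  define j where "j = (INF f\<in>S. J f)"
  have J_ge: "- \<bar>M\<bar> \<le> J f" if "f \<in> S" for f
  proof -
    have "(l f)\<^sup>2 \<le> \<bar>M\<bar> * B f f"
      using bnd[OF that] B_nonneg[OF that] by (smt (verit) mult_right_mono)
    also have "\<dots> \<le> ((\<bar>M\<bar> + B f f) / 2)\<^sup>2"
      using zero_le_power2[of "\<bar>M\<bar> - B f f"] by (simp add: power2_eq_square field_simps)
    finally have "\<bar>l f\<bar> \<le> (\<bar>M\<bar> + B f f) / 2"
      using B_nonneg[OF that] by (subst (asm) abs_le_square_iff[symmetric]) simp
    then show ?thesis by (simp add: J_def abs_le_iff field_simps)
  qed
  have bdd: "bdd_below (J ` S)"
    using J_ge by (intro bdd_belowI2[of _ "- \<bar>M\<bar>"]) auto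
  have j_le: "j \<le> J f" if "f \<in> S" for f
    unfolding j_def using bdd that by (rule cINF_lower)
  have "\<exists>f\<in>S. J f < j + 1 / (real k + 1)" for k
  proof -
    have "Inf (J ` S) < j + 1 / (real k + 1)" by (simp add: j_def)
    then show ?thesis using cInf_lessD[of "J ` S"] nonempty by auto
  qed
  then obtain s where s: "\<And>k. s k \<in> S" and Js: "\<And>k. J (s k) < j + 1 / (real k + 1)"
    by metis
  have J_comb: "J (\<lambda>x. a *\<^sub>R f x + b *\<^sub>R g x)
      = a\<^sup>2 * B f f + 2 * a * b * B f g + b\<^sup>2 * B g g - 2 * (a * l f + b * l g)"
    if "f \<in> S" "g \<in> S" for a b f g
    using that by (simp add: J_def B_comb_square lin)
  have par: "B (\<lambda>x. f x - g x) (\<lambda>x. f x - g x) \<le> 2 * (J f - j) + 2 * (J g - j)"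
    if "f \<in> S" "g \<in> S" for f g
  proof -
    have "j \<le> J (\<lambda>x. (1/2) *\<^sub>R f x + (1/2) *\<^sub>R g x)"
      by (intro j_le comb that)
    also have "4 * J (\<lambda>x. (1/2) *\<^sub>R f x + (1/2) *\<^sub>R g x)
        = 2 * J f + 2 * J g - B (\<lambda>x. f x - g x) (\<lambda>x. f x - g x)"
      using that by (simp only: J_comb B_diff_square) (simp add: J_def field_simps power2_eq_square)
    finally show ?thesis by (simp add: field_simps)
  qed
  have small: "(\<lambda>k. 1 / (real k + 1)) \<longlonglongrightarrow> 0"
    using LIMSEQ_inverse_real_of_nat by (simp add: inverse_eq_divide add.commute)
  show thesis
  proof (rule that[of s]; intro allI impI ballI)
    fix e :: real assume "e > 0"
    then have "eventually (\<lambda>k. 1 / (real k + 1) < e / 4) sequentially"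
      using order_tendstoD(2)[OF small, of "e / 4"] by simp
    then obtain N where N: "\<And>k. k \<ge> N \<Longrightarrow> 1 / (real k + 1) < e / 4"
      by (auto simp: eventually_sequentially)
    have "B (\<lambda>x. s m x - s n x) (\<lambda>x. s m x - s n x) < e" if "m \<ge> N" "n \<ge> N" for m n
      using par[OF s s, of m n] Js[of m] Js[of n] N[OF that(1)] N[OF that(2)] by simp
    then show "\<exists>N. \<forall>m\<ge>N. \<forall>n\<ge>N. B (\<lambda>x. s m x - s n x) (\<lambda>x. s m x - s n x) < e" by blast
  next
    fix f assume f: "f \<in> S"
    have "(B (s k) f - l f)\<^sup>2 \<le> (J (s k) - j) * B f f" for k
    proof (rule quadratic_nonneg_discriminant)
      fix t
      have "j \<le> J (\<lambda>x. 1 *\<^sub>R s k x + t *\<^sub>R f x)" by (intro j_le comb s f)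
      then show "0 \<le> J (s k) - j + 2 * t * (B (s k) f - l f) + t\<^sup>2 * B f f"
        using s f by (simp only: J_comb) (simp add: J_def algebra_simps)
    qed (rule B_nonneg[OF f])
    also have "(J (s k) - j) * B f f \<le> 1 / (real k + 1) * B f f" for k
      using Js[of k] B_nonneg[OF f] by (intro mult_right_mono) auto
    finally have le: "(B (s k) f - l f)\<^sup>2 \<le> 1 / (real k + 1) * B f f" for k .
    have "(\<lambda>k. (B (s k) f - l f)\<^sup>2) \<longlonglongrightarrow> 0"
      by (rule tendsto_sandwich[OF _ _ tendsto_const tendsto_mult_left_zero[OF small, of "B f f"]])
        (use le in auto)
    then have "(\<lambda>k. B (s k) f - l f) \<longlonglongrightarrow> 0"
      using tendsto_real_sqrt[of "\<lambda>k. (B (s k) f - l f)\<^sup>2" 0 sequentially]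
      by (simp add: tendsto_rabs_zero_iff)
    then show "(\<lambda>k. B (s k) f) \<longlonglongrightarrow> l f" by (simp add: LIM_zero_iff)
  qed (rule s)
qed

end

section \<open>The space of square integrable functions\<close>

lemma L2_measurable: "f \<in> L2 X \<Longrightarrow> f \<in> borel_measurable (lebesgue_on X)"
  by (simp add: L2_def)

lemma L2_integrable_square: "f \<in> L2 X \<Longrightarrow> integrable (lebesgue_on X) (\<lambda>x. (norm (f x))\<^sup>2)"
  by (simp add: L2_def)

lemma L2I_bound:
  assumes "f \<in> borel_measurable (lebesgue_on X)" "integrable (lebesgue_on X) h"
    and "AE x in lebesgue_on X. (norm (f x))\<^sup>2 \<le> h x"
  shows "f \<in> L2 X"
proof -
  have "integrable (lebesgue_on X) (\<lambda>x. (norm (f x))\<^sup>2)"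
    by (rule Bochner_Integration.integrable_bound[OF assms(2)]) (use assms in auto)
  then show ?thesis using assms(1) by (simp add: L2_def)
qed

lemma norm_add_square_le: "(norm (x + y))\<^sup>2 \<le> 2 * (norm x)\<^sup>2 + 2 * (norm (y::'b::real_inner))\<^sup>2"
  using inner_ge_zero[of "x - y"]
  by (simp add: power2_norm_eq_inner inner_add_left inner_add_right inner_diff_left
      inner_diff_right inner_commute)

lemma L2_comb:
  fixes f g :: "'a::euclidean_space \<Rightarrow> 'b::euclidean_space"
  assumes "f \<in> L2 X" "g \<in> L2 X"
  shows "(\<lambda>x. a *\<^sub>R f x + b *\<^sub>R g x) \<in> L2 X"
proof (rule L2I_bound)
  show "(\<lambda>x. a *\<^sub>R f x + b *\<^sub>R g x) \<in> borel_measurable (lebesgue_on X)"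
    using assms by (auto simp: L2_def)
  show "integrable (lebesgue_on X) (\<lambda>x. 2 * (a\<^sup>2 * (norm (f x))\<^sup>2) + 2 * (b\<^sup>2 * (norm (g x))\<^sup>2))"
    using assms by (auto simp: L2_def)
  show "AE x in lebesgue_on X. (norm (a *\<^sub>R f x + b *\<^sub>R g x))\<^sup>2
      \<le> 2 * (a\<^sup>2 * (norm (f x))\<^sup>2) + 2 * (b\<^sup>2 * (norm (g x))\<^sup>2)"
    using norm_add_square_le[of "a *\<^sub>R f _" "b *\<^sub>R g _"] by (simp add: power_mult_distrib)
qed

lemma L2_zero [simp]: "(\<lambda>x. 0) \<in> L2 X"
  by (simp add: L2_def)

lemma L2_integrable_inner:
  fixes f g :: "'a::euclidean_space \<Rightarrow> 'b::euclidean_space"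
  assumes "f \<in> L2 X" "g \<in> L2 X"
  shows "integrable (lebesgue_on X) (\<lambda>x. f x \<bullet> g x)"
proof (rule Bochner_Integration.integrable_bound)
  show "integrable (lebesgue_on X) (\<lambda>x. (norm (f x))\<^sup>2 + (norm (g x))\<^sup>2)"
    using assms by (auto simp: L2_def)
  show "(\<lambda>x. f x \<bullet> g x) \<in> borel_measurable (lebesgue_on X)"
    using assms by (auto simp: L2_def)
  have "\<bar>f x \<bullet> g x\<bar> \<le> (norm (f x))\<^sup>2 + (norm (g x))\<^sup>2" for x
    using Cauchy_Schwarz_ineq2[of "f x" "g x"] sum_squares_bound[of "norm (f x)" "norm (g x)"]
      mult_nonneg_nonneg[of "norm (f x)" "norm (g x)"] by simp
  then show "AE x in lebesgue_on X. norm (f x \<bullet> g x) \<le> norm ((norm (f x))\<^sup>2 + (norm (g x))\<^sup>2)"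
    by simp
qed

interpretation L2: semi_inner "L2 X :: ('a::euclidean_space \<Rightarrow> 'b::euclidean_space) set" "l2_inner X"
  for X
proof
  show "(L2 X :: ('a \<Rightarrow> 'b) set) \<noteq> {}" using L2_zero by blast
next
  fix f g h :: "'a \<Rightarrow> 'b" and a b :: real assume fgh: "f \<in> L2 X" "g \<in> L2 X" "h \<in> L2 X"
  have "(\<lambda>x. (a *\<^sub>R f x + b *\<^sub>R g x) \<bullet> h x) = (\<lambda>x. a * (f x \<bullet> h x) + b * (g x \<bullet> h x))"
    by (simp add: inner_add_left)
  then show "l2_inner X (\<lambda>x. a *\<^sub>R f x + b *\<^sub>R g x) h = a * l2_inner X f h + b * l2_inner X g h"
    using fgh by (simp add: l2_inner_def L2_integrable_inner)
qed (auto simp: L2_comb l2_inner_def inner_commute)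

lemma l2_norm_nonneg [simp]: "0 \<le> l2_norm X f"
  by (simp add: l2_norm_def)

lemma l2_norm_square: "(l2_norm X f)\<^sup>2 = l2_inner X f f"
  by (simp add: l2_norm_def l2_inner_def dot_square_norm)

lemma l2_inner_le: "f \<in> L2 X \<Longrightarrow> g \<in> L2 X \<Longrightarrow> \<bar>l2_inner X f g\<bar> \<le> l2_norm X f * l2_norm X g"
  by (subst abs_le_square_iff[of _ "l2_norm X f * l2_norm X g", simplified abs_mult, simplified])
    (use L2.cauchy_schwarz[of f X g] in \<open>simp add: power_mult_distrib l2_norm_square\<close>)

lemma l2_norm_triangle:
  assumes "f \<in> L2 X" "g \<in> L2 X"
  shows "l2_norm X (\<lambda>x. f x + g x) \<le> l2_norm X f + l2_norm X g"
proof (rule power2_le_imp_le)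
  have "(l2_norm X (\<lambda>x. f x + g x))\<^sup>2 = (l2_norm X f)\<^sup>2 + 2 * l2_inner X f g + (l2_norm X g)\<^sup>2"
    using L2.B_comb_square[OF assms, of 1 1] by (simp add: l2_norm_square)
  also have "\<dots> \<le> (l2_norm X f + l2_norm X g)\<^sup>2"
    using l2_inner_le[OF assms] by (simp add: power2_sum)
  finally show "(l2_norm X (\<lambda>x. f x + g x))\<^sup>2 \<le> (l2_norm X f + l2_norm X g)\<^sup>2" .
qed simp

lemma l2_norm_scale: "l2_norm X (\<lambda>x. a *\<^sub>R f x) = \<bar>a\<bar> * l2_norm X f"
  by (simp add: l2_norm_def power_mult_distrib real_sqrt_mult)

lemma l2_norm_minus_commute: "l2_norm X (\<lambda>x. f x - g x) = l2_norm X (\<lambda>x. g x - f x)"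
  by (simp add: l2_norm_def norm_minus_commute)

lemma l2_norm_triangle_diff:
  assumes "f \<in> L2 X" "g \<in> L2 X" "h \<in> L2 X"
  shows "l2_norm X (\<lambda>x. f x - h x) \<le> l2_norm X (\<lambda>x. f x - g x) + l2_norm X (\<lambda>x. g x - h x)"
  using l2_norm_triangle[OF L2.diff_mem[OF assms(1,2)] L2.diff_mem[OF assms(2,3)]] by simp

lemma l2_norm_diff_le:
  assumes "f \<in> L2 X" "g \<in> L2 X"
  shows "\<bar>l2_norm X f - l2_norm X g\<bar> \<le> l2_norm X (\<lambda>x. f x - g x)"
  using l2_norm_triangle_diff[OF assms L2_zero] l2_norm_triangle_diff[OF assms(2,1) L2_zero]
  by (simp add: l2_norm_minus_commute[of _ g f])

lemma l2_norm_cong_AE: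
  assumes "AE x in lebesgue_on X. f x = g x"
    "f \<in> borel_measurable (lebesgue_on X)" "g \<in> borel_measurable (lebesgue_on X)"
  shows "l2_norm X f = l2_norm X g"
  unfolding l2_norm_def using assms by (intro arg_cong[where f=sqrt] integral_cong_AE) auto

lemma l2_inner_cong_AE:
  assumes "AE x in lebesgue_on X. f x = g x" "f \<in> borel_measurable (lebesgue_on X)"
    "g \<in> borel_measurable (lebesgue_on X)" "h \<in> borel_measurable (lebesgue_on X)"
  shows "l2_inner X f h = l2_inner X g h"
  unfolding l2_inner_def using assms by (intro integral_cong_AE) auto

lemma l2_norm_mono_AE:
  assumes "AE x in lebesgue_on X. norm (f x) \<le> norm (g x)"
    "f \<in> borel_measurable (lebesgue_on X)" "g \<in> L2 X"
  shows "l2_norm X f \<le> l2_norm X g"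
  unfolding l2_norm_def
proof (intro real_sqrt_le_mono integral_mono_AE)
  have *: "AE x in lebesgue_on X. (norm (f x))\<^sup>2 \<le> (norm (g x))\<^sup>2"
    using assms(1) by eventually_elim (simp add: power_mono)
  then show "AE x in lebesgue_on X. (norm (f x))\<^sup>2 \<le> (norm (g x))\<^sup>2" .
  have "f \<in> L2 X"
    by (rule L2I_bound[OF assms(2) L2_integrable_square[OF assms(3)] *])
  then show "integrable (lebesgue_on X) (\<lambda>x. (norm (f x))\<^sup>2)" by (rule L2_integrable_square)
qed (rule L2_integrable_square[OF assms(3)])

lemma l2_norm_eq_0_iff:
  assumes "f \<in> L2 X"
  shows "l2_norm X f = 0 \<longleftrightarrow> (AE x in lebesgue_on X. f x = 0)"
  unfolding l2_norm_def real_sqrt_eq_0_iff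
  by (subst integral_nonneg_eq_0_iff_AE) (use assms in \<open>auto simp: L2_def\<close>)

lemma L2_cong_AE:
  assumes "AE x in lebesgue_on X. f x = g x" "f \<in> L2 X" "g \<in> borel_measurable (lebesgue_on X)"
  shows "g \<in> L2 X"
  by (rule L2I_bound[OF assms(3) L2_integrable_square[OF assms(2)]]) (use assms(1) in auto)

lemma tendsto_l2_norm:
  assumes "\<And>n. f n \<in> L2 X" "g \<in> L2 X" "(\<lambda>n. l2_norm X (\<lambda>x. f n x - g x)) \<longlonglongrightarrow> 0"
  shows "(\<lambda>n. l2_norm X (f n)) \<longlonglongrightarrow> l2_norm X g"
proof -
  have "(\<lambda>n. l2_norm X (f n) - l2_norm X g) \<longlonglongrightarrow> 0"
    by (rule Lim_null_comparison[OF _ assms(3)]) (use l2_norm_diff_le[OF assms(1,2)] in auto)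
  then show ?thesis by (simp add: LIM_zero_iff)
qed

lemma tendsto_l2_inner:
  assumes "\<And>n. f n \<in> L2 X" "g \<in> L2 X" "h \<in> L2 X" "(\<lambda>n. l2_norm X (\<lambda>x. f n x - g x)) \<longlonglongrightarrow> 0"
  shows "(\<lambda>n. l2_inner X (f n) h) \<longlonglongrightarrow> l2_inner X g h"
proof -
  have "\<bar>l2_inner X (f n) h - l2_inner X g h\<bar> \<le> l2_norm X (\<lambda>x. f n x - g x) * l2_norm X h" for n
    using l2_inner_le[OF L2.diff_mem[OF assms(1,2)] assms(3), of n] L2.B_diff[OF assms(1,2,3)] by simp
  then have "(\<lambda>n. l2_inner X (f n) h - l2_inner X g h) \<longlonglongrightarrow> 0"
    by (intro Lim_null_comparison[OF _ tendsto_mult_left_zero[OF assms(4), of "l2_norm X h"]]) auto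
  then show ?thesis by (simp add: LIM_zero_iff)
qed

lemma L2_bounded_linear:
  fixes f :: "'a::euclidean_space \<Rightarrow> 'b::euclidean_space" and T :: "'b \<Rightarrow> 'c::euclidean_space"
  assumes "bounded_linear T" "f \<in> L2 X"
  shows "(\<lambda>x. T (f x)) \<in> L2 X"
proof -
  interpret T: bounded_linear T by fact
  obtain K where K: "\<And>x. norm (T x) \<le> norm x * K" using T.bounded by blast
  have "T \<in> borel_measurable borel"
    by (intro borel_measurable_continuous_onI) (simp add: T.continuous_on continuous_on_id)
  then have "(\<lambda>x. T (f x)) \<in> borel_measurable (lebesgue_on X)"
    using assms(2) by (auto simp: L2_def)
  moreover have "integrable (lebesgue_on X) (\<lambda>x. (norm (f x))\<^sup>2 * K\<^sup>2)"
    using assms(2) by (simp add: L2_def)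
  ultimately show ?thesis
    by (rule L2I_bound) (auto simp: power_mult_distrib[symmetric] intro!: power_mono K)
qed

lemma l2_norm_bounded_linear:
  fixes f :: "'a::euclidean_space \<Rightarrow> 'b::euclidean_space" and T :: "'b \<Rightarrow> 'c::euclidean_space"
  assumes "bounded_linear T"
  obtains K where "0 \<le> K"
    "\<And>f::'a \<Rightarrow> 'b. f \<in> L2 X \<Longrightarrow> l2_norm X (\<lambda>x. T (f x)) \<le> K * l2_norm X f"
proof -
  obtain K where "0 < K" and K: "\<And>x. norm (T x) \<le> norm x * K"
    using bounded_linear.pos_bounded[OF assms] by blast
  have "l2_norm X (\<lambda>x. T (f x)) \<le> K * l2_norm X f" if f: "f \<in> L2 X" for f :: "'a \<Rightarrow> 'b"
  proof -
    have "l2_norm X (\<lambda>x. T (f x)) \<le> l2_norm X (\<lambda>x. K *\<^sub>R f x)"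
      using K L2_measurable[OF L2_bounded_linear[OF assms f]] L2.scale_mem[OF f, of K] \<open>0 < K\<close>
      by (intro l2_norm_mono_AE) (auto simp: mult.commute)
    then show ?thesis using \<open>0 < K\<close> by (simp only: l2_norm_scale abs_of_pos)
  qed
  then show thesis using that[of K] \<open>0 < K\<close> by simp
qed

lemma L2_integrable:
  fixes f :: "'a::euclidean_space \<Rightarrow> 'b::euclidean_space"
  assumes "X \<in> lmeasurable" "f \<in> L2 X"
  shows "integrable (lebesgue_on X) f"
proof (rule Bochner_Integration.integrable_bound)
  interpret finite_measure "lebesgue_on X" by (rule finite_measure_lebesgue_on[OF assms(1)])
  show "integrable (lebesgue_on X) (\<lambda>x. 1 + (norm (f x))\<^sup>2)"
    using assms(2) by (auto simp: L2_def)
  show "f \<in> borel_measurable (lebesgue_on X)" by (rule L2_measurable[OF assms(2)])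
  have "norm (f x) \<le> 1 + (norm (f x))\<^sup>2" for x
    using sum_squares_bound[of 1 "norm (f x)"] norm_ge_zero[of "f x"] by (simp del: norm_ge_zero)
  then show "AE x in lebesgue_on X. norm (f x) \<le> norm (1 + (norm (f x))\<^sup>2)" by simp
qed

lemma integral_norm_le_l2_norm:
  fixes f :: "'a::euclidean_space \<Rightarrow> 'b::euclidean_space"
  assumes "X \<in> lmeasurable" "f \<in> L2 X"
  shows "(\<integral>x. norm (f x) \<partial>lebesgue_on X) \<le> sqrt (measure lebesgue X) * l2_norm X f"
proof -
  interpret finite_measure "lebesgue_on X" by (rule finite_measure_lebesgue_on[OF assms(1)])
  have 1: "(\<lambda>x. 1::real) \<in> L2 X" by (simp add: L2_def)
  have 2: "(\<lambda>x. norm (f x)) \<in> L2 X" using assms(2) by (auto simp: L2_def)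
  have "l2_norm X (\<lambda>x. 1::real) = sqrt (measure lebesgue X)"
    using assms(1) by (simp add: l2_norm_def measure_restrict_space)
  moreover have "l2_norm X (\<lambda>x. norm (f x)) = l2_norm X f" by (simp add: l2_norm_def)
  ultimately show ?thesis
    using l2_inner_le[OF 1 2] by (simp add: l2_inner_def abs_le_iff)
qed

lemma AE_summable_of_integrals:
  fixes h :: "nat \<Rightarrow> 'a \<Rightarrow> real"
  assumes "\<And>n. integrable M (h n)" "\<And>n x. 0 \<le> h n x" "summable (\<lambda>n. \<integral>x. h n x \<partial>M)"
  shows "AE x in M. summable (\<lambda>n. h n x)"
proof -
  have "(\<integral>\<^sup>+x. (\<Sum>n. ennreal (h n x)) \<partial>M) = (\<Sum>n. \<integral>\<^sup>+x. ennreal (h n x) \<partial>M)"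
    by (rule nn_integral_suminf) (use assms in measurable)
  also have "\<dots> = (\<Sum>n. ennreal (\<integral>x. h n x \<partial>M))"
    using assms by (simp add: nn_integral_eq_integral)
  also have "\<dots> = ennreal (\<Sum>n. \<integral>x. h n x \<partial>M)"
    by (rule suminf_ennreal2) (use assms in auto)
  finally have "(\<integral>\<^sup>+x. (\<Sum>n. ennreal (h n x)) \<partial>M) \<noteq> \<infinity>" by simp
  then have "AE x in M. (\<Sum>n. ennreal (h n x)) \<noteq> \<infinity>"
    by (intro nn_integral_PInf_AE) (use assms in measurable)
  then show ?thesis
    by eventually_elim (use assms(2) in \<open>auto intro!: summable_suminf_not_top\<close>)
qed

lemma L2_complete:
  fixes f :: "nat \<Rightarrow> 'a::euclidean_space \<Rightarrow> 'b::euclidean_space"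
  assumes X: "X \<in> lmeasurable" and f: "\<And>n. f n \<in> L2 X"
    and Cauchy: "\<And>e. e > 0 \<Longrightarrow> \<exists>N. \<forall>m\<ge>N. \<forall>n\<ge>N. l2_norm X (\<lambda>x. f m x - f n x) < e"
  obtains g where "g \<in> L2 X" "(\<lambda>n. l2_norm X (\<lambda>x. f n x - g x)) \<longlonglongrightarrow> 0"
proof -
  have "\<forall>k. \<exists>N. \<forall>m\<ge>N. \<forall>n\<ge>N. l2_norm X (\<lambda>x. f m x - f n x) < (1/2)^k"
    using Cauchy by simp
  then obtain N where N: "\<And>k m n. m \<ge> N k \<Longrightarrow> n \<ge> N k \<Longrightarrow> l2_norm X (\<lambda>x. f m x - f n x) < (1/2)^k"
    by metis
  define r where "r k = k + (\<Sum>i\<le>k. N i)" for k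
  have r: "r k \<ge> N k" "r k \<ge> k" "r (Suc k) \<ge> N k" for k
  proof -
    have "N k \<le> (\<Sum>i\<le>k. N i)" by (rule member_le_sum) auto
    then show "r k \<ge> N k" "r k \<ge> k" "r (Suc k) \<ge> N k" by (simp_all add: r_def)
  qed
  let ?h = "\<lambda>k x. norm (f (r (Suc k)) x - f (r k) x)"
  have hL2: "(\<lambda>x. f m x - f n x) \<in> L2 X" for m n by (rule L2.diff_mem[OF f f])
  have int: "integrable (lebesgue_on X) (?h k)" for k
    using L2_integrable[OF X hL2] by auto
  have "(\<integral>x. ?h k x \<partial>lebesgue_on X) \<le> sqrt (measure lebesgue X) * (1/2)^k" for k
    using integral_norm_le_l2_norm[OF X hL2[of "r (Suc k)" "r k"]]
      mult_left_mono[OF less_imp_le[OF N[OF r(3) r(1)]], of "sqrt (measure lebesgue X)" k] by simp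
  then have "summable (\<lambda>k. \<integral>x. ?h k x \<partial>lebesgue_on X)"
    by (intro summable_comparison_test'[OF summable_mult[OF summable_geometric[of "1/2"]],
          of 0 _ "sqrt (measure lebesgue X)"]) auto
  then have AE: "AE x in lebesgue_on X. summable (\<lambda>k. ?h k x)"
    by (intro AE_summable_of_integrals int) auto
  define g where "g x = lim (\<lambda>k. f (r k) x)" for x
  have conv: "AE x in lebesgue_on X. (\<lambda>k. f (r k) x) \<longlonglongrightarrow> g x"
    using AE
  proof eventually_elim
    case (elim x)
    then have "summable (\<lambda>k. f (r (Suc k)) x - f (r k) x)" by (rule summable_norm_cancel)
    then have "convergent (\<lambda>n. f (r n) x - f (r 0) x)"
      by (simp add: summable_iff_convergent sum_lessThan_telescope[of "\<lambda>k. f (r k) x"])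
    then have "convergent (\<lambda>k. f (r k) x)"
      using convergent_diff_const_right_iff by blast
    then show ?case by (simp add: g_def convergent_LIMSEQ_iff)
  qed
  have gm: "g \<in> borel_measurable (lebesgue_on X)"
    unfolding g_def by (rule borel_measurable_lim_metric) (rule L2_measurable[OF f])
  have fatou: "(\<lambda>x. f m x - g x) \<in> L2 X \<and> l2_norm X (\<lambda>x. f m x - g x) \<le> (1/2)^k"
    if "m \<ge> N k" for m k
  proof -
    have [measurable]: "f m \<in> borel_measurable (lebesgue_on X)" "g \<in> borel_measurable (lebesgue_on X)"
      "\<And>i. f (r i) \<in> borel_measurable (lebesgue_on X)"
      using L2_measurable[OF f] gm by auto
    have le: "(\<integral>\<^sup>+x. ennreal ((norm (f m x - g x))\<^sup>2) \<partial>lebesgue_on X) \<le> ennreal (((1/2)^k)\<^sup>2)"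
    proof -
      have "AE x in lebesgue_on X. ennreal ((norm (f m x - g x))\<^sup>2)
          = liminf (\<lambda>i. ennreal ((norm (f m x - f (r i) x))\<^sup>2))"
        using conv
      proof eventually_elim
        case (elim x)
        then have "(\<lambda>i. ennreal ((norm (f m x - f (r i) x))\<^sup>2)) \<longlonglongrightarrow> ennreal ((norm (f m x - g x))\<^sup>2)"
          by (intro tendsto_intros)
        then show ?case by (intro lim_imp_Liminf[symmetric]) simp_all
      qed
      then have "(\<integral>\<^sup>+x. ennreal ((norm (f m x - g x))\<^sup>2) \<partial>lebesgue_on X)
          = (\<integral>\<^sup>+x. liminf (\<lambda>i. ennreal ((norm (f m x - f (r i) x))\<^sup>2)) \<partial>lebesgue_on X)"
        by (rule nn_integral_cong_AE)
      also have "\<dots> \<le> liminf (\<lambda>i. \<integral>\<^sup>+x. ennreal ((norm (f m x - f (r i) x))\<^sup>2) \<partial>lebesgue_on X)"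
        by (rule nn_integral_liminf) measurable
      also have "\<dots> \<le> liminf (\<lambda>i. ennreal (((1/2)^k)\<^sup>2))"
      proof (rule Liminf_mono)
        have "\<integral>\<^sup>+x. ennreal ((norm (f m x - f (r i) x))\<^sup>2) \<partial>lebesgue_on X \<le> ennreal (((1/2)^k)\<^sup>2)"
          if i: "i \<ge> N k" for i
        proof -
          have "\<integral>\<^sup>+x. ennreal ((norm (f m x - f (r i) x))\<^sup>2) \<partial>lebesgue_on X
            = ennreal (\<integral>x. (norm (f m x - f (r i) x))\<^sup>2 \<partial>lebesgue_on X)"
            by (rule nn_integral_eq_integral) (auto intro: L2_integrable_square[OF hL2])
          also have "\<dots> = ennreal ((l2_norm X (\<lambda>x. f m x - f (r i) x))\<^sup>2)"
            by (simp add: l2_norm_def)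
          also have "\<dots> \<le> ennreal (((1/2)^k)\<^sup>2)"
            using N[OF that] N[OF \<open>m \<ge> N k\<close> order_trans[OF i r(2)]]
            by (intro ennreal_leI power_mono) auto
          finally show ?thesis .
        qed
        then show "\<forall>\<^sub>F i in sequentially. \<integral>\<^sup>+x. ennreal ((norm (f m x - f (r i) x))\<^sup>2) \<partial>lebesgue_on X
            \<le> ennreal (((1/2)^k)\<^sup>2)"
          by (auto simp: eventually_sequentially)
      qed
      also have "\<dots> = ennreal (((1/2)^k)\<^sup>2)" by (simp add: Liminf_const)
      finally show ?thesis .
    qed
    then have sq: "integrable (lebesgue_on X) (\<lambda>x. (norm (f m x - g x))\<^sup>2)"
      by (intro integrableI_bounded) (auto intro: le_less_trans)
    have "(\<integral>x. (norm (f m x - g x))\<^sup>2 \<partial>lebesgue_on X) \<le> ((1/2)^k)\<^sup>2"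
      using le by (subst (asm) nn_integral_eq_integral[OF sq]) auto
    then have "l2_norm X (\<lambda>x. f m x - g x) \<le> (1/2)^k"
      unfolding l2_norm_def by (intro real_le_lsqrt) auto
    then show ?thesis using sq by (simp add: L2_def)
  qed
  show thesis
  proof (rule that)
    show "g \<in> L2 X"
      using L2.diff_mem[OF f[of "N 0"] conjunct1[OF fatou[of 0 "N 0"]]] by simp
    show "(\<lambda>n. l2_norm X (\<lambda>x. f n x - g x)) \<longlonglongrightarrow> 0"
    proof (rule LIMSEQ_I)
      fix e :: real assume "e > 0"
      then obtain k where "(1/2)^k < e" using real_arch_pow_inv[of e "1/2"] by auto
      then have "\<forall>n\<ge>N k. norm (l2_norm X (\<lambda>x. f n x - g x) - 0) < e"
        using fatou by fastforce
      then show "\<exists>no. \<forall>n\<ge>no. norm (l2_norm X (\<lambda>x. f n x - g x) - 0) < e" by blast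
    qed
  qed
qed

section \<open>Smooth functions and test functions\<close>

lemmas frechet_derivative_worksI = frechet_derivative_works[THEN iffD1]

lemma pd_eqI: "(f has_derivative D) (at x) \<Longrightarrow> pd i f x = D (axis i 1)"
  using frechet_derivative_at[of f D x] by (simp add: pd_def)

lemma C_k_continuous: "C_k k f \<Longrightarrow> continuous_on UNIV f"
  by (cases k)
    (auto intro!: continuous_at_imp_continuous_on differentiable_imp_continuous_within)

lemma C_k_SucD: "C_k (Suc k) f \<Longrightarrow> C_k k f"
proof (induction k arbitrary: f)
  case 0
  then show ?case using C_k_continuous by (simp del: C_k.simps(2))
next
  case (Suc k)
  then show ?case by (metis C_k.simps(2))
qed

lemma C_k_const: "C_k k (\<lambda>x. c)"
proof (induction k arbitrary: c)
  case (Suc k)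
  have "pd i (\<lambda>x. c) = (\<lambda>x. 0)" for i :: 'a
    by (rule ext, rule pd_eqI) (rule has_derivative_const)
  then show ?case using Suc by simp
qed auto

lemma pd_add:
  assumes "f differentiable (at x)" "g differentiable (at x)"
  shows "pd i (\<lambda>x. f x + g x) x = pd i f x + pd i g x"
  using pd_eqI[OF has_derivative_add[OF frechet_derivative_worksI[OF assms(1)]
      frechet_derivative_worksI[OF assms(2)]]] by (simp add: pd_def)

lemma pd_mult:
  assumes "f differentiable (at x)" "g differentiable (at x)"
  shows "pd i (\<lambda>x. f x * g x) x = f x * pd i g x + pd i f x * g x"
  using pd_eqI[OF has_derivative_mult[OF frechet_derivative_worksI[OF assms(1)]
      frechet_derivative_worksI[OF assms(2)]]] by (simp add: pd_def)

lemma pd_cmult: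
  assumes "f differentiable (at x)"
  shows "pd i (\<lambda>x. c * f x) x = c * pd i f x"
  using pd_eqI[OF has_derivative_mult_right[OF frechet_derivative_worksI[OF assms]]]
  by (simp add: pd_def)

lemma C_k_add: "C_k k f \<Longrightarrow> C_k k g \<Longrightarrow> C_k k (\<lambda>x. f x + g x)"
proof (induction k arbitrary: f g)
  case (Suc k)
  then have "pd i (\<lambda>x. f x + g x) = (\<lambda>x. pd i f x + pd i g x)" for i
    by (intro ext pd_add) auto
  with Suc show ?case by (auto intro: differentiable_add)
qed (auto intro: continuous_intros)

lemma C_k_mult: "C_k k f \<Longrightarrow> C_k k g \<Longrightarrow> C_k k (\<lambda>x. f x * g x)"
proof (induction k arbitrary: f g)
  case (Suc k)
  then have "pd i (\<lambda>x. f x * g x) = (\<lambda>x. f x * pd i g x + pd i f x * g x)" for i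
    by (intro ext pd_mult) auto
  moreover have "C_k k (\<lambda>x. f x * pd i g x + pd i f x * g x)" for i
    using Suc C_k_SucD[OF Suc.prems(1)] C_k_SucD[OF Suc.prems(2)] by (intro C_k_add Suc.IH) auto
  ultimately show ?case using Suc.prems by (auto intro: differentiable_mult)
qed (auto intro: continuous_intros)

lemma C_k_cmult: "C_k k f \<Longrightarrow> C_k k (\<lambda>x. c * f x)"
  by (rule C_k_mult[OF C_k_const])

lemma C_k_prod: "(\<And>i. i \<in> I \<Longrightarrow> C_k k (f i)) \<Longrightarrow> C_k k (\<lambda>x. \<Prod>i\<in>I. f i x)"
  by (induction I rule: infinite_finite_induct) (auto intro: C_k_mult C_k_const)

abbreviation smooth :: "(real^'n \<Rightarrow> real) \<Rightarrow> bool" where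
  "smooth f \<equiv> (\<forall>k. C_k k f)"

lemma smooth_differentiable: "smooth f \<Longrightarrow> f differentiable (at x)"
  using C_k.simps(2)[of 0 f] by blast

lemma smooth_pd: "smooth f \<Longrightarrow> smooth (pd i f)"
  using C_k.simps(2)[of _ f] by blast

lemma smooth_continuous: "smooth f \<Longrightarrow> continuous_on UNIV f"
  using C_k_continuous by blast

lemma pd_sum:
  assumes "\<And>j. j \<in> J \<Longrightarrow> f j differentiable (at x)"
  shows "pd i (\<lambda>x. \<Sum>j\<in>J. f j x) x = (\<Sum>j\<in>J. pd i (f j) x)"
proof -
  have "((\<lambda>x. \<Sum>j\<in>J. f j x) has_derivative (\<lambda>h. \<Sum>j\<in>J. frechet_derivative (f j) (at x) h)) (at x)"
    by (rule has_derivative_sum) (use assms frechet_derivative_worksI in blast)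
  from pd_eqI[OF this] show ?thesis by (simp add: pd_def)
qed

lemma C_k_sum: "(\<And>j. j \<in> J \<Longrightarrow> C_k k (f j)) \<Longrightarrow> C_k k (\<lambda>x. \<Sum>j\<in>J. f j x)"
  by (induction J rule: infinite_finite_induct) (auto intro: C_k_add C_k_const)

lemma has_derivative_pd:
  fixes f :: "real^'n \<Rightarrow> real"
  assumes "f differentiable (at x)"
  shows "(f has_derivative (\<lambda>h. \<Sum>i\<in>UNIV. h $ i * pd i f x)) (at x)"
proof -
  let ?D = "frechet_derivative f (at x)"
  have D: "(f has_derivative ?D) (at x)" using assms by (rule frechet_derivative_worksI)
  then interpret D: linear ?D by (rule has_derivative_linear)
  have "?D h = (\<Sum>i\<in>UNIV. h $ i * pd i f x)" for h
  proof -
    have "?D h = ?D (\<Sum>i\<in>UNIV. h $ i *\<^sub>R axis i 1)"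
      by (rule arg_cong[where f="?D"])
        (simp add: vec_eq_iff axis_def if_distrib[where f="\<lambda>x. _ * x"] cong: if_cong)
    then show ?thesis by (simp add: D.sum D.scale pd_def)
  qed
  then have "?D = (\<lambda>h. \<Sum>i\<in>UNIV. h $ i * pd i f x)" by blast
  then show ?thesis using D by simp
qed

lemma pd_reflect_shift:
  assumes "f differentiable (at (a - x))"
  shows "pd i (\<lambda>y. f (a - y)) x = - pd i f (a - x)"
    and "(\<lambda>y. f (a - y)) differentiable (at x)"
proof -
  have "((\<lambda>y. f (a - y)) has_derivative (\<lambda>h. frechet_derivative f (at (a - x)) (- h))) (at x)"
  proof (rule has_derivative_compose[of "\<lambda>y. a - y"])
    show "((-) a has_derivative uminus) (at x)" by (auto intro!: derivative_eq_intros)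
    show "(f has_derivative frechet_derivative f (at (a - x))) (at (a - x))"
      using assms by (rule frechet_derivative_worksI)
  qed
  moreover have "linear (frechet_derivative f (at (a - x)))"
    using assms frechet_derivative_worksI has_derivative_linear by blast
  ultimately show "pd i (\<lambda>y. f (a - y)) x = - pd i f (a - x)"
    and "(\<lambda>y. f (a - y)) differentiable (at x)"
    by (auto simp: pd_eqI linear_neg pd_def[of i f] differentiable_def)
qed

lemma C_k_reflect_shift: "C_k k f \<Longrightarrow> C_k k (\<lambda>y. f (a - y))"
proof (induction k arbitrary: f)
  case 0
  then show ?case
    by (auto intro!: continuous_on_compose2[of UNIV f UNIV] continuous_intros)
next
  case (Suc k)
  then have "pd i (\<lambda>y. f (a - y)) = (\<lambda>y. (-1) * pd i f (a - y))" for i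
    using pd_reflect_shift(1)[of f] by (intro ext) simp
  moreover have "C_k k (\<lambda>y. (-1) * pd i f (a - y))" for i
    using Suc by (intro C_k_cmult) auto
  ultimately show ?case using Suc.prems pd_reflect_shift(2)[of f a] by simp
qed

subsection \<open>Bump functions\<close>

text \<open>The family of functions \<open>P(1/t) exp(-1/t)\<close>, extended by zero to \<open>t \<le> 0\<close>, is
  closed under differentiation.\<close>

definition flat :: "real poly \<Rightarrow> real \<Rightarrow> real" where
  "flat P t = (if t > 0 then poly P (1 / t) * exp (- (1 / t)) else 0)"

lemma poly_exp_tendsto_0: "((\<lambda>s. s ^ k * poly P s * exp (- s)) \<longlongrightarrow> 0) at_top" for P :: "real poly"
proof (induction P arbitrary: k)
  case (pCons a P)
  have "((\<lambda>s. a * (s ^ k / exp s) + s ^ Suc k * poly P s * exp (- s)) \<longlongrightarrow> a * 0 + 0) at_top"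
    by (intro tendsto_add tendsto_mult tendsto_const tendsto_power_div_exp_0 pCons.IH)
  then show ?case by (simp add: algebra_simps exp_minus divide_inverse)
qed simp

lemma flat_has_derivative:
  "(flat P has_real_derivative flat (pCons 0 (pCons 0 (P - pderiv P))) t) (at t)"
proof -
  consider "t > 0" | "t < 0" | "t = 0" by linarith
  then show ?thesis
  proof cases
    case 1
    have "((\<lambda>t. poly P (1 / t) * exp (- (1 / t))) has_real_derivative
        flat (pCons 0 (pCons 0 (P - pderiv P))) t) (at t)"
      using 1 by (auto intro!: derivative_eq_intros poly_DERIV[THEN DERIV_chain2]
          simp: flat_def field_simps power2_eq_square)
    moreover have "eventually (\<lambda>t. t > 0) (nhds t)"
      using 1 eventually_nhds_in_open[of "{0<..}" t] by simp
    then have "eventually (\<lambda>t. poly P (1 / t) * exp (- (1 / t)) = flat P t) (nhds t)"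
      by eventually_elim (simp add: flat_def)
    ultimately show ?thesis
      by (subst DERIV_cong_ev[OF refl _ refl, of _ "\<lambda>t. poly P (1 / t) * exp (- (1 / t))"])
        (auto elim: eventually_mono)
  next
    case 2
    have "eventually (\<lambda>t. t < 0) (nhds t)"
      using 2 eventually_nhds_in_open[of "{..<0}" t] by simp
    then have "eventually (\<lambda>t. flat P t = 0) (nhds t)"
      by eventually_elim (simp add: flat_def)
    then show ?thesis
      using 2 by (subst DERIV_cong_ev[OF refl _ refl, of _ "\<lambda>t. 0"]) (auto simp: flat_def)
  next
    case 3
    have "((\<lambda>h. flat P h / h) \<longlongrightarrow> 0) (at_left 0)"
      by (rule tendsto_eventually)
        (auto simp: flat_def eventually_at_filter intro!: always_eventually)
    moreover have "((\<lambda>h. flat P h / h) \<longlongrightarrow> 0) (at_right 0)"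
    proof -
      have "((\<lambda>h. inverse h ^ 1 * poly P (inverse h) * exp (- inverse h)) \<longlongrightarrow> 0) (at_right 0)"
        by (rule filterlim_compose[OF poly_exp_tendsto_0 filterlim_inverse_at_top_right])
      then show ?thesis
        by (rule Lim_transform_eventually)
          (auto simp: flat_def eventually_at_filter field_simps intro!: always_eventually)
    qed
    ultimately have "((\<lambda>h. flat P h / h) \<longlongrightarrow> 0) (at 0)"
      by (simp add: filterlim_split_at)
    then show ?thesis using 3 by (simp add: has_field_derivative_iff flat_def)
  qed
qed

lemma C_k_flat: "C_k k (\<lambda>x::real^'n. flat P (c * x $ i + d))"
proof (induction k arbitrary: P)
  case 0
  have "continuous_on UNIV (flat P)"
    using flat_has_derivative by (intro DERIV_continuous_on) blast
  then show ?case
    by (auto intro!: continuous_on_compose2[of UNIV "flat P" UNIV] continuous_intros)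
next
  case (Suc k)
  let ?Q = "pCons 0 (pCons 0 (P - pderiv P))"
  have D: "((\<lambda>x::real^'n. flat P (c * x $ i + d)) has_derivative
      (\<lambda>h. (c * h $ i) * flat ?Q (c * x $ i + d))) (at x)" for x
  proof (rule has_derivative_compose[of "\<lambda>x. c * x $ i + d", THEN has_derivative_eq_rhs])
    show "((\<lambda>x. c * x $ i + d) has_derivative (\<lambda>h. c * h $ i)) (at x)"
      by (auto intro!: derivative_eq_intros bounded_linear.has_derivative[OF bounded_linear_vec_nth])
    show "(flat P has_derivative (*) (flat ?Q (c * x $ i + d))) (at (c * x $ i + d))"
      using flat_has_derivative by (simp add: has_field_derivative_def)
  qed (simp add: mult.commute)
  have "pd j (\<lambda>x::real^'n. flat P (c * x $ i + d))
      = (\<lambda>x. (if j = i then c else 0) * flat ?Q (c * x $ i + d))" for j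
    by (rule ext, subst pd_eqI[OF D]) (auto simp: axis_def)
  moreover have "(\<lambda>x::real^'n. flat P (c * x $ i + d)) differentiable (at x)" for x
    using D differentiableI by blast
  ultimately show ?case using C_k_cmult[OF Suc[of ?Q]] by simp
qed

lemma flat_1: "flat 1 t = (if t > 0 then exp (- (1 / t)) else 0)"
  by (simp add: flat_def)

definition box_bump :: "real^'n \<Rightarrow> real^'n \<Rightarrow> real^'n \<Rightarrow> real" where
  "box_bump a b x = (\<Prod>i\<in>UNIV. flat 1 (x $ i - a $ i) * flat 1 (b $ i - x $ i))"

lemma smooth_box_bump: "smooth (box_bump a b)"
proof
  fix k
  have "C_k k (\<lambda>x. \<Prod>i\<in>UNIV. flat 1 (1 * x $ i + (- a $ i)) * flat 1 ((- 1) * x $ i + b $ i))"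
    by (intro C_k_prod C_k_mult C_k_flat)
  then show "C_k k (box_bump a b)" by (simp add: box_bump_def[abs_def] algebra_simps)
qed

lemma flat_1_bounds: "0 \<le> flat 1 t" "flat 1 t \<le> 1"
  by (auto simp: flat_1)

lemma box_bump_bounds: "0 \<le> box_bump a b x" "box_bump a b x \<le> 1"
  unfolding box_bump_def
  by (intro prod_nonneg ballI mult_nonneg_nonneg flat_1_bounds)
    (intro prod_le_1 conjI mult_le_one mult_nonneg_nonneg flat_1_bounds)

lemma box_bump_pos_iff: "0 < box_bump a b x \<longleftrightarrow> x \<in> box a b"
proof -
  have "0 < box_bump a b x \<longleftrightarrow> box_bump a b x \<noteq> 0"
    using box_bump_bounds(1)[of a b x] by auto
  also have "\<dots> \<longleftrightarrow> x \<in> box a b"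
    by (auto simp: box_bump_def flat_1 mem_box_cart zero_less_mult_iff split: if_splits)
  finally show ?thesis .
qed

subsection \<open>Test functions\<close>

lemma test_functionsI:
  assumes "smooth \<phi>" "compact K" "K \<subseteq> X" "\<And>x. x \<notin> K \<Longrightarrow> \<phi> x = 0"
  shows "\<phi> \<in> test_functions X"
proof -
  have "closure {x. \<phi> x \<noteq> 0} \<subseteq> K"
    using assms(2,4) by (intro closure_minimal compact_imp_closed) auto
  moreover from this have "compact (closure {x. \<phi> x \<noteq> 0})"
    using assms(2) by (metis closed_closure compact_Int_closed inf.absorb_iff2)
  ultimately show ?thesis using assms by (auto simp: test_functions_def)
qed

lemma test_functionsE:
  assumes "\<phi> \<in> test_functions X"
  obtains K where "compact K" "K \<subseteq> X" "\<And>x. x \<notin> K \<Longrightarrow> \<phi> x = 0" "smooth \<phi>"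
    "\<And>x i. x \<notin> K \<Longrightarrow> pd i \<phi> x = 0"
proof -
  define K where "K = closure {x. \<phi> x \<noteq> 0}"
  have K: "compact K" "K \<subseteq> X" "smooth \<phi>" using assms by (simp_all add: test_functions_def K_def)
  have 0: "\<phi> x = 0" if "x \<notin> K" for x
    using that closure_subset[of "{x. \<phi> x \<noteq> 0}"] by (auto simp: K_def)
  have 1: "pd i \<phi> x = 0" if "x \<notin> K" for x i
  proof -
    have "((\<lambda>x. 0::real) has_derivative (\<lambda>h. 0)) (at x)" by simp
    moreover have "open (- K)" using K(1) by (simp add: compact_imp_closed open_Compl)
    ultimately have "(\<phi> has_derivative (\<lambda>h. 0)) (at x)"
      by (rule has_derivative_transform_within_open) (use that 0 in auto)
    then show ?thesis by (simp add: pd_eqI)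
  qed
  show thesis using that[of K] K 0 1 by blast
qed

lemma test_smooth: "\<phi> \<in> test_functions X \<Longrightarrow> smooth \<phi>"
  by (simp add: test_functions_def)

lemma test_pd: assumes "\<phi> \<in> test_functions X" shows "pd i \<phi> \<in> test_functions X"
  using assms
proof (rule test_functionsE)
  fix K assume "compact K" "K \<subseteq> X" "smooth \<phi>" "\<And>x i. x \<notin> K \<Longrightarrow> pd i \<phi> x = 0"
  then show ?thesis by (intro test_functionsI[of _ K] smooth_pd) auto
qed

lemma test_mult_smooth:
  assumes "\<phi> \<in> test_functions X" "smooth f" shows "(\<lambda>x. f x * \<phi> x) \<in> test_functions X"
  using assms(1)
proof (rule test_functionsE)
  fix K assume "compact K" "K \<subseteq> X" "\<And>x. x \<notin> K \<Longrightarrow> \<phi> x = 0" "smooth \<phi>"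
  then show ?thesis using assms(2) by (intro test_functionsI[of _ K]) (auto intro: C_k_mult)
qed

lemma test_cmult: "\<phi> \<in> test_functions X \<Longrightarrow> (\<lambda>x. c * \<phi> x) \<in> test_functions X"
  by (rule test_mult_smooth) (auto intro: C_k_const)

lemma test_add:
  assumes "\<phi> \<in> test_functions X" "\<psi> \<in> test_functions X"
  shows "(\<lambda>x. \<phi> x + \<psi> x) \<in> test_functions X"
proof -
  obtain K where K: "compact K" "K \<subseteq> X" "\<And>x. x \<notin> K \<Longrightarrow> \<phi> x = 0" "smooth \<phi>"
    using test_functionsE[OF assms(1)] by metis
  obtain L where L: "compact L" "L \<subseteq> X" "\<And>x. x \<notin> L \<Longrightarrow> \<psi> x = 0" "smooth \<psi>"
    using test_functionsE[OF assms(2)] by metis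
  from K L show ?thesis
    by (intro test_functionsI[of _ "K \<union> L"]) (auto intro: C_k_add compact_Un)
qed

lemma test_zero: "(\<lambda>x. 0) \<in> test_functions X"
  by (rule test_functionsI[of _ "{}"]) (auto intro: C_k_const)

lemma test_sum:
  "(\<And>i. i \<in> I \<Longrightarrow> \<phi> i \<in> test_functions X) \<Longrightarrow> (\<lambda>x. \<Sum>i\<in>I. \<phi> i x) \<in> test_functions X"
  by (induction I rule: infinite_finite_induct) (auto intro: test_add test_zero)

lemma test_mono: "\<phi> \<in> test_functions X \<Longrightarrow> X \<subseteq> X' \<Longrightarrow> \<phi> \<in> test_functions X'"
  by (auto simp: test_functions_def)

lemma test_box_bump: "cbox a b \<subseteq> X \<Longrightarrow> box_bump a b \<in> test_functions X"
proof (rule test_functionsI[of _ "cbox a b"])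
  fix x assume "x \<notin> cbox a b"
  then have "\<not> 0 < box_bump a b x" using box_subset_cbox[of a b] by (auto simp: box_bump_pos_iff)
  then show "box_bump a b x = 0" using box_bump_bounds(1)[of a b x] by simp
qed (auto simp: smooth_box_bump)

lemma test_bounded:
  assumes "\<phi> \<in> test_functions X"
  obtains C where "\<And>x. \<bar>\<phi> x\<bar> \<le> C"
  using assms
proof (rule test_functionsE)
  fix K assume K: "compact K" "\<And>x. x \<notin> K \<Longrightarrow> \<phi> x = 0" "smooth \<phi>"
  then have "bounded (\<phi> ` K)"
    by (meson compact_continuous_image compact_imp_bounded continuous_on_subset
        smooth_continuous subset_UNIV)
  then obtain C where "\<And>x. x \<in> K \<Longrightarrow> \<bar>\<phi> x\<bar> \<le> C" by (auto simp: bounded_iff)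
  then have "\<bar>\<phi> x\<bar> \<le> max C 0" for x
    using K(2)[of x] by (cases "x \<in> K") (auto simp: le_max_iff_disj)
  then show thesis by (rule that)
qed

lemma smooth_measurable: "smooth f \<Longrightarrow> f \<in> borel_measurable borel"
  by (intro borel_measurable_continuous_onI smooth_continuous)

lemma test_measurable : "\<phi> \<in> test_functions X \<Longrightarrow> \<phi> \<in> borel_measurable borel"
  by (intro smooth_measurable test_smooth)

lemma test_integrable:
  assumes "\<phi> \<in> test_functions X" shows "integrable lborel \<phi>"
  using assms
proof (rule test_functionsE)
  fix K assume K: "compact K" "\<And>x. x \<notin> K \<Longrightarrow> \<phi> x = 0" "smooth \<phi>"
  then have "integrable lborel (\<lambda>x. indicator K x *\<^sub>R \<phi> x)"
    by (intro borel_integrable_compact) (auto intro: continuous_on_subset smooth_continuous)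
  moreover have "(\<lambda>x. indicator K x *\<^sub>R \<phi> x) = \<phi>" using K(2) by (force simp: indicator_def)
  ultimately show ?thesis by simp
qed

section \<open>Integration by parts and symmetry of second derivatives\<close>

lemma integral_lebesgue_on_eq_lborel:
  fixes f :: "'a::euclidean_space \<Rightarrow> 'b::euclidean_space"
  assumes "f \<in> borel_measurable borel" "X \<in> sets lebesgue" "\<And>x. x \<notin> X \<Longrightarrow> f x = 0"
  shows "(\<integral>x. f x \<partial>lebesgue_on X) = (\<integral>x. f x \<partial>lborel)"
    and "integrable (lebesgue_on X) f \<longleftrightarrow> integrable lborel f"
proof -
  have eq: "(\<lambda>x. indicator X x *\<^sub>R f x) = f" using assms(3) by (force simp: indicator_def)
  show "(\<integral>x. f x \<partial>lebesgue_on X) = (\<integral>x. f x \<partial>lborel)"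
    using assms(1,2) by (simp add: integral_restrict_space eq integral_completion)
  show "integrable (lebesgue_on X) f \<longleftrightarrow> integrable lborel f"
    using assms(1,2) by (simp add: integrable_restrict_space eq integrable_completion)
qed

lemma
  fixes f :: "'a::euclidean_space \<Rightarrow> 'b::{banach, second_countable_topology}"
  assumes [measurable]: "f \<in> borel_measurable borel"
  shows integral_lborel_translate: "(\<integral>x. f (x + a) \<partial>lborel) = (\<integral>x. f x \<partial>lborel)"
    and integrable_lborel_translate: "integrable lborel (\<lambda>x. f (x + a)) \<longleftrightarrow> integrable lborel f"
proof -
  have "(\<integral>x. f x \<partial>distr lborel borel ((+) a)) = (\<integral>x. f (a + x) \<partial>lborel)"
    by (rule integral_distr) measurable
  then show "(\<integral>x. f (x + a) \<partial>lborel) = (\<integral>x. f x \<partial>lborel)"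
    by (simp add: lborel_distr_plus add.commute)
  have "integrable (distr lborel borel ((+) a)) f = integrable lborel (\<lambda>x. f (a + x))"
    by (rule integrable_distr_eq) measurable
  then show "integrable lborel (\<lambda>x. f (x + a)) \<longleftrightarrow> integrable lborel f"
    by (simp add: lborel_distr_plus add.commute)
qed

lemma nn_integral_lborel_translate:
  fixes f :: "'a::euclidean_space \<Rightarrow> ennreal"
  assumes [measurable]: "f \<in> borel_measurable borel"
  shows "(\<integral>\<^sup>+x. f (x + a) \<partial>lborel) = (\<integral>\<^sup>+x. f x \<partial>lborel)"
proof -
  have "(\<integral>\<^sup>+x. f x \<partial>distr lborel borel ((+) a)) = (\<integral>\<^sup>+x. f (a + x) \<partial>lborel)"
    by (rule nn_integral_distr) measurable
  then show ?thesis by (simp add: lborel_distr_plus add.commute)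
qed

lemma has_field_derivative_along_axis:
  assumes "\<And>x. f differentiable (at x)"
  shows "((\<lambda>t. f (x + t *\<^sub>R axis i 1)) has_real_derivative pd i f (x + t *\<^sub>R axis i 1)) (at t)"
proof -
  let ?D = "frechet_derivative f (at (x + t *\<^sub>R axis i 1))"
  have "((\<lambda>t. f (x + t *\<^sub>R axis i 1)) has_derivative (\<lambda>h. ?D (h *\<^sub>R axis i 1))) (at t)"
    by (rule has_derivative_compose[where g=f, OF _ frechet_derivative_worksI[OF assms]])
      (auto intro!: derivative_eq_intros)
  moreover have "linear ?D"
    using assms frechet_derivative_worksI has_derivative_linear by blast
  then have "(\<lambda>h. ?D (h *\<^sub>R axis i 1)) = (*) (pd i f (x + t *\<^sub>R axis i 1))"
    by (auto simp: linear_scale pd_def)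
  ultimately show ?thesis by (simp add: has_field_derivative_def)
qed

lemma mvt_axis:
  assumes "\<And>x. f differentiable (at x)" "0 < h"
  obtains s where "0 < s" "s < h" "f (x + h *\<^sub>R axis i 1) - f x = h * pd i f (x + s *\<^sub>R axis i 1)"
  using MVT2[of 0 h "\<lambda>t. f (x + t *\<^sub>R axis i 1)" "\<lambda>t. pd i f (x + t *\<^sub>R axis i 1)"]
    has_field_derivative_along_axis[OF assms(1)] assms(2) by auto

lemma pd_commute:
  assumes "C_k (Suc (Suc 0)) f"
  shows "pd i (pd j f) x = pd j (pd i f) x"
proof -
  have d: "f differentiable (at y)" "pd k f differentiable (at y)"
    "continuous_on UNIV (pd k (pd l f))" for y k l
    using assms by auto
  let ?e = "\<lambda>i. axis i (1::real)"
  have pd_diff: "pd k (\<lambda>y. f (y + v) - f y) y = pd k f (y + v) - pd k f y"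
    "(\<lambda>y. f (y + v) - f y) differentiable (at y)" for k v y
  proof -
    have s: "((\<lambda>y. f (y + v)) has_derivative frechet_derivative f (at (y + v))) (at y)"
      by (rule has_derivative_compose[where f="\<lambda>y. y + v" and f'="\<lambda>h. h" and g=f,
            OF _ frechet_derivative_worksI[OF d(1)]]) (auto intro!: derivative_eq_intros)
    note D = has_derivative_diff[OF s frechet_derivative_worksI[OF d(1)]]
    show "pd k (\<lambda>y. f (y + v) - f y) y = pd k f (y + v) - pd k f y"
      using pd_eqI[OF D] by (simp add: pd_def)
    show "(\<lambda>y. f (y + v) - f y) differentiable (at y)" using D by (rule differentiableI)
  qed
  have *: "\<exists>s r. 0 < s \<and> s < h \<and> 0 < r \<and> r < h \<and>
      f (x + h *\<^sub>R ?e i + h *\<^sub>R ?e j) - f (x + h *\<^sub>R ?e i) - (f (x + h *\<^sub>R ?e j) - f x)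
      = h * h * pd j (pd i f) (x + s *\<^sub>R ?e i + r *\<^sub>R ?e j)" if hpos: "h > 0" for h i j
  proof -
    let ?g = "\<lambda>y. f (y + h *\<^sub>R ?e j) - f y"
    obtain s where s0: "0 < s" "s < h" "?g (x + h *\<^sub>R ?e i) - ?g x = h * pd i ?g (x + s *\<^sub>R ?e i)"
      using mvt_axis[of ?g h x i, OF pd_diff(2) hpos] by blast
    have s: "f (x + h *\<^sub>R ?e i + h *\<^sub>R ?e j) - f (x + h *\<^sub>R ?e i) - (f (x + h *\<^sub>R ?e j) - f x)
        = h * (pd i f (x + s *\<^sub>R ?e i + h *\<^sub>R ?e j) - pd i f (x + s *\<^sub>R ?e i))"
      using s0(3) unfolding pd_diff(1) by simp
    obtain r where "0 < r" "r < h"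
      "pd i f (x + s *\<^sub>R ?e i + h *\<^sub>R ?e j) - pd i f (x + s *\<^sub>R ?e i)
        = h * pd j (pd i f) (x + s *\<^sub>R ?e i + r *\<^sub>R ?e j)"
      using mvt_axis[of "pd i f" h "x + s *\<^sub>R ?e i" j, OF d(2) hpos] by blast
    then show ?thesis using s s0 by (intro exI[of _ s] exI[of _ r]) simp
  qed
  define h where "h n = 1 / (real n + 1)" for n
  have h: "h n > 0" for n by (simp add: h_def)
  have h0: "h \<longlonglongrightarrow> 0"
    unfolding h_def using LIMSEQ_inverse_real_of_nat by (simp add: inverse_eq_divide add.commute)
  have sq: "u \<longlonglongrightarrow> 0" if "\<And>n. 0 < u n" "\<And>n. u n < h n" for u
    by (rule tendsto_sandwich[OF _ _ tendsto_const h0])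
      (use that in \<open>auto intro!: always_eventually less_imp_le\<close>)
  obtain s r where sr: "\<And>n. 0 < s n" "\<And>n. s n < h n" "\<And>n. 0 < r n" "\<And>n. r n < h n"
    "\<And>n. f (x + h n *\<^sub>R ?e i + h n *\<^sub>R ?e j) - f (x + h n *\<^sub>R ?e i) - (f (x + h n *\<^sub>R ?e j) - f x)
      = h n * h n * pd j (pd i f) (x + s n *\<^sub>R ?e i + r n *\<^sub>R ?e j)"
    using *[OF h, of _ i j] by metis
  obtain s' r' where sr': "\<And>n. 0 < s' n" "\<And>n. s' n < h n" "\<And>n. 0 < r' n" "\<And>n. r' n < h n"
    "\<And>n. f (x + h n *\<^sub>R ?e j + h n *\<^sub>R ?e i) - f (x + h n *\<^sub>R ?e j) - (f (x + h n *\<^sub>R ?e i) - f x)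
      = h n * h n * pd i (pd j f) (x + s' n *\<^sub>R ?e j + r' n *\<^sub>R ?e i)"
    using *[OF h, of _ j i] by metis
  have "h n * h n * pd j (pd i f) (x + s n *\<^sub>R ?e i + r n *\<^sub>R ?e j)
      = h n * h n * pd i (pd j f) (x + s' n *\<^sub>R ?e j + r' n *\<^sub>R ?e i)" for n
    using sr(5)[of n] sr'(5)[of n] by (simp add: algebra_simps)
  then have eq: "pd j (pd i f) (x + s n *\<^sub>R ?e i + r n *\<^sub>R ?e j)
      = pd i (pd j f) (x + s' n *\<^sub>R ?e j + r' n *\<^sub>R ?e i)" for n
    by (simp add: less_imp_neq[OF h, symmetric])
  have lim: "(\<lambda>n. pd k (pd l f) (x + u n *\<^sub>R v + w n *\<^sub>R z)) \<longlonglongrightarrow> pd k (pd l f) x"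
    if "u \<longlonglongrightarrow> 0" "w \<longlonglongrightarrow> 0" for u w k l v z
  proof (rule continuous_on_tendsto_compose[OF d(3)])
    have "(\<lambda>n. x + u n *\<^sub>R v + w n *\<^sub>R z) \<longlonglongrightarrow> x + 0 *\<^sub>R v + 0 *\<^sub>R z"
      by (intro tendsto_intros that)
    then show "(\<lambda>n. x + u n *\<^sub>R v + w n *\<^sub>R z) \<longlonglongrightarrow> x" by simp
  qed auto
  have "(\<lambda>n. pd j (pd i f) (x + s n *\<^sub>R ?e i + r n *\<^sub>R ?e j)) \<longlonglongrightarrow> pd j (pd i f) x"
    using sr by (intro lim sq)
  moreover have "(\<lambda>n. pd i (pd j f) (x + s' n *\<^sub>R ?e j + r' n *\<^sub>R ?e i)) \<longlonglongrightarrow> pd i (pd j f) x"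
    using sr' by (intro lim sq)
  ultimately show ?thesis using eq LIMSEQ_unique by auto
qed

lemma smooth_pd_commute: "smooth f \<Longrightarrow> pd i (pd j f) x = pd j (pd i f) x"
  by (rule pd_commute) blast

lemma bounded_of_compact_support:
  assumes "continuous_on UNIV g" "compact K" "\<And>x. x \<notin> K \<Longrightarrow> g x = (0::real)"
  obtains C where "0 \<le> C" "\<And>x. \<bar>g x\<bar> \<le> C"
proof -
  have "bounded (g ` K)"
    by (meson assms compact_continuous_image compact_imp_bounded continuous_on_subset subset_UNIV)
  then obtain C where "\<And>x. x \<in> K \<Longrightarrow> \<bar>g x\<bar> \<le> C" by (auto simp: bounded_iff)
  then have "\<bar>g x\<bar> \<le> max C 0" for x
    using assms(3)[of x] by (cases "x \<in> K") (auto simp: le_max_iff_disj)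
  then show thesis using that[of "max C 0"] by simp
qed

lemma pd_eq_0_outside:
  assumes "compact K" "\<And>x. x \<notin> K \<Longrightarrow> f x = 0" "x \<notin> K"
  shows "pd i f x = 0"
proof -
  have "((\<lambda>x. 0::real) has_derivative (\<lambda>h. 0)) (at x)" by simp
  moreover have "open (- K)" using assms(1) by (simp add: compact_imp_closed open_Compl)
  ultimately have "(f has_derivative (\<lambda>h. 0)) (at x)"
    by (rule has_derivative_transform_within_open) (use assms in auto)
  then show ?thesis by (simp add: pd_eqI)
qed

text \<open>Difference quotients have integral zero by translation invariance.\<close>

lemma integral_pd_eq_0:
  fixes f :: "real^'n \<Rightarrow> real"
  assumes f: "C_k (Suc 0) f" and K: "compact K" "\<And>x. x \<notin> K \<Longrightarrow> f x = 0"
  shows "(\<integral>x. pd i f x \<partial>lborel) = 0"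
proof -
  let ?e = "axis i (1::real)"
  have d: "f differentiable (at x)" and c: "continuous_on UNIV f" "continuous_on UNIV (pd i f)" for x
    using f C_k_continuous[OF f] by auto
  have [measurable]: "f \<in> borel_measurable borel" "pd i f \<in> borel_measurable borel"
    using c by (auto intro: borel_measurable_continuous_onI)
  obtain C where C: "0 \<le> C" "\<And>x. \<bar>pd i f x\<bar> \<le> C"
    using bounded_of_compact_support[OF c(2) K(1) pd_eq_0_outside[OF K]] by blast
  define h where "h n = 1 / (real n + 1)" for n
  have h: "h n > 0" "h n \<le> 1" for n by (simp_all add: h_def)
  have h0: "h \<longlonglongrightarrow> 0"
    unfolding h_def using LIMSEQ_inverse_real_of_nat by (simp add: inverse_eq_divide add.commute)
  define L where "L = {x + y |x y. x \<in> K \<and> y \<in> cball 0 1}"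
  have L: "compact L" unfolding L_def by (intro compact_sums K) auto
  have fint: "integrable lborel f"
  proof -
    have "integrable lborel (\<lambda>x. indicator K x *\<^sub>R f x)"
      using K c by (intro borel_integrable_compact) (auto intro: continuous_on_subset)
    moreover have "(\<lambda>x. indicator K x *\<^sub>R f x) = f" using K(2) by (force simp: indicator_def)
    ultimately show ?thesis by simp
  qed
  let ?q = "\<lambda>n x. (f (x + h n *\<^sub>R ?e) - f x) / h n"
  have "(\<lambda>n. \<integral>x. ?q n x \<partial>lborel) \<longlonglongrightarrow> (\<integral>x. pd i f x \<partial>lborel)"
  proof (rule integral_dominated_convergence[where w="\<lambda>x. C * indicator L x"])
    show "integrable lborel (\<lambda>x. C * indicator L x)"
      using L by (intro integrable_mult_right integrable_real_indicator)
        (auto simp: compact_imp_closed borel_closed emeasure_compact_finite[unfolded infinity_ennreal_def])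
    show "AE x in lborel. (\<lambda>n. ?q n x) \<longlonglongrightarrow> pd i f x"
    proof (rule always_eventually, rule allI)
      fix x
      have "((\<lambda>t. (f (x + t *\<^sub>R ?e) - f x) / t) \<longlongrightarrow> pd i f x) (at 0)"
        using has_field_derivative_along_axis[OF d, of x i 0] by (simp add: has_field_derivative_iff)
      moreover have "filterlim h (at 0) sequentially"
        using h0 h(1) by (auto simp: filterlim_at less_imp_neq[symmetric] intro!: always_eventually)
      ultimately show "(\<lambda>n. ?q n x) \<longlonglongrightarrow> pd i f x" by (rule filterlim_compose)
    qed
    show "AE x in lborel. norm (?q n x) \<le> C * indicator L x" for n
    proof (rule always_eventually, rule allI)
      fix x
      obtain s where "0 < s" "s < h n" and s: "f (x + h n *\<^sub>R ?e) - f x = h n * pd i f (x + s *\<^sub>R ?e)"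
        using mvt_axis[OF d h(1)] by blast
      then have q: "?q n x = pd i f (x + s *\<^sub>R ?e)" using h(1)[of n] by simp
      show "norm (?q n x) \<le> C * indicator L x"
      proof (cases "x \<in> L")
        case False
        have "x + s *\<^sub>R ?e \<notin> K"
        proof
          assume "x + s *\<^sub>R ?e \<in> K"
          moreover have "- (s *\<^sub>R ?e) \<in> cball 0 1"
            using \<open>0 < s\<close> \<open>s < h n\<close> h(2)[of n] by simp
          ultimately have "(x + s *\<^sub>R ?e) + - (s *\<^sub>R ?e) \<in> L" unfolding L_def by blast
          then show False using False by simp
        qed
        then show ?thesis using False q pd_eq_0_outside[OF K] by simp
      qed (use q C in simp)
    qed
  qed measurable
  moreover have "(\<integral>x. ?q n x \<partial>lborel) = 0" for n
    using fint by (simp add: integrable_lborel_translate integral_lborel_translate)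
  ultimately have "(\<lambda>n. 0) \<longlonglongrightarrow> (\<integral>x. pd i f x \<partial>lborel)" by (simp only:)
  then show ?thesis by (simp add: LIMSEQ_const_iff)
qed

lemma integral_by_parts:
  assumes f: "C_k (Suc 0) f" and \<phi>: "\<phi> \<in> test_functions UNIV"
  shows "(\<integral>x. f x * pd i \<phi> x \<partial>lborel) = - (\<integral>x. pd i f x * \<phi> x \<partial>lborel)"
  using \<phi>
proof (rule test_functionsE)
  fix K assume K: "compact K" "\<And>x. x \<notin> K \<Longrightarrow> \<phi> x = 0" "smooth \<phi>" "\<And>x i. x \<notin> K \<Longrightarrow> pd i \<phi> x = 0"
  have int: "integrable lborel (\<lambda>x. g x)"
    if "continuous_on UNIV g" "\<And>x. x \<notin> K \<Longrightarrow> g x = 0" for g :: "_ \<Rightarrow> real"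
  proof -
    have "integrable lborel (\<lambda>x. indicator K x *\<^sub>R g x)"
      using K that by (intro borel_integrable_compact) (auto intro: continuous_on_subset)
    moreover have "(\<lambda>x. indicator K x *\<^sub>R g x) = g" using that(2) by (force simp: indicator_def)
    ultimately show ?thesis by simp
  qed
  have c: "continuous_on UNIV f" "continuous_on UNIV (pd i f)" "continuous_on UNIV \<phi>"
    "continuous_on UNIV (pd i \<phi>)"
    using f C_k_continuous[OF f] K(3) smooth_continuous[OF smooth_pd]
    by (auto intro: smooth_continuous)
  have "C_k (Suc 0) (\<lambda>x. f x * \<phi> x)" using K(3) by (intro C_k_mult f) blast
  then have "(\<integral>x. pd i (\<lambda>x. f x * \<phi> x) x \<partial>lborel) = 0"
    by (rule integral_pd_eq_0[OF _ K(1)]) (simp add: K(2))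
  moreover have "pd i (\<lambda>x. f x * \<phi> x) x = f x * pd i \<phi> x + pd i f x * \<phi> x" for x
    using f smooth_differentiable[OF K(3)] by (intro pd_mult) auto
  moreover have "integrable lborel (\<lambda>x. f x * pd i \<phi> x)" "integrable lborel (\<lambda>x. pd i f x * \<phi> x)"
    using K by (simp_all add: int continuous_on_mult c)
  ultimately show ?thesis by simp
qed

section \<open>Mollification\<close>

definition mollifier :: "real \<Rightarrow> real^'n \<Rightarrow> real" where
  "mollifier r x = (let b = (\<chi> i. r / CARD('n)) in
     box_bump (- b) b x / (\<integral>y. box_bump (- b) b y \<partial>lborel))"

lemma mollifier_properties:
  fixes x :: "real^'n"
  assumes "r > 0"
  shows mollifier_test: "(mollifier r :: real^'n \<Rightarrow> real) \<in> test_functions UNIV"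
    and mollifier_nonneg: "0 \<le> mollifier r x"
    and mollifier_even: "mollifier r (- x) = mollifier r x"
    and mollifier_integral: "(\<integral>x. (mollifier r :: real^'n \<Rightarrow> real) x \<partial>lborel) = 1"
    and mollifier_eq_0: "r \<le> norm x \<Longrightarrow> mollifier r x = 0"
proof -
  define b :: "real^'n" where "b = (\<chi> i. r / CARD('n))"
  define g where "g = box_bump (- b) b"
  define I where "I = (\<integral>y. g y \<partial>lborel)"
  have m: "mollifier r = (\<lambda>x. (1 / I) * g x)"
    by (simp add: mollifier_def[abs_def] Let_def g_def b_def I_def)
  have g: "g \<in> test_functions UNIV" unfolding g_def by (rule test_box_bump) simp
  have pos: "0 < g x \<longleftrightarrow> x \<in> box (- b) b" for x by (simp add: g_def box_bump_pos_iff)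
  have nonneg: "0 \<le> g x" for x by (simp add: g_def box_bump_bounds)
  have "I > 0"
  proof (rule ccontr)
    assume "\<not> I > 0"
    moreover have "I \<ge> 0" unfolding I_def by (rule Bochner_Integration.integral_nonneg) (rule nonneg)
    ultimately have "I = 0" by simp
    then have "AE x in lborel. g x = 0"
      unfolding I_def using nonneg by (subst (asm) integral_nonneg_eq_0_iff_AE[OF test_integrable[OF g]]) auto
    then have "AE x in lborel. x \<notin> box (- b) b"
      by eventually_elim (use pos in force)
    then have "emeasure lborel (box (- b) b) = 0"
      by (subst (asm) AE_iff_null_sets[symmetric]) auto
    then have "measure lborel (box (- b) b) = 0" by (simp add: measure_def)
    moreover have "measure lborel (box (- b) b) = (\<Prod>i\<in>UNIV. b $ i - (- b) $ i)"
      using assms content_cbox_cart[of "- b" b] interval_ne_empty_cart(1)[of "- b" b]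
      by (simp add: measure_lborel_box_eq measure_lborel_cbox_eq b_def)
    ultimately show False using assms by (simp add: b_def)
  qed
  show "(mollifier r :: real^'n \<Rightarrow> real) \<in> test_functions UNIV"
    unfolding m by (rule test_cmult[OF g])
  show "0 \<le> mollifier r x" unfolding m using \<open>I > 0\<close> nonneg[of x] by simp
  have "g (- x) = g x"
    by (simp add: g_def box_bump_def b_def mult.commute add.commute)
  then show "mollifier r (- x) = mollifier r x" unfolding m by simp
  show "(\<integral>x. (mollifier r :: real^'n \<Rightarrow> real) x \<partial>lborel) = 1"
    unfolding m using \<open>I > 0\<close> by (simp add: I_def[symmetric])
  show "mollifier r x = 0" if "r \<le> norm x"
  proof -
    have "x \<notin> box (- b) b"
    proof
      assume "x \<in> box (- b) b"
      then have "\<bar>x $ i\<bar> < r / CARD('n)" for i by (auto simp: mem_box_cart b_def abs_less_iff minus_less_iff)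
      then have "(\<Sum>i\<in>UNIV. \<bar>x $ i\<bar>) < (\<Sum>i\<in>(UNIV::'n set). r / CARD('n))"
        by (intro sum_strict_mono) auto
      then show False using that norm_le_l1_cart[of x] by simp
    qed
    then have "g x = 0" using pos[of x] nonneg[of x] by simp
    then show ?thesis unfolding m by simp
  qed
qed

definition convolve :: "(real^'n \<Rightarrow> real) \<Rightarrow> (real^'n \<Rightarrow> real) \<Rightarrow> real^'n \<Rightarrow> real" where
  "convolve \<rho> u x = (\<integral>y. \<rho> (x - y) * u y \<partial>lborel)"

lemma integrable_bounded_mult:
  fixes u f :: "'a \<Rightarrow> real"
  assumes "integrable M u" "f \<in> borel_measurable M" "\<And>x. \<bar>f x\<bar> \<le> C"
  shows "integrable M (\<lambda>x. f x * u x)"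
proof (rule Bochner_Integration.integrable_bound[of M "\<lambda>x. C * u x"])
  have "\<bar>f x\<bar> * \<bar>u x\<bar> \<le> \<bar>C\<bar> * \<bar>u x\<bar>" for x
    using assms(3)[of x] by (intro mult_right_mono) auto
  then show "AE x in M. norm (f x * u x) \<le> norm (C * u x)"
    by (simp add: abs_mult)
qed (use assms in auto)

lemma convolve_integrable:
  assumes "\<rho> \<in> test_functions UNIV" "integrable lborel u"
  shows "integrable lborel (\<lambda>y. \<rho> (x - y) * u y)"
proof -
  have [measurable]: "\<rho> \<in> borel_measurable borel" by (rule test_measurable[OF assms(1)])
  obtain C where "\<And>x. \<bar>\<rho> x\<bar> \<le> C" using test_bounded[OF assms(1)] by blast
  then show ?thesis by (intro integrable_bounded_mult[OF assms(2)]) auto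
qed

lemma lipschitz_test:
  assumes "\<phi> \<in> test_functions UNIV"
  obtains L where "0 \<le> L" "\<And>x y. \<bar>\<phi> x - \<phi> y\<bar> \<le> L * norm (x - y)"
    "\<And>x h. \<bar>\<Sum>i\<in>UNIV. h $ i * pd i \<phi> x\<bar> \<le> L * norm h"
proof -
  have "\<forall>i. \<exists>C. \<forall>x. \<bar>pd i \<phi> x\<bar> \<le> C"
    using test_bounded[OF test_pd[OF assms]] by metis
  then obtain C where C: "\<And>i x. \<bar>pd i \<phi> x\<bar> \<le> C i" by metis
  have C0: "0 \<le> C i" for i using C[of i undefined] by linarith
  define L where "L = (\<Sum>i\<in>UNIV. C i)"
  have b: "\<bar>\<Sum>i\<in>UNIV. h $ i * pd i \<phi> x\<bar> \<le> L * norm h" for x h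
  proof -
    have "\<bar>\<Sum>i\<in>UNIV. h $ i * pd i \<phi> x\<bar> \<le> (\<Sum>i\<in>UNIV. \<bar>h $ i * pd i \<phi> x\<bar>)" by (rule sum_abs)
    also have "\<dots> \<le> (\<Sum>i\<in>UNIV. norm h * C i)"
      by (intro sum_mono) (simp add: abs_mult mult_mono C component_le_norm_cart)
    finally show ?thesis unfolding L_def sum_distrib_right by (simp add: mult.commute)
  qed
  have "\<bar>\<phi> x - \<phi> y\<bar> \<le> L * norm (x - y)" for x y
  proof -
    have "onorm (\<lambda>h. \<Sum>i\<in>UNIV. h $ i * pd i \<phi> z) \<le> L" for z
      using b by (intro onorm_le) simp
    then show ?thesis
      using differentiable_bound[of UNIV \<phi> "\<lambda>x h. \<Sum>i\<in>UNIV. h $ i * pd i \<phi> x" L x y]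
        has_derivative_pd[OF smooth_differentiable[OF test_smooth[OF assms]]]
      by simp
  qed
  then show thesis using that[of L] b C0 by (auto simp: L_def sum_nonneg)
qed

lemma convolve_has_derivative:
  fixes u :: "real^'n \<Rightarrow> real"
  assumes \<rho>: "\<rho> \<in> test_functions UNIV" and u: "integrable lborel u"
  shows "(convolve \<rho> u has_derivative (\<lambda>h. \<Sum>i\<in>UNIV. h $ i * convolve (pd i \<rho>) u x)) (at x)"
proof -
  have [measurable]: "\<rho> \<in> borel_measurable borel" "pd i \<rho> \<in> borel_measurable borel"
    "u \<in> borel_measurable borel" for i
    using test_measurable[OF \<rho>] test_measurable[OF test_pd[OF \<rho>]] u by auto
  obtain L where L: "0 \<le> L" "\<And>x y. \<bar>\<rho> x - \<rho> y\<bar> \<le> L * norm (x - y)"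
    "\<And>x h. \<bar>\<Sum>i\<in>UNIV. h $ i * pd i \<rho> x\<bar> \<le> L * norm h"
    using lipschitz_test[OF \<rho>] by blast
  note int = convolve_integrable[OF \<rho> u] convolve_integrable[OF test_pd[OF \<rho>] u]
  let ?D = "\<lambda>h. \<Sum>i\<in>UNIV. h $ i * convolve (pd i \<rho>) u x"
  let ?r = "\<lambda>h z. \<rho> (z + h) - \<rho> z - (\<Sum>i\<in>UNIV. h $ i * pd i \<rho> z)"
  have eq: "convolve \<rho> u z - convolve \<rho> u x - ?D (z - x) = (\<integral>y. ?r (z - x) (x - y) * u y \<partial>lborel)" for z
  proof -
    have "(\<integral>y. ?r (z - x) (x - y) * u y \<partial>lborel) = (\<integral>y. \<rho> (z - y) * u y - \<rho> (x - y) * u y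
        - (\<Sum>i\<in>UNIV. (z - x) $ i * (pd i \<rho> (x - y) * u y)) \<partial>lborel)"
      by (intro Bochner_Integration.integral_cong refl)
        (simp add: left_diff_distrib sum_distrib_right mult.assoc)
    also have "\<dots> = convolve \<rho> u z - convolve \<rho> u x - ?D (z - x)"
      using int by (simp add: convolve_def)
    finally show ?thesis by simp
  qed
  have bl: "bounded_linear ?D"
    by (intro bounded_linear_sum bounded_linear_mult_left bounded_linear_compose[OF bounded_linear_mult_left bounded_linear_vec_nth])
  have lim: "((\<lambda>z. (convolve \<rho> u z - convolve \<rho> u x - ?D (z - x)) /\<^sub>R norm (z - x)) \<longlongrightarrow> 0) (at x)"
    unfolding tendsto_at_iff_sequentially comp_def
  proof (intro allI impI)
    fix \<xi> assume \<xi>: "\<forall>n. \<xi> n \<in> UNIV - {x}" "\<xi> \<longlonglongrightarrow> x"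
    have "(\<lambda>n. \<integral>y. inverse (norm (\<xi> n - x)) * (?r (\<xi> n - x) (x - y) * u y) \<partial>lborel) \<longlonglongrightarrow> (\<integral>y. (0::real) \<partial>(lborel :: (real^'n) measure))"
    proof (rule integral_dominated_convergence[where w="\<lambda>y. 2 * L * \<bar>u y\<bar>"])
      show "AE y in lborel. (\<lambda>n. inverse (norm (\<xi> n - x)) * (?r (\<xi> n - x) (x - y) * u y)) \<longlonglongrightarrow> 0"
      proof (rule always_eventually, rule allI)
        fix y
        have "(\<rho> has_derivative (\<lambda>h. \<Sum>i\<in>UNIV. h $ i * pd i \<rho> (x - y))) (at (x - y))"
          by (rule has_derivative_pd[OF smooth_differentiable[OF test_smooth[OF \<rho>]]])
        then have "((\<lambda>h. ?r h (x - y) / norm h) \<longlongrightarrow> 0) (at 0)"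
          unfolding has_derivative_at
          by (intro tendsto_norm_zero_cancel[of "\<lambda>h. ?r h (x - y) / norm h"])
            (simp add: divide_inverse abs_mult mult.commute)
        moreover have "filterlim (\<lambda>n. \<xi> n - x) (at 0) sequentially"
          using \<xi> by (auto simp: filterlim_at LIM_zero)
        ultimately have "(\<lambda>n. ?r (\<xi> n - x) (x - y) / norm (\<xi> n - x)) \<longlonglongrightarrow> 0"
          by (rule filterlim_compose)
        from tendsto_mult_left_zero[OF this, of "u y"]
        show "(\<lambda>n. inverse (norm (\<xi> n - x)) * (?r (\<xi> n - x) (x - y) * u y)) \<longlonglongrightarrow> 0"
          by (simp add: divide_inverse mult_ac)
      qed
      show "AE y in lborel. norm (inverse (norm (\<xi> n - x)) * (?r (\<xi> n - x) (x - y) * u y)) \<le> 2 * L * \<bar>u y\<bar>" for n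
      proof (rule always_eventually, rule allI)
        fix y
        define a where "a = ?r (\<xi> n - x) (x - y)"
        have "\<bar>a\<bar> \<le> 2 * L * norm (\<xi> n - x)"
          unfolding a_def using L(2)[of "x - y + (\<xi> n - x)" "x - y"] L(3)[of "\<xi> n - x" "x - y"] by auto
        then have "\<bar>a\<bar> * \<bar>u y\<bar> \<le> 2 * L * norm (\<xi> n - x) * \<bar>u y\<bar>"
          by (rule mult_right_mono) simp
        moreover have "norm (\<xi> n - x) > 0" using \<xi> by simp
        ultimately have "norm (inverse (norm (\<xi> n - x)) * (a * u y)) \<le> 2 * L * \<bar>u y\<bar>"
          by (simp add: abs_mult field_simps)
        then show "norm (inverse (norm (\<xi> n - x)) * (?r (\<xi> n - x) (x - y) * u y)) \<le> 2 * L * \<bar>u y\<bar>"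
          unfolding a_def .
      qed
      show "integrable lborel (\<lambda>y. 2 * L * \<bar>u y\<bar>)" using u by simp
    qed measurable
    then show "(\<lambda>n. (convolve \<rho> u (\<xi> n) - convolve \<rho> u x - ?D (\<xi> n - x)) /\<^sub>R norm (\<xi> n - x)) \<longlonglongrightarrow> 0"
      by (simp only: eq integral_mult_right_zero real_scaleR_def Bochner_Integration.integral_zero)
  qed
  show ?thesis
    unfolding has_derivative_at_within using bl lim by simp
qed

lemma pd_convolve:
  assumes "\<rho> \<in> test_functions UNIV" "integrable lborel u"
  shows "pd i (convolve \<rho> u) = convolve (pd i \<rho>) u"
  using pd_eqI[OF convolve_has_derivative[OF assms], of i]
  by (auto simp: axis_def if_distrib[where f="\<lambda>a. a * _"] cong: if_cong)

lemma smooth_convolve: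
  assumes "\<rho> \<in> test_functions UNIV" "integrable lborel u"
  shows "smooth (convolve \<rho> u)"
proof
  fix k show "C_k k (convolve \<rho> u)"
    using assms(1)
  proof (induction k arbitrary: \<rho>)
    case 0
    then show ?case
      using has_derivative_continuous[OF convolve_has_derivative[OF 0 assms(2)]]
      by (simp add: continuous_at_imp_continuous_on)
  next
    case (Suc k)
    then show ?case
      using convolve_has_derivative[OF Suc.prems assms(2)]
      by (auto simp: pd_convolve[OF _ assms(2)] test_pd intro: differentiableI)
  qed
qed

lemma tendsto_0_approx:
  fixes F :: "'a \<Rightarrow> real"
  assumes "\<And>e. e > 0 \<Longrightarrow> \<exists>G. (G \<longlongrightarrow> 0) A \<and> (\<forall>x. \<bar>F x\<bar> \<le> G x + e)"
  shows "(F \<longlongrightarrow> 0) A"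
proof (rule tendstoI)
  fix e :: real assume "e > 0"
  obtain G where G: "(G \<longlongrightarrow> 0) A" "\<And>x. \<bar>F x\<bar> \<le> G x + e / 2"
    using assms[of "e / 2"] \<open>e > 0\<close> by auto
  have "eventually (\<lambda>x. G x < e / 2) A"
    using order_tendstoD(2)[OF G(1), of "e / 2"] \<open>e > 0\<close> by simp
  then show "eventually (\<lambda>x. dist (F x) 0 < e) A"
  proof eventually_elim
    case (elim x)
    then show ?case using G(2)[of x] by simp
  qed
qed

lemma translation_L1_approx:
  fixes f g :: "'a::euclidean_space \<Rightarrow> real"
  assumes f: "integrable lborel f" and g: "integrable lborel g"
  shows "(\<integral>x. \<bar>f (x + h) - f x\<bar> \<partial>lborel)
    \<le> (\<integral>x. \<bar>g (x + h) - g x\<bar> \<partial>lborel) + 2 * (\<integral>x. \<bar>f x - g x\<bar> \<partial>lborel)"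
proof -
  have [measurable]: "f \<in> borel_measurable borel" "g \<in> borel_measurable borel"
    using f g by auto
  have int: "integrable lborel (\<lambda>x. u (x + h))" if "integrable lborel u" for u :: "'a \<Rightarrow> real"
  proof -
    have "u \<in> borel_measurable borel" using that by auto
    with that show ?thesis by (simp add: integrable_lborel_translate)
  qed
  have d: "integrable lborel (\<lambda>x. \<bar>f x - g x\<bar>)" using f g by auto
  have "(\<integral>x. \<bar>f (x + h) - f x\<bar> \<partial>lborel)
    \<le> (\<integral>x. \<bar>g (x + h) - g x\<bar> + (\<bar>f (x + h) - g (x + h)\<bar> + \<bar>f x - g x\<bar>) \<partial>lborel)"
    by (intro integral_mono) (use f g int in auto)
  also have "\<dots> = (\<integral>x. \<bar>g (x + h) - g x\<bar> \<partial>lborel)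
      + ((\<integral>x. \<bar>f (x + h) - g (x + h)\<bar> \<partial>lborel) + (\<integral>x. \<bar>f x - g x\<bar> \<partial>lborel))"
    using f g int[OF f] int[OF g] by simp
  also have "(\<integral>x. \<bar>f (x + h) - g (x + h)\<bar> \<partial>lborel) = (\<integral>x. \<bar>f x - g x\<bar> \<partial>lborel)"
    by (rule integral_lborel_translate[of "\<lambda>x. \<bar>f x - g x\<bar>"]) measurable
  finally show ?thesis by simp
qed

lemma translation_L1_open:
  fixes T :: "'a::euclidean_space set"
  assumes "open T" "emeasure lborel T < \<infinity>"
  shows "((\<lambda>h. \<integral>x. \<bar>indicator T (x + h) - indicator T x :: real\<bar> \<partial>lborel) \<longlongrightarrow> 0) (at 0)"
proof -
  let ?i = "indicator T :: 'a \<Rightarrow> real"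
  have [measurable]: "T \<in> sets borel" using assms(1) by simp
  have iT: "integrable lborel ?i" using assms(2) by (intro integrable_real_indicator) auto
  then have iTh: "integrable lborel (\<lambda>x. ?i (x + h))" for h
    by (simp add: integrable_lborel_translate)
  have ip: "integrable lborel (\<lambda>x. ?i x * ?i (x + h))" for h
    by (rule Bochner_Integration.integrable_bound[OF iT]) (auto simp: indicator_def)
  have eq: "(\<integral>x. \<bar>?i (x + h) - ?i x\<bar> \<partial>lborel) = 2 * (\<integral>x. ?i x - ?i x * ?i (x + h) \<partial>lborel)" for h
  proof -
    have "(\<integral>x. \<bar>?i (x + h) - ?i x\<bar> \<partial>lborel) = (\<integral>x. ?i (x + h) + ?i x - 2 * (?i x * ?i (x + h)) \<partial>lborel)"
      by (intro Bochner_Integration.integral_cong refl) (auto simp: indicator_def)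
    also have "\<dots> = (\<integral>x. ?i (x + h) \<partial>lborel) + (\<integral>x. ?i x \<partial>lborel) - 2 * (\<integral>x. ?i x * ?i (x + h) \<partial>lborel)"
      using iT iTh ip by simp
    also have "(\<integral>x. ?i (x + h) \<partial>lborel) = (\<integral>x. ?i x \<partial>lborel)"
      by (rule integral_lborel_translate) measurable
    finally show ?thesis using iT ip by simp
  qed
  have "((\<lambda>h. \<integral>x. ?i x - ?i x * ?i (x + h) \<partial>lborel) \<longlongrightarrow> 0) (at 0)"
    unfolding tendsto_at_iff_sequentially comp_def
  proof (intro allI impI)
    fix \<xi> :: "nat \<Rightarrow> 'a" assume \<xi>: "\<forall>n. \<xi> n \<in> UNIV - {0}" "\<xi> \<longlonglongrightarrow> 0"
    have "(\<lambda>n. \<integral>x. ?i x - ?i x * ?i (x + \<xi> n) \<partial>lborel) \<longlonglongrightarrow> (\<integral>x. (0::real) \<partial>(lborel :: 'a measure))"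
    proof (rule integral_dominated_convergence[where w="?i"])
      show "AE x in lborel. (\<lambda>n. ?i x - ?i x * ?i (x + \<xi> n)) \<longlonglongrightarrow> 0"
      proof (rule always_eventually, rule allI)
        fix x
        show "(\<lambda>n. ?i x - ?i x * ?i (x + \<xi> n)) \<longlonglongrightarrow> 0"
        proof (cases "x \<in> T")
          case True
          have "(\<lambda>n. x + \<xi> n) \<longlonglongrightarrow> x + 0" by (intro tendsto_intros \<xi>)
          then have "eventually (\<lambda>n. x + \<xi> n \<in> T) sequentially"
            using assms(1) True by (intro topological_tendstoD) auto
          then show ?thesis
            by (intro tendsto_eventually) (auto elim!: eventually_mono simp: True)
        qed simp
      qed
      show "AE x in lborel. norm (?i x - ?i x * ?i (x + \<xi> n)) \<le> ?i x" for n
        by (auto simp: indicator_def)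
    qed (measurable, rule iT)
    then show "(\<lambda>n. \<integral>x. ?i x - ?i x * ?i (x + \<xi> n) \<partial>lborel) \<longlonglongrightarrow> 0" by simp
  qed
  from tendsto_mult_right_zero[OF this, of 2] show ?thesis by (simp only: eq)
qed

lemma translation_L1_continuous:
  fixes f :: "'a::euclidean_space \<Rightarrow> real"
  assumes "integrable lborel f"
  shows "((\<lambda>h. \<integral>x. \<bar>f (x + h) - f x\<bar> \<partial>lborel) \<longlongrightarrow> 0) (at 0)"
  using assms
proof (induction rule: integrable_induct)
  case (base A c)
  have [measurable]: "A \<in> sets borel" using base by simp
  have iA: "integrable lborel (indicator A :: 'a \<Rightarrow> real)"
    using base by (intro integrable_real_indicator) auto
  have "((\<lambda>h. \<integral>x. \<bar>indicator A (x + h) - indicator A x :: real\<bar> \<partial>lborel) \<longlongrightarrow> 0) (at (0::'a))"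
  proof (rule tendsto_0_approx)
    fix e :: real assume "e > 0"
    have "A \<in> lmeasurable" using base by (auto simp: fmeasurable_def)
    then obtain T where T: "open T" "A \<subseteq> T" "T - A \<in> lmeasurable" "emeasure lebesgue (T - A) < ennreal (e / 2)"
      using sets_lebesgue_outer_open[of A "e / 2"] \<open>e > 0\<close> by (auto simp: fmeasurable_def)
    have Tm: "T \<in> lmeasurable"
      using fmeasurable.Un[OF \<open>A \<in> lmeasurable\<close> T(3)] T(2) by (simp add: Un_absorb1)
    have "measure lebesgue T - measure lebesgue A = measure lebesgue (T - A)"
      using measurable_measure_Diff[OF Tm _ T(2)] \<open>A \<in> lmeasurable\<close> by (simp add: fmeasurableD)
    also have "\<dots> < e / 2"
      using T(4) T(3) \<open>e > 0\<close> by (simp add: emeasure_eq_measure2 ennreal_less_iff)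
    finally have Tlt: "measure lebesgue T < measure lebesgue A + e / 2" by simp
    have [measurable]: "T \<in> sets borel" using T by simp
    have T_fin: "emeasure lborel T < \<infinity>" using Tm by (auto simp: fmeasurable_def)
    have iT: "integrable lborel (indicator T :: 'a \<Rightarrow> real)"
      using T_fin by (intro integrable_real_indicator) auto
    have "(\<integral>x. \<bar>indicator A x - indicator T x :: real\<bar> \<partial>lborel) = (\<integral>x. indicator T x - indicator A x \<partial>lborel)"
      using T(2) by (intro Bochner_Integration.integral_cong refl) (auto simp: indicator_def)
    also have "\<dots> = measure lborel T - measure lborel A" using iA iT by simp
    also have "\<dots> \<le> e / 2" using Tlt by (simp add: measure_completion)
    finally have "2 * (\<integral>x. \<bar>indicator A x - indicator T x :: real\<bar> \<partial>lborel) \<le> e" by simp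
    then have "\<bar>\<integral>x. \<bar>indicator A (x + h) - indicator A x :: real\<bar> \<partial>lborel\<bar>
        \<le> (\<integral>x. \<bar>indicator T (x + h) - indicator T x :: real\<bar> \<partial>lborel) + e" for h
      using translation_L1_approx[OF iA iT, of h] by simp
    then show "\<exists>G. (G \<longlongrightarrow> 0) (at (0::'a)) \<and>
        (\<forall>h. \<bar>\<integral>x. \<bar>indicator A (x + h) - indicator A x :: real\<bar> \<partial>lborel\<bar> \<le> G h + e)"
      using translation_L1_open[OF T(1) T_fin] by blast
  qed
  from tendsto_mult_left_zero[OF this, of "\<bar>c\<bar>"]
  show ?case by (simp add: left_diff_distrib[symmetric] abs_mult)
next
  case (add f g)
  have [measurable]: "f \<in> borel_measurable borel" "g \<in> borel_measurable borel"
    using add by auto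
  have int: "integrable lborel (\<lambda>x. f (x + h))" "integrable lborel (\<lambda>x. g (x + h))" for h
    using add by (auto simp: integrable_lborel_translate)
  show ?case
  proof (rule Lim_null_comparison[OF always_eventually, OF allI])
    fix h
    have "(\<integral>x. \<bar>f (x + h) + g (x + h) - (f x + g x)\<bar> \<partial>lborel)
        \<le> (\<integral>x. \<bar>f (x + h) - f x\<bar> + \<bar>g (x + h) - g x\<bar> \<partial>lborel)"
      by (intro integral_mono) (use int add in auto)
    then show "norm (\<integral>x. \<bar>f (x + h) + g (x + h) - (f x + g x)\<bar> \<partial>lborel)
        \<le> (\<integral>x. \<bar>f (x + h) - f x\<bar> \<partial>lborel) + (\<integral>x. \<bar>g (x + h) - g x\<bar> \<partial>lborel)"
      using int add by simp
  qed (rule tendsto_add_zero[OF add.IH])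
next
  case (lim f s)
  show ?case
  proof (rule tendsto_0_approx)
    fix e :: real assume "e > 0"
    have "(\<lambda>i. \<integral>x. \<bar>f x - s i x\<bar> \<partial>lborel) \<longlonglongrightarrow> (\<integral>x. (0::real) \<partial>(lborel :: 'a measure))"
    proof (rule integral_dominated_convergence[where w="\<lambda>x. 3 * \<bar>f x\<bar>"])
      show "AE x in lborel. (\<lambda>i. \<bar>f x - s i x\<bar>) \<longlonglongrightarrow> 0"
      proof (rule always_eventually, rule allI)
        fix x
        have "(\<lambda>i. \<bar>f x - s i x\<bar>) \<longlonglongrightarrow> \<bar>f x - f x\<bar>" by (intro tendsto_intros lim.hyps) simp
        then show "(\<lambda>i. \<bar>f x - s i x\<bar>) \<longlonglongrightarrow> 0" by simp
      qed
      show "AE x in lborel. norm \<bar>f x - s i x\<bar> \<le> 3 * \<bar>f x\<bar>" for i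
      proof (rule always_eventually, rule allI)
        fix x show "norm \<bar>f x - s i x\<bar> \<le> 3 * \<bar>f x\<bar>" using lim.hyps(3)[of x i] by simp
      qed
    qed (use lim in auto)
    then have "eventually (\<lambda>i. (\<integral>x. \<bar>f x - s i x\<bar> \<partial>lborel) < e / 2) sequentially"
      using \<open>e > 0\<close> by (intro order_tendstoD(2)[of _ 0]) auto
    then obtain i where i: "(\<integral>x. \<bar>f x - s i x\<bar> \<partial>lborel) < e / 2" by (auto simp: eventually_sequentially)
    then have "\<bar>\<integral>x. \<bar>f (x + h) - f x\<bar> \<partial>lborel\<bar> \<le> (\<integral>x. \<bar>s i (x + h) - s i x\<bar> \<partial>lborel) + e" for h
      using translation_L1_approx[OF lim.hyps(4) lim.hyps(1)[of i], of h] by simp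
    then show "\<exists>G. (G \<longlongrightarrow> 0) (at 0) \<and> (\<forall>h. \<bar>\<integral>x. \<bar>f (x + h) - f x\<bar> \<partial>lborel\<bar> \<le> G h + e)"
      using lim.IH[of i] by blast
  qed
qed

lemma convolve_mollifier_eq:
  assumes "r > 0" "u \<in> borel_measurable borel"
  shows "convolve (mollifier r) u x = (\<integral>z. mollifier r z * u (x + z) \<partial>lborel)"
proof -
  have [measurable]: "u \<in> borel_measurable borel" "(mollifier r :: real^'a \<Rightarrow> real) \<in> borel_measurable borel"
    using assms test_measurable[OF mollifier_test] by auto
  have "convolve (mollifier r) u x = (\<integral>z. mollifier r (x - (z + x)) * u (z + x) \<partial>lborel)"
    unfolding convolve_def by (rule integral_lborel_translate[symmetric]) measurable
  then show ?thesis by (simp add: add.commute mollifier_even assms(1))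
qed

lemma mollifier_nn_integral: "r > 0 \<Longrightarrow> (\<integral>\<^sup>+x. ennreal (mollifier r x) \<partial>(lborel :: (real^'n) measure)) = 1"
  using test_integrable[OF mollifier_test, of r] mollifier_integral[of r]
  by (subst nn_integral_eq_integral) (auto simp: mollifier_nonneg)

lemma convolve_mollifier_integrable:
  fixes u :: "real^'n \<Rightarrow> real"
  assumes r: "r > 0" and u: "integrable lborel u"
  shows "integrable lborel (convolve (mollifier r) u)"
proof -
  let ?m = "mollifier r :: real^'n \<Rightarrow> real"
  have [measurable]: "u \<in> borel_measurable borel" using u by auto
  have [measurable]: "?m \<in> borel_measurable borel" by (rule test_measurable[OF mollifier_test[OF r]])
  have cm: "convolve ?m u \<in> borel_measurable borel"
    by (rule smooth_measurable[OF smooth_convolve[OF mollifier_test[OF r] u]])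
  have "(\<integral>\<^sup>+x. ennreal (norm (convolve ?m u x)) \<partial>lborel)
      \<le> (\<integral>\<^sup>+x. (\<integral>\<^sup>+z. ennreal (?m z) * ennreal \<bar>u (x + z)\<bar> \<partial>lborel) \<partial>lborel)"
  proof (intro nn_integral_mono)
    fix x
    have "ennreal (norm (convolve ?m u x)) \<le> (\<integral>\<^sup>+z. norm (?m z * u (x + z)) \<partial>lborel)"
    proof (cases "integrable lborel (\<lambda>z. ?m z * u (x + z))")
      case True
      then show ?thesis
        using integral_norm_bound_ennreal[OF True] by (simp add: convolve_mollifier_eq[OF r])
    qed (simp add: convolve_mollifier_eq[OF r] not_integrable_integral_eq)
    also have "\<dots> = (\<integral>\<^sup>+z. ennreal (?m z) * ennreal \<bar>u (x + z)\<bar> \<partial>lborel)"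
      by (intro nn_integral_cong) (simp add: abs_mult mollifier_nonneg[OF r] ennreal_mult)
    finally show "ennreal (norm (convolve ?m u x)) \<le> (\<integral>\<^sup>+z. ennreal (?m z) * ennreal \<bar>u (x + z)\<bar> \<partial>lborel)" .
  qed
  also have "\<dots> = (\<integral>\<^sup>+z. (\<integral>\<^sup>+x. ennreal (?m z) * ennreal \<bar>u (x + z)\<bar> \<partial>lborel) \<partial>lborel)"
    by (rule lborel_pair.Fubini') measurable
  also have "\<dots> = (\<integral>\<^sup>+z. ennreal (?m z) * (\<integral>\<^sup>+x. ennreal \<bar>u x\<bar> \<partial>lborel) \<partial>lborel)"
    using nn_integral_lborel_translate[of "\<lambda>x. ennreal \<bar>u x\<bar>"]
    by (simp add: nn_integral_cmult)
  also have "\<dots> = (\<integral>\<^sup>+x. ennreal \<bar>u x\<bar> \<partial>lborel)"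
    by (subst nn_integral_multc) (auto simp: mollifier_nn_integral r)
  also have "\<dots> < \<infinity>" using u by (simp add: integrable_iff_bounded)
  finally show ?thesis using cm by (intro integrableI_bounded) auto
qed

lemma convolve_mollifier_tendsto:
  fixes u :: "real^'n \<Rightarrow> real"
  assumes u: "integrable lborel u"
  shows "((\<lambda>r. \<integral>x. \<bar>convolve (mollifier r) u x - u x\<bar> \<partial>lborel) \<longlongrightarrow> 0) (at_right 0)"
proof (rule tendstoI)
  fix e :: real assume "e > 0"
  have [measurable]: "u \<in> borel_measurable borel" using u by auto
  obtain d where d: "d > 0" "\<And>h. h \<noteq> 0 \<Longrightarrow> norm h < d \<Longrightarrow> (\<integral>x. \<bar>u (x + h) - u x\<bar> \<partial>lborel) < e / 2"
    using tendstoD[OF translation_L1_continuous[OF u], of "e / 2"] \<open>e > 0\<close>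
    by (auto simp: eventually_at)
  have d': "(\<integral>x. \<bar>u (x + h) - u x\<bar> \<partial>lborel) \<le> e / 2" if "norm h < d" for h
    using d(2)[of h] that \<open>e > 0\<close> by (cases "h = 0") auto
  have main: "(\<integral>x. \<bar>convolve (mollifier r) u x - u x\<bar> \<partial>lborel) \<le> e / 2" if r: "0 < r" "r < d" for r
  proof -
    let ?m = "mollifier r :: real^'n \<Rightarrow> real"
    have [measurable]: "?m \<in> borel_measurable borel" by (rule test_measurable[OF mollifier_test[OF r(1)]])
    have cm [measurable]: "convolve ?m u \<in> borel_measurable borel"
      by (rule smooth_measurable[OF smooth_convolve[OF mollifier_test[OF r(1)] u]])
    obtain C where C: "\<And>x. \<bar>?m x\<bar> \<le> C" using test_bounded[OF mollifier_test[OF r(1)]] by blast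
    have int: "integrable lborel (\<lambda>z. u (x + z))" for x
      using u integrable_lborel_translate[of u x] by (simp add: add.commute)
    have int2: "integrable lborel (\<lambda>x. u (x + z))" for z
      using u integrable_lborel_translate[of u z] by simp
    have i1: "integrable lborel (\<lambda>z. ?m z * u (x + z))" for x
      by (rule integrable_bounded_mult[OF int]) (use C in auto)
    have i2: "integrable lborel (\<lambda>z. ?m z * u x)" for x
      by (intro integrable_mult_left test_integrable[OF mollifier_test[OF r(1)]])
    have "\<bar>convolve ?m u x - u x\<bar> \<le> (\<integral>z. ?m z * \<bar>u (x + z) - u x\<bar> \<partial>lborel)" for x
    proof -
      have "convolve ?m u x - u x = (\<integral>z. ?m z * u (x + z) \<partial>lborel) - (\<integral>z. ?m z * u x \<partial>lborel)"
        using mollifier_integral[OF r(1), where 'n='n] by (simp add: convolve_mollifier_eq r)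
      also have "\<dots> = (\<integral>z. ?m z * (u (x + z) - u x) \<partial>lborel)"
        using i1[of x] i2[of x] by (simp add: right_diff_distrib)
      also have "\<bar>\<dots>\<bar> \<le> (\<integral>z. \<bar>?m z * (u (x + z) - u x)\<bar> \<partial>lborel)" by (rule integral_abs_bound)
      finally show ?thesis by (simp add: abs_mult mollifier_nonneg r)
    qed
    moreover have "integrable lborel (\<lambda>z. ?m z * \<bar>u (x + z) - u x\<bar>)" for x
      using integrable_abs[OF Bochner_Integration.integrable_diff[OF i1[of x] i2[of x]]]
      by (simp add: right_diff_distrib[symmetric] abs_mult mollifier_nonneg r)
    ultimately have le: "ennreal \<bar>convolve ?m u x - u x\<bar> \<le> (\<integral>\<^sup>+z. ennreal (?m z) * ennreal \<bar>u (x + z) - u x\<bar> \<partial>lborel)" for x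
      by (subst ennreal_mult[symmetric]) (auto simp: nn_integral_eq_integral mollifier_nonneg r intro!: ennreal_leI)
    have "(\<integral>\<^sup>+x. ennreal \<bar>convolve ?m u x - u x\<bar> \<partial>lborel)
        \<le> (\<integral>\<^sup>+x. (\<integral>\<^sup>+z. ennreal (?m z) * ennreal \<bar>u (x + z) - u x\<bar> \<partial>lborel) \<partial>lborel)"
      by (intro nn_integral_mono le)
    also have "\<dots> = (\<integral>\<^sup>+z. (\<integral>\<^sup>+x. ennreal (?m z) * ennreal \<bar>u (x + z) - u x\<bar> \<partial>lborel) \<partial>lborel)"
      by (rule lborel_pair.Fubini') measurable
    also have "\<dots> \<le> (\<integral>\<^sup>+z. ennreal (?m z) * ennreal (e / 2) \<partial>(lborel :: (real^'n) measure))"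
    proof (intro nn_integral_mono)
      fix z
      show "(\<integral>\<^sup>+x. ennreal (?m z) * ennreal \<bar>u (x + z) - u x\<bar> \<partial>lborel) \<le> ennreal (?m z) * ennreal (e / 2)"
      proof (cases "norm z < d")
        case True
        have "(\<integral>\<^sup>+x. ennreal \<bar>u (x + z) - u x\<bar> \<partial>lborel) = ennreal (\<integral>x. \<bar>u (x + z) - u x\<bar> \<partial>lborel)"
          using int2 u by (intro nn_integral_eq_integral) auto
        also have "\<dots> \<le> ennreal (e / 2)" by (intro ennreal_leI d' True)
        finally show ?thesis by (subst nn_integral_cmult) (auto intro: mult_left_mono)
      next
        case False
        then show ?thesis using mollifier_eq_0[OF r(1), of z] r by simp
      qed
    qed
    also have "\<dots> = ennreal (e / 2)"
      by (subst nn_integral_multc) (auto simp: mollifier_nn_integral r)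
    finally have fin: "(\<integral>\<^sup>+x. ennreal \<bar>convolve ?m u x - u x\<bar> \<partial>lborel) \<le> ennreal (e / 2)" .
    then have "integrable lborel (\<lambda>x. \<bar>convolve ?m u x - u x\<bar>)"
      by (intro integrableI_bounded) (auto intro: le_less_trans)
    then show ?thesis
      using fin \<open>e > 0\<close> by (subst (asm) nn_integral_eq_integral) auto
  qed
  show "eventually (\<lambda>r. dist (\<integral>x. \<bar>convolve (mollifier r) u x - u x\<bar> \<partial>lborel) 0 < e) (at_right 0)"
    unfolding eventually_at_right_field
  proof (intro exI[of _ d] conjI allI impI d)
    fix r assume "0 < r" "r < d"
    from main[OF this] show "dist (\<integral>x. \<bar>convolve (mollifier r) u x - u x\<bar> \<partial>lborel) 0 < e"
      using \<open>e > 0\<close> by (simp add: dist_real_def abs_of_nonneg)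
  qed
qed

lemma convolve_mollifier_square:
  fixes u :: "real^'n \<Rightarrow> real"
  assumes r: "r > 0" and u: "integrable lborel u" and u2: "integrable lborel (\<lambda>x. (u x)\<^sup>2)"
  shows "integrable lborel (\<lambda>x. (convolve (mollifier r) u x)\<^sup>2)"
    and "(\<integral>x. (convolve (mollifier r) u x)\<^sup>2 \<partial>lborel) \<le> (\<integral>x. (u x)\<^sup>2 \<partial>lborel)"
proof -
  let ?m = "mollifier r :: real^'n \<Rightarrow> real"
  have [measurable]: "u \<in> borel_measurable borel" using u by auto
  have [measurable]: "?m \<in> borel_measurable borel" by (rule test_measurable[OF mollifier_test[OF r]])
  have cm [measurable]: "convolve ?m u \<in> borel_measurable borel"
    by (rule smooth_measurable[OF smooth_convolve[OF mollifier_test[OF r] u]])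
  obtain C where C: "\<And>x. \<bar>?m x\<bar> \<le> C" using test_bounded[OF mollifier_test[OF r]] by blast
  have int: "integrable lborel (\<lambda>z. v (x + z))" if "integrable lborel v" for x and v :: "real^'n \<Rightarrow> real"
  proof -
    have "v \<in> borel_measurable borel" using that by auto
    with that integrable_lborel_translate[of v x] show ?thesis by (simp add: add.commute)
  qed
  have im: "integrable lborel (\<lambda>z. ?m z * v (x + z))" if "integrable lborel v" for x v
    by (rule integrable_bounded_mult[OF int[OF that]]) (use C in auto)
  have sq: "(convolve ?m u x)\<^sup>2 \<le> (\<integral>z. ?m z * (u (x + z))\<^sup>2 \<partial>lborel)" for x
  proof -
    let ?c = "convolve ?m u x"
    have "0 \<le> (\<integral>z. ?m z * (u (x + z) - ?c)\<^sup>2 \<partial>lborel)"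
      by (intro Bochner_Integration.integral_nonneg mult_nonneg_nonneg mollifier_nonneg r) simp
    also have "\<dots> = (\<integral>z. ?m z * (u (x + z))\<^sup>2 - 2 * ?c * (?m z * u (x + z)) + ?c\<^sup>2 * ?m z \<partial>lborel)"
      by (intro Bochner_Integration.integral_cong refl) (simp add: power2_diff algebra_simps)
    also have "\<dots> = (\<integral>z. ?m z * (u (x + z))\<^sup>2 \<partial>lborel) - 2 * ?c * ?c + ?c\<^sup>2 * 1"
      using im[OF u2, of x] im[OF u, of x]
      by (simp add: test_integrable[OF mollifier_test[OF r]] mollifier_integral[OF r] convolve_mollifier_eq[OF r, symmetric])
    finally show ?thesis by (simp add: power2_eq_square)
  qed
  have "(\<integral>\<^sup>+x. ennreal ((convolve ?m u x)\<^sup>2) \<partial>lborel)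
      \<le> (\<integral>\<^sup>+x. (\<integral>\<^sup>+z. ennreal (?m z) * ennreal ((u (x + z))\<^sup>2) \<partial>lborel) \<partial>lborel)"
  proof (intro nn_integral_mono)
    fix x
    have "(\<integral>\<^sup>+z. ennreal (?m z) * ennreal ((u (x + z))\<^sup>2) \<partial>lborel) = ennreal (\<integral>z. ?m z * (u (x + z))\<^sup>2 \<partial>lborel)"
      using im[OF u2, of x]
      by (subst ennreal_mult[symmetric]) (auto simp: nn_integral_eq_integral mollifier_nonneg r)
    then show "ennreal ((convolve ?m u x)\<^sup>2) \<le> (\<integral>\<^sup>+z. ennreal (?m z) * ennreal ((u (x + z))\<^sup>2) \<partial>lborel)"
      using sq[of x] by (simp add: ennreal_leI)
  qed
  also have "\<dots> = (\<integral>\<^sup>+z. (\<integral>\<^sup>+x. ennreal (?m z) * ennreal ((u (x + z))\<^sup>2) \<partial>lborel) \<partial>lborel)"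
    by (rule lborel_pair.Fubini') measurable
  also have "\<dots> = (\<integral>\<^sup>+z. ennreal (?m z) * (\<integral>\<^sup>+x. ennreal ((u x)\<^sup>2) \<partial>lborel) \<partial>lborel)"
    using nn_integral_lborel_translate[of "\<lambda>x. ennreal ((u x)\<^sup>2)"]
    by (simp add: nn_integral_cmult)
  also have "\<dots> = (\<integral>\<^sup>+x. ennreal ((u x)\<^sup>2) \<partial>lborel)"
    by (subst nn_integral_multc) (auto simp: mollifier_nn_integral r)
  also have "\<dots> = ennreal (\<integral>x. (u x)\<^sup>2 \<partial>lborel)"
    using u2 by (intro nn_integral_eq_integral) auto
  finally have fin: "(\<integral>\<^sup>+x. ennreal ((convolve ?m u x)\<^sup>2) \<partial>lborel) \<le> ennreal (\<integral>x. (u x)\<^sup>2 \<partial>lborel)" .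
  then show int: "integrable lborel (\<lambda>x. (convolve ?m u x)\<^sup>2)"
    by (intro integrableI_bounded) (auto intro: le_less_trans)
  show "(\<integral>x. (convolve ?m u x)\<^sup>2 \<partial>lborel) \<le> (\<integral>x. (u x)\<^sup>2 \<partial>lborel)"
    using fin by (subst (asm) nn_integral_eq_integral[OF int]) auto
qed

section \<open>Locally integrable functions and weak derivatives\<close>

lemma borel_representative:
  fixes f :: "'a::euclidean_space \<Rightarrow> real"
  assumes f: "f \<in> borel_measurable (lebesgue_on S)" and S: "S \<in> sets borel"
  obtains g where "g \<in> borel_measurable borel" "\<And>x. x \<notin> S \<Longrightarrow> g x = 0"
    "AE x in lborel. x \<in> S \<longrightarrow> g x = f x"
proof -
  have S': "S \<in> sets lebesgue" using S by simp
  have "(\<lambda>x. if x \<in> S then f x else 0) \<in> borel_measurable lebesgue"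
    using borel_measurable_if[OF S'] f by blast
  then obtain h where h: "h \<in> borel_measurable lborel" "AE x in lborel. (if x \<in> S then f x else 0) = h x"
    using completion_ex_borel_measurable_real by blast
  show thesis
  proof
    show "(\<lambda>x. indicator S x * h x) \<in> borel_measurable borel" using h(1) S by simp
    show "AE x in lborel. x \<in> S \<longrightarrow> indicator S x * h x = f x"
      using h(2) by eventually_elim auto
  qed auto
qed

lemma AE_lebesgue_on_iff:
  assumes "S \<in> sets lebesgue"
  shows "(AE x in lebesgue_on S. P x) \<longleftrightarrow> (AE x in lebesgue. x \<in> S \<longrightarrow> P x)"
  using assms by (subst AE_restrict_space_iff) auto

lemma integrable_lebesgue_on_iff:
  fixes f :: "'a::euclidean_space \<Rightarrow> 'b::euclidean_space"
  assumes "S \<in> sets lebesgue"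
  shows "integrable (lebesgue_on S) f \<longleftrightarrow> integrable lebesgue (\<lambda>x. indicator S x *\<^sub>R f x)"
  using assms by (simp add: integrable_restrict_space)

lemma integral_lebesgue_on:
  fixes f :: "'a::euclidean_space \<Rightarrow> 'b::euclidean_space"
  assumes "S \<in> sets lebesgue"
  shows "(\<integral>x. f x \<partial>lebesgue_on S) = (\<integral>x. indicator S x *\<^sub>R f x \<partial>lebesgue)"
  using assms by (simp add: integral_restrict_space)

text \<open>A locally integrable function restricted to a compact set becomes a Borel function on the
  whole space, to which mollification applies.\<close>

lemma locally_integrable_representative:
  fixes f :: "'a::euclidean_space \<Rightarrow> real"
  assumes f: "locally_integrable X f" and K: "compact K" "K \<subseteq> X" and X: "open X"
  obtains u where "integrable lborel u" "\<And>x. x \<notin> K \<Longrightarrow> u x = 0"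
    "AE x in lborel. x \<in> K \<longrightarrow> u x = f x"
    "\<forall>\<phi>\<in>borel_measurable borel. (\<forall>x. x \<notin> K \<longrightarrow> \<phi> x = 0) \<longrightarrow>
       (\<integral>x. \<phi> x * f x \<partial>lebesgue_on X) = (\<integral>x. \<phi> x * u x \<partial>lborel)"
proof -
  have Kb: "K \<in> sets borel" using K by (simp add: compact_imp_closed)
  have intK: "integrable (lebesgue_on K) f" using f K by (simp add: locally_integrable_def)
  have "f \<in> borel_measurable (lebesgue_on K)" using intK by auto
  from borel_representative[OF this Kb] obtain u where
    u: "u \<in> borel_measurable borel" "\<And>x. x \<notin> K \<Longrightarrow> u x = 0" "AE x in lborel. x \<in> K \<longrightarrow> u x = f x"
    by blast
  have AE: "AE x in lebesgue. indicator K x *\<^sub>R f x = u x"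
    using AE_completion[OF u(3)] by eventually_elim (auto simp: u(2) indicator_def)
  have i: "integrable lebesgue (\<lambda>x. indicator K x *\<^sub>R f x)"
    using intK Kb by (simp add: integrable_restrict_space)
  have "integrable lebesgue u"
    by (rule integrable_cong_AE_imp[OF i]) (use u(1) AE in \<open>auto intro: measurable_completion\<close>)
  then have "integrable lborel u" using u(1) by (simp add: integrable_completion)
  moreover have "(\<integral>x. \<phi> x * f x \<partial>lebesgue_on X) = (\<integral>x. \<phi> x * u x \<partial>lborel)"
    if \<phi>: "\<phi> \<in> borel_measurable borel" "\<And>x. x \<notin> K \<Longrightarrow> \<phi> x = 0" for \<phi>
  proof -
    have "(\<integral>x. \<phi> x * f x \<partial>lebesgue_on X) = (\<integral>x. indicator X x *\<^sub>R (\<phi> x * f x) \<partial>lebesgue)"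
      using X by (intro integral_lebesgue_on) auto
    also have "\<dots> = (\<integral>x. \<phi> x * (indicator K x *\<^sub>R f x) \<partial>lebesgue)"
      using K \<phi>(2) by (intro Bochner_Integration.integral_cong refl) (auto simp: indicator_def)
    also have "\<dots> = (\<integral>x. \<phi> x * u x \<partial>lebesgue)"
    proof (rule integral_cong_AE)
      have [measurable]: "(\<lambda>x. indicator K x *\<^sub>R f x) \<in> borel_measurable lebesgue"
        "u \<in> borel_measurable lebesgue" "\<phi> \<in> borel_measurable lebesgue"
        using i u(1) \<phi>(1) by (auto intro: measurable_completion)
      show "(\<lambda>x. \<phi> x * (indicator K x *\<^sub>R f x)) \<in> borel_measurable lebesgue"
        "(\<lambda>x. \<phi> x * u x) \<in> borel_measurable lebesgue" by measurable
      show "AE x in lebesgue. \<phi> x * (indicator K x *\<^sub>R f x) = \<phi> x * u x"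
        using AE by eventually_elim (simp only:)
    qed
    also have "\<dots> = (\<integral>x. \<phi> x * u x \<partial>lborel)"
      using \<phi>(1) u(1) by (intro integral_completion) auto
    finally show ?thesis .
  qed
  ultimately show thesis using that[of u] u by blast
qed

lemma locally_integrable_test_mult:
  fixes f :: "real^'n \<Rightarrow> 'b::euclidean_space"
  assumes f: "locally_integrable X f" and \<phi>: "\<phi> \<in> test_functions X" and X: "open X"
  shows "integrable (lebesgue_on X) (\<lambda>x. \<phi> x *\<^sub>R f x)"
  using \<phi>
proof (rule test_functionsE)
  fix K assume K: "compact K" "K \<subseteq> X" "\<And>x. x \<notin> K \<Longrightarrow> \<phi> x = 0"
  obtain C where C: "\<And>x. \<bar>\<phi> x\<bar> \<le> C" using test_bounded[OF \<phi>] by blast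
  have Kl: "K \<in> sets lebesgue" using K by (simp add: compact_imp_closed)
  have m [measurable]: "\<phi> \<in> borel_measurable lebesgue"
    using test_measurable[OF \<phi>] by (simp add: measurable_completion)
  have i: "integrable lebesgue (\<lambda>x. indicator K x *\<^sub>R f x)"
    using f K integrable_lebesgue_on_iff[OF Kl, of f] by (simp add: locally_integrable_def)
  have "integrable lebesgue (\<lambda>x. \<phi> x *\<^sub>R (indicator K x *\<^sub>R f x))"
  proof (rule Bochner_Integration.integrable_bound)
    show "integrable lebesgue (\<lambda>x. C *\<^sub>R (indicator K x *\<^sub>R f x))" by (rule integrable_scaleR_right) (rule i)
    have "norm (\<phi> x *\<^sub>R v) \<le> norm (C *\<^sub>R v)" for x and v :: 'b
      unfolding norm_scaleR using C[of x] by (intro mult_right_mono) auto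
    then show "AE x in lebesgue. norm (\<phi> x *\<^sub>R (indicator K x *\<^sub>R f x)) \<le> norm (C *\<^sub>R (indicator K x *\<^sub>R f x))"
      by blast
  qed (rule borel_measurable_scaleR[OF m borel_measurable_integrable[OF i]])
  moreover have "(\<lambda>x. \<phi> x *\<^sub>R (indicator K x *\<^sub>R f x)) = (\<lambda>x. indicator X x *\<^sub>R (\<phi> x *\<^sub>R f x))"
    using K by (auto simp: indicator_def fun_eq_iff)
  ultimately show ?thesis using X by (simp add: integrable_restrict_space)
qed

lemma test_mollifier_shift:
  assumes "r > 0" "cball x r \<subseteq> X"
  shows "(\<lambda>y. mollifier r (x - y)) \<in> test_functions X"
proof (rule test_functionsI[of _ "cball x r"])
  show "smooth (\<lambda>y. mollifier r (x - y))"
    using C_k_reflect_shift test_smooth[OF mollifier_test[OF assms(1)]] by blast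
qed (use assms in \<open>auto simp: dist_norm mollifier_eq_0\<close>)

lemma compact_neighbourhood:
  fixes K :: "'a::euclidean_space set"
  assumes "compact K" "open X" "K \<subseteq> X"
  obtains L r where "0 < r" "compact L" "L \<subseteq> X" "K \<subseteq> L" "\<And>x. x \<in> K \<Longrightarrow> cball x r \<subseteq> L"
proof -
  obtain r where r: "r > 0" "(\<Union>x\<in>K. cball x r) \<subseteq> X"
    using compact_subset_open_imp_cball_epsilon_subset[OF assms] by blast
  define L where "L = {x + y |x y. x \<in> K \<and> y \<in> cball 0 r}"
  have eq: "L = (\<Union>x\<in>K. cball x r)"
  proof -
    have "z \<in> cball x r \<longleftrightarrow> (\<exists>y\<in>cball 0 r. z = x + y)" for x z :: 'a
      by (auto simp: dist_norm norm_minus_commute intro!: bexI[of _ "z - x"])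
    then show ?thesis unfolding L_def by blast
  qed
  show thesis
  proof
    show "compact L" unfolding L_def by (intro compact_sums assms) auto
    show "K \<subseteq> L" "L \<subseteq> X" "\<And>x. x \<in> K \<Longrightarrow> cball x r \<subseteq> L" using r by (auto simp: eq)
  qed (rule r)
qed

lemma AE_eq_0_of_test:
  fixes f :: "real^'n \<Rightarrow> real"
  assumes f: "locally_integrable X f" and X: "open X"
    and 0: "\<And>\<phi>. \<phi> \<in> test_functions X \<Longrightarrow> (\<integral>x. \<phi> x * f x \<partial>lebesgue_on X) = 0"
  shows "AE x in lebesgue_on X. f x = 0"
proof -
  have *: "AE x in lebesgue. x \<in> K \<longrightarrow> f x = 0" if K: "compact K" "K \<subseteq> X" for K
  proof -
    obtain L r0 where L: "0 < r0" "compact L" "L \<subseteq> X" "K \<subseteq> L" "\<And>x. x \<in> K \<Longrightarrow> cball x r0 \<subseteq> L"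
      by (rule compact_neighbourhood[OF K(1) X K(2)]) (rule that, assumption+)
    obtain u where u: "integrable lborel u" "\<And>x. x \<notin> L \<Longrightarrow> u x = 0"
      "AE x in lborel. x \<in> L \<longrightarrow> u x = f x"
      "\<forall>\<phi>\<in>borel_measurable borel. (\<forall>x. x \<notin> L \<longrightarrow> \<phi> x = 0) \<longrightarrow>
         (\<integral>x. \<phi> x * f x \<partial>lebesgue_on X) = (\<integral>x. \<phi> x * u x \<partial>lborel)"
      by (rule locally_integrable_representative[OF f L(2,3) X]) (rule that, assumption+)
    have Kb [measurable]: "K \<in> sets borel" using K by (simp add: compact_imp_closed)
    have iK: "integrable lborel (\<lambda>x. indicator K x * \<bar>u x\<bar>)"
      by (rule integrable_bounded_mult[of _ _ _ 1]) (use u(1) in \<open>auto simp: indicator_def\<close>)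
    have le: "(\<integral>x. indicator K x * \<bar>u x\<bar> \<partial>lborel) \<le> (\<integral>x. \<bar>convolve (mollifier r) u x - u x\<bar> \<partial>lborel)"
      if r: "0 < r" "r < r0" and i: "integrable lborel (\<lambda>x. \<bar>convolve (mollifier r) u x - u x\<bar>)" for r
    proof (rule integral_mono[OF iK i])
      fix x
      show "indicator K x * \<bar>u x\<bar> \<le> \<bar>convolve (mollifier r) u x - u x\<bar>"
      proof (cases "x \<in> K")
        case True
        have sub: "cball x r \<subseteq> L" using L(5)[OF True] r by (meson less_imp_le order_trans subset_cball)
        have t: "(\<lambda>y. mollifier r (x - y)) \<in> test_functions X"
          using sub L(3) r by (intro test_mollifier_shift) auto
        have "(\<integral>y. mollifier r (x - y) * u y \<partial>lborel) = (\<integral>y. mollifier r (x - y) * f y \<partial>lebesgue_on X)"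
        proof (rule u(4)[rule_format, symmetric])
          show "(\<lambda>y. mollifier r (x - y)) \<in> borel_measurable borel" by (rule test_measurable[OF t])
          fix y assume "y \<notin> L"
          then have "y \<notin> cball x r" using sub by blast
          then show "mollifier r (x - y) = 0" using mollifier_eq_0[OF r(1), of "x - y"] by (simp add: dist_norm)
        qed
        then show ?thesis using 0[OF t] by (simp add: convolve_def True)
      qed simp
    qed
    have "(\<integral>x. indicator K x * \<bar>u x\<bar> \<partial>lborel) \<le> 0"
    proof (rule tendsto_lowerbound[OF convolve_mollifier_tendsto[OF u(1)]])
      show "eventually (\<lambda>r. (\<integral>x. indicator K x * \<bar>u x\<bar> \<partial>lborel)
          \<le> (\<integral>x. \<bar>convolve (mollifier r) u x - u x\<bar> \<partial>lborel)) (at_right 0)"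
        unfolding eventually_at_right_field
      proof (intro exI[of _ r0] conjI allI impI L(1))
        fix r assume "0 < r" "r < r0"
        then show "(\<integral>x. indicator K x * \<bar>u x\<bar> \<partial>lborel) \<le> (\<integral>x. \<bar>convolve (mollifier r) u x - u x\<bar> \<partial>lborel)"
          by (intro le Bochner_Integration.integrable_abs Bochner_Integration.integrable_diff convolve_mollifier_integrable u)
      qed
    qed simp
    then have "(\<integral>x. indicator K x * \<bar>u x\<bar> \<partial>lborel) = 0"
      by (intro antisym Bochner_Integration.integral_nonneg) auto
    then have "AE x in lborel. indicator K x * \<bar>u x\<bar> = 0"
      by (subst (asm) integral_nonneg_eq_0_iff_AE[OF iK]) auto
    then have "AE x in lborel. x \<in> K \<longrightarrow> f x = 0"
      using u(3) by eventually_elim (use L(4) in auto)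
    then show ?thesis by (rule AE_completion)
  qed
  have "\<exists>C. (\<forall>n::nat. compact (C n)) \<and> (\<forall>n. C n \<subseteq> X) \<and> \<Union>(range C) = X"
  proof (rule open_Union_compact_subsets[OF X])
    fix C assume "\<And>n::nat. compact (C n)" "\<And>n. C n \<subseteq> X" "\<Union>(range C) = X"
    then show ?thesis by (intro exI[of _ C]) simp
  qed
  then obtain C where C: "\<And>n::nat. compact (C n)" "\<And>n. C n \<subseteq> X" "\<Union>(range C) = X" by blast
  have "AE x in lebesgue. \<forall>n. x \<in> C n \<longrightarrow> f x = 0"
    unfolding AE_all_countable using * C by blast
  then have "AE x in lebesgue. x \<in> X \<longrightarrow> f x = 0"
    by eventually_elim (use C(3) in auto)
  then show ?thesis using X by (simp add: AE_lebesgue_on_iff)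
qed

lemma integrable_imp_locally_integrable:
  fixes f :: "'a::euclidean_space \<Rightarrow> 'b::euclidean_space"
  assumes "integrable (lebesgue_on X) f" "X \<in> sets lebesgue"
  shows "locally_integrable X f"
  unfolding locally_integrable_def
proof (intro allI impI)
  fix K :: "'a set" assume K: "compact K \<and> K \<subseteq> X"
  then have Kl: "K \<in> sets lebesgue" by (simp add: compact_imp_closed)
  have "integrable lebesgue (\<lambda>x. indicator X x *\<^sub>R f x)"
    using assms integrable_lebesgue_on_iff by blast
  then have "integrable lebesgue (\<lambda>x. indicator K x *\<^sub>R (indicator X x *\<^sub>R f x))"
    by (rule integrable_mult_indicator[OF Kl])
  moreover have "(\<lambda>x. indicator K x *\<^sub>R (indicator X x *\<^sub>R f x)) = (\<lambda>x. indicator K x *\<^sub>R f x)"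
    using K by (auto simp: indicator_def fun_eq_iff)
  ultimately show "integrable (lebesgue_on K) f" using integrable_lebesgue_on_iff[OF Kl] by metis
qed

lemma L2_locally_integrable:
  fixes f :: "'a::euclidean_space \<Rightarrow> 'b::euclidean_space"
  shows "f \<in> L2 X \<Longrightarrow> X \<in> lmeasurable \<Longrightarrow> locally_integrable X f"
  by (intro integrable_imp_locally_integrable L2_integrable fmeasurableD)

lemma locally_integrable_inner:
  "locally_integrable X f \<Longrightarrow> locally_integrable X (\<lambda>x. f x \<bullet> b)"
  by (auto simp: locally_integrable_def)

lemma locally_integrable_nth:
  fixes f :: "'a::euclidean_space \<Rightarrow> real^'m"
  shows "locally_integrable X f \<Longrightarrow> locally_integrable X (\<lambda>x. f x $ i)"
  using locally_integrable_inner[of X f "axis i 1"] by (simp add: cart_eq_inner_axis)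

lemma locally_integrable_diff:
  "locally_integrable X f \<Longrightarrow> locally_integrable X g \<Longrightarrow> locally_integrable X (\<lambda>x. f x - g x)"
  by (auto simp: locally_integrable_def)

lemma integral_test_inner:
  fixes f :: "real^'n \<Rightarrow> 'b::euclidean_space"
  assumes "locally_integrable X f" "\<phi> \<in> test_functions X" "open X"
  shows "(\<integral>x. \<phi> x *\<^sub>R f x \<partial>lebesgue_on X) \<bullet> b = (\<integral>x. \<phi> x * (f x \<bullet> b) \<partial>lebesgue_on X)"
proof -
  have "(\<integral>x. (\<phi> x *\<^sub>R f x) \<bullet> b \<partial>lebesgue_on X) = (\<integral>x. \<phi> x *\<^sub>R f x \<partial>lebesgue_on X) \<bullet> b"
    by (rule integral_inner_left) (rule locally_integrable_test_mult[OF assms])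
  then show ?thesis by simp
qed

lemma integral_test_nth:
  fixes f :: "real^'n \<Rightarrow> real^'m"
  assumes "locally_integrable X f" "\<phi> \<in> test_functions X" "open X"
  shows "(\<integral>x. \<phi> x *\<^sub>R f x \<partial>lebesgue_on X) $ i = (\<integral>x. \<phi> x * f x $ i \<partial>lebesgue_on X)"
  using integral_test_inner[OF assms, of "axis i 1"] by (simp add: cart_eq_inner_axis)

lemma is_function_unique:
  fixes f g :: "real^'n \<Rightarrow> 'b::euclidean_space"
  assumes X: "open X" and "is_function X T f" "is_function X T g"
  shows "AE x in lebesgue_on X. f x = g x"
proof -
  have f: "locally_integrable X f" and g: "locally_integrable X g"
    and eq: "\<And>\<phi>. \<phi> \<in> test_functions X \<Longrightarrow>
      (\<integral>x. \<phi> x *\<^sub>R f x \<partial>lebesgue_on X) = (\<integral>x. \<phi> x *\<^sub>R g x \<partial>lebesgue_on X)"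
    using assms by (auto simp: is_function_def distr_eq_def)
  have "AE x in lebesgue_on X. (f x - g x) \<bullet> b = 0" for b
  proof (rule AE_eq_0_of_test[OF locally_integrable_inner[OF locally_integrable_diff[OF f g]] X])
    fix \<phi> assume \<phi>: "\<phi> \<in> test_functions X"
    have "(\<integral>x. \<phi> x *\<^sub>R (f x - g x) \<partial>lebesgue_on X) = 0"
      using eq[OF \<phi>] locally_integrable_test_mult[OF f \<phi> X] locally_integrable_test_mult[OF g \<phi> X]
      by (simp add: scaleR_diff_right)
    then show "(\<integral>x. \<phi> x * ((f x - g x) \<bullet> b) \<partial>lebesgue_on X) = 0"
      using integral_test_inner[OF locally_integrable_diff[OF f g] \<phi> X, of b] by simp
  qed
  then have "AE x in lebesgue_on X. \<forall>b\<in>Basis. (f x - g x) \<bullet> b = 0"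
    by (subst AE_ball_countable) (auto intro: countable_finite)
  then show ?thesis
    by eventually_elim (auto simp: euclidean_eq_iff[of "f _"] inner_diff_left)
qed

lemma is_function_grad_iff:
  fixes g :: "real^'n \<Rightarrow> real^'n"
  assumes "open X"
  shows "is_function X (distr_grad X u) g \<longleftrightarrow> locally_integrable X g \<and>
    (\<forall>i. \<forall>\<phi>\<in>test_functions X. (\<integral>x. u x * pd i \<phi> x \<partial>lebesgue_on X) = - (\<integral>x. \<phi> x * g x $ i \<partial>lebesgue_on X))"
  using integral_test_nth[OF _ _ assms, of g]
  by (auto simp: is_function_def distr_eq_def vec_eq_iff distr_grad_def distr_pd_def minus_equation_iff)

subsection \<open>Chain rule\<close>

lemma representative_pd_convolve:
  fixes u g :: "real^'n \<Rightarrow> real"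
  assumes u: "integrable lborel u" and r: "r > 0"
    and w: "(\<integral>y. pd i (\<lambda>y. mollifier r (x - y)) y * u y \<partial>lborel) = - (\<integral>y. mollifier r (x - y) * g y \<partial>lborel)"
  shows "pd i (convolve (mollifier r) u) x = convolve (mollifier r) g x"
proof -
  have "pd i (\<lambda>y. mollifier r (x - y)) y = - pd i (mollifier r) (x - y)" for y
    by (rule pd_reflect_shift) (rule smooth_differentiable[OF test_smooth[OF mollifier_test[OF r]]])
  then show ?thesis
    using w by (simp add: pd_convolve[OF mollifier_test[OF r] u] convolve_def)
qed

lemma integral_bounded_mult_le:
  fixes c d :: "'a \<Rightarrow> real"
  assumes "integrable M d" "c \<in> borel_measurable M" "\<And>x. \<bar>c x\<bar> \<le> C"
  shows "\<bar>\<integral>x. c x * d x \<partial>M\<bar> \<le> C * (\<integral>x. \<bar>d x\<bar> \<partial>M)"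
proof -
  have "\<bar>\<integral>x. c x * d x \<partial>M\<bar> \<le> (\<integral>x. \<bar>c x * d x\<bar> \<partial>M)" by (rule integral_abs_bound)
  also have "\<dots> \<le> (\<integral>x. C * \<bar>d x\<bar> \<partial>M)"
  proof (rule integral_mono)
    show "integrable M (\<lambda>x. \<bar>c x * d x\<bar>)" by (rule integrable_abs[OF integrable_bounded_mult[OF assms]])
    show "integrable M (\<lambda>x. C * \<bar>d x\<bar>)" using assms(1) by simp
    show "\<bar>c x * d x\<bar> \<le> C * \<bar>d x\<bar>" for x
      unfolding abs_mult by (intro mult_right_mono assms(3)) simp
  qed
  finally show ?thesis by simp
qed

lemma weak_gradient_chain:
  fixes u :: "real^'n \<Rightarrow> real"
  assumes X: "open X" and u: "locally_integrable X u" and g: "is_function X (distr_grad X u) g"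
    and F: "\<And>t. (F has_real_derivative F' t) (at t)" and F'c: "continuous_on UNIV F'"
    and F'1: "\<And>t. \<bar>F' t\<bar> \<le> 1"
  shows "locally_integrable X (\<lambda>x. F (u x))"
    and "is_function X (distr_grad X (\<lambda>x. F (u x))) (\<lambda>x. F' (u x) *\<^sub>R g x)"
proof -
  have Fc: "continuous_on UNIV F" using F by (intro DERIV_continuous_on) blast
  have Fm [measurable]: "F \<in> borel_measurable borel" "F' \<in> borel_measurable borel"
    using Fc F'c by (auto intro: borel_measurable_continuous_onI)
  have Flip: "\<bar>F a - F b\<bar> \<le> \<bar>a - b\<bar>" for a b
  proof -
    have "norm (F a - F b) \<le> 1 * norm (a - b)"
      by (rule field_differentiable_bound[of UNIV F F']) (use F F'1 in auto)
    then show ?thesis by simp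
  qed
  have gl: "locally_integrable X g"
    and gw: "\<And>i \<phi>. \<phi> \<in> test_functions X \<Longrightarrow>
      (\<integral>x. u x * pd i \<phi> x \<partial>lebesgue_on X) = - (\<integral>x. \<phi> x * g x $ i \<partial>lebesgue_on X)"
    using g by (auto simp: is_function_grad_iff[OF X])
  show Fl: "locally_integrable X (\<lambda>x. F (u x))"
    unfolding locally_integrable_def
  proof (intro allI impI)
    fix K assume K: "compact K \<and> K \<subseteq> X"
    then have [simp]: "integrable (lebesgue_on K) u" using u by (simp add: locally_integrable_def)
    have "K \<in> lmeasurable" using K by (simp add: lmeasurable_compact)
    then interpret finite_measure "lebesgue_on K" by (rule finite_measure_lebesgue_on)
    show "integrable (lebesgue_on K) (\<lambda>x. F (u x))"
    proof (rule Bochner_Integration.integrable_bound)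
      show "integrable (lebesgue_on K) (\<lambda>x. \<bar>F 0\<bar> + \<bar>u x\<bar>)" by simp
      have "\<bar>F t\<bar> \<le> \<bar>F 0\<bar> + \<bar>t\<bar>" for t using Flip[of t 0] by simp
      then show "AE x in lebesgue_on K. norm (F (u x)) \<le> norm (\<bar>F 0\<bar> + \<bar>u x\<bar>)" by simp
      have "u \<in> borel_measurable (lebesgue_on K)" by (rule borel_measurable_integrable) simp
      then show "(\<lambda>x. F (u x)) \<in> borel_measurable (lebesgue_on K)" by measurable
    qed
  qed
  have F'gl: "locally_integrable X (\<lambda>x. F' (u x) *\<^sub>R g x)"
    unfolding locally_integrable_def
  proof (intro allI impI)
    fix K assume K: "compact K \<and> K \<subseteq> X"
    then have i: "integrable (lebesgue_on K) u" "integrable (lebesgue_on K) g"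
      using u gl by (simp_all add: locally_integrable_def)
    show "integrable (lebesgue_on K) (\<lambda>x. F' (u x) *\<^sub>R g x)"
    proof (rule Bochner_Integration.integrable_bound[OF i(2)])
      have [measurable]: "u \<in> borel_measurable (lebesgue_on K)" "g \<in> borel_measurable (lebesgue_on K)"
        using i by auto
      show "(\<lambda>x. F' (u x) *\<^sub>R g x) \<in> borel_measurable (lebesgue_on K)" by measurable
      have "\<bar>F' t\<bar> * norm v \<le> norm v" for t and v :: "real^'n"
        using F'1[of t] by (simp add: mult_left_le_one_le)
      then show "AE x in lebesgue_on K. norm (F' (u x) *\<^sub>R g x) \<le> norm (g x)" by simp
    qed
  qed
  have "(\<integral>x. F (u x) * pd i \<phi> x \<partial>lebesgue_on X) = - (\<integral>x. \<phi> x * (F' (u x) *\<^sub>R g x) $ i \<partial>lebesgue_on X)"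
    if \<phi>: "\<phi> \<in> test_functions X" for i \<phi>
    using \<phi>
  proof (rule test_functionsE)
    fix K assume K: "compact K" "K \<subseteq> X" "\<And>x. x \<notin> K \<Longrightarrow> \<phi> x = 0" "smooth \<phi>"
      "\<And>x i. x \<notin> K \<Longrightarrow> pd i \<phi> x = 0"
    obtain L r0 where L: "0 < r0" "compact L" "L \<subseteq> X" "K \<subseteq> L" "\<And>x. x \<in> K \<Longrightarrow> cball x r0 \<subseteq> L"
      by (rule compact_neighbourhood[OF K(1) X K(2)]) (rule that, assumption+)
    obtain U where U: "integrable lborel U" "AE x in lborel. x \<in> L \<longrightarrow> U x = u x"
      "\<forall>\<phi>\<in>borel_measurable borel. (\<forall>x. x \<notin> L \<longrightarrow> \<phi> x = 0) \<longrightarrow>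
         (\<integral>x. \<phi> x * u x \<partial>lebesgue_on X) = (\<integral>x. \<phi> x * U x \<partial>lborel)"
      by (rule locally_integrable_representative[OF u L(2,3) X]) (rule that, assumption+)
    obtain G where G: "integrable lborel G" "AE x in lborel. x \<in> L \<longrightarrow> G x = g x $ i"
      "\<forall>\<phi>\<in>borel_measurable borel. (\<forall>x. x \<notin> L \<longrightarrow> \<phi> x = 0) \<longrightarrow>
         (\<integral>x. \<phi> x * g x $ i \<partial>lebesgue_on X) = (\<integral>x. \<phi> x * G x \<partial>lborel)"
      by (rule locally_integrable_representative[OF locally_integrable_nth[OF gl] L(2,3) X]) (rule that, assumption+)
    have [measurable]: "U \<in> borel_measurable borel" "G \<in> borel_measurable borel"
      "\<phi> \<in> borel_measurable borel" "pd i \<phi> \<in> borel_measurable borel"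
      using U G test_measurable[OF \<phi>] test_measurable[OF test_pd[OF \<phi>]] by auto
    have \<phi>U: "\<phi> \<in> test_functions UNIV" using test_mono[OF \<phi>] by simp
    obtain C where C: "\<And>x. \<bar>\<phi> x\<bar> \<le> C" using test_bounded[OF \<phi>] by blast
    obtain C' where C': "\<And>x. \<bar>pd i \<phi> x\<bar> \<le> C'" using test_bounded[OF test_pd[OF \<phi>]] by blast
    define r where "r k = r0 / (real k + 2)" for k
    have r: "0 < r k" "r k < r0" for k
    proof -
      have "r0 * 1 < r0 * (real k + 2)" using L(1) by (intro mult_strict_left_mono) auto
      then show "0 < r k" "r k < r0" using L(1) by (simp_all add: r_def divide_less_eq)
    qed
    have "r \<longlonglongrightarrow> 0" unfolding r_def
      by (rule real_tendsto_divide_at_top[OF tendsto_const])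
        (rule filterlim_at_top_mono[OF filterlim_real_sequentially], simp)
    then have "filterlim r (at_right 0) sequentially"
      using r(1) by (intro tendsto_imp_filterlim_at_right) auto
    note lim = filterlim_compose[OF convolve_mollifier_tendsto this]
    let ?U = "\<lambda>k. convolve (mollifier (r k)) U" and ?G = "\<lambda>k. convolve (mollifier (r k)) G"
    have iU: "integrable lborel (\<lambda>x. ?U k x - U x)" and iG: "integrable lborel (\<lambda>x. ?G k x - G x)" for k
      by (intro Bochner_Integration.integrable_diff convolve_mollifier_integrable r U G)+
    obtain s :: "nat \<Rightarrow> nat" where s: "strict_mono s" "AE x in lborel. (\<lambda>k. ?U (s k) x - U x) \<longlonglongrightarrow> 0"
      using tendsto_L1_AE_subseq[of lborel "\<lambda>k x. ?U k x - U x", OF iU] lim[OF U(1)] by auto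
    have sU: "smooth (?U k)" for k by (rule smooth_convolve[OF mollifier_test[OF r(1)] U(1)])
    have [measurable]: "?U k \<in> borel_measurable borel" "?G k \<in> borel_measurable borel" for k
      using smooth_measurable[OF sU] smooth_measurable[OF smooth_convolve[OF mollifier_test[OF r(1)] G(1)]] by auto
    have pdU: "pd i (?U k) x = ?G k x" if x: "x \<in> K" for k x
    proof (rule representative_pd_convolve[OF U(1) r(1)])
      have sub: "cball x (r k) \<subseteq> L" using L(5)[OF x] r(2)[of k] by (meson less_imp_le order_trans subset_cball)
      define \<psi> where "\<psi> = (\<lambda>y. mollifier (r k) (x - y))"
      have \<psi>: "\<psi> \<in> test_functions X"
        unfolding \<psi>_def using sub L(3) r by (intro test_mollifier_shift) auto
      have \<psi>0: "\<psi> y = 0" if "y \<notin> L" for y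
      proof -
        have "y \<notin> cball x (r k)" using sub that by blast
        then show ?thesis unfolding \<psi>_def by (intro mollifier_eq_0 r) (simp add: dist_norm)
      qed
      have "(\<integral>y. pd i \<psi> y * U y \<partial>lborel) = (\<integral>y. pd i \<psi> y * u y \<partial>lebesgue_on X)"
        using test_measurable[OF test_pd[OF \<psi>]] pd_eq_0_outside[OF L(2) \<psi>0] by (intro U(3)[rule_format, symmetric]) auto
      also have "\<dots> = - (\<integral>y. \<psi> y * g y $ i \<partial>lebesgue_on X)"
        using gw[OF \<psi>, of i] by (simp add: mult.commute)
      also have "(\<integral>y. \<psi> y * g y $ i \<partial>lebesgue_on X) = (\<integral>y. \<psi> y * G y \<partial>lborel)"
        using test_measurable[OF \<psi>] \<psi>0 by (intro G(3)[rule_format]) auto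
      finally show "(\<integral>y. pd i (\<lambda>y. mollifier (r k) (x - y)) y * U y \<partial>lborel)
          = - (\<integral>y. mollifier (r k) (x - y) * G y \<partial>lborel)" by (simp add: \<psi>_def)
    qed
    have ibp: "(\<integral>x. pd i \<phi> x * F (?U k x) \<partial>lborel) = - (\<integral>x. (\<phi> x * F' (?U k x)) * ?G k x \<partial>lborel)" for k
    proof -
      have D: "((\<lambda>x. F (?U k x)) has_derivative (\<lambda>h. F' (?U k x) * frechet_derivative (?U k) (at x) h)) (at x)" for x
        using has_derivative_compose[OF frechet_derivative_worksI[OF smooth_differentiable[OF sU]], of F "(*) (F' (?U k x))"] F
        by (simp add: has_field_derivative_def)
      have pdF: "pd j (\<lambda>x. F (?U k x)) = (\<lambda>x. F' (?U k x) * pd j (?U k) x)" for j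
        using pd_eqI[OF D] by (simp add: pd_def fun_eq_iff)
      have "continuous_on UNIV (\<lambda>x. F' (?U k x) * pd j (?U k) x)" for j
        using smooth_continuous[OF sU] smooth_continuous[OF smooth_pd[OF sU]]
        by (intro continuous_on_mult continuous_on_compose2[OF F'c]) auto
      then have "C_k (Suc 0) (\<lambda>x. F (?U k x))" using D by (auto simp: pdF intro: differentiableI)
      from integral_by_parts[OF this \<phi>U, of i]
      have "(\<integral>x. pd i \<phi> x * F (?U k x) \<partial>lborel) = - (\<integral>x. \<phi> x * (F' (?U k x) * pd i (?U k) x) \<partial>lborel)"
        by (simp add: pdF mult_ac)
      also have "(\<integral>x. \<phi> x * (F' (?U k x) * pd i (?U k) x) \<partial>lborel) = (\<integral>x. (\<phi> x * F' (?U k x)) * ?G k x \<partial>lborel)"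
      proof (intro Bochner_Integration.integral_cong refl)
        fix x show "\<phi> x * (F' (?U k x) * pd i (?U k) x) = (\<phi> x * F' (?U k x)) * ?G k x"
          using K(3)[of x] pdU[of x k] by (cases "x \<in> K") simp_all
      qed
      finally show ?thesis .
    qed
    have i1: "integrable lborel (\<lambda>x. pd i \<phi> x * F (V x))" if V: "integrable lborel V" for V
    proof (rule Bochner_Integration.integrable_bound)
      have [measurable]: "V \<in> borel_measurable borel" using V by auto
      show "(\<lambda>x. pd i \<phi> x * F (V x)) \<in> borel_measurable lborel" by measurable
      show "integrable lborel (\<lambda>x. \<bar>pd i \<phi> x * F 0\<bar> + C' * \<bar>V x\<bar>)"
        using V test_integrable[OF test_pd[OF \<phi>]] by simp
      have "\<bar>pd i \<phi> x * F t\<bar> \<le> \<bar>pd i \<phi> x * F 0\<bar> + C' * \<bar>t\<bar>" for x t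
      proof -
        have "\<bar>pd i \<phi> x * F t\<bar> \<le> \<bar>pd i \<phi> x * F 0\<bar> + \<bar>pd i \<phi> x\<bar> * \<bar>F t - F 0\<bar>"
          using abs_triangle_ineq[of "pd i \<phi> x * F 0" "pd i \<phi> x * (F t - F 0)"]
          unfolding abs_mult[of "pd i \<phi> x" "F t - F 0", symmetric] by (simp add: right_diff_distrib)
        also have "\<bar>pd i \<phi> x\<bar> * \<bar>F t - F 0\<bar> \<le> C' * \<bar>t - 0\<bar>"
          using C'[of x] by (intro mult_mono Flip) auto
        finally show ?thesis by simp
      qed
      then show "AE x in lborel. norm (pd i \<phi> x * F (V x)) \<le> norm (\<bar>pd i \<phi> x * F 0\<bar> + C' * \<bar>V x\<bar>)"
        unfolding real_norm_def by (intro always_eventually allI order_trans[OF _ abs_ge_self]) blast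
    qed
    have 1: "(\<lambda>k. \<integral>x. pd i \<phi> x * F (?U (s k) x) \<partial>lborel) \<longlonglongrightarrow> (\<integral>x. pd i \<phi> x * F (U x) \<partial>lborel)"
    proof (rule LIM_zero_cancel, rule Lim_null_comparison[OF always_eventually, OF allI])
      fix k
      have iF: "integrable lborel (\<lambda>x. F (?U (s k) x) - F (U x))"
        by (rule Bochner_Integration.integrable_bound[OF iU[of "s k"]]) (use Flip in auto)
      have "(\<integral>x. pd i \<phi> x * F (?U (s k) x) \<partial>lborel) - (\<integral>x. pd i \<phi> x * F (U x) \<partial>lborel)
          = (\<integral>x. pd i \<phi> x * (F (?U (s k) x) - F (U x)) \<partial>lborel)"
        using i1[OF convolve_mollifier_integrable[OF r(1) U(1)], of "s k"] i1[OF U(1)]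
        by (simp add: right_diff_distrib)
      also have "\<bar>\<dots>\<bar> \<le> C' * (\<integral>x. \<bar>F (?U (s k) x) - F (U x)\<bar> \<partial>lborel)"
        by (rule integral_bounded_mult_le[OF iF]) (use C' in auto)
      also have "\<dots> \<le> C' * (\<integral>x. \<bar>?U (s k) x - U x\<bar> \<partial>lborel)"
        using iF iU C'[of undefined] Flip by (intro mult_left_mono integral_mono) auto
      finally show "norm ((\<integral>x. pd i \<phi> x * F (?U (s k) x) \<partial>lborel) - (\<integral>x. pd i \<phi> x * F (U x) \<partial>lborel))
          \<le> C' * (\<integral>x. \<bar>?U (s k) x - U x\<bar> \<partial>lborel)" by simp
    next
      show "(\<lambda>k. C' * (\<integral>x. \<bar>?U (s k) x - U x\<bar> \<partial>lborel)) \<longlonglongrightarrow> 0"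
        using LIMSEQ_subseq_LIMSEQ[OF lim[OF U(1)] s(1)] by (intro tendsto_mult_right_zero) (simp add: comp_def)
    qed
    have i2: "integrable lborel (\<lambda>x. (\<phi> x * F' (V x)) * w x)"
      if "integrable lborel w" "V \<in> borel_measurable borel" for V w
    proof (rule integrable_bounded_mult[OF that(1)])
      show "\<bar>\<phi> x * F' (V x)\<bar> \<le> C" for x
        using mult_mono[OF C[of x] F'1[of "V x"]] C[of x] by (simp add: abs_mult)
    qed (use that(2) in measurable)
    have 2: "(\<lambda>k. \<integral>x. (\<phi> x * F' (?U (s k) x)) * ?G (s k) x \<partial>lborel) \<longlonglongrightarrow> (\<integral>x. (\<phi> x * F' (U x)) * G x \<partial>lborel)"
    proof -
      have "(\<lambda>k. \<integral>x. (\<phi> x * F' (?U (s k) x)) * (?G (s k) x - G x) \<partial>lborel) \<longlonglongrightarrow> 0"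
      proof (rule Lim_null_comparison[OF always_eventually, OF allI])
        fix k
        show "norm (\<integral>x. (\<phi> x * F' (?U (s k) x)) * (?G (s k) x - G x) \<partial>lborel)
            \<le> C * (\<integral>x. \<bar>?G (s k) x - G x\<bar> \<partial>lborel)"
          unfolding real_norm_def
        proof (rule integral_bounded_mult_le[OF iG])
          show "\<bar>\<phi> x * F' (?U (s k) x)\<bar> \<le> C" for x
            using mult_mono[OF C[of x] F'1[of "?U (s k) x"]] C[of x] by (simp add: abs_mult)
        qed measurable
      next
        show "(\<lambda>k. C * (\<integral>x. \<bar>?G (s k) x - G x\<bar> \<partial>lborel)) \<longlonglongrightarrow> 0"
          using LIMSEQ_subseq_LIMSEQ[OF lim[OF G(1)] s(1)] by (intro tendsto_mult_right_zero) (simp add: comp_def)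
      qed
      moreover have "(\<lambda>k. \<integral>x. (\<phi> x * F' (?U (s k) x)) * G x \<partial>lborel) \<longlonglongrightarrow> (\<integral>x. (\<phi> x * F' (U x)) * G x \<partial>lborel)"
      proof (rule integral_dominated_convergence[where w="\<lambda>x. C * \<bar>G x\<bar>"])
        show "AE x in lborel. (\<lambda>k. \<phi> x * F' (?U (s k) x) * G x) \<longlonglongrightarrow> \<phi> x * F' (U x) * G x"
          using s(2)
        proof eventually_elim
          case (elim x)
          then have "(\<lambda>k. ?U (s k) x) \<longlonglongrightarrow> U x" by (rule LIM_zero_cancel)
          then have "(\<lambda>k. F' (?U (s k) x)) \<longlonglongrightarrow> F' (U x)"
            by (intro continuous_on_tendsto_compose[OF F'c]) auto
          then show ?case by (intro tendsto_intros)
        qed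
        show "AE x in lborel. norm (\<phi> x * F' (?U (s k) x) * G x) \<le> C * \<bar>G x\<bar>" for k
        proof (rule always_eventually, rule allI)
          fix x
          have "\<bar>\<phi> x * F' (?U (s k) x)\<bar> \<le> C"
            using mult_mono[OF C[of x] F'1[of "?U (s k) x"]] C[of x] by (simp add: abs_mult)
          then show "norm (\<phi> x * F' (?U (s k) x) * G x) \<le> C * \<bar>G x\<bar>"
            by (simp only: real_norm_def abs_mult[of "\<phi> x * F' (?U (s k) x)"] mult_right_mono abs_ge_zero)
        qed
        show "integrable lborel (\<lambda>x. C * \<bar>G x\<bar>)" using G(1) by simp
      qed measurable
      ultimately have "(\<lambda>k. (\<integral>x. (\<phi> x * F' (?U (s k) x)) * (?G (s k) x - G x) \<partial>lborel)
          + (\<integral>x. (\<phi> x * F' (?U (s k) x)) * G x \<partial>lborel)) \<longlonglongrightarrow> 0 + (\<integral>x. (\<phi> x * F' (U x)) * G x \<partial>lborel)"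
        by (rule tendsto_add)
      moreover have "(\<integral>x. (\<phi> x * F' (?U (s k) x)) * (?G (s k) x - G x) \<partial>lborel)
          + (\<integral>x. (\<phi> x * F' (?U (s k) x)) * G x \<partial>lborel) = (\<integral>x. (\<phi> x * F' (?U (s k) x)) * ?G (s k) x \<partial>lborel)" for k
      proof -
        have "(\<lambda>x. (\<phi> x * F' (?U (s k) x)) * (?G (s k) x - G x) + (\<phi> x * F' (?U (s k) x)) * G x)
           = (\<lambda>x. (\<phi> x * F' (?U (s k) x)) * ?G (s k) x)" by (simp add: algebra_simps)
        then show ?thesis
          using i2[OF iG, of "?U (s k)" "s k"] i2[OF G(1), of "?U (s k)"]
          by (subst Bochner_Integration.integral_add[symmetric]) simp_all
      qed
      ultimately show ?thesis by simp
    qed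
    have key: "(\<integral>x. pd i \<phi> x * F (U x) \<partial>lborel) = - (\<integral>x. (\<phi> x * F' (U x)) * G x \<partial>lborel)"
      using LIMSEQ_unique[OF 1, of "- (\<integral>x. (\<phi> x * F' (U x)) * G x \<partial>lborel)"] tendsto_minus[OF 2]
      by (simp add: ibp)
    have "(\<integral>x. pd i \<phi> x * F (u x) \<partial>lebesgue_on X) = (\<integral>x. pd i \<phi> x * F (U x) \<partial>lborel)"
    proof -
      obtain V where V: "integrable lborel V" "AE x in lborel. x \<in> L \<longrightarrow> V x = F (u x)"
        "\<forall>\<phi>\<in>borel_measurable borel. (\<forall>x. x \<notin> L \<longrightarrow> \<phi> x = 0) \<longrightarrow>
           (\<integral>x. \<phi> x * F (u x) \<partial>lebesgue_on X) = (\<integral>x. \<phi> x * V x \<partial>lborel)"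
        by (rule locally_integrable_representative[OF Fl L(2,3) X]) (rule that, assumption+)
      have "AE x in lborel. pd i \<phi> x * V x = pd i \<phi> x * F (U x)"
        using V(2) U(2) by eventually_elim (metis K(5) L(4) mult_zero_left subsetD)
      then have "(\<integral>x. pd i \<phi> x * V x \<partial>lborel) = (\<integral>x. pd i \<phi> x * F (U x) \<partial>lborel)"
        using V(1) by (intro integral_cong_AE) auto
      then show ?thesis using K(5) L(4) by (subst V(3)[rule_format]) auto
    qed
    moreover have "(\<integral>x. \<phi> x * (F' (u x) *\<^sub>R g x) $ i \<partial>lebesgue_on X) = (\<integral>x. (\<phi> x * F' (U x)) * G x \<partial>lborel)"
    proof -
      obtain V where V: "integrable lborel V" "AE x in lborel. x \<in> L \<longrightarrow> V x = (F' (u x) *\<^sub>R g x) $ i"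
        "\<forall>\<phi>\<in>borel_measurable borel. (\<forall>x. x \<notin> L \<longrightarrow> \<phi> x = 0) \<longrightarrow>
           (\<integral>x. \<phi> x * (F' (u x) *\<^sub>R g x) $ i \<partial>lebesgue_on X) = (\<integral>x. \<phi> x * V x \<partial>lborel)"
        by (rule locally_integrable_representative[OF locally_integrable_nth[OF F'gl] L(2,3) X]) (rule that, assumption+)
      have "AE x in lborel. \<phi> x * V x = (\<phi> x * F' (U x)) * G x"
        using V(2) U(2) G(2) by eventually_elim (metis K(3) L(4) mult.assoc mult_zero_left real_scaleR_def subsetD vector_scaleR_component)
      then have "(\<integral>x. \<phi> x * V x \<partial>lborel) = (\<integral>x. (\<phi> x * F' (U x)) * G x \<partial>lborel)"
        using V(1) by (intro integral_cong_AE) auto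
      then show ?thesis using K(3) L(4) by (subst V(3)[rule_format]) auto
    qed
    ultimately show ?thesis using key by (simp add: mult.commute)
  qed
  then show "is_function X (distr_grad X (\<lambda>x. F (u x))) (\<lambda>x. F' (u x) *\<^sub>R g x)"
    using F'gl by (simp only: is_function_grad_iff[OF X]) blast
qed

section \<open>The distance to the boundary\<close>

lemma bdist_nonneg [simp]: "0 \<le> bdist X x"
  by (simp add: bdist_def infdist_nonneg)

lemma bdist_continuous: "continuous_on S (bdist X)"
  unfolding bdist_def[abs_def] by (intro continuous_intros)

lemma bdist_measurable: "bdist X \<in> borel_measurable borel"
  by (intro borel_measurable_continuous_onI bdist_continuous)

lemma bounded_open_frontier:
  fixes X :: "'a::euclidean_space set"
  assumes "open X" "bounded X" "X \<noteq> {}"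
  shows "X \<noteq> UNIV" "frontier X \<noteq> {}"
proof -
  show "X \<noteq> UNIV" using assms by auto
  then show "frontier X \<noteq> {}" using assms frontier_eq_empty by blast
qed

lemma bdist_pos:
  fixes X :: "'a::euclidean_space set"
  assumes "open X" "bounded X" "x \<in> X"
  shows "0 < bdist X x"
proof -
  have "frontier X \<noteq> {}" using bounded_open_frontier assms by blast
  moreover have "x \<notin> frontier X" using assms by (auto simp: frontier_def interior_open)
  ultimately show ?thesis unfolding bdist_def by (intro infdist_pos_not_in_closed) auto
qed

lemma bdist_le_dist_outside:
  fixes X :: "'a::euclidean_space set"
  assumes "x \<in> X" "y \<notin> X"
  shows "bdist X x \<le> dist x y"
proof -
  have "closed_segment x y \<inter> frontier X \<noteq> {}"
    by (rule connected_Int_frontier) (use assms in auto)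
  then obtain z where z: "z \<in> closed_segment x y" "z \<in> frontier X" by blast
  then have "bdist X x \<le> dist x z" unfolding bdist_def by (intro infdist_le)
  also have "\<dots> \<le> dist x y"
    using segment_bound1[OF z(1)] by (simp add: dist_norm norm_minus_commute)
  finally show ?thesis .
qed

lemma lipschitz_derivative_bound:
  fixes f :: "'a::real_normed_vector \<Rightarrow> real"
  assumes D: "(f has_derivative D) (at x)" and L: "\<And>y z. \<bar>f y - f z\<bar> \<le> norm (y - z)"
  shows "\<bar>D h\<bar> \<le> norm h"
proof -
  have "((\<lambda>t. f (x + t *\<^sub>R h)) has_derivative (\<lambda>t. D (t *\<^sub>R h))) (at 0)"
    by (rule has_derivative_compose[where f="\<lambda>t. x + t *\<^sub>R h" and f'="\<lambda>t. t *\<^sub>R h" and g=f])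
      (use D in \<open>auto intro!: derivative_eq_intros\<close>)
  moreover have "(\<lambda>t. D (t *\<^sub>R h)) = (*) (D h)"
    using has_derivative_linear[OF D] by (auto simp: linear_scale)
  ultimately have "((\<lambda>t. f (x + t *\<^sub>R h)) has_real_derivative D h) (at 0)"
    by (simp add: has_field_derivative_def)
  then have "((\<lambda>t. \<bar>(f (x + t *\<^sub>R h) - f x) / t\<bar>) \<longlongrightarrow> \<bar>D h\<bar>) (at 0)"
    by (intro tendsto_rabs) (simp add: has_field_derivative_iff)
  moreover have "\<bar>(f (x + t *\<^sub>R h) - f x) / t\<bar> \<le> norm h" if "t \<noteq> 0" for t
    using L[of "x + t *\<^sub>R h" x] that by (simp add: abs_divide divide_le_eq mult.commute)
  then have "eventually (\<lambda>t. \<bar>(f (x + t *\<^sub>R h) - f x) / t\<bar> \<le> norm h) (at 0)"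
    by (auto simp: eventually_at_filter)
  ultimately show ?thesis by (rule tendsto_upperbound) simp
qed

lemma norm_gradient_le_1:
  fixes f :: "real^'n \<Rightarrow> real"
  assumes "f differentiable (at x)" "\<And>y z. \<bar>f y - f z\<bar> \<le> norm (y - z)"
  shows "norm (\<chi> i. pd i f x) \<le> 1"
proof -
  let ?g = "\<chi> i. pd i f x"
  have "\<bar>\<Sum>i\<in>UNIV. ?g $ i * pd i f x\<bar> \<le> norm ?g"
    by (rule lipschitz_derivative_bound[OF has_derivative_pd[OF assms(1)] assms(2)])
  moreover have "(\<Sum>i\<in>UNIV. ?g $ i * pd i f x) = (norm ?g)\<^sup>2"
    by (simp add: power2_norm_eq_inner inner_vec_def)
  ultimately have "norm ?g * norm ?g \<le> 1 * norm ?g" by (simp add: power2_eq_square)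
  then show ?thesis by (cases "norm ?g = 0") (auto simp: mult_le_cancel_right)
qed

lemma smooth_cutoff:
  fixes X :: "(real^'n) set"
  assumes X: "open X" "bounded X" "X \<noteq> {}" and e: "e > 0"
  obtains \<eta> where "\<eta> \<in> test_functions UNIV" "\<And>x. 0 \<le> \<eta> x" "\<And>x. norm (\<chi> i. pd i \<eta> x) \<le> 1"
    "\<And>x. \<eta> x \<noteq> 0 \<Longrightarrow> cball x e \<subseteq> X" "\<And>x. x \<in> X \<Longrightarrow> bdist X x - 3 * e \<le> \<eta> x"
proof -
  define d where "d x = infdist x (- X)" for x
  define h where "h x = max 0 (d x - 2 * e)" for x
  have ne: "- X \<noteq> {}" using bounded_open_frontier(1)[OF X] by blast
  have dL: "\<bar>d x - d y\<bar> \<le> norm (x - y)" for x y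
    unfolding d_def using infdist_triangle_abs by (metis dist_norm)
  have hL: "\<bar>h x - h y\<bar> \<le> norm (x - y)" for x y
    using dL[of x y] unfolding h_def by linarith
  have hc: "continuous_on UNIV h" unfolding h_def[abs_def] d_def by (intro continuous_intros)
  have h0: "0 \<le> h x" for x by (simp add: h_def)
  have hout: "h x = 0" if "x \<notin> closure X" for x
  proof -
    have "x \<in> - X" using that closure_subset by blast
    then show ?thesis using e by (simp add: h_def d_def)
  qed
  have hi: "integrable lborel h"
  proof -
    have "compact (closure X)" using X by (simp add: compact_closure)
    then have "integrable lborel (\<lambda>x. indicator (closure X) x *\<^sub>R h x)"
      using hc by (intro borel_integrable_compact) (auto intro: continuous_on_subset)
    moreover have "(\<lambda>x. indicator (closure X) x *\<^sub>R h x) = h" using hout by (force simp: indicator_def)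
    ultimately show ?thesis by simp
  qed
  then have hm [measurable]: "h \<in> borel_measurable borel" by auto
  let ?m = "mollifier e :: real^'n \<Rightarrow> real"
  have mm [measurable]: "?m \<in> borel_measurable borel" by (rule test_measurable[OF mollifier_test[OF e]])
  obtain C where C: "\<And>x. \<bar>?m x\<bar> \<le> C" using test_bounded[OF mollifier_test[OF e]] by blast
  define \<eta> where "\<eta> = convolve ?m h"
  have eta: "\<eta> x = (\<integral>z. ?m z * h (x + z) \<partial>lborel)" for x
    unfolding \<eta>_def by (rule convolve_mollifier_eq[OF e hm])
  have im: "integrable lborel (\<lambda>z. ?m z * h (x + z))" for x
    using hi integrable_lborel_translate[OF hm, of x] C
    by (intro integrable_bounded_mult[of _ _ _ C]) (auto simp: add.commute)
  have i1: "integrable lborel ?m" by (rule test_integrable[OF mollifier_test[OF e]])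
  have sm: "smooth \<eta>" unfolding \<eta>_def by (rule smooth_convolve[OF mollifier_test[OF e] hi])
  have supp: "cball x e \<subseteq> X" if "\<eta> x \<noteq> 0" for x
  proof -
    have "\<exists>z. ?m z * h (x + z) \<noteq> 0"
    proof (rule ccontr)
      assume "\<nexists>z. ?m z * h (x + z) \<noteq> 0"
      then have z: "?m z * h (x + z) = 0" for z by blast
      have "\<eta> x = 0" unfolding eta z by simp
      with that show False by simp
    qed
    then obtain z where z: "?m z \<noteq> 0" "h (x + z) \<noteq> 0" by auto
    have "norm z < e" using z(1) mollifier_eq_0[OF e, of z] by force
    moreover have "d (x + z) > 2 * e" using z(2) by (simp add: h_def split: if_splits)
    ultimately have dx: "d x > e" using dL[of "x + z" x] by simp
    show ?thesis
    proof
      fix y assume "y \<in> cball x e"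
      then have "dist x y < d x" using dx by simp
      then show "y \<in> X" unfolding d_def using infdist_le[of y "- X" x] by force
    qed
  qed
  have lip: "\<bar>\<eta> x - \<eta> y\<bar> \<le> norm (x - y)" for x y
  proof -
    have "\<bar>\<eta> x - \<eta> y\<bar> = \<bar>\<integral>z. ?m z * h (x + z) - ?m z * h (y + z) \<partial>lborel\<bar>"
      unfolding eta using im by simp
    also have "\<dots> \<le> (\<integral>z. \<bar>?m z * h (x + z) - ?m z * h (y + z)\<bar> \<partial>lborel)" by (rule integral_abs_bound)
    also have "\<dots> \<le> (\<integral>z. ?m z * norm (x - y) \<partial>lborel)"
    proof (rule integral_mono)
      show "integrable lborel (\<lambda>z. \<bar>?m z * h (x + z) - ?m z * h (y + z)\<bar>)" using im by auto
      show "integrable lborel (\<lambda>z. ?m z * norm (x - y))" using i1 by simp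
      show "\<bar>?m z * h (x + z) - ?m z * h (y + z)\<bar> \<le> ?m z * norm (x - y)" for z
        using hL[of "x + z" "y + z"] mollifier_nonneg[OF e, of z]
        by (simp add: right_diff_distrib[symmetric] abs_mult mult_left_mono)
    qed
    also have "\<dots> = norm (x - y)" by (simp add: mollifier_integral[OF e])
    finally show ?thesis .
  qed
  have low: "bdist X x - 3 * e \<le> \<eta> x" if x: "x \<in> X" for x
  proof -
    have "bdist X x \<le> d x"
      unfolding d_def using ne x by (subst infdist_notempty) (auto intro!: cINF_greatest bdist_le_dist_outside)
    then have "bdist X x - 3 * e \<le> h x - e" by (simp add: h_def)
    also have "\<dots> = (\<integral>z. ?m z * (h x - e) \<partial>lborel)" by (simp add: mollifier_integral[OF e])
    also have "\<dots> \<le> (\<integral>z. ?m z * h (x + z) \<partial>lborel)"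
    proof (rule integral_mono[OF _ im])
      show "integrable lborel (\<lambda>z. ?m z * (h x - e))" using i1 by simp
      fix z
      show "?m z * (h x - e) \<le> ?m z * h (x + z)"
      proof (cases "norm z < e")
        case True
        then have "h x - e \<le> h (x + z)" using hL[of x "x + z"] by simp
        then show ?thesis by (intro mult_left_mono mollifier_nonneg e)
      qed (simp add: mollifier_eq_0[OF e])
    qed
    finally show ?thesis by (simp add: eta)
  qed
  show thesis
  proof (rule that[of \<eta>])
    show "\<eta> \<in> test_functions UNIV"
      by (rule test_functionsI[OF sm, of "closure X"])
        (use X supp closure_subset[of X] e in \<open>auto simp: compact_closure subset_iff\<close>)
    show "0 \<le> \<eta> x" for x
      unfolding eta by (intro Bochner_Integration.integral_nonneg mult_nonneg_nonneg mollifier_nonneg e h0)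
    show "norm (\<chi> i. pd i \<eta> x) \<le> 1" for x
      by (rule norm_gradient_le_1[OF smooth_differentiable[OF sm] lip])
  qed (use supp low in auto)
qed

lemma L2_representative:
  fixes f :: "'a::euclidean_space \<Rightarrow> real"
  assumes X: "open X" "bounded X" and f: "f \<in> L2 X"
  obtains u where "integrable lborel u" "integrable lborel (\<lambda>x. (u x)\<^sup>2)"
    "(\<integral>x. (u x)\<^sup>2 \<partial>lborel) = (l2_norm X f)\<^sup>2"
    "\<forall>\<phi>\<in>borel_measurable borel. (\<integral>x. \<phi> x * f x \<partial>lebesgue_on X) = (\<integral>x. \<phi> x * u x \<partial>lborel)"
proof -
  have X': "X \<in> lmeasurable" "X \<in> sets lebesgue" "X \<in> sets borel"
    using X by (auto simp: lmeasurable_open)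
  obtain u where u [measurable]: "u \<in> borel_measurable borel" and u0: "\<And>x. x \<notin> X \<Longrightarrow> u x = 0"
    and uf: "AE x in lborel. x \<in> X \<longrightarrow> u x = f x"
    using borel_representative[OF L2_measurable[OF f] X'(3)] by blast
  have AE: "AE x in lebesgue_on X. f x = u x"
    unfolding AE_lebesgue_on_iff[OF X'(2)] using AE_completion[OF uf] by eventually_elim auto
  have um: "u \<in> borel_measurable (lebesgue_on X)"
    using u by (metis measurable_completion measurable_restrict_space1 sets_lborel measurable_cong_sets)
  have uL2: "u \<in> L2 X" by (rule L2_cong_AE[OF AE f um])
  have "integrable lborel u"
    using L2_integrable[OF X'(1) uL2] integral_lebesgue_on_eq_lborel(2)[OF u X'(2) u0] by simp
  moreover have u2: "(\<lambda>x. (u x)\<^sup>2) \<in> borel_measurable borel" by measurable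
  have "integrable lborel (\<lambda>x. (u x)\<^sup>2)"
    using L2_integrable_square[OF uL2] integral_lebesgue_on_eq_lborel(2)[OF u2 X'(2)] u0 by simp
  moreover have "(\<integral>x. (u x)\<^sup>2 \<partial>lborel) = (l2_norm X f)\<^sup>2"
  proof -
    have "(l2_norm X f)\<^sup>2 = (l2_norm X u)\<^sup>2"
      using l2_norm_cong_AE[OF AE L2_measurable[OF f] um] by simp
    also have "\<dots> = (\<integral>x. (u x)\<^sup>2 \<partial>lebesgue_on X)" by (simp add: l2_norm_def)
    also have "\<dots> = (\<integral>x. (u x)\<^sup>2 \<partial>lborel)"
      using integral_lebesgue_on_eq_lborel(1)[OF u2 X'(2)] u0 by simp
    finally show ?thesis by simp
  qed
  moreover have "(\<integral>x. \<phi> x * f x \<partial>lebesgue_on X) = (\<integral>x. \<phi> x * u x \<partial>lborel)"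
    if \<phi> [measurable]: "\<phi> \<in> borel_measurable borel" for \<phi>
  proof -
    have \<phi>m: "\<phi> \<in> borel_measurable (lebesgue_on X)"
      using \<phi> by (metis measurable_completion measurable_restrict_space1 sets_lborel measurable_cong_sets)
    have "(\<integral>x. \<phi> x * f x \<partial>lebesgue_on X) = (\<integral>x. \<phi> x * u x \<partial>lebesgue_on X)"
      using AE by (intro integral_cong_AE) (use \<phi>m um L2_measurable[OF f] in auto)
    also have "\<dots> = (\<integral>x. \<phi> x * u x \<partial>lborel)"
      using u0 by (intro integral_lebesgue_on_eq_lborel(1) X') auto
    finally show ?thesis .
  qed
  ultimately show thesis using that[of u] by blast
qed

section \<open>Weighted estimates for generalized conjugate functions\<close>

definition test_fields :: "(real^'n) set \<Rightarrow> (real^'n \<Rightarrow> real^'n) set" where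
  "test_fields X = {\<Psi>. \<forall>k. (\<lambda>x. \<Psi> x $ k) \<in> test_functions X}"

definition jac :: "(real^'n \<Rightarrow> real^'n) \<Rightarrow> real^'n \<Rightarrow> real^'n^'n" where
  "jac \<Psi> x = (\<chi> k i. pd i (\<lambda>y. \<Psi> y $ k) x)"

definition unit_mat :: "'n::finite \<Rightarrow> 'n \<Rightarrow> real^'n^'n" where
  "unit_mat k i = axis k (axis i 1)"

lemma unit_mat_nth: "unit_mat k i $ p $ q = (if k = p then if i = q then 1 else 0 else 0)"
  by (simp add: unit_mat_def axis_def)

lemma matrix_expansion: "A = (\<Sum>k\<in>UNIV. \<Sum>i\<in>UNIV. A $ k $ i *\<^sub>R unit_mat k i)" for A :: "real^'n^'n"
proof -
  have "(\<Sum>k\<in>UNIV. \<Sum>i\<in>UNIV. A $ k $ i * unit_mat k i $ p $ q) = A $ p $ q" for p q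
  proof -
    have "(\<Sum>i\<in>UNIV. A $ k $ i * unit_mat k i $ p $ q) = (if k = p then A $ k $ q else 0)" for k
      by (simp add: unit_mat_nth if_distrib[where f="\<lambda>x. _ * x"] cong: if_cong)
    then show ?thesis by simp
  qed
  then show ?thesis by (simp add: vec_eq_iff)
qed

lemma linear_matrix_expansion:
  fixes s :: "real^'n^'n \<Rightarrow> 'e::euclidean_space"
  assumes "linear s"
  shows "s A \<bullet> b = (\<Sum>k\<in>UNIV. \<Sum>i\<in>UNIV. A $ k $ i * (s (unit_mat k i) \<bullet> b))"
proof -
  interpret linear s by fact
  have "s A = s (\<Sum>k\<in>UNIV. \<Sum>i\<in>UNIV. A $ k $ i *\<^sub>R unit_mat k i)"
    by (rule arg_cong[OF matrix_expansion])
  then show ?thesis by (simp add: sum scale inner_sum_left)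
qed

text \<open>For a linear map \<open>s\<close> of matrices, \<open>s (jac \<Psi>)\<close> is a first order differential operator.
  The formal adjoint of its negative sends \<open>\<psi> b\<close> to the following field. With the trace this is the
  gradient, with the antisymmetric part it is a rotation.\<close>

definition adj_field ::
  "(real^'n^'n \<Rightarrow> 'e::euclidean_space) \<Rightarrow> 'e \<Rightarrow> (real^'n \<Rightarrow> real) \<Rightarrow> real^'n \<Rightarrow> real^'n" where
  "adj_field s b \<psi> x = (\<chi> k. \<Sum>i\<in>UNIV. (s (unit_mat k i) \<bullet> b) * pd i \<psi> x)"

lemma test_fieldsD: "\<Psi> \<in> test_fields X \<Longrightarrow> (\<lambda>x. \<Psi> x $ k) \<in> test_functions X"
  by (simp add: test_fields_def)

lemma adj_field_test:
  "\<psi> \<in> test_functions X \<Longrightarrow> adj_field s b \<psi> \<in> test_fields X"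
  by (auto simp: test_fields_def adj_field_def intro!: test_sum test_cmult test_pd)

lemma pd_adj_field:
  assumes "smooth \<psi>"
  shows "pd j (\<lambda>y. adj_field s b \<psi> y $ k) x
    = (\<Sum>i\<in>UNIV. (s (unit_mat k i) \<bullet> b) * pd j (pd i \<psi>) x)"
proof -
  have d: "pd i \<psi> differentiable (at x)" for i by (rule smooth_differentiable[OF smooth_pd[OF assms]])
  have "(\<lambda>x. c * pd i \<psi> x) differentiable (at x)" for i c using d by (intro differentiable_mult) auto
  then show ?thesis
    by (simp add: adj_field_def pd_sum pd_cmult[OF d])
qed

lemma linear_jac_adj_field:
  assumes "linear s" "smooth \<psi>"
  shows "s (jac (adj_field s b \<psi>) x) \<bullet> b' = (\<Sum>k\<in>UNIV. \<Sum>j\<in>UNIV. \<Sum>i\<in>UNIV.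
    (s (unit_mat k i) \<bullet> b) * (s (unit_mat k j) \<bullet> b') * pd j (pd i \<psi>) x)"
  unfolding linear_matrix_expansion[OF assms(1), of "jac _ x"]
  by (simp add: jac_def pd_adj_field[OF assms(2)] sum_distrib_left sum_distrib_right mult_ac)

locale mollified_field =
  fixes s :: "real^'n^'n \<Rightarrow> 'e::euclidean_space" and W :: "'e \<Rightarrow> real^'n \<Rightarrow> real"
  assumes lin: "linear s" and sW: "\<And>b. smooth (W b)"
begin

text \<open>The operator applied to the vector with components \<open>W b\<close>.\<close>

definition F :: "real^'n \<Rightarrow> real^'n" where
  "F x = (\<Sum>b\<in>Basis. adj_field s b (W b) x)"

lemma F_nth: "F x $ k = (\<Sum>b\<in>Basis. \<Sum>i\<in>UNIV. (s (unit_mat k i) \<bullet> b) * pd i (W b) x)"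
  by (simp add: F_def adj_field_def)

lemma smooth_F: "smooth (\<lambda>x. F x $ k)"
  unfolding F_nth using smooth_pd[OF sW] by (auto intro!: C_k_sum C_k_cmult)

lemma integral_F:
  assumes \<Psi>: "\<Psi> \<in> test_fields UNIV"
  shows "(\<integral>x. F x \<bullet> \<Psi> x \<partial>lborel) = - (\<Sum>b\<in>Basis. \<integral>x. (s (jac \<Psi> x) \<bullet> b) * W b x \<partial>lborel)"
proof -
  note t = test_fieldsD[OF \<Psi>]
  have i1: "integrable lborel (\<lambda>x. pd i (W b) x * \<Psi> x $ k)" for i b k
    by (rule test_integrable[OF test_mult_smooth[OF t smooth_pd[OF sW]]])
  have i2: "integrable lborel (\<lambda>x. W b x * pd i (\<lambda>y. \<Psi> y $ k) x)" for i b k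
    by (rule test_integrable[OF test_mult_smooth[OF test_pd[OF t] sW]])
  have ibp: "(\<integral>x. pd i (W b) x * \<Psi> x $ k \<partial>lborel) = - (\<integral>x. W b x * pd i (\<lambda>y. \<Psi> y $ k) x \<partial>lborel)" for i b k
    using integral_by_parts[OF _ t, of "W b" i k] sW by simp
  have "(\<integral>x. F x \<bullet> \<Psi> x \<partial>lborel) = (\<integral>x. (\<Sum>k\<in>UNIV. \<Sum>b\<in>Basis. \<Sum>i\<in>UNIV.
      (s (unit_mat k i) \<bullet> b) * (pd i (W b) x * \<Psi> x $ k)) \<partial>lborel)"
    by (simp add: inner_vec_def F_nth sum_distrib_right sum_distrib_left mult_ac)
  also have "\<dots> = (\<Sum>k\<in>UNIV. \<Sum>b\<in>Basis. \<Sum>i\<in>UNIV.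
      (s (unit_mat k i) \<bullet> b) * (\<integral>x. pd i (W b) x * \<Psi> x $ k \<partial>lborel))"
    using i1 by simp
  also have "\<dots> = - (\<Sum>b\<in>Basis. \<Sum>k\<in>UNIV. \<Sum>i\<in>UNIV.
      (s (unit_mat k i) \<bullet> b) * (\<integral>x. W b x * pd i (\<lambda>y. \<Psi> y $ k) x \<partial>lborel))"
    unfolding ibp by (subst sum.swap) (simp add: sum_negf)
  also have "(\<Sum>b\<in>Basis. \<Sum>k\<in>UNIV. \<Sum>i\<in>UNIV. (s (unit_mat k i) \<bullet> b) * (\<integral>x. W b x * pd i (\<lambda>y. \<Psi> y $ k) x \<partial>lborel))
      = (\<Sum>b\<in>Basis. \<integral>x. (s (jac \<Psi> x) \<bullet> b) * W b x \<partial>lborel)"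
  proof (rule sum.cong[OF refl])
    fix b
    have "(\<integral>x. (s (jac \<Psi> x) \<bullet> b) * W b x \<partial>lborel) = (\<integral>x. (\<Sum>k\<in>UNIV. \<Sum>i\<in>UNIV.
        (s (unit_mat k i) \<bullet> b) * (W b x * pd i (\<lambda>y. \<Psi> y $ k) x)) \<partial>lborel)"
      unfolding linear_matrix_expansion[OF lin, of "jac _ _"]
      by (simp add: jac_def sum_distrib_right sum_distrib_left mult_ac)
    then show "(\<Sum>k\<in>UNIV. \<Sum>i\<in>UNIV. (s (unit_mat k i) \<bullet> b) * (\<integral>x. W b x * pd i (\<lambda>y. \<Psi> y $ k) x \<partial>lborel))
        = (\<integral>x. (s (jac \<Psi> x) \<bullet> b) * W b x \<partial>lborel)"
      using i2 by simp
  qed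
  finally show ?thesis .
qed

text \<open>Caccioppoli's inequality: test with \<open>\<eta>\<^sup>2 F\<close>, where \<open>s (jac F) = 0\<close> on the support of \<open>\<eta>\<close>.\<close>

lemma caccioppoli:
  assumes \<eta>: "\<eta> \<in> test_functions UNIV" and \<eta>1: "\<And>x. norm (\<chi> i. pd i \<eta> x) \<le> 1"
    and s1: "\<And>w \<xi>. norm (s (\<chi> k i. w $ k * \<xi> $ i)) \<le> norm w * norm \<xi>"
    and harm: "\<And>x b. \<eta> x \<noteq> 0 \<Longrightarrow> b \<in> Basis \<Longrightarrow> s (jac F x) \<bullet> b = 0"
    and W2: "\<And>b. b \<in> Basis \<Longrightarrow> integrable lborel (\<lambda>x. (W b x)\<^sup>2)"
  shows "(\<integral>x. (\<eta> x)\<^sup>2 * (norm (F x))\<^sup>2 \<partial>lborel) \<le> 4 * (\<Sum>b\<in>Basis. \<integral>x. (W b x)\<^sup>2 \<partial>lborel)"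
proof -
  let ?\<Psi> = "\<lambda>x. (\<eta> x)\<^sup>2 *\<^sub>R F x"
  have s\<eta>: "smooth \<eta>" by (rule test_smooth[OF \<eta>])
  have \<Psi>: "?\<Psi> \<in> test_fields UNIV"
    using test_mult_smooth[OF test_mult_smooth[OF \<eta> s\<eta>] smooth_F]
    by (simp add: test_fields_def power2_eq_square mult_ac)
  have jac: "jac ?\<Psi> x = (\<eta> x)\<^sup>2 *\<^sub>R jac F x + (2 * \<eta> x) *\<^sub>R (\<chi> k i. F x $ k * (\<chi> i. pd i \<eta> x) $ i)" for x
  proof -
    have "pd i (\<lambda>y. \<eta> y * \<eta> y * F y $ k) x = \<eta> x * \<eta> x * pd i (\<lambda>y. F y $ k) x + 2 * \<eta> x * pd i \<eta> x * F x $ k" for i k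
    proof -
      have d: "\<eta> differentiable (at x)" "(\<lambda>y. F y $ k) differentiable (at x)"
        "(\<lambda>y. \<eta> y * \<eta> y) differentiable (at x)"
        using smooth_differentiable[OF s\<eta>] smooth_differentiable[OF smooth_F] by (auto intro: differentiable_mult)
      show ?thesis unfolding pd_mult[OF d(3,2)] pd_mult[OF d(1,1)] by (simp add: algebra_simps)
    qed
    then show ?thesis by (simp add: vec_eq_iff jac_def power2_eq_square mult_ac)
  qed
  interpret s: linear s by (rule lin)
  let ?R = "\<lambda>x. s (\<chi> k i. F x $ k * (\<chi> i. pd i \<eta> x) $ i)"
  have sj: "s (jac ?\<Psi> x) \<bullet> b = 2 * \<eta> x * (?R x \<bullet> b)" if "b \<in> Basis" for x b
    using harm[of x b] that by (cases "\<eta> x = 0") (simp_all add: jac s.add s.scale inner_add_left)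
  have "(\<integral>x. (\<eta> x)\<^sup>2 * (norm (F x))\<^sup>2 \<partial>lborel) = (\<integral>x. F x \<bullet> ?\<Psi> x \<partial>lborel)"
    by (simp add: power2_norm_eq_inner)
  also have "\<dots> = (\<Sum>b\<in>Basis. \<integral>x. - ((s (jac ?\<Psi> x) \<bullet> b) * W b x) \<partial>lborel)"
    unfolding integral_F[OF \<Psi>] by (simp add: sum_negf)
  also have "\<dots> = (\<integral>x. (\<Sum>b\<in>Basis. - ((s (jac ?\<Psi> x) \<bullet> b) * W b x)) \<partial>lborel)"
  proof (rule Bochner_Integration.integral_sum[symmetric])
    fix b :: 'e assume b: "b \<in> Basis"
    have "integrable lborel (\<lambda>x. W b x * pd i (\<lambda>y. ?\<Psi> y $ k) x)" for i k
      by (rule test_integrable[OF test_mult_smooth[OF test_pd[OF test_fieldsD[OF \<Psi>]] sW]])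
    then have "integrable lborel (\<lambda>x. \<Sum>k\<in>UNIV. \<Sum>i\<in>UNIV. (s (unit_mat k i) \<bullet> b) * (W b x * pd i (\<lambda>y. ?\<Psi> y $ k) x))"
      by simp
    moreover have "(\<lambda>x. \<Sum>k\<in>UNIV. \<Sum>i\<in>UNIV. (s (unit_mat k i) \<bullet> b) * (W b x * pd i (\<lambda>y. ?\<Psi> y $ k) x))
        = (\<lambda>x. (s (jac ?\<Psi> x) \<bullet> b) * W b x)"
      unfolding linear_matrix_expansion[OF lin, of "jac _ _"]
      by (simp add: jac_def[of ?\<Psi>] sum_distrib_right sum_distrib_left mult_ac)
    ultimately show "integrable lborel (\<lambda>x. - ((s (jac ?\<Psi> x) \<bullet> b) * W b x))" by simp
  qed
  also have "\<dots> \<le> (\<integral>x. 2 * (\<Sum>b\<in>Basis. (W b x)\<^sup>2) + (1/2) * ((\<eta> x)\<^sup>2 * (norm (F x))\<^sup>2) \<partial>lborel)"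
  proof (rule integral_mono')
    have "integrable lborel (\<lambda>x. F x \<bullet> ?\<Psi> x)"
      using test_integrable[OF test_mult_smooth[OF test_fieldsD[OF \<Psi>] smooth_F]]
      by (simp add: inner_vec_def)
    then have iF: "integrable lborel (\<lambda>x. (\<eta> x)\<^sup>2 * (norm (F x))\<^sup>2)"
      by (simp add: power2_norm_eq_inner)
    then show "integrable lborel (\<lambda>x. 2 * (\<Sum>b\<in>Basis. (W b x)\<^sup>2) + (1/2) * ((\<eta> x)\<^sup>2 * (norm (F x))\<^sup>2))"
      using W2 by simp
    fix x
    let ?w = "\<Sum>b\<in>Basis. W b x *\<^sub>R b"
    have w2: "(norm ?w)\<^sup>2 = (\<Sum>b\<in>Basis. (W b x)\<^sup>2)"
      by (subst euclidean_inner[of ?w ?w, folded power2_norm_eq_inner])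
        (simp add: power2_eq_square inner_sum_left_Basis)
    have "(\<Sum>b\<in>Basis. - ((s (jac ?\<Psi> x) \<bullet> b) * W b x)) = - (2 * \<eta> x * (?R x \<bullet> ?w))"
      using sj by (simp add: inner_sum_right sum_negf sum_distrib_left mult_ac)
    also have "\<dots> \<le> \<bar>2 * \<eta> x * (?R x \<bullet> ?w)\<bar>" by linarith
    also have "\<dots> \<le> 2 * \<bar>\<eta> x\<bar> * (norm (F x) * norm ?w)"
    proof -
      have "\<bar>?R x \<bullet> ?w\<bar> \<le> norm (?R x) * norm ?w" by (rule Cauchy_Schwarz_ineq2)
      also have "\<dots> \<le> (norm (F x) * 1) * norm ?w"
        using order_trans[OF s1[of "F x" "\<chi> i. pd i \<eta> x"] mult_left_mono[OF \<eta>1 norm_ge_zero]]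
        by (intro mult_right_mono) simp_all
      finally show ?thesis by (simp add: abs_mult mult_left_mono)
    qed
    also have "\<dots> \<le> 2 * (norm ?w)\<^sup>2 + (1/2) * ((\<eta> x)\<^sup>2 * (norm (F x))\<^sup>2)"
      using zero_le_power2[of "2 * norm ?w - \<bar>\<eta> x\<bar> * norm (F x)"]
      by (simp add: power2_diff power_mult_distrib algebra_simps)
    finally show "(\<Sum>b\<in>Basis. - ((s (jac ?\<Psi> x) \<bullet> b) * W b x))
        \<le> 2 * (\<Sum>b\<in>Basis. (W b x)\<^sup>2) + (1/2) * ((\<eta> x)\<^sup>2 * (norm (F x))\<^sup>2)" by (simp only: w2)
    show "0 \<le> 2 * (\<Sum>b\<in>Basis. (W b x)\<^sup>2) + (1/2) * ((\<eta> x)\<^sup>2 * (norm (F x))\<^sup>2)"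
      by (intro add_nonneg_nonneg mult_nonneg_nonneg sum_nonneg) auto
  qed
  also have "\<dots> = 2 * (\<Sum>b\<in>Basis. \<integral>x. (W b x)\<^sup>2 \<partial>lborel) + (1/2) * (\<integral>x. (\<eta> x)\<^sup>2 * (norm (F x))\<^sup>2 \<partial>lborel)"
  proof -
    have "integrable lborel (\<lambda>x. F x \<bullet> ?\<Psi> x)"
      using test_integrable[OF test_mult_smooth[OF test_fieldsD[OF \<Psi>] smooth_F]]
      by (simp add: inner_vec_def)
    then have "integrable lborel (\<lambda>x. (\<eta> x)\<^sup>2 * (norm (F x))\<^sup>2)" by (simp add: power2_norm_eq_inner)
    then show ?thesis using W2 by simp
  qed
  finally show ?thesis by simp
qed

end

lemma norm_square_Basis: "(norm x)\<^sup>2 = (\<Sum>b\<in>Basis. (x \<bullet> b)\<^sup>2)"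
  unfolding power2_norm_eq_inner by (subst euclidean_inner) (simp add: power2_eq_square)

lemma L2_inner_const: "f \<in> L2 X \<Longrightarrow> (\<lambda>x. f x \<bullet> b) \<in> L2 X"
  by (rule L2_bounded_linear[OF bounded_linear_inner_left])

lemma sum_l2_norm_inner:
  fixes f :: "'a::euclidean_space \<Rightarrow> 'e::euclidean_space"
  assumes "f \<in> L2 X"
  shows "(\<Sum>b\<in>Basis. (l2_norm X (\<lambda>x. f x \<bullet> b))\<^sup>2) = (l2_norm X f)\<^sup>2"
proof -
  have "(\<Sum>b\<in>Basis. (l2_norm X (\<lambda>x. f x \<bullet> b))\<^sup>2) = (\<Sum>b\<in>Basis. \<integral>x. (f x \<bullet> b)\<^sup>2 \<partial>lebesgue_on X)"
    by (simp add: l2_norm_def)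
  also have "\<dots> = (\<integral>x. (\<Sum>b\<in>Basis. (f x \<bullet> b)\<^sup>2) \<partial>lebesgue_on X)"
    using L2_integrable_square[OF L2_inner_const[OF assms]]
    by (intro Bochner_Integration.integral_sum[symmetric]) simp
  also have "\<dots> = (l2_norm X f)\<^sup>2"
    by (simp add: l2_norm_def flip: norm_square_Basis)
  finally show ?thesis .
qed

lemma borel_imp_lebesgue_on_measurable:
  "f \<in> borel_measurable borel \<Longrightarrow> f \<in> borel_measurable (lebesgue_on S)"
  by (intro measurable_restrict_space1 measurable_completion) simp

lemma smooth_linear_jac:
  fixes s :: "real^'n^'n \<Rightarrow> 'e::euclidean_space"
  assumes "linear s" "\<Psi> \<in> test_fields X"
  shows "(\<lambda>x. s (jac \<Psi> x) \<bullet> b) \<in> test_functions X"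
proof -
  have "(\<lambda>x. s (jac \<Psi> x) \<bullet> b)
      = (\<lambda>x. \<Sum>k\<in>UNIV. \<Sum>i\<in>UNIV. (s (unit_mat k i) \<bullet> b) * pd i (\<lambda>y. \<Psi> y $ k) x)"
  proof
    fix x show "s (jac \<Psi> x) \<bullet> b = (\<Sum>k\<in>UNIV. \<Sum>i\<in>UNIV. (s (unit_mat k i) \<bullet> b) * pd i (\<lambda>y. \<Psi> y $ k) x)"
      using linear_matrix_expansion[OF assms(1), of "jac \<Psi> x" b] by (simp add: jac_def mult.commute)
  qed
  then show ?thesis
    by (simp only:) (intro test_sum test_cmult test_pd test_fieldsD[OF assms(2)])
qed

lemma continuous_imp_L2:
  fixes f :: "'a::euclidean_space \<Rightarrow> 'b::euclidean_space"
  assumes X: "X \<in> lmeasurable" and f: "f \<in> borel_measurable borel" and b: "\<And>x. norm (f x) \<le> C"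
  shows "f \<in> L2 X"
proof -
  interpret finite_measure "lebesgue_on X" by (rule finite_measure_lebesgue_on[OF X])
  have "f \<in> borel_measurable (lebesgue_on X)"
    by (rule borel_imp_lebesgue_on_measurable[OF f])
  then show ?thesis
    by (rule L2I_bound[where h="\<lambda>x. C\<^sup>2"]) (auto intro!: power_mono b)
qed

lemma test_field_measurable:
  assumes "\<Psi> \<in> test_fields X" shows "\<Psi> \<in> borel_measurable borel"
  by (rule borel_measurable_euclidean_space[THEN iffD2])
    (auto simp: Basis_vec_def inner_axis intro: test_measurable[OF test_fieldsD[OF assms]])

lemma test_field_bounded:
  assumes "\<Psi> \<in> test_fields X"
  obtains C where "\<And>x. norm (\<Psi> x) \<le> C"
proof -
  have "\<exists>C. \<forall>x. \<bar>\<Psi> x $ k\<bar> \<le> C" for k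
    by (rule test_bounded[OF test_fieldsD[OF assms, of k]]) blast
  then obtain C where C: "\<And>k x. \<bar>\<Psi> x $ k\<bar> \<le> C k" by metis
  have "norm (\<Psi> x) \<le> (\<Sum>k\<in>UNIV. C k)" for x
    by (rule order_trans[OF norm_le_l1_cart sum_mono]) (rule C)
  then show thesis by (rule that)
qed

lemma test_field_support:
  assumes "\<Psi> \<in> test_fields X"
  obtains K where "compact K" "K \<subseteq> X" "\<And>x. x \<notin> K \<Longrightarrow> \<Psi> x = 0"
proof -
  have "\<exists>K. compact K \<and> K \<subseteq> X \<and> (\<forall>x. x \<notin> K \<longrightarrow> \<Psi> x $ k = 0)" for k
    by (rule test_functionsE[OF test_fieldsD[OF assms, of k]]) blast
  then obtain K where K: "\<And>k. compact (K k)" "\<And>k. K k \<subseteq> X" "\<And>k x. x \<notin> K k \<Longrightarrow> \<Psi> x $ k = 0" by metis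
  have "compact (\<Union>k. K k)" using K by (intro compact_UN) auto
  moreover have "(\<Union>k. K k) \<subseteq> X" using K by auto
  moreover have "\<Psi> x = 0" if "x \<notin> (\<Union>k. K k)" for x using K(3) that by (auto simp: vec_eq_iff)
  ultimately show thesis by (rule that)
qed

lemma compact_bdist_pos:
  fixes X :: "'a::euclidean_space set"
  assumes "open X" "bounded X" "compact K" "K \<subseteq> X"
  obtains \<delta> where "0 < \<delta>" "\<And>x. x \<in> K \<Longrightarrow> \<delta> \<le> bdist X x"
proof (cases "K = {}")
  case False
  then obtain z where z: "z \<in> K" "\<And>x. x \<in> K \<Longrightarrow> bdist X z \<le> bdist X x"
    using continuous_attains_inf[OF assms(3) False bdist_continuous] by blast
  then show thesis using that[of "bdist X z"] bdist_pos[of X z] assms by auto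
qed (use that[of 1] in auto)

lemma test_field_div_bdist_L2:
  assumes "open X" "bounded X" "\<Psi> \<in> test_fields X"
  shows "(\<lambda>x. \<Psi> x /\<^sub>R bdist X x) \<in> L2 X"
proof -
  obtain K where K: "compact K" "K \<subseteq> X" "\<And>x. x \<notin> K \<Longrightarrow> \<Psi> x = 0"
    using test_field_support[OF assms(3)] by blast
  obtain \<delta> where \<delta>: "0 < \<delta>" "\<And>x. x \<in> K \<Longrightarrow> \<delta> \<le> bdist X x"
    using compact_bdist_pos[OF assms(1,2) K(1,2)] by blast
  obtain C where C: "\<And>x. norm (\<Psi> x) \<le> C" using test_field_bounded[OF assms(3)] by blast
  have [measurable]: "\<Psi> \<in> borel_measurable borel" "bdist X \<in> borel_measurable borel"
    using test_field_measurable[OF assms(3)] bdist_measurable by auto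
  show ?thesis
  proof (rule continuous_imp_L2[where C="inverse \<delta> * C"])
    show "X \<in> lmeasurable" using assms by (simp add: lmeasurable_open)
    show "(\<lambda>x. \<Psi> x /\<^sub>R bdist X x) \<in> borel_measurable borel" by measurable
    show "norm (\<Psi> x /\<^sub>R bdist X x) \<le> inverse \<delta> * C" for x
    proof (cases "x \<in> K")
      case True
      then have "inverse (bdist X x) \<le> inverse \<delta>" using \<delta> by (intro le_imp_inverse_le) auto
      then show ?thesis using C[of x] \<delta>(1) by (auto intro!: mult_mono)
    next
      case False
      then show ?thesis using K(3) \<delta>(1) order_trans[OF norm_ge_zero C] by simp
    qed
  qed
qed

lemma L2_norm_mem: "f \<in> L2 X \<Longrightarrow> (\<lambda>x. norm (f x)) \<in> L2 X"
  using measurable_compose[OF L2_measurable borel_measurable_norm, of f X] by (simp add: L2_def)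

theorem weighted_estimate:
  fixes X :: "(real^'n) set" and s :: "real^'n^'n \<Rightarrow> 'e::euclidean_space"
  assumes X: "open X" "bounded X" "X \<noteq> {}" and lin: "linear s"
    and s1: "\<And>w \<xi>. norm (s (\<chi> k i. w $ k * \<xi> $ i)) \<le> norm w * norm \<xi>"
    and v: "v \<in> L2 X"
    and harm: "\<And>\<psi> b. \<psi> \<in> test_functions X \<Longrightarrow> b \<in> Basis \<Longrightarrow>
      (\<integral>x. s (jac (adj_field s b \<psi>) x) \<bullet> v x \<partial>lebesgue_on X) = 0"
    and \<Psi>: "\<Psi> \<in> test_fields X"
  shows "\<bar>\<integral>x. s (jac \<Psi> x) \<bullet> v x \<partial>lebesgue_on X\<bar>
    \<le> 2 * l2_norm X v * l2_norm X (\<lambda>x. \<Psi> x /\<^sub>R bdist X x)"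
proof -
  have Xl: "X \<in> lmeasurable" "X \<in> sets lebesgue" using X by (auto simp: lmeasurable_open)
  let ?N = "l2_norm X v" and ?Q = "\<lambda>x. \<Psi> x /\<^sub>R bdist X x"
  define P where "P b u \<longleftrightarrow> integrable lborel u \<and> integrable lborel (\<lambda>x. (u x)\<^sup>2) \<and>
    (\<integral>x. (u x)\<^sup>2 \<partial>lborel) = (l2_norm X (\<lambda>x. v x \<bullet> b))\<^sup>2 \<and>
    (\<forall>\<phi>\<in>borel_measurable borel. (\<integral>x. \<phi> x * (v x \<bullet> b) \<partial>lebesgue_on X) = (\<integral>x. \<phi> x * u x \<partial>lborel))" for b u
  have "\<exists>u. P b u" for b
    unfolding P_def by (rule L2_representative[OF X(1,2) L2_inner_const[OF v, of b]]) blast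
  then have "\<exists>V. \<forall>b. P b (V b)" by (intro choice allI)
  then obtain V where VP: "\<And>b. P b (V b)" by blast
  have V: "\<And>b. integrable lborel (V b)" "\<And>b. integrable lborel (\<lambda>x. (V b x)\<^sup>2)"
    "\<And>b. (\<integral>x. (V b x)\<^sup>2 \<partial>lborel) = (l2_norm X (\<lambda>x. v x \<bullet> b))\<^sup>2"
    "\<And>b \<phi>. \<phi> \<in> borel_measurable borel \<Longrightarrow>
       (\<integral>x. \<phi> x * (v x \<bullet> b) \<partial>lebesgue_on X) = (\<integral>x. \<phi> x * V b x \<partial>lborel)"
    using VP unfolding P_def by simp_all
  define W where "W r b = convolve (mollifier r) (V b)" for r b
  have field: "mollified_field s (W r)" if "r > 0" for r
    unfolding W_def by (intro mollified_field.intro lin smooth_convolve[OF mollifier_test[OF that] V(1)])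
  have split: "(\<integral>x. s (jac \<Phi> x) \<bullet> v x \<partial>lebesgue_on X)
      = (\<Sum>b\<in>Basis. \<integral>x. (s (jac \<Phi> x) \<bullet> b) * V b x \<partial>lborel)" if \<Phi>: "\<Phi> \<in> test_fields X" for \<Phi>
  proof -
    have i: "integrable (lebesgue_on X) (\<lambda>x. (s (jac \<Phi> x) \<bullet> b) * (v x \<bullet> b))" for b
      using locally_integrable_test_mult[OF locally_integrable_inner[OF L2_locally_integrable[OF v Xl(1)]]
          smooth_linear_jac[OF lin \<Phi>] X(1)] by simp
    have "(\<integral>x. s (jac \<Phi> x) \<bullet> v x \<partial>lebesgue_on X)
        = (\<integral>x. (\<Sum>b\<in>Basis. (s (jac \<Phi> x) \<bullet> b) * (v x \<bullet> b)) \<partial>lebesgue_on X)"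
      by (subst euclidean_inner) simp
    also have "\<dots> = (\<Sum>b\<in>Basis. \<integral>x. (s (jac \<Phi> x) \<bullet> b) * V b x \<partial>lborel)"
      using i V(4)[OF test_measurable[OF smooth_linear_jac[OF lin \<Phi>]]] by simp
    finally show ?thesis .
  qed
  have sF: "s (jac (mollified_field.F s (W r)) x) \<bullet> b = 0"
    if r: "r > 0" "cball x r \<subseteq> X" and b: "b \<in> Basis" for r x b
  proof -
    interpret mollified_field s "W r" by (rule field[OF r(1)])
    define \<psi> where "\<psi> = (\<lambda>y. mollifier r (x - y))"
    have \<psi>: "\<psi> \<in> test_functions X" unfolding \<psi>_def by (rule test_mollifier_shift[OF r])
    have m: "mollifier r \<in> test_functions (UNIV :: (real^'n) set)" by (rule mollifier_test[OF r(1)])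
    have p1: "pd i \<psi> = (\<lambda>y. - pd i (mollifier r) (x - y))" for i
      unfolding \<psi>_def by (intro ext pd_reflect_shift(1) smooth_differentiable[OF test_smooth[OF m]])
    have p2: "pd j (pd i \<psi>) y = pd j (pd i (mollifier r)) (x - y)" for i j y
    proof -
      have d: "pd i (mollifier r) differentiable (at z)" for z :: "real^'n"
        by (rule smooth_differentiable[OF test_smooth[OF test_pd[OF m]]])
      have "pd j (\<lambda>y. (-1) * pd i (mollifier r) (x - y)) y = (-1) * pd j (\<lambda>y. pd i (mollifier r) (x - y)) y"
        by (rule pd_cmult[OF pd_reflect_shift(2)[OF d]])
      then show ?thesis unfolding p1 by (simp add: pd_reflect_shift(1)[OF d])
    qed
    define D where "D i j b' = (\<integral>y. pd j (pd i \<psi>) y * V b' y \<partial>lborel)" for i j b'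
    have Dsym: "D i j b' = D j i b'" for i j b'
      unfolding D_def using smooth_pd_commute[OF test_smooth[OF \<psi>], of j i] by simp
    have pdW: "pd j (pd i (W r b')) x = D i j b'" for i j b'
      by (simp add: W_def pd_convolve[OF m V(1)] pd_convolve[OF test_pd[OF m] V(1)] convolve_def D_def p2)
    have "jac F x $ k $ j = (\<Sum>b'\<in>Basis. \<Sum>i\<in>UNIV. (s (unit_mat k i) \<bullet> b') * D i j b')" for k j
    proof -
      have d: "pd i (W r b') differentiable (at x)" for i b'
        by (rule smooth_differentiable[OF smooth_pd[OF sW]])
      have d': "(\<lambda>x. c * pd i (W r b') x) differentiable (at x)" for i c b'
        using d by (intro differentiable_mult) auto
      then have d'': "(\<lambda>x. \<Sum>i\<in>UNIV. c i * pd i (W r b') x) differentiable (at x)" for c b'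
        by (intro differentiable_sum) auto
      have "pd j (\<lambda>x. \<Sum>i\<in>UNIV. c i * pd i (W r b') x) x = (\<Sum>i\<in>UNIV. c i * D i j b')" for c b'
        using d' by (subst pd_sum) (auto simp: pd_cmult[OF d] pdW)
      moreover have "jac F x $ k $ j
          = (\<Sum>b'\<in>Basis. pd j (\<lambda>x. \<Sum>i\<in>UNIV. (s (unit_mat k i) \<bullet> b') * pd i (W r b') x) x)"
        unfolding jac_def F_nth vec_lambda_beta by (rule pd_sum) (rule d'')
      ultimately show ?thesis by simp
    qed
    then have "s (jac F x) \<bullet> b = (\<Sum>k\<in>UNIV. \<Sum>j\<in>UNIV. \<Sum>b'\<in>Basis. \<Sum>i\<in>UNIV.
        (s (unit_mat k i) \<bullet> b') * D i j b' * (s (unit_mat k j) \<bullet> b))"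
      by (simp add: linear_matrix_expansion[OF lin, of "jac F x"] sum_distrib_right)
    also have "\<dots> = (\<Sum>b'\<in>Basis. \<Sum>k\<in>UNIV. \<Sum>i\<in>UNIV. \<Sum>j\<in>UNIV.
        (s (unit_mat k i) \<bullet> b') * D i j b' * (s (unit_mat k j) \<bullet> b))"
    proof -
      have "(\<Sum>j\<in>UNIV. \<Sum>b'\<in>Basis. \<Sum>i\<in>UNIV. (s (unit_mat k i) \<bullet> b') * D i j b' * (s (unit_mat k j) \<bullet> b))
         = (\<Sum>b'\<in>Basis. \<Sum>i\<in>UNIV. \<Sum>j\<in>UNIV. (s (unit_mat k i) \<bullet> b') * D i j b' * (s (unit_mat k j) \<bullet> b))" for k
        by (rule trans[OF sum.swap], rule sum.cong[OF refl], rule sum.swap)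
      then show ?thesis by (simp only:) (rule sum.swap)
    qed
    also have "\<dots> = (\<Sum>b'\<in>Basis. \<Sum>k\<in>UNIV. \<Sum>j\<in>UNIV. \<Sum>i\<in>UNIV.
        (s (unit_mat k i) \<bullet> b) * (s (unit_mat k j) \<bullet> b') * D i j b')"
      by (intro sum.cong refl) (subst Dsym, simp add: mult_ac)
    also have "\<dots> = (\<Sum>b'\<in>Basis. \<integral>y. (s (jac (adj_field s b \<psi>) y) \<bullet> b') * V b' y \<partial>lborel)"
    proof (intro sum.cong refl)
      fix b' :: 'e
      have i: "integrable lborel (\<lambda>y. pd j (pd i \<psi>) y * V b' y)" for i j
      proof (rule test_bounded[OF test_pd[OF test_pd[OF \<psi>]], of j i])
        fix C assume "\<And>y. \<bar>pd j (pd i \<psi>) y\<bar> \<le> C"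
        then show ?thesis
          using test_measurable[OF test_pd[OF test_pd[OF \<psi>]], of j i]
          by (intro integrable_bounded_mult[OF V(1)]) auto
      qed
      have "(\<integral>y. (s (jac (adj_field s b \<psi>) y) \<bullet> b') * V b' y \<partial>lborel)
          = (\<integral>y. (\<Sum>k\<in>UNIV. \<Sum>j\<in>UNIV. \<Sum>i\<in>UNIV. (s (unit_mat k i) \<bullet> b) * (s (unit_mat k j) \<bullet> b')
               * (pd j (pd i \<psi>) y * V b' y)) \<partial>lborel)"
        by (simp add: linear_jac_adj_field[OF lin test_smooth[OF \<psi>]] sum_distrib_right mult.assoc)
      then show "(\<Sum>k\<in>UNIV. \<Sum>j\<in>UNIV. \<Sum>i\<in>UNIV. (s (unit_mat k i) \<bullet> b) * (s (unit_mat k j) \<bullet> b') * D i j b')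
          = (\<integral>y. (s (jac (adj_field s b \<psi>) y) \<bullet> b') * V b' y \<partial>lborel)"
        using i by (simp add: D_def)
    qed
    also have "\<dots> = 0"
      unfolding split[OF adj_field_test[OF \<psi>], symmetric] by (rule harm[OF \<psi> b])
    finally show ?thesis .
  qed
  have QL: "?Q \<in> L2 X" by (rule test_field_div_bdist_L2[OF X(1,2) \<Psi>])
  have \<Psi>U: "\<Psi> \<in> test_fields UNIV" using \<Psi> by (auto simp: test_fields_def intro: test_mono[OF _ subset_UNIV])
  have key: "\<bar>\<Sum>b\<in>Basis. \<integral>x. (s (jac \<Psi> x) \<bullet> b) * W r b x \<partial>lborel\<bar> \<le> c * (2 * ?N * l2_norm X ?Q)"
    if r: "r > 0" and c: "c \<ge> 0" and \<eta>: "\<eta> \<in> test_functions UNIV" "\<And>x. 0 \<le> \<eta> x"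
      "\<And>x. norm (\<chi> i. pd i \<eta> x) \<le> 1" "\<And>x. \<eta> x \<noteq> 0 \<Longrightarrow> cball x r \<subseteq> X"
      and sup: "\<And>x. \<Psi> x \<noteq> 0 \<Longrightarrow> bdist X x \<le> c * \<eta> x" for r c \<eta>
  proof -
    interpret mollified_field s "W r" by (rule field[OF r])
    have Y: "integrable lborel (\<lambda>x. (W r b x)\<^sup>2)" "(\<integral>x. (W r b x)\<^sup>2 \<partial>lborel) \<le> (\<integral>x. (V b x)\<^sup>2 \<partial>lborel)" for b
      unfolding W_def using convolve_mollifier_square[OF r V(1,2)] by auto
    have "(\<integral>x. (\<eta> x)\<^sup>2 * (norm (F x))\<^sup>2 \<partial>lborel) \<le> 4 * (\<Sum>b\<in>Basis. \<integral>x. (W r b x)\<^sup>2 \<partial>lborel)"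
      by (rule caccioppoli[OF \<eta>(1,3) s1 sF Y(1)]) (use \<eta>(4) r in auto)
    also have "\<dots> \<le> 4 * (\<Sum>b\<in>Basis. (l2_norm X (\<lambda>x. v x \<bullet> b))\<^sup>2)"
      using Y(2) V(3) by (intro mult_left_mono sum_mono) auto
    also have "\<dots> = (2 * ?N)\<^sup>2" by (simp add: sum_l2_norm_inner[OF v] power_mult_distrib)
    finally have F2: "(\<integral>x. (\<eta> x)\<^sup>2 * (norm (F x))\<^sup>2 \<partial>lborel) \<le> (2 * ?N)\<^sup>2" .
    have \<eta>F: "(\<lambda>x. \<eta> x *\<^sub>R F x) \<in> test_fields X"
    proof -
      have "\<eta> \<in> test_functions X"
        using \<eta>(1)
      proof (rule test_functionsE)
        fix K assume K: "compact K" "\<And>x. x \<notin> K \<Longrightarrow> \<eta> x = 0" "smooth \<eta>"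
        have "closure {x. \<eta> x \<noteq> 0} \<subseteq> X"
        proof
          fix x assume "x \<in> closure {x. \<eta> x \<noteq> 0}"
          then obtain y where "\<eta> y \<noteq> 0" "dist y x < r" using r by (auto simp: closure_approachable)
          then show "x \<in> X" using \<eta>(4)[of y] by auto
        qed
        moreover have "closure {x. \<eta> x \<noteq> 0} \<subseteq> K"
          using K by (intro closure_minimal) (auto intro: compact_imp_closed)
        then have "compact (closure {x. \<eta> x \<noteq> 0})"
          using K(1) by (metis closed_closure compact_Int_closed inf.absorb_iff2)
        ultimately show ?thesis using K(3) by (simp add: test_functions_def)
      qed
      then show ?thesis
        using test_mult_smooth[OF _ smooth_F] by (simp add: test_fields_def mult.commute)
    qed
    have \<eta>FL: "(\<lambda>x. \<eta> x *\<^sub>R F x) \<in> L2 X"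
      by (rule test_field_bounded[OF \<eta>F]) (rule continuous_imp_L2[OF Xl(1) test_field_measurable[OF \<eta>F]])
    have nF: "l2_norm X (\<lambda>x. \<eta> x *\<^sub>R F x) \<le> 2 * ?N"
    proof (rule power2_le_imp_le)
      have [measurable]: "(\<lambda>x. \<eta> x *\<^sub>R F x) \<in> borel_measurable borel" by (rule test_field_measurable[OF \<eta>F])
      obtain K where K: "K \<subseteq> X" "\<And>x. x \<notin> K \<Longrightarrow> \<eta> x *\<^sub>R F x = 0" by (rule test_field_support[OF \<eta>F]) (rule that, assumption+)
      have "(l2_norm X (\<lambda>x. \<eta> x *\<^sub>R F x))\<^sup>2 = (\<integral>x. (norm (\<eta> x *\<^sub>R F x))\<^sup>2 \<partial>lebesgue_on X)"
        by (simp add: l2_norm_def)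
      also have "\<dots> = (\<integral>x. (norm (\<eta> x *\<^sub>R F x))\<^sup>2 \<partial>lborel)"
      proof (rule integral_lebesgue_on_eq_lborel(1)[OF _ Xl(2)])
        show "(\<lambda>x. (norm (\<eta> x *\<^sub>R F x))\<^sup>2) \<in> borel_measurable borel" by measurable
        show "(norm (\<eta> x *\<^sub>R F x))\<^sup>2 = 0" if "x \<notin> X" for x
          using K that by (metis norm_zero subsetD zero_power2)
      qed
      also have "\<dots> \<le> (2 * ?N)\<^sup>2" using F2 by (simp add: power_mult_distrib)
      finally show "(l2_norm X (\<lambda>x. \<eta> x *\<^sub>R F x))\<^sup>2 \<le> (2 * ?N)\<^sup>2" .
    qed simp
    have "\<bar>\<Sum>b\<in>Basis. \<integral>x. (s (jac \<Psi> x) \<bullet> b) * W r b x \<partial>lborel\<bar> = \<bar>\<integral>x. F x \<bullet> \<Psi> x \<partial>lborel\<bar>"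
      by (simp add: integral_F[OF \<Psi>U])
    also have "\<dots> = \<bar>\<integral>x. F x \<bullet> \<Psi> x \<partial>lebesgue_on X\<bar>"
    proof -
      obtain K where K: "K \<subseteq> X" "\<And>x. x \<notin> K \<Longrightarrow> \<Psi> x = 0" by (rule test_field_support[OF \<Psi>]) (rule that, assumption+)
      have "(\<lambda>x. F x \<bullet> \<Psi> x) \<in> borel_measurable borel"
        unfolding inner_vec_def using smooth_measurable[OF smooth_F] test_measurable[OF test_fieldsD[OF \<Psi>]]
        by (auto intro!: borel_measurable_sum borel_measurable_times)
      moreover have "F x \<bullet> \<Psi> x = 0" if "x \<notin> X" for x
        using K that by (metis inner_zero_right subsetD)
      ultimately show ?thesis by (subst integral_lebesgue_on_eq_lborel(1)[OF _ Xl(2)]) auto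
    qed
    also have "\<dots> \<le> (\<integral>x. \<bar>F x \<bullet> \<Psi> x\<bar> \<partial>lebesgue_on X)" by (rule integral_abs_bound)
    also have "\<dots> \<le> (\<integral>x. c * (norm (\<eta> x *\<^sub>R F x) \<bullet> norm (?Q x)) \<partial>lebesgue_on X)"
    proof (rule integral_mono')
      show "integrable (lebesgue_on X) (\<lambda>x. c * (norm (\<eta> x *\<^sub>R F x) \<bullet> norm (?Q x)))"
        by (intro integrable_mult_right L2_integrable_inner L2_norm_mem \<eta>FL QL)
      fix x assume "x \<in> space (lebesgue_on X)"
      then have d: "0 < bdist X x" using bdist_pos[OF X(1,2)] by simp
      show "\<bar>F x \<bullet> \<Psi> x\<bar> \<le> c * (norm (\<eta> x *\<^sub>R F x) \<bullet> norm (?Q x))"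
      proof (cases "\<Psi> x = 0")
        case False
        have "\<bar>F x \<bullet> \<Psi> x\<bar> \<le> norm (F x) * norm (\<Psi> x)" by (rule Cauchy_Schwarz_ineq2)
        also have "\<dots> = bdist X x * (norm (F x) * norm (?Q x))" using d by simp
        also have "\<dots> \<le> c * \<eta> x * (norm (F x) * norm (?Q x))"
          by (intro mult_right_mono sup False) simp
        finally show ?thesis using \<eta>(2)[of x] by (simp add: mult_ac)
      qed (use c in simp)
      show "0 \<le> c * (norm (\<eta> x *\<^sub>R F x) \<bullet> norm (?Q x))" using c by simp
    qed
    also have "\<dots> = c * l2_inner X (\<lambda>x. norm (\<eta> x *\<^sub>R F x)) (\<lambda>x. norm (?Q x))"
      by (simp add: l2_inner_def)
    also have "\<dots> \<le> c * (l2_norm X (\<lambda>x. norm (\<eta> x *\<^sub>R F x)) * l2_norm X (\<lambda>x. norm (?Q x)))"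
    proof (intro mult_left_mono c)
      have "(\<lambda>x. norm (\<eta> x *\<^sub>R F x)) \<in> L2 X" "(\<lambda>x. norm (?Q x)) \<in> L2 X"
        by (intro L2_norm_mem \<eta>FL QL)+
      from l2_inner_le[OF this] show "l2_inner X (\<lambda>x. norm (\<eta> x *\<^sub>R F x)) (\<lambda>x. norm (?Q x))
        \<le> l2_norm X (\<lambda>x. norm (\<eta> x *\<^sub>R F x)) * l2_norm X (\<lambda>x. norm (?Q x))" by linarith
    qed
    also have "\<dots> \<le> c * (2 * ?N * l2_norm X ?Q)"
      using nF by (intro mult_left_mono c mult_mono) (auto simp: l2_norm_def)
    finally show ?thesis .
  qed
  have lim: "((\<lambda>r. \<Sum>b\<in>Basis. \<integral>x. (s (jac \<Psi> x) \<bullet> b) * W r b x \<partial>lborel)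
      \<longlongrightarrow> (\<Sum>b\<in>Basis. \<integral>x. (s (jac \<Psi> x) \<bullet> b) * V b x \<partial>lborel)) (at_right 0)"
  proof (intro tendsto_sum)
    fix b :: 'e
    let ?\<phi> = "\<lambda>x. s (jac \<Psi> x) \<bullet> b"
    have \<phi>: "?\<phi> \<in> test_functions X" by (rule smooth_linear_jac[OF lin \<Psi>])
    obtain C where C: "\<And>x. \<bar>?\<phi> x\<bar> \<le> C" by (rule test_bounded[OF \<phi>]) (rule that, assumption+)
    have [measurable]: "?\<phi> \<in> borel_measurable borel" by (rule test_measurable[OF \<phi>])
    show "((\<lambda>r. \<integral>x. ?\<phi> x * W r b x \<partial>lborel) \<longlongrightarrow> (\<integral>x. ?\<phi> x * V b x \<partial>lborel)) (at_right 0)"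
    proof (rule LIM_zero_cancel, rule Lim_null_comparison)
      show "((\<lambda>r. C * (\<integral>x. \<bar>W r b x - V b x\<bar> \<partial>lborel)) \<longlongrightarrow> 0) (at_right 0)"
        unfolding W_def by (rule tendsto_mult_right_zero[OF convolve_mollifier_tendsto[OF V(1)]])
      show "eventually (\<lambda>r. norm ((\<integral>x. ?\<phi> x * W r b x \<partial>lborel) - (\<integral>x. ?\<phi> x * V b x \<partial>lborel))
          \<le> C * (\<integral>x. \<bar>W r b x - V b x\<bar> \<partial>lborel)) (at_right 0)"
        using eventually_at_right_less[of 0]
      proof eventually_elim
        case (elim r)
        have iW: "integrable lborel (W r b)"
          unfolding W_def by (rule convolve_mollifier_integrable[OF elim V(1)])
        have "(\<integral>x. ?\<phi> x * W r b x \<partial>lborel) - (\<integral>x. ?\<phi> x * V b x \<partial>lborel)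
            = (\<integral>x. ?\<phi> x * (W r b x - V b x) \<partial>lborel)"
          using integrable_bounded_mult[OF iW _ C] integrable_bounded_mult[OF V(1)[of b] _ C]
          by (simp add: right_diff_distrib)
        then show ?case
          using integral_bounded_mult_le[OF Bochner_Integration.integrable_diff[OF iW V(1)[of b]] _ C] by simp
      qed
    qed
  qed
  have bound: "\<bar>\<integral>x. s (jac \<Psi> x) \<bullet> v x \<partial>lebesgue_on X\<bar> \<le> c * (2 * ?N * l2_norm X ?Q)" if c: "c > 1" for c
  proof -
    obtain K where K: "compact K" "K \<subseteq> X" "\<And>x. x \<notin> K \<Longrightarrow> \<Psi> x = 0"
      by (rule test_field_support[OF \<Psi>]) (rule that, assumption+)
    obtain \<delta> where \<delta>: "0 < \<delta>" "\<And>x. x \<in> K \<Longrightarrow> \<delta> \<le> bdist X x"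
      by (rule compact_bdist_pos[OF X(1,2) K(1,2)]) (rule that, assumption+)
    define e where "e = \<delta> * (1 - 1 / c) / 3"
    have e: "e > 0" using \<delta> c by (simp add: e_def)
    obtain \<eta> where \<eta>: "\<eta> \<in> test_functions UNIV" "\<And>x. 0 \<le> \<eta> x" "\<And>x. norm (\<chi> i. pd i \<eta> x) \<le> 1"
      "\<And>x. \<eta> x \<noteq> 0 \<Longrightarrow> cball x e \<subseteq> X" "\<And>x. x \<in> X \<Longrightarrow> bdist X x - 3 * e \<le> \<eta> x"
      by (rule smooth_cutoff[OF X e]) (rule that, assumption+)
    have sup: "bdist X x \<le> c * \<eta> x" if "\<Psi> x \<noteq> 0" for x
    proof -
      have x: "x \<in> K" using K(3) that by blast
      have "3 * e \<le> bdist X x * (1 - 1 / c)"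
        using \<delta>(2)[OF x] c by (simp add: e_def mult_right_mono)
      then have "bdist X x / c \<le> bdist X x - 3 * e" by (simp add: algebra_simps)
      also have "\<dots> \<le> \<eta> x" using \<eta>(5) x K(2) by blast
      finally show ?thesis using c by (simp add: divide_le_eq mult.commute)
    qed
    have "eventually (\<lambda>r. \<bar>\<Sum>b\<in>Basis. \<integral>x. (s (jac \<Psi> x) \<bullet> b) * W r b x \<partial>lborel\<bar> \<le> c * (2 * ?N * l2_norm X ?Q)) (at_right 0)"
      unfolding eventually_at_right_field
    proof (intro exI[of _ e] conjI allI impI e)
      fix r assume r: "0 < r" "r < e"
      have "cball x r \<subseteq> X" if "\<eta> x \<noteq> 0" for x
        using \<eta>(4)[OF that] r by (meson less_imp_le order_trans subset_cball)
      then show "\<bar>\<Sum>b\<in>Basis. \<integral>x. (s (jac \<Psi> x) \<bullet> b) * W r b x \<partial>lborel\<bar> \<le> c * (2 * ?N * l2_norm X ?Q)"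
        using c sup \<eta> r by (intro key[of r c \<eta>]) auto
    qed
    then have "\<bar>\<Sum>b\<in>Basis. \<integral>x. (s (jac \<Psi> x) \<bullet> b) * V b x \<partial>lborel\<bar> \<le> c * (2 * ?N * l2_norm X ?Q)"
      by (rule tendsto_upperbound[OF tendsto_rabs[OF lim]]) simp
    then show ?thesis by (simp add: split[OF \<Psi>])
  qed
  show ?thesis
  proof (rule tendsto_lowerbound)
    show "((\<lambda>c. c * (2 * ?N * l2_norm X ?Q)) \<longlongrightarrow> 2 * ?N * l2_norm X ?Q) (at_right 1)"
      by (auto intro!: tendsto_eq_intros)
    show "eventually (\<lambda>c. \<bar>\<integral>x. s (jac \<Psi> x) \<bullet> v x \<partial>lebesgue_on X\<bar> \<le> c * (2 * ?N * l2_norm X ?Q)) (at_right 1)"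
      using eventually_at_right_less[of 1] by eventually_elim (rule bound)
  qed simp
qed

lemma jac_comb:
  assumes "\<Phi> \<in> test_fields X" "\<Psi> \<in> test_fields X"
  shows "jac (\<lambda>x. a *\<^sub>R \<Phi> x + b *\<^sub>R \<Psi> x) x = a *\<^sub>R jac \<Phi> x + b *\<^sub>R jac \<Psi> x"
proof -
  have "pd i (\<lambda>y. a * \<Phi> y $ k + b * \<Psi> y $ k) x = a * pd i (\<lambda>y. \<Phi> y $ k) x + b * pd i (\<lambda>y. \<Psi> y $ k) x" for i k
  proof -
    have d: "(\<lambda>y. \<Phi> y $ k) differentiable (at x)" "(\<lambda>y. \<Psi> y $ k) differentiable (at x)"
      using assms by (auto intro!: smooth_differentiable test_smooth[OF test_fieldsD])
    have "(\<lambda>y. a * \<Phi> y $ k) differentiable (at x)" "(\<lambda>y. b * \<Psi> y $ k) differentiable (at x)"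
      using d by (auto intro: differentiable_mult)
    then show ?thesis by (simp add: pd_add pd_cmult[OF d(1)] pd_cmult[OF d(2)])
  qed
  then show ?thesis by (simp add: vec_eq_iff jac_def)
qed

lemma test_fields_comb:
  assumes "\<Phi> \<in> test_fields X" "\<Psi> \<in> test_fields X"
  shows "(\<lambda>x. a *\<^sub>R \<Phi> x + b *\<^sub>R \<Psi> x) \<in> test_fields X"
  using assms by (auto simp: test_fields_def intro!: test_add test_cmult)

lemma test_fields_zero: "(\<lambda>x. 0) \<in> test_fields X"
  by (simp add: test_fields_def test_zero)

lemma linear_trace: "linear (trace :: real^'n^'n \<Rightarrow> real)"
  by (rule linearI) (simp_all add: trace_def sum.distrib sum_distrib_left)

lemma test_trace_jac:
  "\<Psi> \<in> test_fields X \<Longrightarrow> (\<lambda>x. trace (jac \<Psi> x)) \<in> test_functions X"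
  using smooth_linear_jac[OF linear_trace, of \<Psi> X 1] by simp

lemma integrable_test_mult:
  assumes "open X" "locally_integrable X u" "\<phi> \<in> test_functions X"
  shows "integrable (lebesgue_on X) (\<lambda>x. \<phi> x * u x)" "integrable (lebesgue_on X) (\<lambda>x. u x * \<phi> x)"
  using locally_integrable_test_mult[OF assms(2,3,1)] by (simp_all add: mult.commute)

lemma riesz_weak_gradient:
  fixes X :: "(real^'n) set" and u :: "real^'n \<Rightarrow> real"
  assumes X: "open X" "bounded X" and u: "locally_integrable X u" and M: "0 \<le> M"
    and bound: "\<And>\<Psi>. \<Psi> \<in> test_fields X \<Longrightarrow>
      \<bar>\<integral>x. u x * trace (jac \<Psi> x) \<partial>lebesgue_on X\<bar> \<le> M * l2_norm X (\<lambda>x. \<Psi> x /\<^sub>R bdist X x)"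
  obtains g where "is_function X (distr_grad X u) g" "(\<lambda>x. bdist X x *\<^sub>R g x) \<in> L2 X"
    "l2_norm X (\<lambda>x. bdist X x *\<^sub>R g x) \<le> M"
proof -
  have Xl: "X \<in> lmeasurable" "X \<in> sets lebesgue" using X by (auto simp: lmeasurable_open)
  define q :: "(real^'n \<Rightarrow> real^'n) \<Rightarrow> real^'n \<Rightarrow> real^'n" where "q \<Psi> x = \<Psi> x /\<^sub>R bdist X x" for \<Psi> x
  have qL: "q \<Psi> \<in> L2 X" if "\<Psi> \<in> test_fields X" for \<Psi>
    unfolding q_def[abs_def] by (rule test_field_div_bdist_L2[OF X that])
  have q_comb: "q (\<lambda>x. a *\<^sub>R \<Phi> x + b *\<^sub>R \<Psi> x) = (\<lambda>x. a *\<^sub>R q \<Phi> x + b *\<^sub>R q \<Psi> x)" for a b \<Phi> \<Psi>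
    by (simp add: q_def fun_eq_iff scaleR_add_right mult.commute)
  define L where "L \<Psi> = (\<integral>x. u x * trace (jac \<Psi> x) \<partial>lebesgue_on X)" for \<Psi>
  interpret S: semi_inner "test_fields X" "\<lambda>\<Phi> \<Psi>. l2_inner X (q \<Phi>) (q \<Psi>)"
  proof
    show "test_fields X \<noteq> {}" using test_fields_zero by blast
    show "(\<lambda>x. a *\<^sub>R \<Phi> x + b *\<^sub>R \<Psi> x) \<in> test_fields X"
      if "\<Phi> \<in> test_fields X" "\<Psi> \<in> test_fields X" for a b and \<Phi> \<Psi>
      using that by (rule test_fields_comb)
    show "l2_inner X (q \<Phi>) (q \<Psi>) = l2_inner X (q \<Psi>) (q \<Phi>)"
      if "\<Phi> \<in> test_fields X" "\<Psi> \<in> test_fields X" for \<Phi> \<Psi>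
      using that by (intro L2.B_sym qL)
    show "l2_inner X (q (\<lambda>x. a *\<^sub>R f x + b *\<^sub>R g x)) (q h)
        = a * l2_inner X (q f) (q h) + b * l2_inner X (q g) (q h)"
      if "f \<in> test_fields X" "g \<in> test_fields X" "h \<in> test_fields X" for a b f g h
      unfolding q_comb using that by (intro L2.B_comb qL)
    show "0 \<le> l2_inner X (q f) (q f)" if "f \<in> test_fields X" for f
      using that by (intro L2.B_nonneg qL)
  qed
  have L_lin: "L (\<lambda>x. a *\<^sub>R \<Phi> x + b *\<^sub>R \<Psi> x) = a * L \<Phi> + b * L \<Psi>"
    if "\<Phi> \<in> test_fields X" "\<Psi> \<in> test_fields X" for a b \<Phi> \<Psi>
  proof -
    interpret tr: linear "trace :: real^'n^'n \<Rightarrow> real" by (rule linear_trace)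
    have "L (\<lambda>x. a *\<^sub>R \<Phi> x + b *\<^sub>R \<Psi> x)
        = (\<integral>x. a * (u x * trace (jac \<Phi> x)) + b * (u x * trace (jac \<Psi> x)) \<partial>lebesgue_on X)"
      unfolding L_def jac_comb[OF that] by (simp add: tr.add tr.scale algebra_simps)
    then show ?thesis
      unfolding L_def using integrable_test_mult(2)[OF X(1) u test_trace_jac] that by simp
  qed
  have L_le: "(L \<Psi>)\<^sup>2 \<le> M\<^sup>2 * l2_inner X (q \<Psi>) (q \<Psi>)" if "\<Psi> \<in> test_fields X" for \<Psi>
  proof -
    have "\<bar>L \<Psi>\<bar> \<le> \<bar>M * l2_norm X (q \<Psi>)\<bar>"
      using bound[OF that] unfolding L_def q_def[abs_def] by linarith
    then have "(L \<Psi>)\<^sup>2 \<le> (M * l2_norm X (q \<Psi>))\<^sup>2" by (simp only: abs_le_square_iff)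
    then show ?thesis by (simp add: power_mult_distrib l2_norm_square)
  qed
  obtain s where s': "\<forall>k::nat. s k \<in> test_fields X"
    and Cauchy: "\<forall>e>0. \<exists>N. \<forall>m\<ge>N. \<forall>n\<ge>N. l2_inner X (q (\<lambda>x. s m x - s n x)) (q (\<lambda>x. s m x - s n x)) < e"
    and s_lim: "\<forall>\<Psi>\<in>test_fields X. (\<lambda>k. l2_inner X (q (s k)) (q \<Psi>)) \<longlonglongrightarrow> L \<Psi>"
    by (rule S.riesz_sequence[of L "M\<^sup>2"], erule (1) L_lin, erule L_le) (rule that, assumption+)
  then have s: "s k \<in> test_fields X" for k by blast
  have q_diff: "q (\<lambda>x. \<Phi> x - \<Psi> x) = (\<lambda>x. q \<Phi> x - q \<Psi> x)" for \<Phi> \<Psi>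
    by (simp add: q_def fun_eq_iff scaleR_diff_right)
  obtain G where G: "G \<in> L2 X" "(\<lambda>k. l2_norm X (\<lambda>x. q (s k) x - G x)) \<longlonglongrightarrow> 0"
  proof (rule L2_complete[OF Xl(1), of "\<lambda>k. q (s k)"])
    show "q (s n) \<in> L2 X" for n by (rule qL[OF s])
    show "\<exists>N. \<forall>m\<ge>N. \<forall>n\<ge>N. l2_norm X (\<lambda>x. q (s m) x - q (s n) x) < e" if "e > 0" for e
    proof -
      obtain N where "\<forall>m\<ge>N. \<forall>n\<ge>N. l2_inner X (q (\<lambda>x. s m x - s n x)) (q (\<lambda>x. s m x - s n x)) < e\<^sup>2"
        using Cauchy[rule_format, of "e\<^sup>2"] \<open>e > 0\<close> by auto
      then have "\<forall>m\<ge>N. \<forall>n\<ge>N. (l2_norm X (\<lambda>x. q (s m) x - q (s n) x))\<^sup>2 < e\<^sup>2"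
        by (simp add: q_diff l2_norm_square)
      then show ?thesis using \<open>e > 0\<close> by (meson less_imp_le power2_less_imp_less)
    qed
  qed
  have GL: "l2_inner X G (q \<Psi>) = L \<Psi>" if "\<Psi> \<in> test_fields X" for \<Psi>
    using LIMSEQ_unique[OF tendsto_l2_inner[OF qL[OF s] G(1) qL[OF that] G(2)] s_lim[rule_format, OF that]] .
  have GM: "l2_norm X G \<le> M"
  proof -
    have "(\<lambda>k. l2_inner X (q (s k)) G) \<longlonglongrightarrow> l2_inner X G G"
      by (rule tendsto_l2_inner[OF qL[OF s] G(1,1,2)])
    moreover have "(\<lambda>k. M * l2_norm X (q (s k))) \<longlonglongrightarrow> M * l2_norm X G"
      by (intro tendsto_mult_left tendsto_l2_norm[OF qL[OF s] G])
    moreover have "l2_inner X (q (s k)) G \<le> M * l2_norm X (q (s k))" for k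
    proof -
      have "l2_inner X (q (s k)) G = L (s k)"
        using GL[OF s] L2.B_sym[OF qL[OF s] G(1)] by simp
      then show ?thesis using bound[OF s, of k] unfolding L_def q_def[abs_def] by linarith
    qed
    ultimately have "l2_inner X G G \<le> M * l2_norm X G"
      by (intro LIMSEQ_le) auto
    then have "l2_norm X G * l2_norm X G \<le> M * l2_norm X G"
      by (simp add: l2_norm_square[symmetric] power2_eq_square)
    then show ?thesis using M by (cases "l2_norm X G = 0") (auto simp: mult_le_cancel_right)
  qed
  define g where "g x = - (G x /\<^sub>R bdist X x)" for x
  have dm [measurable]: "bdist X \<in> borel_measurable (lebesgue_on S)" for S
    by (rule borel_imp_lebesgue_on_measurable[OF bdist_measurable])
  have gl: "locally_integrable X g"
    unfolding locally_integrable_def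
  proof (intro allI impI)
    fix K assume K: "compact K \<and> K \<subseteq> X"
    have i: "integrable (lebesgue_on K) G"
      using L2_locally_integrable[OF G(1) Xl(1)] K by (simp add: locally_integrable_def)
    then have [measurable]: "G \<in> borel_measurable (lebesgue_on K)" by auto
    obtain \<delta> where \<delta>: "0 < \<delta>" "\<And>x. x \<in> K \<Longrightarrow> \<delta> \<le> bdist X x"
      using compact_bdist_pos[OF X] K by blast
    show "integrable (lebesgue_on K) g"
    proof (rule Bochner_Integration.integrable_bound)
      show "integrable (lebesgue_on K) (\<lambda>x. inverse \<delta> *\<^sub>R G x)" using i by simp
      show "g \<in> borel_measurable (lebesgue_on K)" unfolding g_def[abs_def] by measurable
      show "AE x in lebesgue_on K. norm (g x) \<le> norm (inverse \<delta> *\<^sub>R G x)"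
      proof (rule AE_I2)
        fix x assume "x \<in> space (lebesgue_on K)"
        then have "inverse (bdist X x) \<le> inverse \<delta>" using \<delta> by (intro le_imp_inverse_le) auto
        then show "norm (g x) \<le> norm (inverse \<delta> *\<^sub>R G x)"
          using \<delta>(1) by (simp add: g_def mult_right_mono)
      qed
    qed
  qed
  have "is_function X (distr_grad X u) g"
    unfolding is_function_grad_iff[OF X(1)]
  proof (intro conjI gl allI ballI)
    fix i \<phi> assume \<phi>: "\<phi> \<in> test_functions X"
    define \<Psi> :: "real^'n \<Rightarrow> real^'n" where "\<Psi> x = \<phi> x *\<^sub>R axis i 1" for x
    have comp: "\<Psi> x $ k = (if k = i then 1 else 0) * \<phi> x" for x k by (simp add: \<Psi>_def axis_def)
    have \<Psi>: "\<Psi> \<in> test_fields X" unfolding test_fields_def mem_Collect_eq comp by (intro allI test_cmult[OF \<phi>])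
    have "trace (jac \<Psi> x) = pd i \<phi> x" for x
    proof -
      have "pd k (\<lambda>y. (if k = i then 1 else 0) * \<phi> y) x = (if k = i then pd i \<phi> x else 0)" for k
        by (subst pd_cmult[OF smooth_differentiable[OF test_smooth[OF \<phi>]]]) auto
      then show ?thesis unfolding trace_def jac_def vec_lambda_beta comp by simp
    qed
    then have "(\<integral>x. u x * pd i \<phi> x \<partial>lebesgue_on X) = l2_inner X G (q \<Psi>)"
      using GL[OF \<Psi>] by (simp add: L_def)
    also have "\<dots> = (\<integral>x. - (\<phi> x * g x $ i) \<partial>lebesgue_on X)"
      unfolding l2_inner_def
      by (intro Bochner_Integration.integral_cong refl)
        (simp add: q_def g_def \<Psi>_def inner_axis mult_ac)
    finally show "(\<integral>x. u x * pd i \<phi> x \<partial>lebesgue_on X) = - (\<integral>x. \<phi> x * g x $ i \<partial>lebesgue_on X)" by simp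
  qed
  moreover
  have eq: "AE x in lebesgue_on X. - G x = bdist X x *\<^sub>R g x"
    using bdist_pos[OF X] by (intro AE_I2) (simp add: g_def less_imp_neq[symmetric])
  have [measurable]: "G \<in> borel_measurable (lebesgue_on X)" by (rule L2_measurable[OF G(1)])
  have mg: "(\<lambda>x. bdist X x *\<^sub>R g x) \<in> borel_measurable (lebesgue_on X)"
    unfolding g_def[abs_def] by measurable
  have mG: "(\<lambda>x. - G x) \<in> L2 X" using L2.scale_mem[OF G(1), of "-1"] by simp
  have "(\<lambda>x. bdist X x *\<^sub>R g x) \<in> L2 X" by (rule L2_cong_AE[OF eq mG mg])
  moreover have "l2_norm X (\<lambda>x. bdist X x *\<^sub>R g x) \<le> M"
    using l2_norm_cong_AE[OF eq L2_measurable[OF mG] mg] GM l2_norm_scale[of X "-1" G] by simp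
  ultimately show thesis by (rule that)
qed

section \<open>Gradient fields\<close>

text \<open>The closure of the Jacobians of test fields. Unlike \<open>H10_vec\<close>, it is a closed
  subspace of \<open>L2\<close> on which divergence and rotation act pointwise.\<close>

definition grad_fields :: "(real^'n) set \<Rightarrow> (real^'n \<Rightarrow> real^'n^'n) set" where
  "grad_fields X = {G \<in> L2 X. \<exists>\<Phi>. (\<forall>k::nat. \<Phi> k \<in> test_fields X) \<and>
     (\<lambda>k. l2_norm X (\<lambda>x. jac (\<Phi> k) x - G x)) \<longlonglongrightarrow> 0}"

definition grad_mat :: "(real^'n) set \<Rightarrow> (real^'n \<Rightarrow> real^'n) \<Rightarrow> real^'n \<Rightarrow> real^'n^'n" where
  "grad_mat X v x = (\<chi> k. wgrad X (\<lambda>x. v x $ k) x)"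

lemma l2_norm_square_vec:
  fixes f :: "'a::euclidean_space \<Rightarrow> 'b::euclidean_space^'m"
  assumes "\<And>i. (\<lambda>x. f x $ i) \<in> L2 X"
  shows "(l2_norm X f)\<^sup>2 = (\<Sum>i\<in>UNIV. (l2_norm X (\<lambda>x. f x $ i))\<^sup>2)"
proof -
  have n: "(norm v)\<^sup>2 = (\<Sum>i\<in>UNIV. (norm (v $ i))\<^sup>2)" for v :: "'b^'m"
    by (simp add: power2_norm_eq_inner inner_vec_def)
  have "(\<Sum>i\<in>UNIV. (l2_norm X (\<lambda>x. f x $ i))\<^sup>2) = (\<Sum>i\<in>UNIV. \<integral>x. (norm (f x $ i))\<^sup>2 \<partial>lebesgue_on X)"
    by (simp add: l2_norm_def)
  also have "\<dots> = (\<integral>x. (\<Sum>i\<in>UNIV. (norm (f x $ i))\<^sup>2) \<partial>lebesgue_on X)"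
    by (intro Bochner_Integration.integral_sum[symmetric] L2_integrable_square assms)
  also have "\<dots> = (l2_norm X f)\<^sup>2" by (simp add: l2_norm_def flip: n)
  finally show ?thesis by simp
qed

lemma borel_measurable_vec:
  fixes f :: "'a \<Rightarrow> 'b::euclidean_space^'m"
  assumes "\<And>i. (\<lambda>x. f x $ i) \<in> borel_measurable M"
  shows "f \<in> borel_measurable M"
proof (subst borel_measurable_euclidean_space, rule ballI)
  fix b :: "'b^'m" assume "b \<in> Basis"
  then obtain i u where b: "b = axis i u" by (auto simp: Basis_vec_def)
  show "(\<lambda>x. f x \<bullet> b) \<in> borel_measurable M"
    unfolding b inner_axis using assms[of i] by measurable
qed

lemma L2_vec:
  fixes f :: "'a::euclidean_space \<Rightarrow> 'b::euclidean_space^'m"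
  assumes "\<And>i. (\<lambda>x. f x $ i) \<in> L2 X"
  shows "f \<in> L2 X"
proof (rule L2I_bound)
  show "f \<in> borel_measurable (lebesgue_on X)"
    by (intro borel_measurable_vec L2_measurable assms)
  show "integrable (lebesgue_on X) (\<lambda>x. \<Sum>i\<in>UNIV. (norm (f x $ i))\<^sup>2)"
    by (intro Bochner_Integration.integrable_sum L2_integrable_square assms)
  show "AE x in lebesgue_on X. (norm (f x))\<^sup>2 \<le> (\<Sum>i\<in>UNIV. (norm (f x $ i))\<^sup>2)"
    by (simp add: power2_norm_eq_inner inner_vec_def)
qed

lemma L2_nth:
  fixes f :: "'a::euclidean_space \<Rightarrow> 'b::euclidean_space^'m"
  shows "f \<in> L2 X \<Longrightarrow> (\<lambda>x. f x $ i) \<in> L2 X"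
  by (rule L2_bounded_linear[OF bounded_linear_vec_nth])

lemma l2_norm_nth_le:
  fixes f :: "'a::euclidean_space \<Rightarrow> 'b::euclidean_space^'m"
  assumes "f \<in> L2 X"
  shows "l2_norm X (\<lambda>x. f x $ i) \<le> l2_norm X f"
  by (rule l2_norm_mono_AE[OF always_eventually L2_measurable[OF L2_nth[OF assms]] assms])
    (simp add: Finite_Cartesian_Product.norm_nth_le)

lemma tendsto_l2_norm_vec:
  fixes f :: "nat \<Rightarrow> 'a::euclidean_space \<Rightarrow> 'b::euclidean_space^'m"
  assumes "\<And>k i. (\<lambda>x. f k x $ i) \<in> L2 X" "\<And>i. (\<lambda>k. l2_norm X (\<lambda>x. f k x $ i)) \<longlonglongrightarrow> 0"
  shows "(\<lambda>k. l2_norm X (f k)) \<longlonglongrightarrow> 0"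
proof -
  have "(\<lambda>k. (l2_norm X (f k))\<^sup>2) \<longlonglongrightarrow> 0"
    unfolding l2_norm_square_vec[OF assms(1)]
    using assms(2) by (intro tendsto_null_sum) (auto intro!: tendsto_eq_intros)
  from tendsto_real_sqrt[OF this] show ?thesis by simp
qed

lemma test_L2: "\<phi> \<in> test_functions X \<Longrightarrow> X' \<in> lmeasurable \<Longrightarrow> \<phi> \<in> L2 X'"
  by (rule test_bounded[of \<phi> X], assumption)
    (rule continuous_imp_L2[OF _ test_measurable], assumption, assumption, simp)

lemma test_field_L2: "\<Psi> \<in> test_fields X \<Longrightarrow> X' \<in> lmeasurable \<Longrightarrow> \<Psi> \<in> L2 X'"
  by (intro L2_vec test_L2 test_fieldsD)

lemma jac_L2: "\<Psi> \<in> test_fields X \<Longrightarrow> X' \<in> lmeasurable \<Longrightarrow> jac \<Psi> \<in> L2 X'"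
  by (intro L2_vec) (auto simp: jac_def intro: test_L2 test_pd[OF test_fieldsD])

lemma grad_fields_L2: "G \<in> grad_fields X \<Longrightarrow> G \<in> L2 X"
  by (simp add: grad_fields_def)

lemma jac_grad_fields: "\<Psi> \<in> test_fields X \<Longrightarrow> X \<in> lmeasurable \<Longrightarrow> jac \<Psi> \<in> grad_fields X"
  by (auto simp: grad_fields_def jac_L2 l2_norm_def intro!: exI[of _ "\<lambda>_. \<Psi>"])

lemma grad_fields_comb:
  assumes X: "X \<in> lmeasurable" and "G \<in> grad_fields X" "H \<in> grad_fields X"
  shows "(\<lambda>x. a *\<^sub>R G x + b *\<^sub>R H x) \<in> grad_fields X"
proof -
  obtain \<Phi> where \<Phi>: "\<And>k::nat. \<Phi> k \<in> test_fields X" "(\<lambda>k. l2_norm X (\<lambda>x. jac (\<Phi> k) x - G x)) \<longlonglongrightarrow> 0"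
    using assms(2) by (auto simp: grad_fields_def)
  obtain \<Psi> where \<Psi>: "\<And>k::nat. \<Psi> k \<in> test_fields X" "(\<lambda>k. l2_norm X (\<lambda>x. jac (\<Psi> k) x - H x)) \<longlonglongrightarrow> 0"
    using assms(3) by (auto simp: grad_fields_def)
  let ?X = "\<lambda>k x. a *\<^sub>R \<Phi> k x + b *\<^sub>R \<Psi> k x"
  have L: "(\<lambda>x. jac (\<Phi> k) x - G x) \<in> L2 X" "(\<lambda>x. jac (\<Psi> k) x - H x) \<in> L2 X" for k
    by (rule L2.diff_mem[OF jac_L2[OF \<Phi>(1) X] grad_fields_L2[OF assms(2)]],
        rule L2.diff_mem[OF jac_L2[OF \<Psi>(1) X] grad_fields_L2[OF assms(3)]])
  have "(\<lambda>k. l2_norm X (\<lambda>x. jac (?X k) x - (a *\<^sub>R G x + b *\<^sub>R H x))) \<longlonglongrightarrow> 0"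
  proof (rule Lim_null_comparison[OF always_eventually, OF allI])
    fix k
    have "(\<lambda>x. jac (?X k) x - (a *\<^sub>R G x + b *\<^sub>R H x))
        = (\<lambda>x. a *\<^sub>R (jac (\<Phi> k) x - G x) + b *\<^sub>R (jac (\<Psi> k) x - H x))"
      unfolding jac_comb[OF \<Phi>(1) \<Psi>(1)] by (simp add: algebra_simps)
    then show "norm (l2_norm X (\<lambda>x. jac (?X k) x - (a *\<^sub>R G x + b *\<^sub>R H x)))
        \<le> \<bar>a\<bar> * l2_norm X (\<lambda>x. jac (\<Phi> k) x - G x) + \<bar>b\<bar> * l2_norm X (\<lambda>x. jac (\<Psi> k) x - H x)"
      using l2_norm_triangle[OF L2.scale_mem[OF L(1), of a k] L2.scale_mem[OF L(2), of b k]]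
      by (simp only: l2_norm_scale real_norm_def abs_of_nonneg[OF l2_norm_nonneg])
  next
    show "(\<lambda>k. \<bar>a\<bar> * l2_norm X (\<lambda>x. jac (\<Phi> k) x - G x) + \<bar>b\<bar> * l2_norm X (\<lambda>x. jac (\<Psi> k) x - H x)) \<longlonglongrightarrow> 0"
      by (intro tendsto_add_zero tendsto_mult_right_zero \<Phi> \<Psi>)
  qed
  moreover have "?X k \<in> test_fields X" for k by (rule test_fields_comb[OF \<Phi>(1) \<Psi>(1)])
  ultimately show ?thesis
    using L2_comb[OF grad_fields_L2[OF assms(2)] grad_fields_L2[OF assms(3)], of a b]
    unfolding grad_fields_def by (intro CollectI conjI exI[of _ ?X] allI)
qed

lemma grad_fields_approx:
  assumes "G \<in> grad_fields X" "e > 0"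
  obtains \<Phi> where "\<Phi> \<in> test_fields X" "l2_norm X (\<lambda>x. jac \<Phi> x - G x) < e"
proof -
  obtain \<Phi> where \<Phi>: "\<And>k::nat. \<Phi> k \<in> test_fields X" "(\<lambda>k. l2_norm X (\<lambda>x. jac (\<Phi> k) x - G x)) \<longlonglongrightarrow> 0"
    using assms(1) by (auto simp: grad_fields_def)
  have "eventually (\<lambda>k. l2_norm X (\<lambda>x. jac (\<Phi> k) x - G x) < e) sequentially"
    using order_tendstoD(2)[OF \<Phi>(2) assms(2)] .
  then obtain k where "l2_norm X (\<lambda>x. jac (\<Phi> k) x - G x) < e" by (auto simp: eventually_sequentially)
  then show thesis using that \<Phi>(1) by blast
qed

lemma grad_fields_closed:
  assumes X: "X \<in> lmeasurable" and G: "\<And>k::nat. G k \<in> grad_fields X" "H \<in> L2 X"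
    "(\<lambda>k. l2_norm X (\<lambda>x. G k x - H x)) \<longlonglongrightarrow> 0"
  shows "H \<in> grad_fields X"
proof -
  have "\<exists>\<Phi>. \<Phi> \<in> test_fields X \<and> l2_norm X (\<lambda>x. jac \<Phi> x - G k x) < 1 / (real k + 1)" for k
    by (rule grad_fields_approx[OF G(1), of "1 / (real k + 1)" k]) auto
  then have "\<exists>\<Phi>. \<forall>k. \<Phi> k \<in> test_fields X \<and> l2_norm X (\<lambda>x. jac (\<Phi> k) x - G k x) < 1 / (real k + 1)"
    by (intro choice allI)
  then obtain \<Phi> where \<Phi>: "\<And>k. \<Phi> k \<in> test_fields X"
    "\<And>k. l2_norm X (\<lambda>x. jac (\<Phi> k) x - G k x) < 1 / (real k + 1)" by blast
  have "(\<lambda>k. l2_norm X (\<lambda>x. jac (\<Phi> k) x - H x)) \<longlonglongrightarrow> 0"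
  proof (rule Lim_null_comparison[OF always_eventually, OF allI])
    fix k
    show "norm (l2_norm X (\<lambda>x. jac (\<Phi> k) x - H x)) \<le> 1 / (real k + 1) + l2_norm X (\<lambda>x. G k x - H x)"
      using l2_norm_triangle_diff[OF jac_L2[OF \<Phi>(1) X] grad_fields_L2[OF G(1)] G(2), of k k] \<Phi>(2)[of k] by simp
  next
    have "(\<lambda>k. 1 / (real k + 1)) \<longlonglongrightarrow> 0"
      using LIMSEQ_inverse_real_of_nat by (simp add: inverse_eq_divide add.commute)
    then show "(\<lambda>k. 1 / (real k + 1) + l2_norm X (\<lambda>x. G k x - H x)) \<longlonglongrightarrow> 0"
      by (intro tendsto_add_zero G(3))
  qed
  then show ?thesis using \<Phi>(1) G(2) by (auto simp: grad_fields_def)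
qed

subsection \<open>Weak gradients of Sobolev functions\<close>

lemma locally_integrable_measurable:
  fixes f :: "real^'n \<Rightarrow> 'b::euclidean_space"
  assumes X: "open X" and f: "locally_integrable X f"
  shows "f \<in> borel_measurable (lebesgue_on X)"
proof (rule open_Union_compact_subsets[OF X])
  fix C :: "nat \<Rightarrow> (real^'n) set"
  assume C: "\<And>n. compact (C n)" "\<And>n. C n \<subseteq> X" "\<Union>(range C) = X"
    "\<And>K. compact K \<Longrightarrow> K \<subseteq> X \<Longrightarrow> \<exists>N. \<forall>n\<ge>N. K \<subseteq> C n"
  show ?thesis
  proof (rule borel_measurable_LIMSEQ_metric)
    fix n
    have "f \<in> borel_measurable (lebesgue_on (C n))"
      using f C(1,2)[of n] by (auto simp: locally_integrable_def)
    then show "(\<lambda>x. if x \<in> C n then f x else 0) \<in> borel_measurable (lebesgue_on X)"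
      using C(1,2)[of n] X by (subst borel_measurable_if_lebesgue_on) (auto simp: compact_imp_closed)
  next
    fix x assume "x \<in> space (lebesgue_on X)"
    then obtain N where "\<forall>n\<ge>N. {x} \<subseteq> C n" using C(4)[of "{x}"] by auto
    then have "eventually (\<lambda>n. (if x \<in> C n then f x else 0) = f x) sequentially"
      by (auto simp: eventually_sequentially)
    then show "(\<lambda>n. if x \<in> C n then f x else 0) \<longlonglongrightarrow> f x" by (rule tendsto_eventually)
  qed
qed

lemma H1_wgrad:
  assumes "open X" "u \<in> H1 X"
  shows "wgrad X u \<in> L2 X" "is_function X (distr_grad X u) (wgrad X u)"
proof -
  obtain g where g: "g \<in> L2 X" "is_function X (distr_grad X u) g" using assms by (auto simp: H1_def)
  show w: "is_function X (distr_grad X u) (wgrad X u)"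
    using someI[of "is_function X (distr_grad X u)", OF g(2)] by (simp add: wgrad_def)
  have "wgrad X u \<in> borel_measurable (lebesgue_on X)"
    using w by (intro locally_integrable_measurable assms) (simp add: is_function_def)
  then show "wgrad X u \<in> L2 X"
    by (rule L2_cong_AE[OF is_function_unique[OF assms(1) g(2) w] g(1)])
qed

lemma wgrad_AE:
  assumes "open X" "is_function X (distr_grad X u) g"
  shows "AE x in lebesgue_on X. wgrad X u x = g x"
  using is_function_unique[OF assms(1) _ assms(2), of "wgrad X u"] someI[of "is_function X (distr_grad X u)", OF assms(2)]
  by (simp add: wgrad_def)

lemma test_is_function_grad:
  assumes X: "open X" "bounded X" and \<phi>: "\<phi> \<in> test_functions X"
  shows "is_function X (distr_grad X \<phi>) (\<lambda>x. \<chi> i. pd i \<phi> x)"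
    and "(\<lambda>x. \<chi> i. pd i \<phi> x) \<in> L2 X"
proof -
  have Xl: "X \<in> lmeasurable" "X \<in> sets lebesgue" using X by (auto simp: lmeasurable_open)
  show L: "(\<lambda>x. \<chi> i. pd i \<phi> x) \<in> L2 X"
    by (rule L2_vec) (simp add: test_L2[OF test_pd[OF \<phi>] Xl(1)])
  show "is_function X (distr_grad X \<phi>) (\<lambda>x. \<chi> i. pd i \<phi> x)"
    unfolding is_function_grad_iff[OF X(1)]
  proof (intro conjI allI ballI L2_locally_integrable[OF L Xl(1)])
    fix i \<psi> assume \<psi>: "\<psi> \<in> test_functions X"
    have \<psi>0: "\<psi> x = 0" "pd i \<psi> x = 0" if "x \<notin> X" for x i
      using test_functionsE[OF \<psi>] that by (metis subsetD)+
    have "(\<integral>x. \<phi> x * pd i \<psi> x \<partial>lborel) = - (\<integral>x. pd i \<phi> x * \<psi> x \<partial>lborel)"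
      using test_smooth[OF \<phi>] test_mono[OF \<psi> subset_UNIV] by (intro integral_by_parts) blast+
    moreover have "(\<integral>x. \<phi> x * pd i \<psi> x \<partial>lebesgue_on X) = (\<integral>x. \<phi> x * pd i \<psi> x \<partial>lborel)"
      using test_measurable[OF \<phi>] test_measurable[OF test_pd[OF \<psi>]] \<psi>0
      by (intro integral_lebesgue_on_eq_lborel(1) Xl) auto
    moreover have "(\<integral>x. \<psi> x * pd i \<phi> x \<partial>lebesgue_on X) = (\<integral>x. \<psi> x * pd i \<phi> x \<partial>lborel)"
      using test_measurable[OF \<psi>] test_measurable[OF test_pd[OF \<phi>]] \<psi>0
      by (intro integral_lebesgue_on_eq_lborel(1) Xl) auto
    ultimately show "(\<integral>x. \<phi> x * pd i \<psi> x \<partial>lebesgue_on X) = - (\<integral>x. \<psi> x * (\<chi> i. pd i \<phi> x) $ i \<partial>lebesgue_on X)"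
      by (simp add: mult.commute)
  qed
qed

lemma is_function_grad_comb:
  assumes X: "open X" and "locally_integrable X u" "locally_integrable X w"
    and "is_function X (distr_grad X u) g" "is_function X (distr_grad X w) h"
  shows "is_function X (distr_grad X (\<lambda>x. a * u x + b * w x)) (\<lambda>x. a *\<^sub>R g x + b *\<^sub>R h x)"
proof -
  have gh: "locally_integrable X g" "locally_integrable X h"
    and w: "\<And>i \<phi>. \<phi> \<in> test_functions X \<Longrightarrow> (\<integral>x. u x * pd i \<phi> x \<partial>lebesgue_on X) = - (\<integral>x. \<phi> x * g x $ i \<partial>lebesgue_on X)"
    "\<And>i \<phi>. \<phi> \<in> test_functions X \<Longrightarrow> (\<integral>x. w x * pd i \<phi> x \<partial>lebesgue_on X) = - (\<integral>x. \<phi> x * h x $ i \<partial>lebesgue_on X)"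
    using assms by (auto simp: is_function_grad_iff)
  show ?thesis
    unfolding is_function_grad_iff[OF X]
  proof (intro conjI allI ballI)
    show "locally_integrable X (\<lambda>x. a *\<^sub>R g x + b *\<^sub>R h x)"
      using gh by (auto simp: locally_integrable_def)
    fix i \<phi> assume \<phi>: "\<phi> \<in> test_functions X"
    have "(\<integral>x. (a * u x + b * w x) * pd i \<phi> x \<partial>lebesgue_on X)
        = (\<integral>x. a * (u x * pd i \<phi> x) + b * (w x * pd i \<phi> x) \<partial>lebesgue_on X)"
      by (simp add: algebra_simps)
    also have "\<dots> = - (a * (\<integral>x. \<phi> x * g x $ i \<partial>lebesgue_on X) + b * (\<integral>x. \<phi> x * h x $ i \<partial>lebesgue_on X))"
      using integrable_test_mult(2)[OF X _ test_pd[OF \<phi>]] assms(2,3) w[OF \<phi>] by simp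
    also have "\<dots> = - (\<integral>x. a * (\<phi> x * g x $ i) + b * (\<phi> x * h x $ i) \<partial>lebesgue_on X)"
      using integrable_test_mult(1)[OF X locally_integrable_nth[OF gh(1)] \<phi>, of i]
        integrable_test_mult(1)[OF X locally_integrable_nth[OF gh(2)] \<phi>, of i] by simp
    finally show "(\<integral>x. (a * u x + b * w x) * pd i \<phi> x \<partial>lebesgue_on X)
        = - (\<integral>x. \<phi> x * (a *\<^sub>R g x + b *\<^sub>R h x) $ i \<partial>lebesgue_on X)"
      by (simp add: algebra_simps)
  qed
qed

lemma is_function_grad_comb_H1:
  assumes X: "open X" "bounded X" and u: "u \<in> H1 X" and w: "w \<in> H1 X"
  shows "(\<lambda>x. a * u x + b * w x) \<in> H1 X"
    and "AE x in lebesgue_on X. wgrad X (\<lambda>x. a * u x + b * w x) x = a *\<^sub>R wgrad X u x + b *\<^sub>R wgrad X w x"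
proof -
  have Xl: "X \<in> lmeasurable" using X by (auto simp: lmeasurable_open)
  have L: "u \<in> L2 X" "w \<in> L2 X" using u w by (auto simp: H1_def)
  have f: "is_function X (distr_grad X (\<lambda>x. a * u x + b * w x)) (\<lambda>x. a *\<^sub>R wgrad X u x + b *\<^sub>R wgrad X w x)"
    using L by (intro is_function_grad_comb X L2_locally_integrable[OF _ Xl] H1_wgrad u w)
  show "AE x in lebesgue_on X. wgrad X (\<lambda>x. a * u x + b * w x) x = a *\<^sub>R wgrad X u x + b *\<^sub>R wgrad X w x"
    by (rule wgrad_AE[OF X(1) f])
  show "(\<lambda>x. a * u x + b * w x) \<in> H1 X"
    using f L2_comb[OF L, of a b] L2_comb[OF H1_wgrad(1)[OF X(1) u] H1_wgrad(1)[OF X(1) w], of a b]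
    by (auto simp: H1_def)
qed

lemma l2_norm_comb_le:
  assumes "f \<in> L2 X" "g \<in> L2 X"
  shows "l2_norm X (\<lambda>x. a *\<^sub>R f x + b *\<^sub>R g x) \<le> \<bar>a\<bar> * l2_norm X f + \<bar>b\<bar> * l2_norm X g"
  using l2_norm_triangle[OF L2.scale_mem[OF assms(1), of a] L2.scale_mem[OF assms(2), of b]]
  by (simp only: l2_norm_scale)

lemma H10_H1: "u \<in> H10 X \<Longrightarrow> u \<in> H1 X"
  by (simp add: H10_def)

lemma test_H10:
  assumes X: "open X" "bounded X" and \<phi>: "\<phi> \<in> test_functions X"
  shows "\<phi> \<in> H10 X"
proof -
  have Xl: "X \<in> lmeasurable" using X by (auto simp: lmeasurable_open)
  have H1: "\<phi> \<in> H1 X"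
    using test_is_function_grad[OF X \<phi>] test_L2[OF \<phi> Xl] by (auto simp: H1_def)
  have "AE x in lebesgue_on X. wgrad X \<phi> x - (\<chi> i. pd i \<phi> x) = 0"
    using wgrad_AE[OF X(1) test_is_function_grad(1)[OF X \<phi>]] by eventually_elim simp
  then have "l2_norm X (\<lambda>x. wgrad X \<phi> x - (\<chi> i. pd i \<phi> x)) = 0"
    by (subst l2_norm_eq_0_iff)
      (auto intro!: L2.diff_mem H1_wgrad X H1 test_is_function_grad[OF X \<phi>])
  moreover have "l2_norm X (\<lambda>x. \<phi> x - \<phi> x) = 0" by (simp add: l2_norm_def)
  ultimately show ?thesis
    using \<phi> H1 unfolding H10_def by (intro CollectI conjI exI[of _ "\<lambda>_. \<phi>"]) simp_all
qed

lemma H10_comb: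
  assumes X: "open X" "bounded X" and u: "u \<in> H10 X" and w: "w \<in> H10 X"
  shows "(\<lambda>x. a * u x + b * w x) \<in> H10 X"
proof -
  have Xl: "X \<in> lmeasurable" using X by (auto simp: lmeasurable_open)
  have L: "u \<in> L2 X" "w \<in> L2 X" using u w by (auto simp: H10_def H1_def)
  note gL = H1_wgrad(1)[OF X(1) H10_H1]
  obtain \<phi> where \<phi>: "\<forall>k::nat. \<phi> k \<in> test_functions X"
    "(\<lambda>k. l2_norm X (\<lambda>x. u x - \<phi> k x)) \<longlonglongrightarrow> 0"
    "(\<lambda>k. l2_norm X (\<lambda>x. wgrad X u x - (\<chi> i. pd i (\<phi> k) x))) \<longlonglongrightarrow> 0"
    using u by (auto simp: H10_def)
  obtain \<psi> where \<psi>: "\<forall>k::nat. \<psi> k \<in> test_functions X"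
    "(\<lambda>k. l2_norm X (\<lambda>x. w x - \<psi> k x)) \<longlonglongrightarrow> 0"
    "(\<lambda>k. l2_norm X (\<lambda>x. wgrad X w x - (\<chi> i. pd i (\<psi> k) x))) \<longlonglongrightarrow> 0"
    using w by (auto simp: H10_def)
  let ?X = "\<lambda>k x. a * \<phi> k x + b * \<psi> k x"
  have tL: "\<phi> k \<in> L2 X" "\<psi> k \<in> L2 X" for k using \<phi>(1) \<psi>(1) test_L2[OF _ Xl] by blast+
  have pL: "(\<lambda>x. \<chi> i. pd i (\<phi> k) x) \<in> L2 X" "(\<lambda>x. \<chi> i. pd i (\<psi> k) x) \<in> L2 X" for k
    using \<phi>(1) \<psi>(1) test_is_function_grad(2)[OF X] by blast+
  have 1: "(\<lambda>k. l2_norm X (\<lambda>x. (a * u x + b * w x) - ?X k x)) \<longlonglongrightarrow> 0"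
  proof (rule Lim_null_comparison[OF always_eventually, OF allI])
    fix k
    have "(\<lambda>x. (a * u x + b * w x) - ?X k x) = (\<lambda>x. a *\<^sub>R (u x - \<phi> k x) + b *\<^sub>R (w x - \<psi> k x))"
      by (simp add: algebra_simps)
    then show "norm (l2_norm X (\<lambda>x. (a * u x + b * w x) - ?X k x))
        \<le> \<bar>a\<bar> * l2_norm X (\<lambda>x. u x - \<phi> k x) + \<bar>b\<bar> * l2_norm X (\<lambda>x. w x - \<psi> k x)"
      using l2_norm_comb_le[OF L2.diff_mem[OF L(1) tL(1)[of k]] L2.diff_mem[OF L(2) tL(2)[of k]]]
      by (simp only: real_norm_def abs_of_nonneg[OF l2_norm_nonneg])
  qed (intro tendsto_add_zero tendsto_mult_right_zero \<phi> \<psi>)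
  have 2: "(\<lambda>k. l2_norm X (\<lambda>x. wgrad X (\<lambda>x. a * u x + b * w x) x - (\<chi> i. pd i (?X k) x))) \<longlonglongrightarrow> 0"
  proof (rule Lim_null_comparison[OF always_eventually, OF allI])
    fix k
    have pd: "pd i (?X k) x = a * pd i (\<phi> k) x + b * pd i (\<psi> k) x" for i x
    proof -
      have d: "\<phi> k differentiable (at x)" "\<psi> k differentiable (at x)"
        using \<phi>(1) \<psi>(1) smooth_differentiable[OF test_smooth] by blast+
      have "(\<lambda>x. a * \<phi> k x) differentiable (at x)" "(\<lambda>x. b * \<psi> k x) differentiable (at x)"
        using d by (auto intro: differentiable_mult)
      then show ?thesis by (simp add: pd_add pd_cmult[OF d(1)] pd_cmult[OF d(2)])
    qed
    have "l2_norm X (\<lambda>x. wgrad X (\<lambda>x. a * u x + b * w x) x - (\<chi> i. pd i (?X k) x))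
        = l2_norm X (\<lambda>x. a *\<^sub>R (wgrad X u x - (\<chi> i. pd i (\<phi> k) x)) + b *\<^sub>R (wgrad X w x - (\<chi> i. pd i (\<psi> k) x)))"
    proof (rule l2_norm_cong_AE)
      show "AE x in lebesgue_on X. wgrad X (\<lambda>x. a * u x + b * w x) x - (\<chi> i. pd i (?X k) x)
        = a *\<^sub>R (wgrad X u x - (\<chi> i. pd i (\<phi> k) x)) + b *\<^sub>R (wgrad X w x - (\<chi> i. pd i (\<psi> k) x))"
        using is_function_grad_comb_H1(2)[OF X H10_H1[OF u] H10_H1[OF w], of a b]
        by eventually_elim (simp add: pd vec_eq_iff algebra_simps)
      show "(\<lambda>x. a *\<^sub>R (wgrad X u x - (\<chi> i. pd i (\<phi> k) x)) + b *\<^sub>R (wgrad X w x - (\<chi> i. pd i (\<psi> k) x)))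
          \<in> borel_measurable (lebesgue_on X)"
        by (intro L2_measurable L2_comb L2.diff_mem gL u w pL)
      have "?X k \<in> test_functions X" using \<phi>(1) \<psi>(1) by (intro test_add test_cmult) auto
      then show "(\<lambda>x. wgrad X (\<lambda>x. a * u x + b * w x) x - (\<chi> i. pd i (?X k) x)) \<in> borel_measurable (lebesgue_on X)"
        by (intro L2_measurable L2.diff_mem test_is_function_grad[OF X] H1_wgrad X
            is_function_grad_comb_H1 H10_H1 u w)
    qed
    also have "\<dots> \<le> \<bar>a\<bar> * l2_norm X (\<lambda>x. wgrad X u x - (\<chi> i. pd i (\<phi> k) x))
        + \<bar>b\<bar> * l2_norm X (\<lambda>x. wgrad X w x - (\<chi> i. pd i (\<psi> k) x))"
      by (intro l2_norm_comb_le L2.diff_mem gL u w pL)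
    finally show "norm (l2_norm X (\<lambda>x. wgrad X (\<lambda>x. a * u x + b * w x) x - (\<chi> i. pd i (?X k) x)))
        \<le> \<bar>a\<bar> * l2_norm X (\<lambda>x. wgrad X u x - (\<chi> i. pd i (\<phi> k) x))
        + \<bar>b\<bar> * l2_norm X (\<lambda>x. wgrad X w x - (\<chi> i. pd i (\<psi> k) x))" by simp
  qed (intro tendsto_add_zero tendsto_mult_right_zero \<phi> \<psi>)
  have "\<forall>k. ?X k \<in> test_functions X" using \<phi>(1) \<psi>(1) by (auto intro!: test_add test_cmult)
  with 1 2 is_function_grad_comb_H1(1)[OF X H10_H1[OF u] H10_H1[OF w], of a b]
  show ?thesis unfolding H10_def by (intro CollectI conjI exI[of _ ?X])
qed

lemma H10_vec_nth: "v \<in> H10_vec X \<Longrightarrow> (\<lambda>x. v x $ i) \<in> H10 X"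
  by (simp add: H10_vec_def)

lemma test_field_H10_vec: "open X \<Longrightarrow> bounded X \<Longrightarrow> \<Psi> \<in> test_fields X \<Longrightarrow> \<Psi> \<in> H10_vec X"
  by (simp add: H10_vec_def test_H10 test_fieldsD)

lemma H10_vec_comb:
  assumes X: "open X" "bounded X" and v: "v \<in> H10_vec X" and w: "w \<in> H10_vec X"
  shows "(\<lambda>x. a *\<^sub>R v x + b *\<^sub>R w x) \<in> H10_vec X"
    and "AE x in lebesgue_on X. grad_mat X (\<lambda>x. a *\<^sub>R v x + b *\<^sub>R w x) x
      = a *\<^sub>R grad_mat X v x + b *\<^sub>R grad_mat X w x"
proof -
  show "(\<lambda>x. a *\<^sub>R v x + b *\<^sub>R w x) \<in> H10_vec X"
    using H10_comb[OF X H10_vec_nth[OF v] H10_vec_nth[OF w]] by (simp add: H10_vec_def)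
  have "AE x in lebesgue_on X. \<forall>i\<in>UNIV. wgrad X (\<lambda>x. a * v x $ i + b * w x $ i) x
      = a *\<^sub>R wgrad X (\<lambda>x. v x $ i) x + b *\<^sub>R wgrad X (\<lambda>x. w x $ i) x"
    using is_function_grad_comb_H1(2)[OF X H10_H1[OF H10_vec_nth[OF v]] H10_H1[OF H10_vec_nth[OF w]], where a=a and b=b]
    by (subst AE_ball_countable) (auto intro: countable_finite)
  then show "AE x in lebesgue_on X. grad_mat X (\<lambda>x. a *\<^sub>R v x + b *\<^sub>R w x) x
      = a *\<^sub>R grad_mat X v x + b *\<^sub>R grad_mat X w x"
    by eventually_elim (simp add: grad_mat_def vec_eq_iff)
qed

lemma grad_mat_L2:
  assumes "open X" "v \<in> H10_vec X" shows "grad_mat X v \<in> L2 X"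
  by (rule L2_vec) (simp add: grad_mat_def H1_wgrad(1)[OF assms(1) H10_H1[OF H10_vec_nth[OF assms(2)]]])

lemma h1_norm_eq:
  assumes "open X" "v \<in> H10_vec X" shows "h1_norm X v = l2_norm X (grad_mat X v)"
proof -
  have "(l2_norm X (grad_mat X v))\<^sup>2 = (\<Sum>i\<in>UNIV. (l2_norm X (wgrad X (\<lambda>x. v x $ i)))\<^sup>2)"
    using l2_norm_square_vec[OF L2_nth[OF grad_mat_L2[OF assms]]] by (simp add: grad_mat_def[abs_def])
  then show ?thesis unfolding h1_norm_def by (metis l2_norm_nonneg real_sqrt_abs abs_of_nonneg)
qed

lemma h1_inner_eq:
  assumes "open X" "v \<in> H10_vec X" "w \<in> H10_vec X"
  shows "h1_inner X v w = l2_inner X (grad_mat X v) (grad_mat X w)"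
proof -
  have "integrable (lebesgue_on X) (\<lambda>x. wgrad X (\<lambda>x. v x $ i) x \<bullet> wgrad X (\<lambda>x. w x $ i) x)" for i
    using assms by (intro L2_integrable_inner H1_wgrad H10_H1 H10_vec_nth)
  then show ?thesis
    by (simp add: h1_inner_def l2_inner_def grad_mat_def inner_vec_def)
qed

lemma H10_vec_approx:
  assumes X: "open X" "bounded X" and v: "v \<in> H10_vec X"
  obtains \<Phi> where "\<forall>k::nat. \<Phi> k \<in> test_fields X" "(\<lambda>k. l2_norm X (\<lambda>x. \<Phi> k x - v x)) \<longlonglongrightarrow> 0"
    "(\<lambda>k. l2_norm X (\<lambda>x. jac (\<Phi> k) x - grad_mat X v x)) \<longlonglongrightarrow> 0"
proof -
  have Xl: "X \<in> lmeasurable" using X by (auto simp: lmeasurable_open)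
  define P where "P i \<phi> \<longleftrightarrow> (\<forall>k::nat. \<phi> k \<in> test_functions X) \<and>
    (\<lambda>k. l2_norm X (\<lambda>x. v x $ i - \<phi> k x)) \<longlonglongrightarrow> 0 \<and>
    (\<lambda>k. l2_norm X (\<lambda>x. wgrad X (\<lambda>x. v x $ i) x - (\<chi> j. pd j (\<phi> k) x))) \<longlonglongrightarrow> 0" for i \<phi>
  have "\<exists>\<phi>. P i \<phi>" for i using H10_vec_nth[OF v, of i] by (simp add: P_def H10_def)
  then have "\<exists>\<phi>. \<forall>i. P i (\<phi> i)" by (intro choice allI)
  then obtain \<phi> where \<phi>: "\<And>i. P i (\<phi> i)" by blast
  define \<Phi> where "\<Phi> k x = (\<chi> i. \<phi> i k x)" for k x
  have t: "\<phi> i k \<in> test_functions X" for i k using \<phi> by (simp add: P_def)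
  have \<Phi>: "\<Phi> k \<in> test_fields X" for k by (simp add: test_fields_def \<Phi>_def t)
  have vL: "(\<lambda>x. v x $ i) \<in> L2 X" for i using H10_H1[OF H10_vec_nth[OF v]] by (simp add: H1_def)
  have "(\<lambda>k. l2_norm X (\<lambda>x. \<Phi> k x - v x)) \<longlonglongrightarrow> 0"
  proof (rule tendsto_l2_norm_vec)
    show "(\<lambda>x. (\<Phi> k x - v x) $ i) \<in> L2 X" for k i
      using L2.diff_mem[OF test_L2[OF t Xl] vL] by (simp add: \<Phi>_def)
    show "(\<lambda>k. l2_norm X (\<lambda>x. (\<Phi> k x - v x) $ i)) \<longlonglongrightarrow> 0" for i
      using \<phi>[of i] by (simp add: \<Phi>_def P_def l2_norm_minus_commute[of _ "\<phi> i _"])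
  qed
  moreover have "(\<lambda>k. l2_norm X (\<lambda>x. jac (\<Phi> k) x - grad_mat X v x)) \<longlonglongrightarrow> 0"
  proof (rule tendsto_l2_norm_vec)
    show "(\<lambda>x. (jac (\<Phi> k) x - grad_mat X v x) $ i) \<in> L2 X" for k i
      by (intro L2_nth L2.diff_mem jac_L2[OF \<Phi> Xl] grad_mat_L2 X v)
    have "(\<lambda>x. (jac (\<Phi> k) x - grad_mat X v x) $ i)
        = (\<lambda>x. (\<chi> j. pd j (\<phi> i k) x) - wgrad X (\<lambda>x. v x $ i) x)" for k i
      by (simp add: jac_def grad_mat_def \<Phi>_def)
    then show "(\<lambda>k. l2_norm X (\<lambda>x. (jac (\<Phi> k) x - grad_mat X v x) $ i)) \<longlonglongrightarrow> 0" for i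
      using \<phi>[of i] by (simp add: P_def l2_norm_minus_commute[of _ "\<lambda>x. \<chi> j. pd j (\<phi> i _) x"])
  qed
  ultimately show thesis using that[of \<Phi>] \<Phi> by blast
qed

lemma grad_mat_grad_fields:
  assumes X: "open X" "bounded X" and v: "v \<in> H10_vec X"
  shows "grad_mat X v \<in> grad_fields X"
  by (rule H10_vec_approx[OF assms]) (auto simp: grad_fields_def grad_mat_L2[OF X(1) v])

lemma grad_mat_test_field:
  assumes X: "open X" "bounded X" and \<Psi>: "\<Psi> \<in> test_fields X"
  shows "AE x in lebesgue_on X. grad_mat X \<Psi> x = jac \<Psi> x"
proof -
  have "AE x in lebesgue_on X. \<forall>i\<in>UNIV. wgrad X (\<lambda>x. \<Psi> x $ i) x = (\<chi> j. pd j (\<lambda>x. \<Psi> x $ i) x)"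
    using wgrad_AE[OF X(1) test_is_function_grad(1)[OF X test_fieldsD[OF \<Psi>]]]
    by (subst AE_ball_countable) (auto intro: countable_finite)
  then show ?thesis by eventually_elim (simp add: grad_mat_def jac_def vec_eq_iff)
qed

lemma hardy_test_field:
  assumes X: "open X" "bounded X" and H: "hardy X H" and \<Psi>: "\<Psi> \<in> test_fields X"
  shows "(l2_norm X (\<lambda>x. \<Psi> x /\<^sub>R bdist X x))\<^sup>2 \<le> H * (l2_norm X (jac \<Psi>))\<^sup>2"
proof -
  have Xl: "X \<in> lmeasurable" using X by (auto simp: lmeasurable_open)
  have m: "\<Psi> \<in> H10_vec X" by (rule test_field_H10_vec[OF X \<Psi>])
  have "l2_norm X (grad_mat X \<Psi>) = l2_norm X (jac \<Psi>)"
    by (rule l2_norm_cong_AE[OF grad_mat_test_field[OF X \<Psi>]])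
      (auto intro: L2_measurable grad_mat_L2[OF X(1) m] jac_L2[OF \<Psi> Xl])
  then show ?thesis using H m h1_norm_eq[OF X(1) m] by (auto simp: hardy_def)
qed

lemma test_fields_diff: "\<Phi> \<in> test_fields X \<Longrightarrow> \<Psi> \<in> test_fields X \<Longrightarrow> (\<lambda>x. \<Phi> x - \<Psi> x) \<in> test_fields X"
  using test_fields_comb[of \<Phi> X \<Psi> 1 "-1"] by simp

lemma jac_diff: "\<Phi> \<in> test_fields X \<Longrightarrow> \<Psi> \<in> test_fields X \<Longrightarrow> jac (\<lambda>x. \<Phi> x - \<Psi> x) = (\<lambda>x. jac \<Phi> x - jac \<Psi> x)"
  using jac_comb[of \<Phi> X \<Psi> 1 "-1"] by (simp add: fun_eq_iff)

lemma l2_convergent_Cauchy: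
  assumes "\<And>k. f k \<in> L2 X" "g \<in> L2 X" "(\<lambda>k. l2_norm X (\<lambda>x. f k x - g x)) \<longlonglongrightarrow> 0" "e > 0"
  shows "\<exists>N. \<forall>m\<ge>N. \<forall>n\<ge>N. l2_norm X (\<lambda>x. f m x - f n x) < e"
proof -
  have "eventually (\<lambda>k. l2_norm X (\<lambda>x. f k x - g x) < e / 2) sequentially"
    using order_tendstoD(2)[OF assms(3), of "e / 2"] assms(4) by simp
  then obtain N where N: "\<And>k. k \<ge> N \<Longrightarrow> l2_norm X (\<lambda>x. f k x - g x) < e / 2"
    by (auto simp: eventually_sequentially)
  have "l2_norm X (\<lambda>x. f m x - f n x) < e" if "m \<ge> N" "n \<ge> N" for m n
    using l2_norm_triangle_diff[OF assms(1,2,1), of m n] N[OF that(1)] N[OF that(2)]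
      l2_norm_minus_commute[of X g "f n"] by simp
  then show ?thesis by blast
qed

lemma bdist_bounded:
  fixes X :: "'a::euclidean_space set"
  assumes "bounded X"
  obtains D where "0 < D" "\<And>x. x \<in> X \<Longrightarrow> bdist X x \<le> D"
proof -
  have "compact (bdist X ` closure X)"
    using assms by (intro compact_continuous_image bdist_continuous) (simp add: compact_closure)
  then obtain D where D: "\<And>y. y \<in> bdist X ` closure X \<Longrightarrow> norm y \<le> D"
    using compact_imp_bounded bounded_iff by metis
  have "bdist X x \<le> max D 1" if "x \<in> X" for x
    using D[of "bdist X x"] closure_subset[of X] that by fastforce
  then show thesis using that[of "max D 1"] by simp
qed

lemma l2_norm_le_weighted:
  fixes X :: "(real^'n) set"
  assumes X: "open X" "bounded X"
  obtains D where "0 < D" "\<And>\<Psi>. \<Psi> \<in> test_fields X \<Longrightarrow> l2_norm X \<Psi> \<le> D * l2_norm X (\<lambda>x. \<Psi> x /\<^sub>R bdist X x)"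
proof -
  have Xl: "X \<in> lmeasurable" using X by (auto simp: lmeasurable_open)
  obtain D where D: "0 < D" "\<And>x. x \<in> X \<Longrightarrow> bdist X x \<le> D"
    by (rule bdist_bounded[OF X(2)]) (rule that, assumption+)
  have "l2_norm X \<Psi> \<le> D * l2_norm X (\<lambda>x. \<Psi> x /\<^sub>R bdist X x)" if \<Psi>: "\<Psi> \<in> test_fields X" for \<Psi>
  proof -
    have "l2_norm X \<Psi> \<le> l2_norm X (\<lambda>x. D *\<^sub>R (\<Psi> x /\<^sub>R bdist X x))"
    proof (rule l2_norm_mono_AE[OF AE_I2])
      fix x assume "x \<in> space (lebesgue_on X)"
      then have d: "0 < bdist X x" "bdist X x \<le> D" using bdist_pos[OF X] D(2) by auto
      have "bdist X x * norm (\<Psi> x) \<le> D * norm (\<Psi> x)" using d by (intro mult_right_mono) auto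
      then show "norm (\<Psi> x) \<le> norm (D *\<^sub>R (\<Psi> x /\<^sub>R bdist X x))"
        using d D(1) by (simp add: field_simps)
    qed (intro L2_measurable test_field_L2[OF \<Psi> Xl] L2.scale_mem test_field_div_bdist_L2 X \<Psi>)+
    then show ?thesis using D(1) by (simp only: l2_norm_scale abs_of_pos)
  qed
  then show thesis using that D(1) by blast
qed

lemma hardy_test_field_sqrt:
  assumes "open X" "bounded X" "hardy X H" "\<Psi> \<in> test_fields X"
  shows "l2_norm X (\<lambda>x. \<Psi> x /\<^sub>R bdist X x) \<le> sqrt \<bar>H\<bar> * l2_norm X (jac \<Psi>)"
proof (rule power2_le_imp_le)
  have "(l2_norm X (\<lambda>x. \<Psi> x /\<^sub>R bdist X x))\<^sup>2 \<le> \<bar>H\<bar> * (l2_norm X (jac \<Psi>))\<^sup>2"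
    using hardy_test_field[OF assms] by (smt (verit) mult_right_mono zero_le_power2)
  then show "(l2_norm X (\<lambda>x. \<Psi> x /\<^sub>R bdist X x))\<^sup>2 \<le> (sqrt \<bar>H\<bar> * l2_norm X (jac \<Psi>))\<^sup>2"
    by (simp add: power_mult_distrib)
qed simp

lemma grad_fields_H10_vec:
  fixes X :: "(real^'n) set"
  assumes X: "open X" "bounded X" and H: "hardy X H" and G: "G \<in> grad_fields X"
  obtains v where "v \<in> H10_vec X" "AE x in lebesgue_on X. grad_mat X v x = G x"
proof -
  have Xl: "X \<in> lmeasurable" using X by (auto simp: lmeasurable_open)
  have GL: "G \<in> L2 X" by (rule grad_fields_L2[OF G])
  obtain \<Phi> where \<Phi>': "\<forall>k::nat. \<Phi> k \<in> test_fields X"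
    and lim: "(\<lambda>k. l2_norm X (\<lambda>x. jac (\<Phi> k) x - G x)) \<longlonglongrightarrow> 0"
    using G by (auto simp: grad_fields_def)
  have \<Phi>: "\<Phi> k \<in> test_fields X" for k using \<Phi>' by blast
  obtain D where D: "0 < D" "\<And>\<Psi>. \<Psi> \<in> test_fields X \<Longrightarrow> l2_norm X \<Psi> \<le> D * l2_norm X (\<lambda>x. \<Psi> x /\<^sub>R bdist X x)"
    by (rule l2_norm_le_weighted[OF X]) (rule that, assumption+)
  define c where "c = D * sqrt \<bar>H\<bar> + 1"
  have c: "c > 0" using D(1) by (simp add: c_def add_nonneg_pos)
  have le: "l2_norm X (\<lambda>x. \<Phi> m x - \<Phi> n x) \<le> c * l2_norm X (\<lambda>x. jac (\<Phi> m) x - jac (\<Phi> n) x)" for m n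
  proof -
    note t = test_fields_diff[OF \<Phi> \<Phi>, of m n]
    have "l2_norm X (\<lambda>x. \<Phi> m x - \<Phi> n x) \<le> D * (sqrt \<bar>H\<bar> * l2_norm X (jac (\<lambda>x. \<Phi> m x - \<Phi> n x)))"
      using D(2)[OF t] mult_left_mono[OF hardy_test_field_sqrt[OF X H t] less_imp_le[OF D(1)]] by linarith
    also have "\<dots> \<le> c * l2_norm X (jac (\<lambda>x. \<Phi> m x - \<Phi> n x))"
      by (simp add: c_def distrib_right mult.assoc)
    finally show ?thesis unfolding jac_diff[OF \<Phi> \<Phi>] .
  qed
  obtain v where v: "v \<in> L2 X" "(\<lambda>k. l2_norm X (\<lambda>x. \<Phi> k x - v x)) \<longlonglongrightarrow> 0"
  proof (rule L2_complete[OF Xl, of \<Phi>])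
    show "\<Phi> n \<in> L2 X" for n by (rule test_field_L2[OF \<Phi> Xl])
    fix e :: real assume "e > 0"
    then obtain N where N: "\<forall>m\<ge>N. \<forall>n\<ge>N. l2_norm X (\<lambda>x. jac (\<Phi> m) x - jac (\<Phi> n) x) < e / c"
      using l2_convergent_Cauchy[OF jac_L2[OF \<Phi> Xl] GL lim, of "e / c"] c by auto
    have "l2_norm X (\<lambda>x. \<Phi> m x - \<Phi> n x) < e" if mn: "m \<ge> N" "n \<ge> N" for m n
    proof -
      have "c * l2_norm X (\<lambda>x. jac (\<Phi> m) x - jac (\<Phi> n) x) < c * (e / c)"
        using N mn c by (intro mult_strict_left_mono) auto
      then show ?thesis using le[of m n] c by simp
    qed
    then show "\<exists>N. \<forall>m\<ge>N. \<forall>n\<ge>N. l2_norm X (\<lambda>x. \<Phi> m x - \<Phi> n x) < e" by blast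
  qed
  have isf: "is_function X (distr_grad X (\<lambda>x. v x $ i)) (\<lambda>x. G x $ i)" for i
    unfolding is_function_grad_iff[OF X(1)]
  proof (intro conjI allI ballI)
    show "locally_integrable X (\<lambda>x. G x $ i)" by (rule L2_locally_integrable[OF L2_nth[OF GL] Xl])
    fix j \<phi> assume \<phi>: "\<phi> \<in> test_functions X"
    have nth: "(\<lambda>k. l2_norm X (\<lambda>x. \<Phi> k x $ i - v x $ i)) \<longlonglongrightarrow> 0"
    proof (rule Lim_null_comparison[OF always_eventually v(2)], rule allI)
      show "norm (l2_norm X (\<lambda>x. \<Phi> k x $ i - v x $ i)) \<le> l2_norm X (\<lambda>x. \<Phi> k x - v x)" for k
        using l2_norm_nth_le[OF L2.diff_mem[OF test_field_L2[OF \<Phi> Xl] v(1)], of k i] by simp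
    qed
    have nthG: "(\<lambda>k. l2_norm X (\<lambda>x. jac (\<Phi> k) x $ i $ j - G x $ i $ j)) \<longlonglongrightarrow> 0"
    proof (rule Lim_null_comparison[OF always_eventually lim], rule allI)
      fix k
      have L: "(\<lambda>x. jac (\<Phi> k) x - G x) \<in> L2 X" by (rule L2.diff_mem[OF jac_L2[OF \<Phi> Xl] GL])
      show "norm (l2_norm X (\<lambda>x. jac (\<Phi> k) x $ i $ j - G x $ i $ j)) \<le> l2_norm X (\<lambda>x. jac (\<Phi> k) x - G x)"
        using l2_norm_nth_le[OF L2_nth[OF L], of i j] l2_norm_nth_le[OF L, of i] by simp
    qed
    have "(\<lambda>k. l2_inner X (\<lambda>x. \<Phi> k x $ i) (pd j \<phi>)) \<longlonglongrightarrow> l2_inner X (\<lambda>x. v x $ i) (pd j \<phi>)"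
      by (rule tendsto_l2_inner[OF L2_nth[OF test_field_L2[OF \<Phi> Xl]] L2_nth[OF v(1)] test_L2[OF test_pd[OF \<phi>] Xl] nth])
    moreover have "(\<lambda>k. - l2_inner X (\<lambda>x. jac (\<Phi> k) x $ i $ j) \<phi>) \<longlonglongrightarrow> - l2_inner X (\<lambda>x. G x $ i $ j) \<phi>"
      by (intro tendsto_minus tendsto_l2_inner[OF L2_nth[OF L2_nth[OF jac_L2[OF \<Phi> Xl]]] L2_nth[OF L2_nth[OF GL]] test_L2[OF \<phi> Xl] nthG])
    moreover have "l2_inner X (\<lambda>x. \<Phi> k x $ i) (pd j \<phi>) = - l2_inner X (\<lambda>x. jac (\<Phi> k) x $ i $ j) \<phi>" for k
      using test_is_function_grad(1)[OF X test_fieldsD[OF \<Phi>[of k]], of i] \<phi>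
      by (simp add: is_function_grad_iff[OF X(1)] l2_inner_def jac_def mult.commute)
    ultimately have "l2_inner X (\<lambda>x. v x $ i) (pd j \<phi>) = - l2_inner X (\<lambda>x. G x $ i $ j) \<phi>"
      using LIMSEQ_unique by simp
    then show "(\<integral>x. v x $ i * pd j \<phi> x \<partial>lebesgue_on X) = - (\<integral>x. \<phi> x * G x $ i $ j \<partial>lebesgue_on X)"
      by (simp add: l2_inner_def mult.commute)
  qed
  have wg: "AE x in lebesgue_on X. wgrad X (\<lambda>x. v x $ i) x = G x $ i" for i by (rule wgrad_AE[OF X(1) isf])
  have H1: "(\<lambda>x. v x $ i) \<in> H1 X" for i
    using isf L2_nth[OF v(1)] L2_nth[OF GL] by (auto simp: H1_def)
  have "(\<lambda>x. v x $ i) \<in> H10 X" for i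
    unfolding H10_def
  proof (intro CollectI conjI exI[of _ "\<lambda>k x. \<Phi> k x $ i"] H1)
    show "\<forall>k. (\<lambda>x. \<Phi> k x $ i) \<in> test_functions X" using test_fieldsD[OF \<Phi>] by blast
    show "(\<lambda>k. l2_norm X (\<lambda>x. v x $ i - \<Phi> k x $ i)) \<longlonglongrightarrow> 0"
    proof (rule Lim_null_comparison[OF always_eventually v(2)], rule allI)
      show "norm (l2_norm X (\<lambda>x. v x $ i - \<Phi> k x $ i)) \<le> l2_norm X (\<lambda>x. \<Phi> k x - v x)" for k
        using l2_norm_nth_le[OF L2.diff_mem[OF test_field_L2[OF \<Phi> Xl] v(1)], of k i]
        by (simp add: l2_norm_minus_commute[of _ "\<lambda>x. v x $ i"])
    qed
    show "(\<lambda>k. l2_norm X (\<lambda>x. wgrad X (\<lambda>x. v x $ i) x - (\<chi> j. pd j (\<lambda>x. \<Phi> k x $ i) x))) \<longlonglongrightarrow> 0"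
    proof (rule Lim_null_comparison[OF always_eventually lim], rule allI)
      fix k
      have L: "(\<lambda>x. jac (\<Phi> k) x - G x) \<in> L2 X" by (rule L2.diff_mem[OF jac_L2[OF \<Phi> Xl] GL])
      have "l2_norm X (\<lambda>x. wgrad X (\<lambda>x. v x $ i) x - (\<chi> j. pd j (\<lambda>x. \<Phi> k x $ i) x))
          = l2_norm X (\<lambda>x. G x $ i - jac (\<Phi> k) x $ i)"
      proof (rule l2_norm_cong_AE)
        show "AE x in lebesgue_on X. wgrad X (\<lambda>x. v x $ i) x - (\<chi> j. pd j (\<lambda>x. \<Phi> k x $ i) x) = G x $ i - jac (\<Phi> k) x $ i"
          using wg[of i] by eventually_elim (simp add: jac_def)
      qed (intro L2_measurable L2.diff_mem H1_wgrad(1)[OF X(1) H1] test_is_function_grad[OF X test_fieldsD[OF \<Phi>]]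
            L2_nth GL jac_L2[OF \<Phi> Xl])+
      then show "norm (l2_norm X (\<lambda>x. wgrad X (\<lambda>x. v x $ i) x - (\<chi> j. pd j (\<lambda>x. \<Phi> k x $ i) x)))
          \<le> l2_norm X (\<lambda>x. jac (\<Phi> k) x - G x)"
        using l2_norm_nth_le[OF L, of i] by (simp add: l2_norm_minus_commute[of _ "\<lambda>x. G x $ i"])
    qed
  qed
  then have "v \<in> H10_vec X" by (simp add: H10_vec_def)
  moreover have "AE x in lebesgue_on X. grad_mat X v x = G x"
  proof -
    have "AE x in lebesgue_on X. \<forall>i\<in>UNIV. wgrad X (\<lambda>x. v x $ i) x = G x $ i"
      using wg by (subst AE_ball_countable) (auto intro: countable_finite)
    then show ?thesis by eventually_elim (simp add: grad_mat_def vec_eq_iff)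
  qed
  ultimately show thesis by (rule that)
qed

lemma locally_integrable_weighted:
  fixes g :: "real^'n \<Rightarrow> real^'n"
  assumes X: "open X" "bounded X" and g: "(\<lambda>x. bdist X x *\<^sub>R g x) \<in> L2 X" and \<Psi>: "\<Psi> \<in> test_fields X"
  shows "(\<integral>x. g x \<bullet> \<Psi> x \<partial>lebesgue_on X)
    = l2_inner X (\<lambda>x. bdist X x *\<^sub>R g x) (\<lambda>x. \<Psi> x /\<^sub>R bdist X x)"
  unfolding l2_inner_def
proof (intro Bochner_Integration.integral_cong refl)
  fix x assume "x \<in> space (lebesgue_on X)"
  then have "0 < bdist X x" using bdist_pos[OF X] by simp
  then show "g x \<bullet> \<Psi> x = (bdist X x *\<^sub>R g x) \<bullet> (\<Psi> x /\<^sub>R bdist X x)" by simp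
qed

text \<open>By Hardy's inequality, a function \<open>g\<close> with square integrable \<open>d g\<close> acts on gradient fields.\<close>

lemma hardy_pairing:
  fixes X :: "(real^'n) set" and g :: "real^'n \<Rightarrow> real^'n"
  assumes X: "open X" "bounded X" and H: "hardy X H" and g: "(\<lambda>x. bdist X x *\<^sub>R g x) \<in> L2 X"
    and \<Phi>: "\<And>k::nat. \<Phi> k \<in> test_fields X" and G: "G \<in> L2 X"
    and lim: "(\<lambda>k. l2_norm X (\<lambda>x. jac (\<Phi> k) x - G x)) \<longlonglongrightarrow> 0"
    and I: "(\<lambda>k. \<integral>x. g x \<bullet> \<Phi> k x \<partial>lebesgue_on X) \<longlonglongrightarrow> I"
  shows "I\<^sup>2 \<le> H * (l2_norm X (\<lambda>x. bdist X x *\<^sub>R g x))\<^sup>2 * (l2_norm X G)\<^sup>2"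
proof -
  have Xl: "X \<in> lmeasurable" using X by (auto simp: lmeasurable_open)
  let ?g = "\<lambda>x. bdist X x *\<^sub>R g x"
  have "(\<integral>x. g x \<bullet> \<Phi> k x \<partial>lebesgue_on X)\<^sup>2 \<le> (l2_norm X ?g)\<^sup>2 * (H * (l2_norm X (jac (\<Phi> k)))\<^sup>2)" for k
  proof -
    have "(\<integral>x. g x \<bullet> \<Phi> k x \<partial>lebesgue_on X)\<^sup>2
        \<le> (l2_norm X ?g)\<^sup>2 * (l2_norm X (\<lambda>x. \<Phi> k x /\<^sub>R bdist X x))\<^sup>2"
      unfolding locally_integrable_weighted[OF X g \<Phi>] l2_norm_square
      by (rule L2.cauchy_schwarz[OF g test_field_div_bdist_L2[OF X \<Phi>]])
    also have "\<dots> \<le> (l2_norm X ?g)\<^sup>2 * (H * (l2_norm X (jac (\<Phi> k)))\<^sup>2)"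
      by (intro mult_left_mono hardy_test_field[OF X H \<Phi>]) simp
    finally show ?thesis .
  qed
  moreover have "(\<lambda>k. (l2_norm X ?g)\<^sup>2 * (H * (l2_norm X (jac (\<Phi> k)))\<^sup>2)) \<longlonglongrightarrow> (l2_norm X ?g)\<^sup>2 * (H * (l2_norm X G)\<^sup>2)"
    by (intro tendsto_mult_left tendsto_power tendsto_l2_norm[OF jac_L2[OF \<Phi> Xl] G lim])
  ultimately have "I\<^sup>2 \<le> (l2_norm X ?g)\<^sup>2 * (H * (l2_norm X G)\<^sup>2)"
    using tendsto_power[OF I, of 2] by (intro LIMSEQ_le) auto
  then show ?thesis by (simp add: mult_ac)
qed

section \<open>The abstract equivalence\<close>

lemma riesz_closed:
  fixes S :: "(real^'n \<Rightarrow> 'b::euclidean_space) set"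
  assumes X: "X \<in> lmeasurable" and S: "S \<subseteq> L2 X" "S \<noteq> {}"
    and comb: "\<And>a b f g. f \<in> S \<Longrightarrow> g \<in> S \<Longrightarrow> (\<lambda>x. a *\<^sub>R f x + b *\<^sub>R g x) \<in> S"
    and closed: "\<And>f g. (\<And>k::nat. f k \<in> S) \<Longrightarrow> g \<in> L2 X \<Longrightarrow>
      (\<lambda>k. l2_norm X (\<lambda>x. f k x - g x)) \<longlonglongrightarrow> 0 \<Longrightarrow> g \<in> S"
    and lin: "\<And>a b f g. f \<in> S \<Longrightarrow> g \<in> S \<Longrightarrow> l (\<lambda>x. a *\<^sub>R f x + b *\<^sub>R g x) = a * l f + b * l g"
    and bnd: "\<And>f. f \<in> S \<Longrightarrow> (l f)\<^sup>2 \<le> M * (l2_norm X f)\<^sup>2"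
  shows "\<exists>g\<in>S. \<forall>f\<in>S. l2_inner X g f = l f"
proof -
  interpret S: semi_inner S "l2_inner X"
  proof
    show "S \<noteq> {}" by (rule S)
    show "(\<lambda>x. a *\<^sub>R f x + b *\<^sub>R g x) \<in> S" if "f \<in> S" "g \<in> S" for a b f g by (rule comb[OF that])
    show "l2_inner X f g = l2_inner X g f" if "f \<in> S" "g \<in> S" for f g
      using S that by (intro L2.B_sym) auto
    show "l2_inner X (\<lambda>x. a *\<^sub>R f x + b *\<^sub>R g x) h = a * l2_inner X f h + b * l2_inner X g h"
      if "f \<in> S" "g \<in> S" "h \<in> S" for a b f g h
      using S that by (intro L2.B_comb) auto
    show "0 \<le> l2_inner X f f" if "f \<in> S" for f
      using S that by (intro L2.B_nonneg) auto
  qed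
  have bnd': "(l f)\<^sup>2 \<le> M * l2_inner X f f" if "f \<in> S" for f
    using bnd[OF that] by (simp add: l2_norm_square)
  obtain s where s: "\<forall>k::nat. s k \<in> S"
    and C: "\<forall>e>0. \<exists>N. \<forall>m\<ge>N. \<forall>n\<ge>N. l2_inner X (\<lambda>x. s m x - s n x) (\<lambda>x. s m x - s n x) < e"
    and lim: "\<forall>f\<in>S. (\<lambda>k. l2_inner X (s k) f) \<longlonglongrightarrow> l f"
    by (rule S.riesz_sequence[of l M], erule (1) lin, erule bnd') (rule that, assumption+)
  have sL: "s k \<in> L2 X" for k using s S by blast
  obtain g where g: "g \<in> L2 X" "(\<lambda>k. l2_norm X (\<lambda>x. s k x - g x)) \<longlonglongrightarrow> 0"
  proof (rule L2_complete[OF X, of s, OF sL])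
    fix e :: real assume "e > 0"
    then obtain N where "\<forall>m\<ge>N. \<forall>n\<ge>N. (l2_norm X (\<lambda>x. s m x - s n x))\<^sup>2 < e\<^sup>2"
      using C[rule_format, of "e\<^sup>2"] by (auto simp: l2_norm_square)
    then show "\<exists>N. \<forall>m\<ge>N. \<forall>n\<ge>N. l2_norm X (\<lambda>x. s m x - s n x) < e"
      using \<open>e > 0\<close> by (meson less_imp_le power2_less_imp_less)
  qed
  have "g \<in> S" by (rule closed[OF _ g]) (use s in blast)
  moreover have "l2_inner X g f = l f" if f: "f \<in> S" for f
    using LIMSEQ_unique[OF tendsto_l2_inner[OF sL g(1) subsetD[OF S(1) f] g(2)] lim[rule_format, OF f]] .
  ultimately show ?thesis by blast
qed

lemma grad_fields_nonempty: "X \<in> lmeasurable \<Longrightarrow> grad_fields X \<noteq> {}"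
  using jac_grad_fields[OF test_fields_zero] by blast

lemma tendsto_l2_bounded_linear:
  fixes T :: "'b::euclidean_space \<Rightarrow> 'c::euclidean_space"
  assumes T: "bounded_linear T" and f: "\<And>k. f k \<in> L2 X" "g \<in> L2 X"
    and lim: "(\<lambda>k. l2_norm X (\<lambda>x. f k x - g x)) \<longlonglongrightarrow> 0"
  shows "(\<lambda>k. l2_norm X (\<lambda>x. T (f k x) - T (g x))) \<longlonglongrightarrow> 0"
proof -
  interpret T: bounded_linear T by fact
  show ?thesis
  proof (rule l2_norm_bounded_linear[OF T, of X])
    fix K assume K: "\<And>f. f \<in> L2 X \<Longrightarrow> l2_norm X (\<lambda>x. T (f x)) \<le> K * l2_norm X f"
    show ?thesis
    proof (rule Lim_null_comparison[OF always_eventually tendsto_mult_right_zero[OF lim, of K]], rule allI)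
      show "norm (l2_norm X (\<lambda>x. T (f k x) - T (g x))) \<le> K * l2_norm X (\<lambda>x. f k x - g x)" for k
        using K[OF L2.diff_mem[OF f], of k] by (simp add: T.diff)
    qed
  qed
qed

text \<open>With \<open>x\<^sub>u\<close> representing \<open>K \<mapsto> \<langle>u, t K\<rangle>\<close>, the pair \<open>u - t x\<^sub>u\<close>, \<open>s x\<^sub>u\<close> is conjugate.
  The estimate for conjugate pairs makes \<open>u \<mapsto> t x\<^sub>u\<close> coercive, so it is onto.\<close>

theorem conjugate_estimate_imp_surjective:
  fixes X :: "(real^'n) set" and t :: "real^'n^'n \<Rightarrow> 'd::euclidean_space"
    and s :: "real^'n^'n \<Rightarrow> 'e::euclidean_space"
  assumes X: "X \<in> lmeasurable" and t: "bounded_linear t" and s: "bounded_linear s"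
    and norm: "\<And>G. G \<in> grad_fields X \<Longrightarrow>
      (l2_norm X G)\<^sup>2 = (l2_norm X (\<lambda>x. t (G x)))\<^sup>2 + (l2_norm X (\<lambda>x. s (G x)))\<^sup>2"
    and Y: "Y \<subseteq> L2 X" "\<And>a b f g. f \<in> Y \<Longrightarrow> g \<in> Y \<Longrightarrow> (\<lambda>x. a *\<^sub>R f x + b *\<^sub>R g x) \<in> Y"
    and tY: "\<And>G. G \<in> grad_fields X \<Longrightarrow> (\<lambda>x. t (G x)) \<in> Y"
    and \<Gamma>: "0 \<le> \<Gamma>"
    and est: "\<And>u G. u \<in> Y \<Longrightarrow> G \<in> grad_fields X \<Longrightarrow>
      (\<And>K. K \<in> grad_fields X \<Longrightarrow> l2_inner X u (\<lambda>x. t (K x)) = l2_inner X (\<lambda>x. s (G x)) (\<lambda>x. s (K x))) \<Longrightarrow>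
      (l2_norm X u)\<^sup>2 \<le> \<Gamma> * (l2_norm X (\<lambda>x. s (G x)))\<^sup>2"
    and f: "f \<in> Y"
  shows "\<exists>G\<in>grad_fields X. (AE x in lebesgue_on X. t (G x) = f x) \<and>
    (l2_norm X G)\<^sup>2 \<le> (1 + \<Gamma>) * (l2_norm X f)\<^sup>2"
proof -
  interpret t: bounded_linear t by fact
  interpret s: bounded_linear s by fact
  let ?G = "grad_fields X" and ?i = "l2_inner X"
  let ?t = "\<lambda>G x. t (G x)" and ?s = "\<lambda>G x. s (G x)"
  have GL: "G \<in> L2 X" if "G \<in> ?G" for G using grad_fields_L2[OF that] .
  have tL: "?t G \<in> L2 X" and sL: "?s G \<in> L2 X" if "G \<in> ?G" for G
    using L2_bounded_linear[OF t GL[OF that]] L2_bounded_linear[OF s GL[OF that]] by auto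
  have YL: "u \<in> L2 X" if "u \<in> Y" for u using Y(1) that by blast
  have polar: "?i G K = ?i (?t G) (?t K) + ?i (?s G) (?s K)" if "G \<in> ?G" "K \<in> ?G" for G K
  proof -
    have sum: "(\<lambda>x. 1 *\<^sub>R G x + 1 *\<^sub>R K x) \<in> ?G" by (rule grad_fields_comb[OF X that])
    have "?i (\<lambda>x. 1 *\<^sub>R G x + 1 *\<^sub>R K x) (\<lambda>x. 1 *\<^sub>R G x + 1 *\<^sub>R K x)
      = ?i (\<lambda>x. 1 *\<^sub>R t (G x) + 1 *\<^sub>R t (K x)) (\<lambda>x. 1 *\<^sub>R t (G x) + 1 *\<^sub>R t (K x))
      + ?i (\<lambda>x. 1 *\<^sub>R s (G x) + 1 *\<^sub>R s (K x)) (\<lambda>x. 1 *\<^sub>R s (G x) + 1 *\<^sub>R s (K x))"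
      using norm[OF sum] by (simp add: l2_norm_square t.add s.add)
    then show ?thesis
      using norm[OF that(1)] norm[OF that(2)]
      unfolding L2.B_comb_square[OF GL[OF that(1)] GL[OF that(2)]]
        L2.B_comb_square[OF tL[OF that(1)] tL[OF that(2)]] L2.B_comb_square[OF sL[OF that(1)] sL[OF that(2)]]
      by (simp add: l2_norm_square)
  qed
  have le: "(l2_norm X (?t G))\<^sup>2 \<le> (l2_norm X G)\<^sup>2" if "G \<in> ?G" for G
    using norm[OF that] by simp
  have "\<exists>\<xi>\<in>?G. \<forall>K\<in>?G. ?i \<xi> K = ?i u (?t K)" if u: "u \<in> L2 X" for u
  proof (rule riesz_closed[where M="(l2_norm X u)\<^sup>2"])
    show "?G \<subseteq> L2 X" using GL by blast
    show "?G \<noteq> {}" by (rule grad_fields_nonempty[OF X])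
    show "(\<lambda>x. a *\<^sub>R f x + b *\<^sub>R g x) \<in> ?G" if "f \<in> ?G" "g \<in> ?G" for a b f g
      by (rule grad_fields_comb[OF X that])
    show "g \<in> ?G" if "\<And>k::nat. f k \<in> ?G" "g \<in> L2 X" "(\<lambda>k. l2_norm X (\<lambda>x. f k x - g x)) \<longlonglongrightarrow> 0" for f g
      by (rule grad_fields_closed[OF X that])
    show "?i u (?t (\<lambda>x. a *\<^sub>R f x + b *\<^sub>R g x)) = a * ?i u (?t f) + b * ?i u (?t g)" if "f \<in> ?G" "g \<in> ?G" for a b f g
      using L2.B_comb_right[OF tL[OF that(1)] tL[OF that(2)] u, of a b] by (simp add: t.add t.scaleR)
    show "(?i u (?t f))\<^sup>2 \<le> (l2_norm X u)\<^sup>2 * (l2_norm X f)\<^sup>2" if "f \<in> ?G" for f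
      using order_trans[OF L2.cauchy_schwarz[OF u tL[OF that]]
          mult_left_mono[OF le[OF that], of "(l2_norm X u)\<^sup>2", unfolded l2_norm_square[of X "?t f"] l2_norm_square[of X u]]]
      by (simp add: l2_norm_square L2.B_nonneg u)
  qed (rule X)
  then have "\<exists>\<xi>. \<forall>u\<in>L2 X. \<xi> u \<in> ?G \<and> (\<forall>K\<in>?G. ?i (\<xi> u) K = ?i u (?t K))"
    by (intro bchoice) blast
  then obtain \<xi> where XG: "\<And>u. u \<in> L2 X \<Longrightarrow> \<xi> u \<in> ?G"
    and \<xi>: "\<And>u K. u \<in> L2 X \<Longrightarrow> K \<in> ?G \<Longrightarrow> ?i (\<xi> u) K = ?i u (?t K)" by blast
  have XL: "\<xi> u \<in> L2 X" if "u \<in> L2 X" for u by (rule GL[OF XG[OF that]])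
  let ?N = "\<lambda>u. (l2_norm X u)\<^sup>2"
  have pair: "?N (\<lambda>x. u x - t (\<xi> u x)) \<le> \<Gamma> * ?N (?s (\<xi> u))"
    "?i (\<lambda>x. u x - t (\<xi> u x)) (?t (\<xi> u)) = ?N (?s (\<xi> u))" if uY: "u \<in> Y" for u
  proof -
    have u: "u \<in> L2 X" by (rule YL[OF uY])
    note XGu = XG[OF u]
    note tX = tL[OF XGu] and sX = sL[OF XGu]
    have conj: "?i (\<lambda>x. u x - t (\<xi> u x)) (?t K) = ?i (?s (\<xi> u)) (?s K)" if K: "K \<in> ?G" for K
      using \<xi>[OF u K] polar[OF XGu K] by (simp add: L2.B_diff[OF u tX tL[OF K]])
    have "(\<lambda>x. u x - t (\<xi> u x)) \<in> Y" using Y(2)[OF uY tY[OF XGu], of 1 "-1"] by simp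
    from est[OF this XGu conj] show "?N (\<lambda>x. u x - t (\<xi> u x)) \<le> \<Gamma> * ?N (?s (\<xi> u))" .
    show "?i (\<lambda>x. u x - t (\<xi> u x)) (?t (\<xi> u)) = ?N (?s (\<xi> u))"
      using conj[OF XGu] by (simp add: l2_norm_square)
  qed
  have coercive: "?N u \<le> (\<Gamma> + 2) * ?i (\<xi> u) (\<xi> u)" if uY: "u \<in> Y" for u
  proof -
    have u: "u \<in> L2 X" by (rule YL[OF uY])
    note tX = tL[OF XG[OF u]]
    have "?N u = ?N (\<lambda>x. 1 *\<^sub>R (u x - t (\<xi> u x)) + 1 *\<^sub>R t (\<xi> u x))" by simp
    also have "\<dots> = ?N (\<lambda>x. u x - t (\<xi> u x)) + 2 * ?N (?s (\<xi> u)) + ?N (?t (\<xi> u))"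
      using L2.B_comb_square[OF L2.diff_mem[OF u tX] tX, of 1 1] pair(2)[OF uY] by (simp only: l2_norm_square) simp
    also have "\<dots> \<le> (\<Gamma> + 2) * (?N (?t (\<xi> u)) + ?N (?s (\<xi> u)))"
      using pair(1)[OF uY] mult_nonneg_nonneg[OF \<Gamma> zero_le_power2, of "l2_norm X (?t (\<xi> u))"]
        zero_le_power2[of "l2_norm X (?t (\<xi> u))"] by (simp only: distrib_left distrib_right)
    also have "?N (?t (\<xi> u)) + ?N (?s (\<xi> u)) = ?i (\<xi> u) (\<xi> u)"
      using norm[OF XG[OF u]] by (simp add: l2_norm_square)
    finally show ?thesis .
  qed
  have ratio: "?N (?s (\<xi> u)) \<le> \<Gamma> * ?N (?t (\<xi> u))" if uY: "u \<in> Y" for u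
  proof -
    have u: "u \<in> L2 X" by (rule YL[OF uY])
    note tX = tL[OF XG[OF u]]
    let ?r = "?N (?s (\<xi> u))"
    have "?r\<^sup>2 \<le> ?N (\<lambda>x. u x - t (\<xi> u x)) * ?N (?t (\<xi> u))"
      using L2.cauchy_schwarz[OF L2.diff_mem[OF u tX] tX] pair(2)[OF uY] by (simp add: l2_norm_square[of _ "\<lambda>x. u x - t (\<xi> u x)"] l2_norm_square[of _ "?t (\<xi> u)"])
    also have "\<dots> \<le> \<Gamma> * ?r * ?N (?t (\<xi> u))" by (intro mult_right_mono pair(1)[OF uY]) simp
    finally have "?r * ?r \<le> ?r * (\<Gamma> * ?N (?t (\<xi> u)))" by (simp add: power2_eq_square mult_ac)
    then show ?thesis
    proof (cases "?r = 0")
      case False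
      then have "0 < ?r" by simp
      with \<open>?r * ?r \<le> ?r * (\<Gamma> * ?N (?t (\<xi> u)))\<close> show ?thesis by (rule mult_left_le_imp_le)
    qed (use \<Gamma> in simp)
  qed
  interpret B: semi_inner Y "\<lambda>u w. ?i (\<xi> u) (\<xi> w)"
  proof
    show "Y \<noteq> {}" using f by blast
    show "(\<lambda>x. a *\<^sub>R u x + b *\<^sub>R w x) \<in> Y" if "u \<in> Y" "w \<in> Y" for a b u w by (rule Y(2)[OF that])
    show "?i (\<xi> u) (\<xi> w) = ?i (\<xi> w) (\<xi> u)" if "u \<in> Y" "w \<in> Y" for u w
      using that by (intro L2.B_sym XL YL)
    show "?i (\<xi> (\<lambda>x. a *\<^sub>R u x + b *\<^sub>R w x)) (\<xi> z) = a * ?i (\<xi> u) (\<xi> z) + b * ?i (\<xi> w) (\<xi> z)"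
      if "u \<in> Y" "w \<in> Y" "z \<in> Y" for a b u w z
    proof -
      note L = YL[OF that(1)] YL[OF that(2)] YL[OF that(3)]
      show ?thesis
        unfolding \<xi>[OF L2_comb[OF L(1,2)] XG[OF L(3)]] \<xi>[OF L(1) XG[OF L(3)]] \<xi>[OF L(2) XG[OF L(3)]]
        by (rule L2.B_comb[OF L(1,2) tL[OF XG[OF L(3)]]])
    qed
    show "0 \<le> ?i (\<xi> u) (\<xi> u)" if "u \<in> Y" for u by (rule L2.B_nonneg[OF XL[OF YL[OF that]]])
  qed
  have fL: "f \<in> L2 X" by (rule YL[OF f])
  have lin: "?i f (\<lambda>x. a *\<^sub>R u x + b *\<^sub>R w x) = a * ?i f u + b * ?i f w" if "u \<in> Y" "w \<in> Y" for a b u w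
    by (rule L2.B_comb_right[OF YL[OF that(1)] YL[OF that(2)] fL])
  have bnd: "(?i f u)\<^sup>2 \<le> (?N f * (\<Gamma> + 2)) * ?i (\<xi> u) (\<xi> u)" if "u \<in> Y" for u
  proof -
    have "(?i f u)\<^sup>2 \<le> ?N f * ?N u" using L2.cauchy_schwarz[OF fL YL[OF that]] by (simp add: l2_norm_square)
    also have "\<dots> \<le> ?N f * ((\<Gamma> + 2) * ?i (\<xi> u) (\<xi> u))" by (intro mult_left_mono coercive[OF that]) simp
    finally show ?thesis by (simp add: mult.assoc)
  qed
  obtain w where w': "\<forall>k::nat. w k \<in> Y"
    and C: "\<forall>e>0. \<exists>N. \<forall>m\<ge>N. \<forall>n\<ge>N. ?i (\<xi> (\<lambda>x. w m x - w n x)) (\<xi> (\<lambda>x. w m x - w n x)) < e"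
    and lim: "\<forall>u\<in>Y. (\<lambda>k. ?i (\<xi> (w k)) (\<xi> u)) \<longlonglongrightarrow> ?i f u"
    by (rule B.riesz_sequence[of "?i f" "?N f * (\<Gamma> + 2)"], erule (1) lin, erule bnd) (rule that, assumption+)
  have w: "w k \<in> Y" for k using w' by blast
  have XwG: "\<xi> (w k) \<in> ?G" and XwL: "\<xi> (w k) \<in> L2 X" for k using XG XL YL[OF w] by auto
  have diff: "?N (\<lambda>x. \<xi> (w m) x - \<xi> (w n) x) = ?i (\<xi> (\<lambda>x. w m x - w n x)) (\<xi> (\<lambda>x. w m x - w n x))" for m n
    unfolding l2_norm_square L2.B_diff_square[OF XwL XwL] B.B_diff_square[OF w w] ..
  obtain G where G: "G \<in> L2 X" "(\<lambda>k. l2_norm X (\<lambda>x. \<xi> (w k) x - G x)) \<longlonglongrightarrow> 0"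
  proof (rule L2_complete[OF X, of "\<lambda>k. \<xi> (w k)", OF XwL])
    fix e :: real assume "e > 0"
    then obtain N where "\<forall>m\<ge>N. \<forall>n\<ge>N. ?N (\<lambda>x. \<xi> (w m) x - \<xi> (w n) x) < e\<^sup>2"
      using C[rule_format, of "e\<^sup>2"] by (auto simp: diff)
    then show "\<exists>N. \<forall>m\<ge>N. \<forall>n\<ge>N. l2_norm X (\<lambda>x. \<xi> (w m) x - \<xi> (w n) x) < e"
      using \<open>e > 0\<close> by (meson less_imp_le power2_less_imp_less)
  qed
  have GG: "G \<in> ?G" by (rule grad_fields_closed[OF X XwG G])
  note tG = tL[OF GG] and sG = sL[OF GG]
  note tlim = tendsto_l2_bounded_linear[OF t XwL G] and slim = tendsto_l2_bounded_linear[OF s XwL G]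
  have tGf: "?i (?t G) u = ?i f u" if u: "u \<in> Y" for u
  proof -
    have "?i (?t (\<xi> (w k))) u = ?i (\<xi> (w k)) (\<xi> u)" for k
      using \<xi>[OF YL[OF u] XwG[of k]] L2.B_sym[OF tL[OF XwG] YL[OF u]] L2.B_sym[OF XL[OF YL[OF u]] XwL] by metis
    then show ?thesis
      using LIMSEQ_unique[OF tendsto_l2_inner[OF tL[OF XwG] tG YL[OF u] tlim]] lim[rule_format, OF u] by simp
  qed
  have d: "(\<lambda>x. t (G x) - f x) \<in> Y" using Y(2)[OF tY[OF GG] f, of 1 "-1"] by simp
  have "?N (\<lambda>x. t (G x) - f x) = 0"
    using tGf[OF d] unfolding l2_norm_square L2.B_diff[OF tG fL YL[OF d]] by simp
  then have "AE x in lebesgue_on X. t (G x) - f x = 0"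
    using l2_norm_eq_0_iff[OF YL[OF d]] by simp
  then have AE: "AE x in lebesgue_on X. t (G x) = f x" by eventually_elim simp
  have "?N (?s G) \<le> \<Gamma> * ?N (?t G)"
  proof (rule LIMSEQ_le)
    show "(\<lambda>k. ?N (?s (\<xi> (w k)))) \<longlonglongrightarrow> ?N (?s G)"
      by (intro tendsto_power tendsto_l2_norm[OF sL[OF XwG] sG slim])
    show "(\<lambda>k. \<Gamma> * ?N (?t (\<xi> (w k)))) \<longlonglongrightarrow> \<Gamma> * ?N (?t G)"
      by (intro tendsto_mult_left tendsto_power tendsto_l2_norm[OF tL[OF XwG] tG tlim])
  qed (use ratio[OF w] in blast)
  moreover have "?N (?t G) = ?N f"
    using l2_norm_cong_AE[OF AE L2_measurable[OF tG] L2_measurable[OF fL]] by simp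
  ultimately have "?N G \<le> (1 + \<Gamma>) * ?N f"
    using norm[OF GG] by (simp add: algebra_simps)
  then show ?thesis using GG AE by blast
qed

section \<open>Divergence and rotation of gradient fields\<close>

lemma test_by_parts:
  assumes X: "open X" "bounded X" and "\<phi> \<in> test_functions X" "\<psi> \<in> test_functions X"
  shows "(\<integral>x. \<phi> x * pd i \<psi> x \<partial>lebesgue_on X) = - (\<integral>x. pd i \<phi> x * \<psi> x \<partial>lebesgue_on X)"
  using test_is_function_grad(1)[OF X assms(3)] assms(4)
  by (simp add: is_function_grad_iff[OF X(1)] mult.commute)

lemma test_mult_integrable:
  assumes X: "open X" "bounded X" and "\<phi> \<in> test_functions X" "\<psi> \<in> test_functions X"
  shows "integrable (lebesgue_on X) (\<lambda>x. \<phi> x * \<psi> x)"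
proof -
  have Xl: "X \<in> lmeasurable" using X by (auto simp: lmeasurable_open)
  show ?thesis using L2_integrable_inner[OF test_L2[OF assms(3) Xl] test_L2[OF assms(4) Xl]] by simp
qed

lemma integral_swap_pd:
  assumes X: "open X" "bounded X" and "\<phi> \<in> test_functions X" "\<psi> \<in> test_functions X"
  shows "(\<integral>x. pd j \<phi> x * pd i \<psi> x \<partial>lebesgue_on X) = (\<integral>x. pd i \<phi> x * pd j \<psi> x \<partial>lebesgue_on X)"
  using test_by_parts[OF X test_pd[OF assms(3)] assms(4), of j i]
    test_by_parts[OF X test_pd[OF assms(3)] assms(4), of i j]
    smooth_pd_commute[OF test_smooth[OF assms(3)], of i j] by simp

lemma l2_norm_power2: "(l2_norm X f)\<^sup>2 = (\<integral>x. (norm (f x))\<^sup>2 \<partial>lebesgue_on X)"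
  unfolding l2_norm_def by (rule real_sqrt_pow2) (rule Bochner_Integration.integral_nonneg, simp)

text \<open>\<open>s\<close> is the antisymmetric part of a matrix up to normalization.\<close>

locale antisymmetric_part =
  fixes s :: "real^'n^'n \<Rightarrow> 'e::euclidean_space"
  assumes lin: "linear s"
    and norm_s: "\<And>A. (norm (s A))\<^sup>2 = (\<Sum>i\<in>UNIV. \<Sum>j\<in>UNIV. (A $ i $ j - A $ j $ i)\<^sup>2) / 2"
begin

lemma norm_matrix: "(norm A)\<^sup>2 = (norm (s A))\<^sup>2 + (\<Sum>i\<in>UNIV. \<Sum>j\<in>UNIV. A $ i $ j * A $ j $ i)"
proof -
  have n: "(norm A)\<^sup>2 = (\<Sum>i\<in>UNIV. \<Sum>j\<in>UNIV. (A $ i $ j)\<^sup>2)"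
    unfolding power2_norm_eq_inner inner_vec_def by (simp add: power2_eq_square)
  have "(\<Sum>i\<in>UNIV. \<Sum>j\<in>UNIV. (A $ i $ j - A $ j $ i)\<^sup>2)
      = (\<Sum>i\<in>UNIV. \<Sum>j\<in>UNIV. (A $ i $ j)\<^sup>2) + (\<Sum>i\<in>UNIV. \<Sum>j\<in>UNIV. (A $ j $ i)\<^sup>2)
        - 2 * (\<Sum>i\<in>UNIV. \<Sum>j\<in>UNIV. A $ i $ j * A $ j $ i)"
    by (simp add: power2_diff sum.distrib sum_subtractf sum_distrib_left mult.assoc)
  also have "(\<Sum>i\<in>UNIV. \<Sum>j\<in>UNIV. (A $ j $ i)\<^sup>2) = (\<Sum>i\<in>UNIV. \<Sum>j\<in>UNIV. (A $ i $ j)\<^sup>2)"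
    by (rule sum.swap)
  finally show ?thesis unfolding norm_s n by linarith
qed

lemma s_transpose_diff: "s (unit_mat k i) = - s (unit_mat i k)"
proof -
  interpret linear s by (rule lin)
  let ?A = "unit_mat k i + unit_mat i k :: real^'n^'n"
  have "?A $ p $ q = ?A $ q $ p" for p q by (auto simp: unit_mat_nth)
  then have "(norm (s ?A))\<^sup>2 = 0" unfolding norm_s by simp
  then have "s (unit_mat k i) + s (unit_mat i k) = 0" by (simp add: add)
  then show ?thesis by (simp add: eq_neg_iff_add_eq_0)
qed

lemma norm_outer_le: "norm (s (\<chi> k i. w $ k * \<xi> $ i)) \<le> norm w * norm \<xi>"
proof (rule power2_le_imp_le)
  let ?A = "\<chi> k i. w $ k * \<xi> $ i"
  have "(norm (s ?A))\<^sup>2 \<le> (norm ?A)\<^sup>2"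
  proof -
    have "(\<Sum>i\<in>UNIV. \<Sum>j\<in>UNIV. ?A $ i $ j * ?A $ j $ i) = (\<Sum>i\<in>UNIV. w $ i * \<xi> $ i)\<^sup>2"
      by (simp add: power2_eq_square sum_product mult_ac)
    then show ?thesis unfolding norm_matrix[of ?A] by simp
  qed
  also have "(norm ?A)\<^sup>2 = (norm w * norm \<xi>)\<^sup>2"
  proof -
    have "(norm ?A)\<^sup>2 = (\<Sum>k\<in>UNIV. \<Sum>i\<in>UNIV. (w $ k)\<^sup>2 * (\<xi> $ i)\<^sup>2)"
      unfolding power2_norm_eq_inner inner_vec_def by (simp add: power2_eq_square mult_ac)
    also have "\<dots> = (\<Sum>k\<in>UNIV. (w $ k)\<^sup>2) * (\<Sum>i\<in>UNIV. (\<xi> $ i)\<^sup>2)" by (rule sum_product[symmetric])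
    also have "\<dots> = (norm w)\<^sup>2 * (norm \<xi>)\<^sup>2"
      unfolding power2_norm_eq_inner inner_vec_def by (simp add: power2_eq_square)
    finally show ?thesis by (simp add: power_mult_distrib)
  qed
  finally show "(norm (s ?A))\<^sup>2 \<le> (norm w * norm \<xi>)\<^sup>2" .
qed simp

lemma sum_symmetric_eq_0:
  assumes "\<And>i k. D i k = D k i"
  shows "(\<Sum>k\<in>UNIV. \<Sum>i\<in>UNIV. (s (unit_mat k i) \<bullet> b) * D k i) = 0"
proof -
  have "(\<Sum>k\<in>UNIV. \<Sum>i\<in>UNIV. (s (unit_mat k i) \<bullet> b) * D k i)
      = (\<Sum>k\<in>UNIV. \<Sum>i\<in>UNIV. - ((s (unit_mat i k) \<bullet> b) * D i k))"
    using assms s_transpose_diff by (intro sum.cong refl) (metis inner_minus_left mult_minus_left)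
  also have "\<dots> = - (\<Sum>k\<in>UNIV. \<Sum>i\<in>UNIV. (s (unit_mat i k) \<bullet> b) * D i k)" by (simp add: sum_negf)
  also have "\<dots> = - (\<Sum>k\<in>UNIV. \<Sum>i\<in>UNIV. (s (unit_mat k i) \<bullet> b) * D k i)" by (subst sum.swap) simp
  finally show ?thesis by simp
qed

lemma trace_unit_mat: "trace (unit_mat k j :: real^'n^'n) = (if k = j then 1 else 0)"
  by (simp add: trace_def unit_mat_nth)

text \<open>The analogues of \<open>div rot = 0\<close> and \<open>rot grad = 0\<close>.\<close>

lemma trace_jac_adj:
  assumes "smooth \<psi>" shows "trace (jac (adj_field s b \<psi>) x) = 0"
proof -
  have "trace (jac (adj_field s b \<psi>) x) = (\<Sum>k\<in>UNIV. \<Sum>i\<in>UNIV. (s (unit_mat k i) \<bullet> b) * pd k (pd i \<psi>) x)"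
    by (simp add: trace_def jac_def pd_adj_field[OF assms])
  also have "\<dots> = 0" by (rule sum_symmetric_eq_0) (rule smooth_pd_commute[OF assms])
  finally show ?thesis .
qed

lemma s_jac_adj_trace:
  assumes "smooth \<psi>" shows "s (jac (adj_field trace b \<psi>) x) = 0"
proof (rule euclidean_eqI)
  fix c :: 'e
  have j: "jac (adj_field trace b \<psi>) x $ k $ j = b * pd j (pd k \<psi>) x" for k j
  proof -
    have "jac (adj_field trace b \<psi>) x $ k $ j
        = (\<Sum>i\<in>UNIV. if i = k then b * pd j (pd k \<psi>) x else 0)"
      unfolding jac_def vec_lambda_beta pd_adj_field[OF assms] trace_unit_mat
      by (intro sum.cong refl) auto
    then show ?thesis by simp
  qed
  have "s (jac (adj_field trace b \<psi>) x) \<bullet> c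
      = (\<Sum>k\<in>UNIV. \<Sum>j\<in>UNIV. (s (unit_mat k j) \<bullet> c) * (b * pd j (pd k \<psi>) x))"
    unfolding linear_matrix_expansion[OF lin, of "jac (adj_field trace b \<psi>) x"]
    by (simp add: j mult_ac inner_sum_left)
  also have "\<dots> = 0" by (rule sum_symmetric_eq_0) (rule arg_cong[OF smooth_pd_commute[OF assms]])
  finally show "s (jac (adj_field trace b \<psi>) x) \<bullet> c = 0 \<bullet> c" by simp
qed

lemma bounded_linear_s: "bounded_linear s"
  using lin by (rule linear_conv_bounded_linear[THEN iffD1])

lemma bounded_linear_trace: "bounded_linear (trace :: real^'n^'n \<Rightarrow> real)"
  using linear_trace by (rule linear_conv_bounded_linear[THEN iffD1])

lemma norm_jac:
  assumes X: "open X" "bounded X" and \<Phi>: "\<Phi> \<in> test_fields X"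
  shows "(l2_norm X (jac \<Phi>))\<^sup>2 = (l2_norm X (\<lambda>x. trace (jac \<Phi> x)))\<^sup>2 + (l2_norm X (\<lambda>x. s (jac \<Phi> x)))\<^sup>2"
proof -
  have Xl: "X \<in> lmeasurable" using X by (auto simp: lmeasurable_open)
  note t = test_fieldsD[OF \<Phi>]
  let ?J = "\<lambda>i j x. pd j (\<lambda>y. \<Phi> y $ i) x"
  have i: "integrable (lebesgue_on X) (\<lambda>x. ?J i j x * ?J k l x)" for i j k l
    by (rule test_mult_integrable[OF X test_pd[OF t] test_pd[OF t]])
  have isq: "integrable (lebesgue_on X) (\<lambda>x. (norm (s (jac \<Phi> x)))\<^sup>2)"
    by (rule L2_integrable_square[OF L2_bounded_linear[OF bounded_linear_s jac_L2[OF \<Phi> Xl]]])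
  have "(l2_norm X (jac \<Phi>))\<^sup>2 = (\<integral>x. (norm (s (jac \<Phi> x)))\<^sup>2 + (\<Sum>i\<in>UNIV. \<Sum>j\<in>UNIV. ?J i j x * ?J j i x) \<partial>lebesgue_on X)"
    unfolding l2_norm_power2 norm_matrix[of "jac \<Phi> _"] by (simp add: jac_def)
  also have "\<dots> = (l2_norm X (\<lambda>x. s (jac \<Phi> x)))\<^sup>2 + (\<Sum>i\<in>UNIV. \<Sum>j\<in>UNIV. \<integral>x. ?J i j x * ?J j i x \<partial>lebesgue_on X)"
    using isq i by (simp add: l2_norm_power2)
  also have "(\<Sum>i\<in>UNIV. \<Sum>j\<in>UNIV. \<integral>x. ?J i j x * ?J j i x \<partial>lebesgue_on X)
      = (\<Sum>i\<in>UNIV. \<Sum>j\<in>UNIV. \<integral>x. ?J i i x * ?J j j x \<partial>lebesgue_on X)"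
    by (intro sum.cong refl integral_swap_pd[OF X t t])
  also have "\<dots> = (\<integral>x. (\<Sum>i\<in>UNIV. \<Sum>j\<in>UNIV. ?J i i x * ?J j j x) \<partial>lebesgue_on X)"
    using i by simp
  also have "\<dots> = (l2_norm X (\<lambda>x. trace (jac \<Phi> x)))\<^sup>2"
    unfolding l2_norm_power2 by (simp add: trace_def jac_def sum_product power2_eq_square)
  finally show ?thesis by simp
qed

lemma norm_grad_fields:
  assumes X: "open X" "bounded X" and G: "G \<in> grad_fields X"
  shows "(l2_norm X G)\<^sup>2 = (l2_norm X (\<lambda>x. trace (G x)))\<^sup>2 + (l2_norm X (\<lambda>x. s (G x)))\<^sup>2"
proof -
  have Xl: "X \<in> lmeasurable" using X by (auto simp: lmeasurable_open)
  have GL: "G \<in> L2 X" by (rule grad_fields_L2[OF G])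
  obtain \<Phi> where \<Phi>: "\<forall>k::nat. \<Phi> k \<in> test_fields X"
    and lim: "(\<lambda>k. l2_norm X (\<lambda>x. jac (\<Phi> k) x - G x)) \<longlonglongrightarrow> 0"
    using G by (auto simp: grad_fields_def)
  have J: "jac (\<Phi> k) \<in> L2 X" for k using \<Phi> jac_L2[OF _ Xl] by blast
  have "(\<lambda>k. (l2_norm X (jac (\<Phi> k)))\<^sup>2) \<longlonglongrightarrow> (l2_norm X G)\<^sup>2"
    by (intro tendsto_power tendsto_l2_norm[OF J GL lim])
  moreover have "(\<lambda>k. (l2_norm X (\<lambda>x. trace (jac (\<Phi> k) x)))\<^sup>2 + (l2_norm X (\<lambda>x. s (jac (\<Phi> k) x)))\<^sup>2)
      \<longlonglongrightarrow> (l2_norm X (\<lambda>x. trace (G x)))\<^sup>2 + (l2_norm X (\<lambda>x. s (G x)))\<^sup>2"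
    using tendsto_l2_norm[OF L2_bounded_linear[OF bounded_linear_trace J] L2_bounded_linear[OF bounded_linear_trace GL]
        tendsto_l2_bounded_linear[OF bounded_linear_trace J GL lim]]
      tendsto_l2_norm[OF L2_bounded_linear[OF bounded_linear_s J] L2_bounded_linear[OF bounded_linear_s GL]
        tendsto_l2_bounded_linear[OF bounded_linear_s J GL lim]]
    by (intro tendsto_add tendsto_power)
  moreover have "(l2_norm X (jac (\<Phi> k)))\<^sup>2 = (l2_norm X (\<lambda>x. trace (jac (\<Phi> k) x)))\<^sup>2 + (l2_norm X (\<lambda>x. s (jac (\<Phi> k) x)))\<^sup>2" for k
    using norm_jac[OF X] \<Phi> by blast
  ultimately show ?thesis using LIMSEQ_unique by simp
qed

end

text \<open>The weak form of the conjugacy relation between \<open>u\<close> and \<open>v\<close>.\<close>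

definition conjugate_on ::
  "(real^'n) set \<Rightarrow> (real^'n^'n \<Rightarrow> 'd::euclidean_space) \<Rightarrow> (real^'n^'n \<Rightarrow> 'e::euclidean_space) \<Rightarrow>
    (real^'n \<Rightarrow> 'd) \<Rightarrow> (real^'n \<Rightarrow> 'e) \<Rightarrow> bool" where
  "conjugate_on X t s u v \<longleftrightarrow>
    (\<forall>\<Psi>\<in>test_fields X. l2_inner X u (\<lambda>x. t (jac \<Psi> x)) = l2_inner X v (\<lambda>x. s (jac \<Psi> x)))"

lemma conjugate_on_grad_fields:
  assumes X: "X \<in> lmeasurable" and t: "bounded_linear t" and s: "bounded_linear s"
    and c: "conjugate_on X t s u v" and u: "u \<in> L2 X" and v: "v \<in> L2 X" and G: "G \<in> grad_fields X"
  shows "l2_inner X u (\<lambda>x. t (G x)) = l2_inner X v (\<lambda>x. s (G x))"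
proof -
  have GL: "G \<in> L2 X" by (rule grad_fields_L2[OF G])
  obtain \<Phi> where \<Phi>: "\<forall>k::nat. \<Phi> k \<in> test_fields X"
    and lim: "(\<lambda>k. l2_norm X (\<lambda>x. jac (\<Phi> k) x - G x)) \<longlonglongrightarrow> 0"
    using G by (auto simp: grad_fields_def)
  have J: "jac (\<Phi> k) \<in> L2 X" for k using \<Phi> jac_L2[OF _ X] by blast
  note tJ = L2_bounded_linear[OF t J] and tG = L2_bounded_linear[OF t GL]
  note sJ = L2_bounded_linear[OF s J] and sG = L2_bounded_linear[OF s GL]
  have "(\<lambda>k. l2_inner X (\<lambda>x. t (jac (\<Phi> k) x)) u) \<longlonglongrightarrow> l2_inner X (\<lambda>x. t (G x)) u"
    by (rule tendsto_l2_inner[OF tJ tG u tendsto_l2_bounded_linear[OF t J GL lim]])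
  moreover have "(\<lambda>k. l2_inner X (\<lambda>x. s (jac (\<Phi> k) x)) v) \<longlonglongrightarrow> l2_inner X (\<lambda>x. s (G x)) v"
    by (rule tendsto_l2_inner[OF sJ sG v tendsto_l2_bounded_linear[OF s J GL lim]])
  moreover have "l2_inner X (\<lambda>x. t (jac (\<Phi> k) x)) u = l2_inner X (\<lambda>x. s (jac (\<Phi> k) x)) v" for k
    using c \<Phi> L2.B_sym[OF tJ[of k] u] L2.B_sym[OF sJ[of k] v] by (simp add: conjugate_on_def)
  ultimately have "l2_inner X (\<lambda>x. t (G x)) u = l2_inner X (\<lambda>x. s (G x)) v" using LIMSEQ_unique by simp
  then show ?thesis using L2.B_sym[OF tG u] L2.B_sym[OF sG v] by simp
qed

section \<open>Consequences for conjugate pairs\<close>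

definition pd_pairing :: "(real^'n) set \<Rightarrow> (real^'n \<Rightarrow> real) \<Rightarrow> 'n \<Rightarrow> (real^'n \<Rightarrow> real) \<Rightarrow> real" where
  "pd_pairing X u i \<phi> = (\<integral>x. u x * pd i \<phi> x \<partial>lebesgue_on X)"

lemma distr_pd_eq: "distr_pd X i u \<phi> = - pd_pairing X u i \<phi>"
  by (simp add: distr_pd_def pd_pairing_def)

lemma pd_zero: "pd i (\<lambda>x. 0) x = 0"
  by (rule pd_eqI[OF has_derivative_const])

lemma pd_pairing_zero: "pd_pairing X u i (\<lambda>x. 0) = 0"
  by (simp add: pd_pairing_def pd_zero)

lemma integrable_pd_pairing:
  assumes X: "open X" "bounded X" and "u \<in> L2 X" "\<phi> \<in> test_functions X"
  shows "integrable (lebesgue_on X) (\<lambda>x. u x * pd i \<phi> x)"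
  by (rule integrable_test_mult(2)[OF X(1) L2_locally_integrable[OF assms(3)] test_pd[OF assms(4)]])
    (use X in \<open>simp add: lmeasurable_open\<close>)

lemma l2_inner_trace_jac:
  assumes X: "open X" "bounded X" and u: "u \<in> L2 X" and \<Psi>: "\<Psi> \<in> test_fields X"
  shows "l2_inner X u (\<lambda>x. trace (jac \<Psi> x)) = (\<Sum>i\<in>UNIV. pd_pairing X u i (\<lambda>x. \<Psi> x $ i))"
proof -
  have "l2_inner X u (\<lambda>x. trace (jac \<Psi> x)) = (\<integral>x. (\<Sum>i\<in>UNIV. u x * pd i (\<lambda>y. \<Psi> y $ i) x) \<partial>lebesgue_on X)"
    by (simp add: l2_inner_def trace_def jac_def sum_distrib_left)
  also have "\<dots> = (\<Sum>i\<in>UNIV. pd_pairing X u i (\<lambda>x. \<Psi> x $ i))"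
    unfolding pd_pairing_def
    by (intro Bochner_Integration.integral_sum integrable_pd_pairing X u test_fieldsD[OF \<Psi>])
  finally show ?thesis .
qed

definition single_field :: "'n::finite \<Rightarrow> (real^'n \<Rightarrow> real) \<Rightarrow> real^'n \<Rightarrow> real^'n" where
  "single_field k \<phi> x = axis k (\<phi> x)"

lemma single_field_nth: "(\<lambda>x. single_field k \<phi> x $ i) = (if i = k then \<phi> else (\<lambda>x. 0))"
  by (auto simp: single_field_def axis_def fun_eq_iff)

lemma single_field_test: "\<phi> \<in> test_functions X \<Longrightarrow> single_field k \<phi> \<in> test_fields X"
  by (simp add: test_fields_def single_field_nth test_zero)

lemma distr_eq_iff_fields:
  fixes F G :: "(real^'n \<Rightarrow> real) \<Rightarrow> real^'n"
  assumes "F (\<lambda>x. 0) = 0" "G (\<lambda>x. 0) = 0"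
  shows "distr_eq X F G \<longleftrightarrow>
    (\<forall>\<Psi>\<in>test_fields X. (\<Sum>i\<in>UNIV. F (\<lambda>x. \<Psi> x $ i) $ i) = (\<Sum>i\<in>UNIV. G (\<lambda>x. \<Psi> x $ i) $ i))"
proof
  assume "distr_eq X F G"
  then show "\<forall>\<Psi>\<in>test_fields X. (\<Sum>i\<in>UNIV. F (\<lambda>x. \<Psi> x $ i) $ i) = (\<Sum>i\<in>UNIV. G (\<lambda>x. \<Psi> x $ i) $ i)"
    by (auto simp: distr_eq_def test_fieldsD)
next
  assume *: "\<forall>\<Psi>\<in>test_fields X. (\<Sum>i\<in>UNIV. F (\<lambda>x. \<Psi> x $ i) $ i) = (\<Sum>i\<in>UNIV. G (\<lambda>x. \<Psi> x $ i) $ i)"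
  have s: "(\<Sum>i\<in>UNIV. H (\<lambda>x. single_field k \<phi> x $ i) $ i) = H \<phi> $ k"
    if "H (\<lambda>x. 0) = 0" for H :: "(real^'n \<Rightarrow> real) \<Rightarrow> real^'n" and k \<phi>
  proof -
    have "H (\<lambda>x. single_field k \<phi> x $ i) $ i = (if i = k then H \<phi> $ k else 0)" for i
      unfolding single_field_nth using that by simp
    then show ?thesis by simp
  qed
  show "distr_eq X F G"
    unfolding distr_eq_def vec_eq_iff
  proof (intro ballI allI)
    fix \<phi> k assume "\<phi> \<in> test_functions X"
    then show "F \<phi> $ k = G \<phi> $ k"
      using bspec[OF * single_field_test[of \<phi> X k]] s[where H=F, OF assms(1)] s[where H=G, OF assms(2)] by simp
  qed
qed

lemma distr_grad_field:
  assumes X: "open X" "bounded X" and u: "u \<in> L2 X" and \<Psi>: "\<Psi> \<in> test_fields X"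
  shows "(\<Sum>i\<in>UNIV. distr_grad X u (\<lambda>x. \<Psi> x $ i) $ i) = - l2_inner X u (\<lambda>x. trace (jac \<Psi> x))"
  by (simp add: l2_inner_trace_jac[OF assms] distr_grad_def distr_pd_eq sum_negf)

lemma distr_grad_zero: "distr_grad X u (\<lambda>x. 0) = 0"
  by (simp add: distr_grad_def distr_pd_eq pd_pairing_zero vec_eq_iff)

lemma conjugate_weak_gradient:
  fixes X :: "(real^'n) set" and s :: "real^'n^'n \<Rightarrow> 'e::euclidean_space"
  assumes X: "bounded_domain X" and s: "antisymmetric_part s"
    and c: "conjugate_on X trace s u v" and u: "u \<in> L2 X" and v: "v \<in> L2 X"
  obtains g where "is_function X (distr_grad X u) g" "(\<lambda>x. bdist X x *\<^sub>R g x) \<in> L2 X"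
    "(l2_norm X (\<lambda>x. bdist X x *\<^sub>R g x))\<^sup>2 \<le> 4 * (l2_norm X u)\<^sup>2"
    "(l2_norm X (\<lambda>x. bdist X x *\<^sub>R g x))\<^sup>2 \<le> 4 * (l2_norm X v)\<^sup>2"
proof -
  interpret antisymmetric_part s by (rule s)
  have o: "open X" "bounded X" "X \<noteq> {}" and Xl: "X \<in> lmeasurable"
    using X by (auto simp: bounded_domain_def lmeasurable_open)
  have eq: "(\<integral>x. u x * trace (jac \<Psi> x) \<partial>lebesgue_on X) = l2_inner X v (\<lambda>x. s (jac \<Psi> x))"
    if "\<Psi> \<in> test_fields X" for \<Psi>
    using c that by (simp add: conjugate_on_def l2_inner_def)
  have comm: "(\<integral>x. s (A x) \<bullet> v x \<partial>lebesgue_on X) = l2_inner X v (\<lambda>x. s (A x))"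
    for A :: "real^'n \<Rightarrow> real^'n^'n"
    by (simp add: l2_inner_def inner_commute)
  have bv: "\<bar>\<integral>x. u x * trace (jac \<Psi> x) \<partial>lebesgue_on X\<bar> \<le> 2 * l2_norm X v * l2_norm X (\<lambda>x. \<Psi> x /\<^sub>R bdist X x)"
    if \<Psi>: "\<Psi> \<in> test_fields X" for \<Psi>
    unfolding eq[OF \<Psi>] comm[symmetric]
  proof (rule weighted_estimate[OF o lin norm_outer_le v _ \<Psi>])
    fix \<psi> and b :: 'e assume \<psi>: "\<psi> \<in> test_functions X"
    show "(\<integral>x. s (jac (adj_field s b \<psi>) x) \<bullet> v x \<partial>lebesgue_on X) = 0"
      unfolding comm eq[OF adj_field_test[OF \<psi>], symmetric] trace_jac_adj[OF test_smooth[OF \<psi>]] by simp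
  qed
  have bu: "\<bar>\<integral>x. u x * trace (jac \<Psi> x) \<partial>lebesgue_on X\<bar> \<le> 2 * l2_norm X u * l2_norm X (\<lambda>x. \<Psi> x /\<^sub>R bdist X x)"
    if \<Psi>: "\<Psi> \<in> test_fields X" for \<Psi>
  proof -
    have "\<bar>\<integral>x. trace (jac \<Psi> x) \<bullet> u x \<partial>lebesgue_on X\<bar> \<le> 2 * l2_norm X u * l2_norm X (\<lambda>x. \<Psi> x /\<^sub>R bdist X x)"
    proof (rule weighted_estimate[OF o linear_trace _ u _ \<Psi>])
      show "norm (trace (\<chi> k i. w $ k * \<xi> $ i)) \<le> norm w * norm \<xi>" for w \<xi> :: "real^'n"
        using Cauchy_Schwarz_ineq2[of w \<xi>] by (simp add: trace_def inner_vec_def)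
      fix \<psi> and b :: real assume \<psi>: "\<psi> \<in> test_functions X"
      have "(\<integral>x. trace (jac (adj_field trace b \<psi>) x) \<bullet> u x \<partial>lebesgue_on X)
          = l2_inner X v (\<lambda>x. s (jac (adj_field trace b \<psi>) x))"
        using eq[OF adj_field_test[OF \<psi>], of trace b] by (simp add: mult.commute)
      then show "(\<integral>x. trace (jac (adj_field trace b \<psi>) x) \<bullet> u x \<partial>lebesgue_on X) = 0"
        unfolding s_jac_adj_trace[OF test_smooth[OF \<psi>]] by (simp add: l2_inner_def)
    qed
    then show ?thesis by (simp add: mult.commute)
  qed
  define M where "M = min (2 * l2_norm X u) (2 * l2_norm X v)"
  have M: "0 \<le> M" by (simp add: M_def)
  have b: "\<bar>\<integral>x. u x * trace (jac \<Psi> x) \<partial>lebesgue_on X\<bar> \<le> M * l2_norm X (\<lambda>x. \<Psi> x /\<^sub>R bdist X x)"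
    if "\<Psi> \<in> test_fields X" for \<Psi>
    using bu[OF that] bv[OF that] by (simp add: M_def min_def)
  obtain g where g: "is_function X (distr_grad X u) g" "(\<lambda>x. bdist X x *\<^sub>R g x) \<in> L2 X"
    "l2_norm X (\<lambda>x. bdist X x *\<^sub>R g x) \<le> M"
    by (rule riesz_weak_gradient[OF o(1,2) L2_locally_integrable[OF u Xl] M b]) (assumption | rule that)+
  have "(l2_norm X (\<lambda>x. bdist X x *\<^sub>R g x))\<^sup>2 \<le> (2 * l2_norm X u)\<^sup>2"
    "(l2_norm X (\<lambda>x. bdist X x *\<^sub>R g x))\<^sup>2 \<le> (2 * l2_norm X v)\<^sup>2"
    by (rule power_mono, use g(3) in \<open>simp add: M_def\<close>, simp)+
  then show thesis using that[OF g(1,2)] by (simp add: power_mult_distrib)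
qed

lemma least_constant_properties:
  assumes "supports I" and nonneg: "\<And>C. I C \<Longrightarrow> 0 \<le> C"
    and closed: "\<And>C. (\<And>n::nat. I (C + 1 / (real n + 1))) \<Longrightarrow> I C"
    and mono: "\<And>C D. I C \<Longrightarrow> C \<le> D \<Longrightarrow> I D"
  shows "I (least_constant I)" "\<And>C. I C \<Longrightarrow> least_constant I \<le> C" "0 \<le> least_constant I"
proof -
  define m where "m = Inf {C. I C}"
  have ne: "{C. I C} \<noteq> {}" using assms(1) by (auto simp: supports_def)
  have bdd: "bdd_below {C. I C}" using nonneg by (intro bdd_belowI[of _ 0]) auto
  have "I m"
  proof (rule closed)
    fix n :: nat
    have "Inf {C. I C} < m + 1 / (real n + 1)" by (simp add: m_def)
    then obtain C where "I C" "C < m + 1 / (real n + 1)" using cInf_lessD[OF ne] by auto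
    then show "I (m + 1 / (real n + 1))" using mono less_imp_le by blast
  qed
  moreover have le: "m \<le> C" if "I C" for C unfolding m_def using that bdd by (intro cInf_lower) auto
  ultimately have "least_constant I = m"
    unfolding least_constant_def by (intro Least_equality)
  then show "I (least_constant I)" "\<And>C. I C \<Longrightarrow> least_constant I \<le> C" "0 \<le> least_constant I"
    using \<open>I m\<close> le nonneg by auto
qed

lemma le_mult_limit:
  fixes a b C :: real
  assumes "\<And>n::nat. a \<le> (C + 1 / (real n + 1)) * b"
  shows "a \<le> C * b"
proof (rule LIMSEQ_le_const)
  have lim: "(\<lambda>n. 1 / (real n + 1)) \<longlonglongrightarrow> 0"
    using LIMSEQ_inverse_real_of_nat by (simp add: inverse_eq_divide add.commute)
  show "(\<lambda>n. (C + 1 / (real n + 1)) * b) \<longlonglongrightarrow> C * b"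
    using tendsto_mult[OF tendsto_add[OF tendsto_const[of C] lim] tendsto_const[of b]] by simp
qed (use assms in blast)

lemma nontrivial_test_function:
  fixes X :: "(real^'n) set"
  assumes X: "bounded_domain X"
  obtains \<phi> where "\<phi> \<in> test_functions X" "\<not> (AE x in lebesgue_on X. \<phi> x = 0)"
    "\<And>i. \<not> (AE x in lebesgue_on X. pd i \<phi> x = 0)"
proof -
  have o: "open X" "bounded X" and Xl: "X \<in> lmeasurable" "X \<in> sets lebesgue"
    using X by (auto simp: bounded_domain_def lmeasurable_open)
  obtain a where "a \<in> X" using X by (auto simp: bounded_domain_def)
  then obtain r where r: "r > 0" "cball a r \<subseteq> X" using o(1) open_contains_cball by blast
  define \<phi> where "\<phi> = (\<lambda>y. mollifier r (a - y))"
  have \<phi>: "\<phi> \<in> test_functions X" unfolding \<phi>_def by (rule test_mollifier_shift[OF r])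
  have m [measurable]: "(mollifier r :: real^'n \<Rightarrow> real) \<in> borel_measurable borel"
    by (rule test_measurable[OF mollifier_test[OF r(1)]])
  have "\<phi> y = mollifier r (y + - a)" for y
    unfolding \<phi>_def using mollifier_even[OF r(1), of "y + - a"] by simp
  then have \<phi>1: "(\<integral>y. \<phi> y \<partial>lborel) = 1"
    using integral_lborel_translate[OF m, of "- a"] by (simp add: mollifier_integral[OF r(1)])
  have \<phi>0: "\<phi> x = 0" "pd i \<phi> x = 0" if "x \<notin> X" for x i
    using test_functionsE[OF \<phi>] that by (metis subsetD)+
  have \<phi>m [measurable]: "\<phi> \<in> borel_measurable borel" "pd i \<phi> \<in> borel_measurable borel" for i
    using test_measurable[OF \<phi>] test_measurable[OF test_pd[OF \<phi>]] by auto
  show thesis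
  proof (rule that[OF \<phi>])
    show "\<not> (AE x in lebesgue_on X. \<phi> x = 0)"
    proof
      assume "AE x in lebesgue_on X. \<phi> x = 0"
      then have "(\<integral>x. \<phi> x \<partial>lebesgue_on X) = 0" by (rule integral_eq_zero_AE)
      then show False using integral_lebesgue_on_eq_lborel(1)[OF \<phi>m(1) Xl(2) \<phi>0(1)] \<phi>1 by simp
    qed
    show "\<not> (AE x in lebesgue_on X. pd i \<phi> x = 0)" for i
    proof
      assume "AE x in lebesgue_on X. pd i \<phi> x = 0"
      then have "AE x in lebesgue_on X. x $ i * pd i \<phi> x = 0" by eventually_elim simp
      then have 0: "(\<integral>x. x $ i * pd i \<phi> x \<partial>lebesgue_on X) = 0" by (rule integral_eq_zero_AE)
      have D: "((\<lambda>x::real^'n. x $ i) has_derivative (\<lambda>h. h $ i)) (at x)" for x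
        by (rule bounded_linear.has_derivative[OF bounded_linear_vec_nth has_derivative_ident])
      have p: "pd j (\<lambda>x::real^'n. x $ i) = (\<lambda>x. if j = i then 1 else 0)" for j
        using pd_eqI[OF D] by (auto simp: axis_def fun_eq_iff)
      have "C_k (Suc 0) (\<lambda>x::real^'n. x $ i)"
        using differentiableI[OF D] by (simp add: p)
      from integral_by_parts[OF this test_mono[OF \<phi> subset_UNIV], of i]
      have "(\<integral>x. x $ i * pd i \<phi> x \<partial>lborel) = -1" by (simp add: p \<phi>1)
      moreover have "(\<integral>x. x $ i * pd i \<phi> x \<partial>lebesgue_on X) = (\<integral>x. x $ i * pd i \<phi> x \<partial>lborel)"
      proof (rule integral_lebesgue_on_eq_lborel(1)[OF _ Xl(2)])
        have "(\<lambda>x::real^'n. x $ i) \<in> borel_measurable borel"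
          by (intro borel_measurable_continuous_onI continuous_intros)
        then show "(\<lambda>x. x $ i * pd i \<phi> x) \<in> borel_measurable borel" using \<phi>m(2) by (rule borel_measurable_times)
      qed (simp add: \<phi>0)
      ultimately show False using 0 by simp
    qed
  qed
qed

lemma hardy_nonneg:
  fixes X :: "(real^'n) set"
  assumes X: "bounded_domain X" and H: "hardy X H"
  shows "0 \<le> H"
proof (rule ccontr)
  assume neg: "\<not> 0 \<le> H"
  have o: "open X" "bounded X" using X by (auto simp: bounded_domain_def)
  obtain \<phi> where \<phi>: "\<phi> \<in> test_functions X" "\<not> (AE x in lebesgue_on X. \<phi> x = 0)"
    by (rule nontrivial_test_function[OF X]) (rule that, assumption+)
  fix k :: 'n
  let ?\<Psi> = "single_field k \<phi>"
  have t: "?\<Psi> \<in> test_fields X" by (rule single_field_test[OF \<phi>(1)])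
  note L = test_field_div_bdist_L2[OF o t]
  have "(l2_norm X (\<lambda>x. ?\<Psi> x /\<^sub>R bdist X x))\<^sup>2 \<le> 0"
    by (rule order_trans[OF hardy_test_field[OF o H t]], rule mult_nonpos_nonneg) (use neg in auto)
  then have "AE x in lebesgue_on X. ?\<Psi> x /\<^sub>R bdist X x = 0"
    using l2_norm_eq_0_iff[OF L] by simp
  moreover have "AE x in lebesgue_on X. bdist X x \<noteq> 0"
    using bdist_pos[OF o] by (intro AE_I2) (simp add: less_imp_neq[symmetric])
  ultimately have "AE x in lebesgue_on X. \<phi> x = 0"
    by eventually_elim (auto simp: single_field_def axis_eq_0_iff)
  with \<phi>(2) show False by simp
qed

lemma is_function_field:
  fixes F :: "(real^'n \<Rightarrow> real) \<Rightarrow> real^'n"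
  assumes X: "open X" and g: "is_function X F g" and \<Psi>: "\<Psi> \<in> test_fields X"
  shows "(\<Sum>i\<in>UNIV. F (\<lambda>x. \<Psi> x $ i) $ i) = (\<integral>x. g x \<bullet> \<Psi> x \<partial>lebesgue_on X)"
proof -
  have gl: "locally_integrable X g" using g by (simp add: is_function_def)
  have "(\<Sum>i\<in>UNIV. F (\<lambda>x. \<Psi> x $ i) $ i) = (\<Sum>i\<in>UNIV. \<integral>x. \<Psi> x $ i * g x $ i \<partial>lebesgue_on X)"
    using g integral_test_nth[OF gl test_fieldsD[OF \<Psi>] X]
    by (simp add: is_function_def distr_eq_def test_fieldsD[OF \<Psi>])
  also have "\<dots> = (\<integral>x. (\<Sum>i\<in>UNIV. \<Psi> x $ i * g x $ i) \<partial>lebesgue_on X)"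
    by (intro Bochner_Integration.integral_sum[symmetric] integrable_test_mult(1)[OF X locally_integrable_nth[OF gl]] test_fieldsD[OF \<Psi>])
  finally show ?thesis by (simp add: inner_vec_def mult.commute)
qed

text \<open>The core of the improved Poincare inequalities: test the potential equation with the
  field \<open>G\<close> that solves \<open>t G = f\<close>.\<close>

lemma improved_poincare_core:
  fixes X :: "(real^'n) set" and t :: "real^'n^'n \<Rightarrow> 'd::euclidean_space"
  assumes X: "bounded_domain X" and H: "hardy X H" and t: "bounded_linear t"
    and f: "f \<in> L2 X" and g: "(\<lambda>x. bdist X x *\<^sub>R g x) \<in> L2 X"
    and weak: "\<And>\<Psi>. \<Psi> \<in> test_fields X \<Longrightarrow>
      l2_inner X f (\<lambda>x. t (jac \<Psi> x)) = - (\<integral>x. g x \<bullet> \<Psi> x \<partial>lebesgue_on X)"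
    and G: "G \<in> grad_fields X" "AE x in lebesgue_on X. t (G x) = f x"
      "(l2_norm X G)\<^sup>2 \<le> C * (l2_norm X f)\<^sup>2" and C: "0 \<le> C"
  shows "(l2_norm X f)\<^sup>2 \<le> H * C * (l2_norm X (\<lambda>x. bdist X x *\<^sub>R g x))\<^sup>2"
proof -
  have o: "open X" "bounded X" and Xl: "X \<in> lmeasurable"
    using X by (auto simp: bounded_domain_def lmeasurable_open)
  have H0: "0 \<le> H" by (rule hardy_nonneg[OF X H])
  have GL: "G \<in> L2 X" by (rule grad_fields_L2[OF G(1)])
  note tG = L2_bounded_linear[OF t GL]
  obtain \<Phi> where \<Phi>': "\<forall>k::nat. \<Phi> k \<in> test_fields X"
    and lim: "(\<lambda>k. l2_norm X (\<lambda>x. jac (\<Phi> k) x - G x)) \<longlonglongrightarrow> 0"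
    using G(1) by (auto simp: grad_fields_def)
  have \<Phi>: "\<Phi> k \<in> test_fields X" for k using \<Phi>' by blast
  have J: "jac (\<Phi> k) \<in> L2 X" for k by (rule jac_L2[OF \<Phi> Xl])
  let ?n = "(l2_norm X f)\<^sup>2" and ?d = "(l2_norm X (\<lambda>x. bdist X x *\<^sub>R g x))\<^sup>2"
  have "l2_inner X (\<lambda>x. t (G x)) f = ?n"
    using l2_inner_cong_AE[OF G(2) L2_measurable[OF tG] L2_measurable[OF f] L2_measurable[OF f]]
    by (simp add: l2_norm_square)
  moreover have "(\<lambda>k. l2_inner X (\<lambda>x. t (jac (\<Phi> k) x)) f) \<longlonglongrightarrow> l2_inner X (\<lambda>x. t (G x)) f"
    by (rule tendsto_l2_inner[OF L2_bounded_linear[OF t J] tG f tendsto_l2_bounded_linear[OF t J GL lim]])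
  moreover have "l2_inner X (\<lambda>x. t (jac (\<Phi> k) x)) f = - (\<integral>x. g x \<bullet> \<Phi> k x \<partial>lebesgue_on X)" for k
    using weak[OF \<Phi>] L2.B_sym[OF L2_bounded_linear[OF t J] f] by simp
  ultimately have "(\<lambda>k. - (\<integral>x. g x \<bullet> \<Phi> k x \<partial>lebesgue_on X)) \<longlonglongrightarrow> ?n" by simp
  then have "(\<lambda>k. \<integral>x. g x \<bullet> \<Phi> k x \<partial>lebesgue_on X) \<longlonglongrightarrow> - ?n" using tendsto_minus by fastforce
  from hardy_pairing[OF o H g \<Phi> GL lim this]
  have "?n\<^sup>2 \<le> H * ?d * (l2_norm X G)\<^sup>2" by simp
  also have "\<dots> \<le> H * ?d * (C * ?n)" using H0 by (intro mult_left_mono G(3)) auto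
  finally have le: "?n * ?n \<le> ?n * (H * C * ?d)" by (simp add: power2_eq_square mult_ac)
  show ?thesis
  proof (cases "?n = 0")
    case False
    then have "0 < ?n" by simp
    with le show ?thesis by (rule mult_left_le_imp_le)
  next
    case True
    have "0 \<le> H * C * ?d" using H0 C by (intro mult_nonneg_nonneg) auto
    then show ?thesis using True by simp
  qed
qed

section \<open>The divergence inequalities\<close>

lemma L2_const: "X \<in> lmeasurable \<Longrightarrow> (\<lambda>x. c) \<in> L2 X"
proof -
  assume "X \<in> lmeasurable"
  then interpret finite_measure "lebesgue_on X" by (rule finite_measure_lebesgue_on)
  show ?thesis by (simp add: L2_def)
qed

lemma integral_lebesgue_on_const:
  fixes c :: "'b::euclidean_space"
  shows "X \<in> lmeasurable \<Longrightarrow> (\<integral>x. c \<partial>lebesgue_on X) = measure lebesgue X *\<^sub>R c"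
proof -
  assume X: "X \<in> lmeasurable"
  then interpret finite_measure "lebesgue_on X" by (rule finite_measure_lebesgue_on)
  have "(\<integral>x. c \<partial>lebesgue_on X) = measure (lebesgue_on X) (space (lebesgue_on X)) *\<^sub>R c"
    by (rule lebesgue_integral_const)
  then show ?thesis using X by (simp add: measure_restrict_space fmeasurableD)
qed

lemma l2_norm_const: "X \<in> lmeasurable \<Longrightarrow> (l2_norm X (\<lambda>x. c))\<^sup>2 = measure lebesgue X * (norm c)\<^sup>2"
  unfolding l2_norm_power2 by (subst integral_lebesgue_on_const) simp_all

lemma bounded_domain_measure_pos: "bounded_domain X \<Longrightarrow> 0 < measure lebesgue X"
  using open_not_negligible[of X] negligible_iff_measure[of X] measure_nonneg[of lebesgue X]
  by (auto simp: bounded_domain_def lmeasurable_open less_le)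

lemma test_integral_pd:
  assumes \<phi>: "\<phi> \<in> test_functions X" and X: "X \<in> sets lebesgue"
  shows "(\<integral>x. pd i \<phi> x \<partial>lebesgue_on X) = 0"
proof -
  have d: "pd j (\<lambda>x::real^'a. 1) = (\<lambda>x. 0)" for j
    using pd_eqI[OF has_derivative_const] by (auto simp: fun_eq_iff)
  have "pd i \<phi> x = 0" if "x \<notin> X" for x
    using test_functionsE[OF \<phi>] that by (metis subsetD)
  from integral_lebesgue_on_eq_lborel(1)[OF test_measurable[OF test_pd[OF \<phi>]] X this]
  have "(\<integral>x. pd i \<phi> x \<partial>lebesgue_on X) = (\<integral>x. pd i \<phi> x \<partial>lborel)" .
  also have "\<dots> = 0"
    using integral_by_parts[OF _ test_mono[OF \<phi> subset_UNIV], of "\<lambda>x. 1" i] by (simp add: d)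
  finally show ?thesis .
qed

lemma is_function_grad_const: "open X \<Longrightarrow> bounded X \<Longrightarrow> is_function X (distr_grad X (\<lambda>x. c)) (\<lambda>x. 0)"
  by (simp add: is_function_grad_iff locally_integrable_def test_integral_pd lmeasurable_open fmeasurableD)

lemma is_function_cong_AE:
  fixes f g :: "real^'n \<Rightarrow> 'b::euclidean_space"
  assumes X: "open X" and f: "is_function X T f" and g: "locally_integrable X g"
    and eq: "AE x in lebesgue_on X. f x = g x"
  shows "is_function X T g"
proof -
  have fl: "locally_integrable X f" using f by (simp add: is_function_def)
  have "(\<integral>x. \<phi> x *\<^sub>R f x \<partial>lebesgue_on X) = (\<integral>x. \<phi> x *\<^sub>R g x \<partial>lebesgue_on X)"
    if "\<phi> \<in> test_functions X" for \<phi>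
    using eq borel_imp_lebesgue_on_measurable[OF test_measurable[OF that]]
      locally_integrable_measurable[OF X fl] locally_integrable_measurable[OF X g]
    by (intro integral_cong_AE borel_measurable_scaleR) auto
  then show ?thesis using f g by (simp add: is_function_def distr_eq_def)
qed

lemma L2_bdist_scaleR:
  assumes X: "bounded X" and g: "g \<in> L2 X" shows "(\<lambda>x. bdist X x *\<^sub>R g x) \<in> L2 X"
proof -
  obtain D where D: "0 < D" "\<And>x. x \<in> X \<Longrightarrow> bdist X x \<le> D" by (rule bdist_bounded[OF X]) blast
  show ?thesis
  proof (rule L2I_bound)
    show "(\<lambda>x. bdist X x *\<^sub>R g x) \<in> borel_measurable (lebesgue_on X)"
      by (intro borel_measurable_scaleR borel_imp_lebesgue_on_measurable[OF bdist_measurable] L2_measurable g)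
    show "integrable (lebesgue_on X) (\<lambda>x. D\<^sup>2 * (norm (g x))\<^sup>2)" using L2_integrable_square[OF g] by simp
    show "AE x in lebesgue_on X. (norm (bdist X x *\<^sub>R g x))\<^sup>2 \<le> D\<^sup>2 * (norm (g x))\<^sup>2"
      by (intro AE_I2) (auto simp: power_mult_distrib intro!: mult_right_mono power_mono D)
  qed
qed

lemma L2_pointwise_limit:
  fixes f :: "nat \<Rightarrow> 'a::euclidean_space \<Rightarrow> 'b::euclidean_space"
  assumes f: "\<And>n. f n \<in> L2 X" "\<And>n. l2_norm X (f n) \<le> R" and lim: "\<And>x. (\<lambda>n. f n x) \<longlonglongrightarrow> g x"
  shows "g \<in> L2 X"
proof -
  have fm [measurable]: "f n \<in> borel_measurable (lebesgue_on X)" for n by (rule L2_measurable[OF f(1)])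
  have gm [measurable]: "g \<in> borel_measurable (lebesgue_on X)"
    by (rule borel_measurable_LIMSEQ_metric[OF fm lim])
  have "(\<integral>\<^sup>+x. ennreal ((norm (g x))\<^sup>2) \<partial>lebesgue_on X)
      = (\<integral>\<^sup>+x. liminf (\<lambda>n. ennreal ((norm (f n x))\<^sup>2)) \<partial>lebesgue_on X)"
    by (intro nn_integral_cong lim_imp_Liminf[symmetric] tendsto_ennrealI tendsto_power tendsto_norm lim) simp
  also have "\<dots> \<le> liminf (\<lambda>n. \<integral>\<^sup>+x. ennreal ((norm (f n x))\<^sup>2) \<partial>lebesgue_on X)"
    by (rule nn_integral_liminf) measurable
  also have "\<dots> \<le> liminf (\<lambda>n. ennreal (R\<^sup>2))"
  proof (intro Liminf_mono always_eventually allI)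
    fix n
    have "(\<integral>\<^sup>+x. ennreal ((norm (f n x))\<^sup>2) \<partial>lebesgue_on X) = ennreal ((l2_norm X (f n))\<^sup>2)"
      unfolding l2_norm_power2 by (intro nn_integral_eq_integral L2_integrable_square f) simp
    also have "\<dots> \<le> ennreal (R\<^sup>2)" by (intro ennreal_leI power_mono f) simp
    finally show "(\<integral>\<^sup>+x. ennreal ((norm (f n x))\<^sup>2) \<partial>lebesgue_on X) \<le> ennreal (R\<^sup>2)" .
  qed
  also have "\<dots> < \<infinity>" by (simp add: Liminf_const)
  finally have "integrable (lebesgue_on X) (\<lambda>x. (norm (g x))\<^sup>2)"
    by (intro integrableI_nonneg) auto
  then show ?thesis by (simp add: L2_def)
qed

lemma integral_lebesgue_on_mono_set:
  fixes h :: "'a::euclidean_space \<Rightarrow> real"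
  assumes h: "integrable (lebesgue_on X) h" "\<And>x. 0 \<le> h x"
    and s: "X \<in> sets lebesgue" "B \<in> sets lebesgue" "B \<subseteq> X"
  shows "(\<integral>x. h x \<partial>lebesgue_on B) \<le> (\<integral>x. h x \<partial>lebesgue_on X)"
proof -
  have i: "integrable lebesgue (\<lambda>x. indicator X x *\<^sub>R h x)"
    using h(1) s(1) by (simp add: integrable_restrict_space)
  have "integrable lebesgue (\<lambda>x. indicator B x *\<^sub>R (indicator X x *\<^sub>R h x))"
    by (rule integrable_mult_indicator[OF s(2) i])
  then have le: "(\<integral>x. indicator B x *\<^sub>R (indicator X x *\<^sub>R h x) \<partial>lebesgue) \<le> (\<integral>x. indicator X x *\<^sub>R h x \<partial>lebesgue)"
    by (rule integral_mono[OF _ i]) (use h(2) in \<open>auto simp: indicator_def\<close>)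
  have eq: "(\<lambda>x. indicator B x *\<^sub>R (indicator X x *\<^sub>R h x)) = (\<lambda>x. indicator B x *\<^sub>R h x)"
    using s(3) by (auto simp: indicator_def fun_eq_iff)
  show ?thesis using le[unfolded eq] s by (simp add: integral_restrict_space)
qed

lemma abs_arctan_le: "\<bar>arctan x\<bar> \<le> \<bar>x\<bar>" for x :: real
proof -
  have "norm (arctan x - arctan 0) \<le> 1 * norm (x - 0)"
  proof (rule field_differentiable_bound[of UNIV])
    show "(arctan has_field_derivative inverse (1 + z\<^sup>2)) (at z within UNIV)" for z :: real by (rule DERIV_arctan)
    show "norm (inverse (1 + z\<^sup>2)) \<le> 1" for z :: real by (simp add: inverse_le_1_iff)
  qed auto
  then show ?thesis by simp
qed

lemma distr_div_is_function:
  assumes X: "open X" "bounded X" and v: "v \<in> H10_vec X"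
  shows "is_function X (distr_div X v) (\<lambda>x. trace (grad_mat X v x))"
proof -
  have Xl: "X \<in> lmeasurable" using X by (auto simp: lmeasurable_open)
  have w: "wgrad X (\<lambda>x. v x $ i) \<in> L2 X" "is_function X (distr_grad X (\<lambda>x. v x $ i)) (wgrad X (\<lambda>x. v x $ i))" for i
    using H1_wgrad[OF X(1) H10_H1[OF H10_vec_nth[OF v]]] by auto
  have "distr_div X v \<phi> = (\<integral>x. \<phi> x * trace (grad_mat X v x) \<partial>lebesgue_on X)" if \<phi>: "\<phi> \<in> test_functions X" for \<phi>
  proof -
    have "distr_div X v \<phi> = (\<Sum>i\<in>UNIV. \<integral>x. \<phi> x * wgrad X (\<lambda>x. v x $ i) x $ i \<partial>lebesgue_on X)"
      using w(2) \<phi> by (simp add: distr_div_def distr_pd_def is_function_grad_iff[OF X(1)])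
    also have "\<dots> = (\<integral>x. (\<Sum>i\<in>UNIV. \<phi> x * wgrad X (\<lambda>x. v x $ i) x $ i) \<partial>lebesgue_on X)"
      by (intro Bochner_Integration.integral_sum[symmetric]
          integrable_test_mult(1)[OF X(1) L2_locally_integrable[OF L2_nth[OF w(1)] Xl] \<phi>])
    finally show ?thesis by (simp add: trace_def grad_mat_def sum_distrib_left)
  qed
  then show ?thesis
    using L2_locally_integrable[OF L2_bounded_linear[OF linear_trace[unfolded linear_conv_bounded_linear] grad_mat_L2[OF X(1) v]] Xl]
    by (simp add: is_function_def distr_eq_def)
qed

lemma estimate_of_solution:
  fixes X :: "(real^'n) set" and t :: "real^'n^'n \<Rightarrow> 'd::euclidean_space" and s :: "real^'n^'n \<Rightarrow> 'e::euclidean_space"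
  assumes X: "X \<in> lmeasurable" and t: "bounded_linear t" and s: "bounded_linear s"
    and c: "conjugate_on X t s u v" and u: "u \<in> L2 X" and v: "v \<in> L2 X" and G: "G \<in> grad_fields X"
    and tG: "AE x in lebesgue_on X. t (G x) = u x" and sG: "(l2_norm X (\<lambda>x. s (G x)))\<^sup>2 \<le> (l2_norm X G)\<^sup>2"
    and le: "(l2_norm X G)\<^sup>2 \<le> C * (l2_norm X u)\<^sup>2" and C: "0 \<le> C"
  shows "(l2_norm X u)\<^sup>2 \<le> C * (l2_norm X v)\<^sup>2"
proof -
  have GL: "G \<in> L2 X" by (rule grad_fields_L2[OF G])
  note tL = L2_bounded_linear[OF t GL] and sL = L2_bounded_linear[OF s GL]
  let ?n = "(l2_norm X u)\<^sup>2" and ?m = "(l2_norm X v)\<^sup>2"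
  have "?n = l2_inner X u (\<lambda>x. t (G x))"
    using l2_inner_cong_AE[OF tG L2_measurable[OF tL] L2_measurable[OF u] L2_measurable[OF u]] L2.B_sym[OF tL u]
    by (simp add: l2_norm_square)
  also have "\<dots> = l2_inner X v (\<lambda>x. s (G x))" by (rule conjugate_on_grad_fields[OF X t s c u v G])
  finally have "?n\<^sup>2 \<le> ?m * (l2_norm X (\<lambda>x. s (G x)))\<^sup>2"
    using power_mono[OF l2_inner_le[OF v sL] abs_ge_zero, of 2] by (simp add: power_mult_distrib)
  also have "\<dots> \<le> ?m * (C * ?n)" by (rule mult_left_mono[OF order_trans[OF sG le]]) simp
  finally have le': "?n * ?n \<le> ?n * (C * ?m)" by (simp add: power2_eq_square mult_ac)
  show ?thesis
  proof (cases "?n = 0")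
    case False
    then have "0 < ?n" by simp
    with le' show ?thesis by (rule mult_left_le_imp_le)
  qed (use C in simp)
qed

lemma friedrichs_velte_mono:
  assumes "friedrichs_velte cj X C" "C \<le> D" shows "friedrichs_velte cj X D"
  unfolding friedrichs_velte_def
proof (intro ballI impI)
  fix u v assume uv: "u \<in> L2 X" "v \<in> L2 X" "cj X u v \<and> mean X u = 0"
  have "C * (l2_norm X v)\<^sup>2 \<le> D * (l2_norm X v)\<^sup>2" by (rule mult_right_mono[OF assms(2)]) simp
  moreover have "(l2_norm X u)\<^sup>2 \<le> C * (l2_norm X v)\<^sup>2"
    by (rule assms(1)[unfolded friedrichs_velte_def, rule_format, OF uv])
  ultimately show "(l2_norm X u)\<^sup>2 \<le> D * (l2_norm X v)\<^sup>2" by linarith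
qed

lemma friedrichs_velte_closed:
  assumes "\<And>n::nat. friedrichs_velte cj X (C + 1 / (real n + 1))" shows "friedrichs_velte cj X C"
  unfolding friedrichs_velte_def
proof (intro ballI impI)
  fix u v assume uv: "u \<in> L2 X" "v \<in> L2 X" "cj X u v \<and> mean X u = 0"
  show "(l2_norm X u)\<^sup>2 \<le> C * (l2_norm X v)\<^sup>2"
    by (rule le_mult_limit) (rule assms[unfolded friedrichs_velte_def, rule_format, OF uv])
qed

lemma improved_poincare_mono:
  assumes "improved_poincare X C" "C \<le> D" shows "improved_poincare X D"
  unfolding improved_poincare_def
proof (intro allI impI)
  fix u g assume *: "locally_integrable X u \<and> is_function X (distr_grad X u) g \<and> (\<lambda>x. bdist X x *\<^sub>R g x) \<in> L2 X"
  let ?d = "(l2_norm X (\<lambda>x. bdist X x *\<^sub>R g x))\<^sup>2"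
  have "C * ?d \<le> D * ?d" by (rule mult_right_mono[OF assms(2)]) simp
  then show "integrable (lebesgue_on X) u \<and> (\<lambda>x. u x - mean X u) \<in> L2 X \<and>
      (l2_norm X (\<lambda>x. u x - mean X u))\<^sup>2 \<le> D * ?d"
    using assms(1)[unfolded improved_poincare_def, rule_format, OF *] by auto
qed

lemma improved_poincare_closed:
  assumes "\<And>n::nat. improved_poincare X (C + 1 / (real n + 1))" shows "improved_poincare X C"
  unfolding improved_poincare_def
proof (intro allI impI conjI)
  fix u g assume *: "locally_integrable X u \<and> is_function X (distr_grad X u) g \<and> (\<lambda>x. bdist X x *\<^sub>R g x) \<in> L2 X"
  note a = assms[unfolded improved_poincare_def, rule_format, OF *]
  show "integrable (lebesgue_on X) u" "(\<lambda>x. u x - mean X u) \<in> L2 X" using a[of 0] by auto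
  show "(l2_norm X (\<lambda>x. u x - mean X u))\<^sup>2 \<le> C * (l2_norm X (\<lambda>x. bdist X x *\<^sub>R g x))\<^sup>2"
    by (rule le_mult_limit) (use a in blast)
qed

lemma hardy_mono:
  assumes "hardy X C" "C \<le> D" shows "hardy X D"
  unfolding hardy_def
proof
  fix u assume u: "u \<in> H10_vec X"
  have "C * (h1_norm X u)\<^sup>2 \<le> D * (h1_norm X u)\<^sup>2" by (rule mult_right_mono[OF assms(2)]) simp
  then show "(\<lambda>x. u x /\<^sub>R bdist X x) \<in> L2 X \<and>
      (l2_norm X (\<lambda>x. u x /\<^sub>R bdist X x))\<^sup>2 \<le> D * (h1_norm X u)\<^sup>2"
    using bspec[OF assms(1)[unfolded hardy_def] u] by auto
qed

lemma hardy_closed: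
  assumes "\<And>n::nat. hardy X (C + 1 / (real n + 1))" shows "hardy X C"
  unfolding hardy_def
proof (intro ballI conjI)
  fix u assume u: "u \<in> H10_vec X"
  note a = bspec[OF assms[unfolded hardy_def] u]
  show "(\<lambda>x. u x /\<^sub>R bdist X x) \<in> L2 X" using a[of 0] by auto
  show "(l2_norm X (\<lambda>x. u x /\<^sub>R bdist X x))\<^sup>2 \<le> C * (h1_norm X u)\<^sup>2"
    by (rule le_mult_limit) (use a in blast)
qed

lemma hardy_least:
  assumes "bounded_domain X" "supports (hardy X)" shows "hardy X (least_constant (hardy X))"
  by (rule least_constant_properties(1)[where I="hardy X", OF assms(2)])
    (fact hardy_nonneg[OF assms(1)] hardy_closed hardy_mono)+

lemma least_constant_comparison:
  assumes F: "supports F" "\<And>C. F C \<Longrightarrow> 0 \<le> C" "\<And>C. (\<And>n::nat. F (C + 1 / (real n + 1))) \<Longrightarrow> F C"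
      "\<And>C D. F C \<Longrightarrow> C \<le> D \<Longrightarrow> F D"
    and P: "supports P" "\<And>C. P C \<Longrightarrow> 0 \<le> C" "\<And>C. (\<And>n::nat. P (C + 1 / (real n + 1))) \<Longrightarrow> P C"
      "\<And>C D. P C \<Longrightarrow> C \<le> D \<Longrightarrow> P D"
    and PF: "\<And>C. P C \<Longrightarrow> F (4 * C)" and FP: "\<And>C. F C \<Longrightarrow> P (H * (1 + C))"
  shows "1 / 4 * least_constant F \<le> least_constant P \<and> least_constant P \<le> H * (1 + least_constant F)"
proof
  have "F (least_constant F)" by (rule least_constant_properties(1)[of F]) (fact F)+
  then have "P (H * (1 + least_constant F))" by (rule FP)
  then show "least_constant P \<le> H * (1 + least_constant F)"
    by (rule least_constant_properties(2)[of P, OF P(1), rotated 3]) (fact P)+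
  have "P (least_constant P)" by (rule least_constant_properties(1)[of P]) (fact P)+
  then have "F (4 * least_constant P)" by (rule PF)
  then have "least_constant F \<le> 4 * least_constant P"
    by (rule least_constant_properties(2)[of F, OF F(1), rotated 3]) (fact F)+
  then show "1 / 4 * least_constant F \<le> least_constant P" by simp
qed

locale conjugate_domain = antisymmetric_part s for s :: "real^'n^'n \<Rightarrow> 'e::euclidean_space" +
  fixes X :: "(real^'n) set" and cj :: "(real^'n) set \<Rightarrow> (real^'n \<Rightarrow> real) \<Rightarrow> (real^'n \<Rightarrow> 'e) \<Rightarrow> bool"
  assumes dom: "bounded_domain X" and sup: "supports (hardy X)"
    and cj_conjugate: "\<And>u v. u \<in> L2 X \<Longrightarrow> v \<in> L2 X \<Longrightarrow> cj X u v \<Longrightarrow> conjugate_on X trace s u v"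
    and conjugate_cj: "\<And>u G. u \<in> L2 X \<Longrightarrow> G \<in> grad_fields X \<Longrightarrow>
      conjugate_on X trace s u (\<lambda>x. s (G x)) \<Longrightarrow> cj X u (\<lambda>x. s (G x))"
    and cj_const: "\<And>b. cj X (\<lambda>x. 0) (\<lambda>x. b)"
begin

lemma o: "open X" "bounded X" and Xl: "X \<in> lmeasurable" and Xm: "X \<in> sets lebesgue"
  using dom by (auto simp: bounded_domain_def lmeasurable_open)

definition mean_zero :: "(real^'n \<Rightarrow> real) set" where "mean_zero = {u \<in> L2 X. mean X u = 0}"

lemma mean_comb:
  "u \<in> L2 X \<Longrightarrow> w \<in> L2 X \<Longrightarrow> mean X (\<lambda>x. a *\<^sub>R u x + b *\<^sub>R w x) = a * mean X u + b * mean X w"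
  using L2_integrable[OF Xl, of u] L2_integrable[OF Xl, of w] by (simp add: mean_def add_divide_distrib)

lemma mean_const: "mean X (\<lambda>x. c) = c"
  using bounded_domain_measure_pos[OF dom] unfolding mean_def integral_lebesgue_on_const[OF Xl] by simp

lemma mean_zero_comb: "f \<in> mean_zero \<Longrightarrow> g \<in> mean_zero \<Longrightarrow> (\<lambda>x. a *\<^sub>R f x + b *\<^sub>R g x) \<in> mean_zero"
  using mean_comb[of f g a b] L2_comb[of f X g a b] by (simp add: mean_zero_def)

lemma trace_mean_zero:
  assumes G: "G \<in> grad_fields X" shows "(\<lambda>x. trace (G x)) \<in> mean_zero"
proof -
  have "conjugate_on X trace s (\<lambda>x. 1) (\<lambda>x. 0)"
    unfolding conjugate_on_def
    by (simp add: l2_inner_trace_jac[OF o L2_const[OF Xl]] pd_pairing_def test_integral_pd[OF test_fieldsD Xm])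
      (simp add: l2_inner_def)
  from conjugate_on_grad_fields[OF Xl bounded_linear_trace bounded_linear_s this L2_const[OF Xl] L2_zero G]
  have "(\<integral>x. trace (G x) \<partial>lebesgue_on X) = 0" by (simp add: l2_inner_def)
  then show ?thesis
    using L2_bounded_linear[OF bounded_linear_trace grad_fields_L2[OF G]] by (simp add: mean_zero_def mean_def)
qed

lemma friedrichs_velte_nonneg:
  assumes "friedrichs_velte cj X \<Gamma>" shows "0 \<le> \<Gamma>"
proof -
  obtain b :: 'e where b: "b \<in> Basis" using nonempty_Basis by blast
  have "(l2_norm X (\<lambda>x. 0::real))\<^sup>2 \<le> \<Gamma> * (l2_norm X (\<lambda>x. b))\<^sup>2"
    using assms cj_const[of b] L2_const[OF Xl, of b] mean_const[of 0] by (simp add: friedrichs_velte_def)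
  then have "0 \<le> \<Gamma> * measure lebesgue X"
    by (simp add: l2_norm_const[OF Xl] norm_Basis[OF b])
  then show ?thesis using bounded_domain_measure_pos[OF dom] by (simp add: zero_le_mult_iff)
qed

lemma friedrichs_velte_surjective:
  assumes FV: "friedrichs_velte cj X \<Gamma>" and f: "f \<in> mean_zero"
  shows "\<exists>G\<in>grad_fields X. (AE x in lebesgue_on X. trace (G x) = f x) \<and>
    (l2_norm X G)\<^sup>2 \<le> (1 + \<Gamma>) * (l2_norm X f)\<^sup>2"
proof (rule conjugate_estimate_imp_surjective[OF Xl bounded_linear_trace bounded_linear_s norm_grad_fields[OF o]
      _ mean_zero_comb trace_mean_zero friedrichs_velte_nonneg[OF FV] _ f])
  show "mean_zero \<subseteq> L2 X" by (auto simp: mean_zero_def)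
  fix u G assume u: "u \<in> mean_zero" and G: "G \<in> grad_fields X"
    and K: "\<And>K. K \<in> grad_fields X \<Longrightarrow> l2_inner X u (\<lambda>x. trace (K x)) = l2_inner X (\<lambda>x. s (G x)) (\<lambda>x. s (K x))"
  have "conjugate_on X trace s u (\<lambda>x. s (G x))"
    unfolding conjugate_on_def using K[OF jac_grad_fields[OF _ Xl]] by blast
  then show "(l2_norm X u)\<^sup>2 \<le> \<Gamma> * (l2_norm X (\<lambda>x. s (G x)))\<^sup>2"
    using FV conjugate_cj[OF _ G] L2_bounded_linear[OF bounded_linear_s grad_fields_L2[OF G]] u
    by (simp add: friedrichs_velte_def mean_zero_def)
qed

lemma friedrichs_velte_imp_babuska_aziz:
  assumes FV: "friedrichs_velte cj X \<Gamma>" shows "babuska_aziz_div X (1 + \<Gamma>)"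
  unfolding babuska_aziz_div_def
proof (intro ballI impI)
  fix f assume f: "f \<in> L2 X" "mean X f = 0"
  then obtain G where G: "G \<in> grad_fields X" "AE x in lebesgue_on X. trace (G x) = f x"
    "(l2_norm X G)\<^sup>2 \<le> (1 + \<Gamma>) * (l2_norm X f)\<^sup>2"
    using friedrichs_velte_surjective[OF FV, of f] by (auto simp: mean_zero_def)
  obtain H where H: "hardy X H" using sup by (auto simp: supports_def)
  obtain v where v: "v \<in> H10_vec X" "AE x in lebesgue_on X. grad_mat X v x = G x"
    by (rule grad_fields_H10_vec[OF o H G(1)]) (rule that, assumption+)
  have "AE x in lebesgue_on X. trace (grad_mat X v x) = f x" using v(2) G(2) by eventually_elim simp
  then have "is_function X (distr_div X v) f"
    by (rule is_function_cong_AE[OF o(1) distr_div_is_function[OF o v(1)] L2_locally_integrable[OF f(1) Xl]])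
  moreover have "h1_norm X v = l2_norm X G"
    using l2_norm_cong_AE[OF v(2) L2_measurable[OF grad_mat_L2[OF o(1) v(1)]] L2_measurable[OF grad_fields_L2[OF G(1)]]]
    by (simp add: h1_norm_eq[OF o(1) v(1)])
  ultimately show "\<exists>v\<in>H10_vec X. is_function X (distr_div X v) f \<and> (h1_norm X v)\<^sup>2 \<le> (1 + \<Gamma>) * (l2_norm X f)\<^sup>2"
    using v(1) G(3) by auto
qed

lemma babuska_aziz_imp_friedrichs_velte:
  assumes BA: "babuska_aziz_div X C" shows "friedrichs_velte cj X \<bar>C\<bar>"
  unfolding friedrichs_velte_def
proof (intro ballI impI)
  fix u v assume u: "u \<in> L2 X" and v: "v \<in> L2 X" and uv: "cj X u v \<and> mean X u = 0"
  then obtain w where w: "w \<in> H10_vec X" "is_function X (distr_div X w) u"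
      "(h1_norm X w)\<^sup>2 \<le> C * (l2_norm X u)\<^sup>2"
    using BA by (auto simp: babuska_aziz_div_def)
  note G = grad_mat_grad_fields[OF o w(1)]
  show "(l2_norm X u)\<^sup>2 \<le> \<bar>C\<bar> * (l2_norm X v)\<^sup>2"
  proof (rule estimate_of_solution[OF Xl bounded_linear_trace bounded_linear_s cj_conjugate[OF u v] u v G])
    show "AE x in lebesgue_on X. trace (grad_mat X w x) = u x"
      by (rule is_function_unique[OF o(1) distr_div_is_function[OF o w(1)] w(2)])
    show "(l2_norm X (\<lambda>x. s (grad_mat X w x)))\<^sup>2 \<le> (l2_norm X (grad_mat X w))\<^sup>2"
      using norm_grad_fields[OF o G] by simp
    have "C * (l2_norm X u)\<^sup>2 \<le> \<bar>C\<bar> * (l2_norm X u)\<^sup>2" by (intro mult_right_mono) auto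
    with w(3) show "(l2_norm X (grad_mat X w))\<^sup>2 \<le> \<bar>C\<bar> * (l2_norm X u)\<^sup>2"
      by (simp add: h1_norm_eq[OF o(1) w(1)])
  qed (use uv in auto)
qed

lemma improved_poincare_nonneg:
  assumes IP: "improved_poincare X P" shows "0 \<le> P"
proof (rule ccontr)
  assume neg: "\<not> 0 \<le> P"
  obtain \<phi> where \<phi>: "\<phi> \<in> test_functions X" "\<forall>i. \<not> (AE x in lebesgue_on X. pd i \<phi> x = 0)"
    by (rule nontrivial_test_function[OF dom]) (rule that, assumption, blast)
  fix k :: 'n
  let ?u = "pd k \<phi>" and ?g = "\<lambda>x. \<chi> i. pd i (pd k \<phi>) x"
  have t: "?u \<in> test_functions X" by (rule test_pd[OF \<phi>(1)])
  have uL: "?u \<in> L2 X" by (rule test_L2[OF t Xl])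
  have m: "mean X ?u = 0" by (simp add: mean_def test_integral_pd[OF \<phi>(1) Xm])
  have "(l2_norm X ?u)\<^sup>2 \<le> P * (l2_norm X (\<lambda>x. bdist X x *\<^sub>R ?g x))\<^sup>2"
    using IP[unfolded improved_poincare_def, rule_format, of ?u ?g] L2_locally_integrable[OF uL Xl]
      test_is_function_grad(1)[OF o t] L2_bdist_scaleR[OF o(2) test_is_function_grad(2)[OF o t]] by (simp add: m)
  also have "\<dots> \<le> 0" using neg by (intro mult_nonpos_nonneg) auto
  finally have "l2_norm X ?u = 0" by simp
  then show False using \<phi>(2) l2_norm_eq_0_iff[OF uL] by blast
qed

lemma improved_poincare_imp_friedrichs_velte:
  assumes IP: "improved_poincare X P" shows "friedrichs_velte cj X (4 * P)"
  unfolding friedrichs_velte_def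
proof (intro ballI impI)
  fix u v assume u: "u \<in> L2 X" and v: "v \<in> L2 X" and uv: "cj X u v \<and> mean X u = 0"
  then have c: "conjugate_on X trace s u v" using cj_conjugate by blast
  obtain g where g: "is_function X (distr_grad X u) g" "(\<lambda>x. bdist X x *\<^sub>R g x) \<in> L2 X"
    "(l2_norm X (\<lambda>x. bdist X x *\<^sub>R g x))\<^sup>2 \<le> 4 * (l2_norm X v)\<^sup>2"
    by (rule conjugate_weak_gradient[OF dom antisymmetric_part_axioms c u v]) (rule that, assumption+)
  have "(l2_norm X u)\<^sup>2 \<le> P * (l2_norm X (\<lambda>x. bdist X x *\<^sub>R g x))\<^sup>2"
    using IP[unfolded improved_poincare_def, rule_format, of u g] g L2_locally_integrable[OF u Xl] uv by simp
  also have "\<dots> \<le> P * (4 * (l2_norm X v)\<^sup>2)"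
    by (rule mult_left_mono[OF g(3) improved_poincare_nonneg[OF IP]])
  finally show "(l2_norm X u)\<^sup>2 \<le> 4 * P * (l2_norm X v)\<^sup>2" by simp
qed

lemma improved_poincare_L2:
  assumes FV: "friedrichs_velte cj X \<Gamma>" and H: "hardy X H" and u: "u \<in> L2 X"
    and g: "is_function X (distr_grad X u) g" "(\<lambda>x. bdist X x *\<^sub>R g x) \<in> L2 X"
  shows "(\<lambda>x. u x - mean X u) \<in> L2 X"
    and "(l2_norm X (\<lambda>x. u x - mean X u))\<^sup>2 \<le> H * (1 + \<Gamma>) * (l2_norm X (\<lambda>x. bdist X x *\<^sub>R g x))\<^sup>2"
proof -
  let ?f = "\<lambda>x. u x - mean X u"
  note cL = L2_const[OF Xl, of "mean X u"]
  show fL: "?f \<in> L2 X" by (rule L2.diff_mem[OF u cL])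
  have "mean X ?f = 0" using mean_comb[OF u cL, of 1 "-1"] by (simp add: mean_const)
  then obtain G where G: "G \<in> grad_fields X" "AE x in lebesgue_on X. trace (G x) = ?f x"
    "(l2_norm X G)\<^sup>2 \<le> (1 + \<Gamma>) * (l2_norm X ?f)\<^sup>2"
    using friedrichs_velte_surjective[OF FV, of ?f] fL by (auto simp: mean_zero_def)
  have fg: "is_function X (distr_grad X ?f) g"
    using is_function_grad_comb[OF o(1) L2_locally_integrable[OF u Xl] L2_locally_integrable[OF cL Xl]
        g(1) is_function_grad_const[OF o], of 1 "-1"] by simp
  show "(l2_norm X ?f)\<^sup>2 \<le> H * (1 + \<Gamma>) * (l2_norm X (\<lambda>x. bdist X x *\<^sub>R g x))\<^sup>2"
  proof (rule improved_poincare_core[OF dom H bounded_linear_trace fL g(2) _ G])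
    show "l2_inner X ?f (\<lambda>x. trace (jac \<Psi> x)) = - (\<integral>x. g x \<bullet> \<Psi> x \<partial>lebesgue_on X)" if "\<Psi> \<in> test_fields X" for \<Psi>
      using distr_grad_field[OF o fL that] is_function_field[OF o(1) fg that] by simp
  qed (use friedrichs_velte_nonneg[OF FV] in simp)
qed

text \<open>The truncations \<open>M arctan (u / M)\<close> reduce the improved Poincare inequality to square integrable functions.
  Their means stay bounded because they are bounded in \<open>L\<^sub>1\<close> of a fixed ball.\<close>

lemma improved_poincare_imp_L2:
  assumes FV: "friedrichs_velte cj X \<Gamma>" and H: "hardy X H" and u: "locally_integrable X u"
    and g: "is_function X (distr_grad X u) g" "(\<lambda>x. bdist X x *\<^sub>R g x) \<in> L2 X"
  shows "u \<in> L2 X"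
proof -
  define M where "M n = real n + 1" for n :: nat
  define w where "w n x = M n * arctan (u x / M n)" for n x
  define F' where "F' n t = 1 / (1 + (t / M n)\<^sup>2)" for n t
  have M: "0 < M n" for n by (simp add: M_def)
  have um: "u \<in> borel_measurable (lebesgue_on X)" by (rule locally_integrable_measurable[OF o(1) u])
  have F': "0 \<le> F' n t" "F' n t \<le> 1" "\<bar>F' n t\<bar> \<le> 1" for n t
  proof -
    have "0 < 1 + (t / M n)\<^sup>2" by (rule add_pos_nonneg) auto
    then show "0 \<le> F' n t" "F' n t \<le> 1" "\<bar>F' n t\<bar> \<le> 1"
      unfolding F'_def by (simp_all only: abs_divide pos_divide_le_eq abs_of_pos abs_one) auto
  qed
  have F: "((\<lambda>t. M n * arctan (t / M n)) has_real_derivative F' n t) (at t)" for n t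
  proof -
    have "((\<lambda>t. t / M n) has_real_derivative 1 / M n) (at t)"
      by (rule DERIV_cdivide[OF DERIV_ident])
    from DERIV_cmult[OF DERIV_chain2[OF DERIV_arctan this], of "M n"] show ?thesis
      by (rule DERIV_cong) (use M[of n] in \<open>simp add: F'_def inverse_eq_divide\<close>)
  qed
  have F'c: "continuous_on UNIV (F' n)" for n
  proof -
    have "1 + (t / M n)\<^sup>2 \<noteq> 0" for t by (rule less_imp_neq[symmetric, OF add_pos_nonneg]) auto
    then show ?thesis unfolding F'_def using M[of n] by (intro continuous_intros ballI) auto
  qed
  note chain = weak_gradient_chain[OF o(1) u g(1) F F'c F'(3), folded w_def]
  have wm: "w n \<in> borel_measurable (lebesgue_on X)" for n
    by (rule locally_integrable_measurable[OF o(1)]) (use chain(1) in \<open>simp add: w_def[abs_def]\<close>)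
  have wb: "\<bar>w n x\<bar> \<le> M n * 2" for n x
  proof -
    have "\<bar>arctan (u x / M n)\<bar> \<le> 2"
      using arctan_lbound[of "u x / M n"] arctan_ubound[of "u x / M n"] pi_less_4 by (simp add: abs_le_iff)
    then show ?thesis using M[of n] by (simp add: w_def abs_mult)
  qed
  have wL: "w n \<in> L2 X" for n
    by (rule L2I_bound[OF wm L2_integrable_square[OF L2_const[OF Xl, of "M n * 2"]]])
      (intro AE_I2, use power_mono[OF wb abs_ge_zero, of n _ 2] in simp)
  have wu: "\<bar>w n x\<bar> \<le> \<bar>u x\<bar>" for n x
  proof -
    have "\<bar>arctan (u x / M n)\<bar> \<le> \<bar>u x / M n\<bar>" by (rule abs_arctan_le)
    then show ?thesis using M[of n] by (simp add: w_def abs_mult field_simps)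
  qed
  have lim: "(\<lambda>n. w n x) \<longlonglongrightarrow> u x" for x
    proof -
    have "(\<lambda>n. 1 / M n) \<longlonglongrightarrow> 0"
      using LIMSEQ_inverse_real_of_nat by (simp add: M_def inverse_eq_divide add.commute)
    from tendsto_mult_right[OF this, of "u x"] have h: "(\<lambda>n. u x / M n) \<longlonglongrightarrow> 0" by (simp add: mult.commute)
    have "isCont (\<lambda>t::real. if t = 0 then 1 else arctan t / t) 0"
      using DERIV_arctan[of 0] unfolding DERIV_def isCont_def
      by (auto elim!: Lim_transform_eventually simp: eventually_at_filter)
    from isCont_tendsto_compose[OF this h]
    have "(\<lambda>n. u x * (if u x / M n = 0 then 1 else arctan (u x / M n) / (u x / M n))) \<longlonglongrightarrow> u x * 1"
      by (intro tendsto_mult_left) simp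
    moreover have "u x * (if u x / M n = 0 then 1 else arctan (u x / M n) / (u x / M n)) = w n x" for n
      using M[of n] by (auto simp: w_def)
    ultimately show ?thesis by simp
  qed
  define gg where "gg n x = F' n (u x) *\<^sub>R g x" for n x
  have gm: "g \<in> borel_measurable (lebesgue_on X)"
    by (rule locally_integrable_measurable[OF o(1)]) (use g(1) in \<open>simp add: is_function_def\<close>)
  have ggm: "(\<lambda>x. bdist X x *\<^sub>R gg n x) \<in> borel_measurable (lebesgue_on X)" for n
    unfolding gg_def F'_def
    by (intro borel_measurable_scaleR borel_imp_lebesgue_on_measurable[OF bdist_measurable] gm
        borel_measurable_divide borel_measurable_add borel_measurable_power um borel_measurable_const)
  have gle: "norm (bdist X x *\<^sub>R gg n x) \<le> norm (bdist X x *\<^sub>R g x)" for n x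
    using mult_left_mono[OF mult_right_mono[OF F'(3)[of n "u x"] norm_ge_zero[of "g x"]] bdist_nonneg[of X x]]
    by (simp add: gg_def abs_mult mult.assoc)
  have ggL: "(\<lambda>x. bdist X x *\<^sub>R gg n x) \<in> L2 X" for n
    by (rule L2I_bound[OF ggm L2_integrable_square[OF g(2)]]) (intro AE_I2 power_mono gle norm_ge_zero)
  have ggle: "(l2_norm X (\<lambda>x. bdist X x *\<^sub>R gg n x))\<^sup>2 \<le> (l2_norm X (\<lambda>x. bdist X x *\<^sub>R g x))\<^sup>2" for n
    by (rule power_mono[OF l2_norm_mono_AE[OF _ ggm g(2)]]) (use gle in auto)
  have ggf: "is_function X (distr_grad X (w n)) (gg n)" for n
    using chain(2)[of n] by (simp add: w_def[abs_def] gg_def[abs_def])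
  define K where "K = sqrt (H * (1 + \<Gamma>) * (l2_norm X (\<lambda>x. bdist X x *\<^sub>R g x))\<^sup>2)"
  have HG: "0 \<le> H * (1 + \<Gamma>)" using hardy_nonneg[OF dom H] friedrichs_velte_nonneg[OF FV] by simp
  have dL: "(\<lambda>x. w n x - mean X (w n)) \<in> L2 X" for n by (rule improved_poincare_L2(1)[OF FV H wL ggf ggL])
  have dK: "l2_norm X (\<lambda>x. w n x - mean X (w n)) \<le> K" for n
    unfolding K_def
    by (rule real_le_rsqrt, rule order_trans[OF improved_poincare_L2(2)[OF FV H wL ggf ggL] mult_left_mono[OF ggle HG]])
  obtain a where "a \<in> X" using dom by (auto simp: bounded_domain_def)
  then obtain r where r: "r > 0" "cball a r \<subseteq> X" using o(1) open_contains_cball by blast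
  let ?B = "cball a r"
  have Bl: "?B \<in> lmeasurable" by simp
  have "\<not> negligible ?B"
    using open_not_negligible[of "ball a r"] negligible_subset[of ?B "ball a r"] ball_subset_cball r(1) by auto
  then have Bpos: "0 < measure lebesgue ?B"
    using negligible_iff_measure[of ?B] Bl measure_nonneg[of lebesgue ?B] by (simp add: less_le)
  define b where "b = (sqrt (measure lebesgue X) * K + (\<integral>x. \<bar>u x\<bar> \<partial>lebesgue_on ?B)) / measure lebesgue ?B"
  have uB: "integrable (lebesgue_on ?B) u" using u r by (simp add: locally_integrable_def)
  have mb: "\<bar>mean X (w n)\<bar> \<le> b" for n
  proof -
    let ?m = "mean X (w n)"
    have iX: "integrable (lebesgue_on X) (w n)" "integrable (lebesgue_on X) (\<lambda>x. \<bar>w n x - ?m\<bar>)"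
      using L2_integrable[OF Xl wL] L2_integrable[OF Xl dL] by auto
    have iB: "integrable (lebesgue_on ?B) (w n)" "integrable (lebesgue_on ?B) (\<lambda>x. \<bar>w n x - ?m\<bar>)"
      using integrable_imp_locally_integrable[OF iX(1) Xm] integrable_imp_locally_integrable[OF iX(2) Xm] r(2)
      by (auto simp: locally_integrable_def)
    have "\<bar>?m\<bar> * measure lebesgue ?B = (\<integral>x. \<bar>?m\<bar> \<partial>lebesgue_on ?B)"
      unfolding integral_lebesgue_on_const[OF Bl] by simp
    also have "\<dots> \<le> (\<integral>x. \<bar>w n x - ?m\<bar> + \<bar>u x\<bar> \<partial>lebesgue_on ?B)"
    proof (rule integral_mono)
      show "integrable (lebesgue_on ?B) (\<lambda>x. \<bar>?m\<bar>)" using L2_integrable[OF Bl L2_const[OF Bl]] .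
      show "integrable (lebesgue_on ?B) (\<lambda>x. \<bar>w n x - ?m\<bar> + \<bar>u x\<bar>)" using iB(2) uB by simp
      show "\<bar>?m\<bar> \<le> \<bar>w n x - ?m\<bar> + \<bar>u x\<bar>" for x using wu[of n x] by linarith
    qed
    also have "\<dots> = (\<integral>x. \<bar>w n x - ?m\<bar> \<partial>lebesgue_on ?B) + (\<integral>x. \<bar>u x\<bar> \<partial>lebesgue_on ?B)"
      using iB(2) uB by simp
    finally have 1: "\<bar>?m\<bar> * measure lebesgue ?B
        \<le> (\<integral>x. \<bar>w n x - ?m\<bar> \<partial>lebesgue_on ?B) + (\<integral>x. \<bar>u x\<bar> \<partial>lebesgue_on ?B)" .
    have 2: "(\<integral>x. \<bar>w n x - ?m\<bar> \<partial>lebesgue_on ?B) \<le> (\<integral>x. \<bar>w n x - ?m\<bar> \<partial>lebesgue_on X)"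
      by (rule integral_lebesgue_on_mono_set[OF iX(2) _ Xm _ r(2)]) auto
    have 3: "(\<integral>x. \<bar>w n x - ?m\<bar> \<partial>lebesgue_on X) \<le> sqrt (measure lebesgue X) * K"
      using integral_norm_le_l2_norm[OF Xl dL[of n]] mult_left_mono[OF dK[of n], of "sqrt (measure lebesgue X)"] by simp
    have "\<bar>?m\<bar> * measure lebesgue ?B
        \<le> sqrt (measure lebesgue X) * K + (\<integral>x. \<bar>u x\<bar> \<partial>lebesgue_on ?B)" using 1 2 3 by linarith
    then show ?thesis unfolding b_def using Bpos by (simp add: pos_le_divide_eq)
  qed
  have "l2_norm X (w n) \<le> K + l2_norm X (\<lambda>x. b)" for n
  proof -
    have "l2_norm X (w n) \<le> l2_norm X (\<lambda>x. w n x - mean X (w n)) + l2_norm X (\<lambda>x. mean X (w n))"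
      using l2_norm_triangle[OF dL[of n] L2_const[OF Xl, of "mean X (w n)"]] by simp
    moreover have "l2_norm X (\<lambda>x. mean X (w n)) \<le> l2_norm X (\<lambda>x. b)"
      by (rule l2_norm_mono_AE[OF _ borel_measurable_const L2_const[OF Xl]]) (use mb[of n] in auto)
    ultimately show ?thesis using dK[of n] by linarith
  qed
  from L2_pointwise_limit[OF wL this lim] show ?thesis .
qed

lemma friedrichs_velte_imp_improved_poincare:
  assumes FV: "friedrichs_velte cj X \<Gamma>" and H: "hardy X H" shows "improved_poincare X (H * (1 + \<Gamma>))"
  unfolding improved_poincare_def
proof (intro allI impI)
  fix u g assume *: "locally_integrable X u \<and> is_function X (distr_grad X u) g \<and> (\<lambda>x. bdist X x *\<^sub>R g x) \<in> L2 X"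
  have u: "u \<in> L2 X" using improved_poincare_imp_L2[OF FV H] * by blast
  show "integrable (lebesgue_on X) u \<and> (\<lambda>x. u x - mean X u) \<in> L2 X \<and>
    (l2_norm X (\<lambda>x. u x - mean X u))\<^sup>2 \<le> H * (1 + \<Gamma>) * (l2_norm X (\<lambda>x. bdist X x *\<^sub>R g x))\<^sup>2"
    using L2_integrable[OF Xl u] improved_poincare_L2[OF FV H u] * by blast
qed

theorem divergence_equivalence:
  "(supports (friedrichs_velte cj X) \<longleftrightarrow> supports (babuska_aziz_div X)) \<and>
   (supports (friedrichs_velte cj X) \<longleftrightarrow> supports (improved_poincare X)) \<and>
   (supports (improved_poincare X) \<longrightarrow>
     1 / 4 * least_constant (friedrichs_velte cj X) \<le> least_constant (improved_poincare X) \<and>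
     least_constant (improved_poincare X)
       \<le> least_constant (hardy X) * (1 + least_constant (friedrichs_velte cj X)))"
proof (intro conjI impI)
  note H = hardy_least[OF dom sup]
  note FP = friedrichs_velte_imp_improved_poincare[OF _ H] and PF = improved_poincare_imp_friedrichs_velte
  show "supports (friedrichs_velte cj X) \<longleftrightarrow> supports (babuska_aziz_div X)"
    using friedrichs_velte_imp_babuska_aziz babuska_aziz_imp_friedrichs_velte unfolding supports_def by blast
  show eq: "supports (friedrichs_velte cj X) \<longleftrightarrow> supports (improved_poincare X)"
    using FP PF unfolding supports_def by blast
  assume P: "supports (improved_poincare X)"
  have F: "supports (friedrichs_velte cj X)" using eq P by blast
  have "1 / 4 * least_constant (friedrichs_velte cj X) \<le> least_constant (improved_poincare X) \<and>
     least_constant (improved_poincare X)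
       \<le> least_constant (hardy X) * (1 + least_constant (friedrichs_velte cj X))"
    by (rule least_constant_comparison[where F="friedrichs_velte cj X" and P="improved_poincare X"])
      (fact F friedrichs_velte_nonneg friedrichs_velte_closed friedrichs_velte_mono
        P improved_poincare_nonneg improved_poincare_closed improved_poincare_mono PF FP)+
  then show "1 / 4 * least_constant (friedrichs_velte cj X) \<le> least_constant (improved_poincare X)"
    and "least_constant (improved_poincare X)
       \<le> least_constant (hardy X) * (1 + least_constant (friedrichs_velte cj X))" by auto
qed

end

section \<open>The rotation\<close>

text \<open>On Jacobians, \<open>rot3\<close> is the negative of the rotation; the sign makes both conjugacy relations
  take the form \<open>conjugate_on\<close>.\<close>

definition rot2 :: "real^2^2 \<Rightarrow> real" where
  "rot2 A = A $ 1 $ 2 - A $ 2 $ 1"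

definition rot3 :: "real^3^3 \<Rightarrow> real^3" where
  "rot3 A = vector [A $ 2 $ 3 - A $ 3 $ 2, A $ 3 $ 1 - A $ 1 $ 3, A $ 1 $ 2 - A $ 2 $ 1]"

lemma rot3_nth: "rot3 A $ 1 = A $ 2 $ 3 - A $ 3 $ 2" "rot3 A $ 2 = A $ 3 $ 1 - A $ 1 $ 3"
    "rot3 A $ 3 = A $ 1 $ 2 - A $ 2 $ 1"
  by (simp_all add: rot3_def)

interpretation rot2: antisymmetric_part rot2
proof (rule antisymmetric_part.intro)
  show "linear rot2" by (rule linearI) (simp_all add: rot2_def algebra_simps)
  show "(norm (rot2 A))\<^sup>2 = (\<Sum>i\<in>UNIV. \<Sum>j\<in>UNIV. (A $ i $ j - A $ j $ i)\<^sup>2) / 2" for A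
    by (simp add: rot2_def sum_2 power2_commute)
qed

interpretation rot3: antisymmetric_part rot3
proof (rule antisymmetric_part.intro)
  show "linear rot3" by (rule linearI) (simp_all add: vec_eq_iff forall_3 rot3_nth algebra_simps)
  show "(norm (rot3 A))\<^sup>2 = (\<Sum>i\<in>UNIV. \<Sum>j\<in>UNIV. (A $ i $ j - A $ j $ i)\<^sup>2) / 2" for A
  proof -
    have "(norm (rot3 A))\<^sup>2 = (A $ 2 $ 3 - A $ 3 $ 2)\<^sup>2 + (A $ 3 $ 1 - A $ 1 $ 3)\<^sup>2 + (A $ 1 $ 2 - A $ 2 $ 1)\<^sup>2"
      unfolding power2_norm_eq_inner inner_vec_def by (simp add: sum_3 rot3_nth power2_eq_square)
    moreover have "(\<Sum>i\<in>UNIV. \<Sum>j\<in>UNIV. (A $ i $ j - A $ j $ i)\<^sup>2)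
        = 2 * ((A $ 2 $ 3 - A $ 3 $ 2)\<^sup>2 + (A $ 3 $ 1 - A $ 1 $ 3)\<^sup>2 + (A $ 1 $ 2 - A $ 2 $ 1)\<^sup>2)"
      by (simp add: sum_3 power2_commute[of "A $ 3 $ 2"] power2_commute[of "A $ 1 $ 3"] power2_commute[of "A $ 2 $ 1"])
    ultimately show ?thesis by simp
  qed
qed

lemma distr_grad_perp_field:
  assumes X: "open X" "bounded X" and v: "v \<in> L2 X" and \<Psi>: "\<Psi> \<in> test_fields X"
  shows "(\<Sum>i\<in>UNIV. distr_grad_perp X v (\<lambda>x. \<Psi> x $ i) $ i) = - l2_inner X v (\<lambda>x. rot2 (jac \<Psi> x))"
proof -
  note i = integrable_pd_pairing[OF X v test_fieldsD[OF \<Psi>]]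
  have "l2_inner X v (\<lambda>x. rot2 (jac \<Psi> x))
      = (\<integral>x. v x * pd 2 (\<lambda>y. \<Psi> y $ 1) x - v x * pd 1 (\<lambda>y. \<Psi> y $ 2) x \<partial>lebesgue_on X)"
    by (simp add: l2_inner_def rot2_def jac_def right_diff_distrib)
  also have "\<dots> = pd_pairing X v 2 (\<lambda>y. \<Psi> y $ 1) - pd_pairing X v 1 (\<lambda>y. \<Psi> y $ 2)"
    unfolding pd_pairing_def by (rule Bochner_Integration.integral_diff[OF i i])
  finally show ?thesis by (simp add: sum_2 distr_grad_perp_def distr_pd_eq)
qed

lemma conj_harmonic2_iff:
  assumes X: "open X" "bounded X" and u: "u \<in> L2 X" and v: "v \<in> L2 X"
  shows "conj_harmonic2 X u v \<longleftrightarrow> conjugate_on X trace rot2 u v"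
proof -
  have p: "distr_grad_perp X v (\<lambda>x. 0) = 0"
    by (simp add: distr_grad_perp_def distr_pd_eq pd_pairing_zero vec_eq_iff forall_2)
  then show ?thesis
    unfolding conj_harmonic2_def 
      distr_eq_iff_fields[where F="distr_grad X u" and G="distr_grad_perp X v", OF distr_grad_zero p] conjugate_on_def
    using distr_grad_field[OF X u] distr_grad_perp_field[OF X v] by simp
qed

lemma distr_rot_field:
  assumes X: "open X" "bounded X" and v: "v \<in> L2 X" and \<Psi>: "\<Psi> \<in> test_fields X"
  shows "(\<Sum>i\<in>UNIV. distr_rot X v (\<lambda>x. \<Psi> x $ i) $ i) = - l2_inner X v (\<lambda>x. rot3 (jac \<Psi> x))"
proof -
  let ?p = "\<lambda>i j k x. v x $ i * pd j (\<lambda>y. \<Psi> y $ k) x"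
  have i: "integrable (lebesgue_on X) (?p i j k)" for i j k
    by (rule integrable_pd_pairing[OF X L2_nth[OF v] test_fieldsD[OF \<Psi>]])
  have "l2_inner X v (\<lambda>x. rot3 (jac \<Psi> x))
      = (\<integral>x. ?p 1 3 2 x - ?p 1 2 3 x + (?p 2 1 3 x - ?p 2 3 1 x) + (?p 3 2 1 x - ?p 3 1 2 x) \<partial>lebesgue_on X)"
    by (simp add: l2_inner_def inner_vec_def sum_3 rot3_nth jac_def right_diff_distrib)
  also have "\<dots> = pd_pairing X (\<lambda>x. v x $ 1) 3 (\<lambda>y. \<Psi> y $ 2) - pd_pairing X (\<lambda>x. v x $ 1) 2 (\<lambda>y. \<Psi> y $ 3)
     + (pd_pairing X (\<lambda>x. v x $ 2) 1 (\<lambda>y. \<Psi> y $ 3) - pd_pairing X (\<lambda>x. v x $ 2) 3 (\<lambda>y. \<Psi> y $ 1))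
     + (pd_pairing X (\<lambda>x. v x $ 3) 2 (\<lambda>y. \<Psi> y $ 1) - pd_pairing X (\<lambda>x. v x $ 3) 1 (\<lambda>y. \<Psi> y $ 2))"
    unfolding pd_pairing_def
    by (simp only: Bochner_Integration.integral_add Bochner_Integration.integral_diff
        Bochner_Integration.integrable_add Bochner_Integration.integrable_diff i)
  finally show ?thesis by (simp add: sum_3 distr_rot_def distr_pd_eq)
qed

lemma distr_rot_zero: "distr_rot X v (\<lambda>x. 0) = 0"
  by (simp add: distr_rot_def distr_pd_eq pd_pairing_zero vec_eq_iff forall_3)

lemma distr_rot_grad_iff:
  assumes X: "open X" "bounded X" and u: "u \<in> L2 X" and v: "v \<in> L2 X"
  shows "distr_eq X (distr_rot X v) (distr_grad X u) \<longleftrightarrow> conjugate_on X trace rot3 u v"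
  unfolding distr_eq_iff_fields[where F="distr_rot X v" and G="distr_grad X u", OF distr_rot_zero distr_grad_zero] conjugate_on_def
  using distr_grad_field[OF X u] distr_rot_field[OF X v] by force

lemma ker_rot_iff:
  assumes X: "open X" "bounded X" and w: "w \<in> L2 X"
  shows "w \<in> ker_rot X \<longleftrightarrow> (\<forall>\<Psi>\<in>test_fields X. l2_inner X w (\<lambda>x. rot3 (jac \<Psi> x)) = 0)"
  using distr_eq_iff_fields[of "distr_rot X w" "\<lambda>\<phi>. 0" X] distr_rot_field[OF X w] distr_rot_zero[of X w]
  by (simp add: ker_rot_def)

lemma ker_rot_grad_fields:
  assumes X: "open X" "bounded X" and w: "w \<in> L2 X" "w \<in> ker_rot X" and G: "G \<in> grad_fields X"
  shows "l2_inner X w (\<lambda>x. rot3 (G x)) = 0"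
proof -
  have Xl: "X \<in> lmeasurable" using X by (auto simp: lmeasurable_open)
  have "conjugate_on X rot3 trace w (\<lambda>x. 0::real)"
    using w(2)[unfolded ker_rot_iff[OF X w(1)]] by (simp add: conjugate_on_def l2_inner_def)
  from conjugate_on_grad_fields[OF Xl rot3.bounded_linear_s rot3.bounded_linear_trace this w(1) L2_zero G]
  show ?thesis by (simp add: l2_inner_def)
qed

lemma rot3_grad_fields_orth:
  assumes X: "open X" "bounded X" and G: "G \<in> grad_fields X"
  shows "(\<lambda>x. rot3 (G x)) \<in> L2_ker_rot_orth X"
proof -
  have L: "(\<lambda>x. rot3 (G x)) \<in> L2 X" by (rule L2_bounded_linear[OF rot3.bounded_linear_s grad_fields_L2[OF G]])
  then show ?thesis using ker_rot_grad_fields[OF X _ _ G] L2.B_sym[OF L] by (simp add: L2_ker_rot_orth_def)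
qed

lemma L2_ker_rot_orth_comb:
  assumes "f \<in> L2_ker_rot_orth X" "g \<in> L2_ker_rot_orth X"
  shows "(\<lambda>x. a *\<^sub>R f x + b *\<^sub>R g x) \<in> L2_ker_rot_orth X"
  using assms L2_comb[of f X g a b] L2.B_comb[of f X g _ a b] by (simp add: L2_ker_rot_orth_def)

lemma grad_test_ker_rot:
  assumes X: "open X" "bounded X" and \<phi>: "\<phi> \<in> test_functions X"
  shows "(\<lambda>x. \<chi> i. pd i \<phi> x) \<in> ker_rot X"
  using integral_swap_pd[OF X \<phi>]
  by (simp add: ker_rot_def distr_eq_def distr_rot_def distr_pd_def vec_eq_iff forall_3)

lemma L2_ker_rot_orth_div:
  assumes X: "open X" "bounded X" and v: "v \<in> L2_ker_rot_orth X"
  shows "distr_eq X (distr_div X v) (\<lambda>\<phi>. 0)"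
  unfolding distr_eq_def
proof
  fix \<phi> assume \<phi>: "\<phi> \<in> test_functions X"
  have vL: "v \<in> L2 X" using v by (simp add: L2_ker_rot_orth_def)
  have "0 = l2_inner X v (\<lambda>x. \<chi> i. pd i \<phi> x)"
    using v grad_test_ker_rot[OF X \<phi>] test_is_function_grad(2)[OF X \<phi>] by (simp add: L2_ker_rot_orth_def)
  also have "\<dots> = (\<Sum>i\<in>UNIV. pd_pairing X (\<lambda>x. v x $ i) i \<phi>)"
    unfolding l2_inner_def inner_vec_def pd_pairing_def
    using integrable_pd_pairing[OF X L2_nth[OF vL] \<phi>] by simp
  finally show "distr_div X v \<phi> = 0" by (simp add: distr_div_def distr_pd_eq sum_negf)
qed

lemma conj_harmonic3_iff:
  assumes X: "open X" "bounded X" and u: "u \<in> L2 X" and v: "v \<in> L2_ker_rot_orth X"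
  shows "conj_harmonic3 X u v \<longleftrightarrow> conjugate_on X trace rot3 u v"
  using distr_rot_grad_iff[OF X u, of v] L2_ker_rot_orth_div[OF X v] v
  by (simp add: conj_harmonic3_def L2_ker_rot_orth_def)

lemma conj_harmonic3_const:
  assumes "open X" "bounded X" shows "conj_harmonic3 X (\<lambda>x. c) (\<lambda>x. b)"
proof -
  have "X \<in> sets lebesgue" using assms by (simp add: lmeasurable_open fmeasurableD)
  then have "distr_pd X i (\<lambda>x. a) \<phi> = 0" if "\<phi> \<in> test_functions X" for i a \<phi>
    using test_integral_pd[OF that] by (simp add: distr_pd_def)
  then show ?thesis
    by (simp add: conj_harmonic3_def distr_eq_def distr_rot_def distr_grad_def distr_div_def vec_eq_iff forall_3)
qed

lemma conj_harmonic2_const: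
  assumes "open X" "bounded X" shows "conj_harmonic2 X (\<lambda>x. c) (\<lambda>x. b)"
proof -
  have "X \<in> sets lebesgue" using assms by (simp add: lmeasurable_open fmeasurableD)
  then have "distr_pd X i (\<lambda>x. a) \<phi> = 0" if "\<phi> \<in> test_functions X" for i a \<phi>
    using test_integral_pd[OF that] by (simp add: distr_pd_def)
  then show ?thesis
    by (simp add: conj_harmonic2_def distr_eq_def distr_grad_perp_def distr_grad_def vec_eq_iff forall_2)
qed

lemma conjugate_domain_rot2:
  assumes "bounded_domain X" "supports (hardy X)"
  shows "conjugate_domain rot2 X conj_harmonic2"
proof -
  have X: "open X" "bounded X" using assms(1) by (auto simp: bounded_domain_def)
  show ?thesis
    by (intro conjugate_domain.intro conjugate_domain_axioms.intro rot2.antisymmetric_part_axioms assms conj_harmonic2_const[OF X])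
      (simp_all add: conj_harmonic2_iff[OF X] L2_bounded_linear[OF rot2.bounded_linear_s grad_fields_L2])
qed

lemma conjugate_domain_rot3:
  assumes "bounded_domain X" "supports (hardy X)"
  shows "conjugate_domain rot3 X conj_harmonic3"
proof -
  have X: "open X" "bounded X" using assms(1) by (auto simp: bounded_domain_def)
  show ?thesis
  proof (intro conjugate_domain.intro conjugate_domain_axioms.intro rot3.antisymmetric_part_axioms assms conj_harmonic3_const[OF X])
    show "conjugate_on X trace rot3 u v" if "u \<in> L2 X" "v \<in> L2 X" "conj_harmonic3 X u v" for u v
      using distr_rot_grad_iff[OF X that(1,2)] that(3) by (simp add: conj_harmonic3_def)
    show "conj_harmonic3 X u (\<lambda>x. rot3 (G x))"
      if "u \<in> L2 X" "G \<in> grad_fields X" "conjugate_on X trace rot3 u (\<lambda>x. rot3 (G x))" for u G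
      using conj_harmonic3_iff[OF X that(1) rot3_grad_fields_orth[OF X that(2)]] that(3) by simp
  qed
qed

lemma distr_rot_is_function:
  assumes X: "open X" "bounded X" and v: "v \<in> H10_vec X"
  shows "is_function X (distr_rot X v) (\<lambda>x. - rot3 (grad_mat X v x))"
proof -
  have Xl: "X \<in> lmeasurable" using X by (auto simp: lmeasurable_open)
  have w: "wgrad X (\<lambda>x. v x $ i) \<in> L2 X" "is_function X (distr_grad X (\<lambda>x. v x $ i)) (wgrad X (\<lambda>x. v x $ i))" for i
    using H1_wgrad[OF X(1) H10_H1[OF H10_vec_nth[OF v]]] by auto
  have l: "locally_integrable X (\<lambda>x. - rot3 (grad_mat X v x))"
    by (rule L2_locally_integrable[OF L2_bounded_linear[OF bounded_linear_minus[OF rot3.bounded_linear_s] grad_mat_L2[OF X(1) v]] Xl])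
  have "distr_rot X v \<phi> = (\<integral>x. \<phi> x *\<^sub>R - rot3 (grad_mat X v x) \<partial>lebesgue_on X)" if \<phi>: "\<phi> \<in> test_functions X" for \<phi>
  proof -
    have d: "distr_pd X j (\<lambda>x. v x $ i) \<phi> = (\<integral>x. \<phi> x * wgrad X (\<lambda>x. v x $ i) x $ j \<partial>lebesgue_on X)" for i j
      using w(2) \<phi> by (simp add: distr_pd_def is_function_grad_iff[OF X(1)])
    have i: "integrable (lebesgue_on X) (\<lambda>x. \<phi> x * wgrad X (\<lambda>x. v x $ i) x $ j)" for i j
      by (rule integrable_test_mult(1)[OF X(1) L2_locally_integrable[OF L2_nth[OF w(1)] Xl] \<phi>])
    have e: "distr_pd X j (\<lambda>x. v x $ i) \<phi> - distr_pd X l (\<lambda>x. v x $ k) \<phi>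
        = (\<integral>x. \<phi> x * - (grad_mat X v x $ k $ l - grad_mat X v x $ i $ j) \<partial>lebesgue_on X)" for i j k l
    proof -
      have "distr_pd X j (\<lambda>x. v x $ i) \<phi> - distr_pd X l (\<lambda>x. v x $ k) \<phi>
        = (\<integral>x. \<phi> x * wgrad X (\<lambda>x. v x $ i) x $ j - \<phi> x * wgrad X (\<lambda>x. v x $ k) x $ l \<partial>lebesgue_on X)"
        unfolding d by (rule Bochner_Integration.integral_diff[OF i i, symmetric])
      then show ?thesis by (simp add: grad_mat_def right_diff_distrib)
    qed
    show ?thesis
      unfolding vec_eq_iff forall_3 integral_test_nth[OF l \<phi> X(1)]
      unfolding distr_rot_def vector_3 e vector_uminus_component rot3_nth by simp
  qed
  then show ?thesis using l by (simp add: is_function_def distr_eq_def)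
qed

lemma wrot_AE:
  assumes X: "open X" "bounded X" and v: "v \<in> H10_vec X"
  shows "AE x in lebesgue_on X. wrot X v x = - rot3 (grad_mat X v x)" "locally_integrable X (wrot X v)"
proof -
  note f = distr_rot_is_function[OF assms]
  have *: "is_function X (distr_rot X v) (wrot X v)" unfolding wrot_def by (rule someI[where P="is_function X (distr_rot X v)", OF f])
  then show "locally_integrable X (wrot X v)" by (simp add: is_function_def)
  show "AE x in lebesgue_on X. wrot X v x = - rot3 (grad_mat X v x)"
    by (rule is_function_unique[OF X(1) * f])
qed

lemma l2_norm_wrot:
  assumes X: "open X" "bounded X" and v: "v \<in> H10_vec X"
  shows "l2_norm X (wrot X v) = l2_norm X (\<lambda>x. rot3 (grad_mat X v x))"
proof -
  have "(\<lambda>x. - rot3 (grad_mat X v x)) \<in> L2 X"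
    by (rule L2_bounded_linear[OF bounded_linear_minus[OF rot3.bounded_linear_s] grad_mat_L2[OF X(1) v]])
  from l2_norm_cong_AE[OF wrot_AE(1)[OF assms] locally_integrable_measurable[OF X(1) wrot_AE(2)[OF assms]] L2_measurable[OF this]]
  show ?thesis by (simp add: l2_norm_def)
qed

lemma H10_vec_ker_rot_iff:
  assumes X: "open X" "bounded X" and v: "v \<in> H10_vec X"
  shows "v \<in> ker_rot X \<longleftrightarrow> (AE x in lebesgue_on X. rot3 (grad_mat X v x) = 0)"
proof
  note f = distr_rot_is_function[OF assms]
  assume "v \<in> ker_rot X"
  then have "is_function X (distr_rot X v) (\<lambda>x. 0)"
    by (simp add: ker_rot_def is_function_def distr_eq_def locally_integrable_def)
  from is_function_unique[OF X(1) f this] show "AE x in lebesgue_on X. rot3 (grad_mat X v x) = 0" by simp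
next
  assume 0: "AE x in lebesgue_on X. rot3 (grad_mat X v x) = 0"
  have "distr_rot X v \<phi> = 0" if "\<phi> \<in> test_functions X" for \<phi>
  proof -
    have "distr_rot X v \<phi> = (\<integral>x. \<phi> x *\<^sub>R - rot3 (grad_mat X v x) \<partial>lebesgue_on X)"
      using distr_rot_is_function[OF assms] that by (simp add: is_function_def distr_eq_def)
    also have "\<dots> = 0" by (rule integral_eq_zero_AE) (use 0 in auto)
    finally show ?thesis .
  qed
  then show "v \<in> ker_rot X" by (simp add: ker_rot_def distr_eq_def)
qed

lemma rot3_dense:
  assumes X: "open X" "bounded X" and v: "v \<in> L2_ker_rot_orth X"
  obtains S where "\<forall>k::nat. S k \<in> grad_fields X" "(\<lambda>k. l2_norm X (\<lambda>x. rot3 (S k x) - v x)) \<longlonglongrightarrow> 0"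
proof -
  have Xl: "X \<in> lmeasurable" using X by (auto simp: lmeasurable_open)
  have vL: "v \<in> L2 X" using v by (simp add: L2_ker_rot_orth_def)
  interpret r: linear rot3 by (rule rot3.lin)
  have rL: "(\<lambda>x. rot3 (G x)) \<in> L2 X" if "G \<in> grad_fields X" for G
    by (rule L2_bounded_linear[OF rot3.bounded_linear_s grad_fields_L2[OF that]])
  let ?B = "\<lambda>G K. l2_inner X (\<lambda>x. rot3 (G x)) (\<lambda>x. rot3 (K x))"
  interpret B: semi_inner "grad_fields X" ?B
  proof
    show "grad_fields X \<noteq> {}" by (rule grad_fields_nonempty[OF Xl])
    show "(\<lambda>x. a *\<^sub>R f x + b *\<^sub>R g x) \<in> grad_fields X" if "f \<in> grad_fields X" "g \<in> grad_fields X" for a b f g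
      by (rule grad_fields_comb[OF Xl that])
    show "?B f g = ?B g f" if "f \<in> grad_fields X" "g \<in> grad_fields X" for f g
      by (rule L2.B_sym[OF rL[OF that(1)] rL[OF that(2)]])
    show "?B (\<lambda>x. a *\<^sub>R f x + b *\<^sub>R g x) h = a * ?B f h + b * ?B g h"
      if "f \<in> grad_fields X" "g \<in> grad_fields X" "h \<in> grad_fields X" for a b f g h
      unfolding r.add r.scale by (rule L2.B_comb[OF rL[OF that(1)] rL[OF that(2)] rL[OF that(3)]])
    show "0 \<le> ?B f f" for f by (simp add: l2_norm_square[symmetric])
  qed
  let ?l = "\<lambda>G. l2_inner X v (\<lambda>x. rot3 (G x))"
  obtain S where S: "\<forall>k::nat. S k \<in> grad_fields X"
    and C: "\<forall>e>0. \<exists>N. \<forall>m\<ge>N. \<forall>n\<ge>N. ?B (\<lambda>x. S m x - S n x) (\<lambda>x. S m x - S n x) < e"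
    and lim: "\<forall>G\<in>grad_fields X. (\<lambda>k. ?B (S k) G) \<longlonglongrightarrow> ?l G"
  proof (rule B.riesz_sequence)
    show "?l (\<lambda>x. a *\<^sub>R f x + b *\<^sub>R g x) = a * ?l f + b * ?l g"
      if "f \<in> grad_fields X" "g \<in> grad_fields X" for a b f g
      unfolding r.add r.scale by (rule L2.B_comb_right[OF rL[OF that(1)] rL[OF that(2)] vL])
    show "(?l f)\<^sup>2 \<le> (l2_norm X v)\<^sup>2 * ?B f f" if "f \<in> grad_fields X" for f
      using power_mono[OF l2_inner_le[OF vL rL[OF that]] abs_ge_zero, of 2]
      by (simp add: power_mult_distrib l2_norm_square)
  qed (rule that, assumption+)
  have rS: "(\<lambda>x. rot3 (S k x)) \<in> L2 X" for k using rL S by blast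
  obtain h where h: "h \<in> L2 X" "(\<lambda>k. l2_norm X (\<lambda>x. rot3 (S k x) - h x)) \<longlonglongrightarrow> 0"
  proof (rule L2_complete[OF Xl rS])
    fix e :: real assume e: "0 < e"
    then obtain N where N: "\<forall>m\<ge>N. \<forall>n\<ge>N. ?B (\<lambda>x. S m x - S n x) (\<lambda>x. S m x - S n x) < e\<^sup>2"
      using C zero_less_power by meson
    have "l2_norm X (\<lambda>x. rot3 (S m x) - rot3 (S n x)) < e" if "m \<ge> N" "n \<ge> N" for m n
    proof (rule power2_less_imp_less)
      show "(l2_norm X (\<lambda>x. rot3 (S m x) - rot3 (S n x)))\<^sup>2 < e\<^sup>2"
        using N that by (simp add: l2_norm_square r.diff)
    qed (use e in simp)
    then show "\<exists>N. \<forall>m\<ge>N. \<forall>n\<ge>N. l2_norm X (\<lambda>x. rot3 (S m x) - rot3 (S n x)) < e" by blast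
  qed (rule that, assumption+)
  have hB: "l2_inner X h (\<lambda>x. rot3 (G x)) = ?l G" if G: "G \<in> grad_fields X" for G
    using tendsto_l2_inner[OF rS h(1) rL[OF G] h(2)] lim[rule_format, OF G] by (rule LIMSEQ_unique)
  have hY: "l2_inner X h w = 0" if w: "w \<in> L2 X" "w \<in> ker_rot X" for w
  proof -
    have "(\<lambda>k. l2_inner X (\<lambda>x. rot3 (S k x)) w) \<longlonglongrightarrow> l2_inner X h w"
      by (rule tendsto_l2_inner[OF rS h(1) w(1) h(2)])
    moreover have "l2_inner X (\<lambda>x. rot3 (S k x)) w = 0" for k
      using rot3_grad_fields_orth[OF X S[rule_format, of k]] w by (simp add: L2_ker_rot_orth_def)
    ultimately show ?thesis using LIMSEQ_unique[OF tendsto_const] by fastforce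
  qed
  let ?d = "\<lambda>x. 1 *\<^sub>R h x + (-1) *\<^sub>R v x"
  have dL: "?d \<in> L2 X" by (rule L2_comb[OF h(1) vL])
  have "?d \<in> ker_rot X"
    unfolding ker_rot_iff[OF X dL]
  proof
    fix \<Psi> assume "\<Psi> \<in> test_fields X"
    then have J: "jac \<Psi> \<in> grad_fields X" by (rule jac_grad_fields[OF _ Xl])
    show "l2_inner X ?d (\<lambda>x. rot3 (jac \<Psi> x)) = 0"
      unfolding L2.B_comb[OF h(1) vL rL[OF J]] hB[OF J] by simp
  qed
  then have "l2_inner X ?d ?d = 0"
    unfolding L2.B_comb[OF h(1) vL dL] using hY[OF dL] v dL by (simp add: L2_ker_rot_orth_def)
  then have "AE x in lebesgue_on X. ?d x = 0" using l2_norm_eq_0_iff[OF dL] by (simp add: l2_norm_square[symmetric])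
  then have hv: "AE x in lebesgue_on X. h x = v x" by eventually_elim simp
  have "l2_norm X (\<lambda>x. rot3 (S k x) - v x) = l2_norm X (\<lambda>x. rot3 (S k x) - h x)" for k
    by (rule l2_norm_cong_AE[OF _ L2_measurable[OF L2.diff_mem[OF rS vL]] L2_measurable[OF L2.diff_mem[OF rS h(1)]]])
      (use hv in \<open>eventually_elim, simp\<close>)
  then show thesis using that[of S] S h(2) by simp
qed

lemma grad_fields_projection:
  assumes X: "open X" "bounded X" and G: "G \<in> grad_fields X"
  obtains K where "K \<in> grad_fields X" "AE x in lebesgue_on X. rot3 (K x) = rot3 (G x)"
    "\<forall>W\<in>grad_fields X. (AE x in lebesgue_on X. rot3 (W x) = 0) \<longrightarrow> l2_inner X K W = 0"
proof -
  have Xl: "X \<in> lmeasurable" using X by (auto simp: lmeasurable_open)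
  interpret r: linear rot3 by (rule rot3.lin)
  let ?N = "{W \<in> grad_fields X. AE x in lebesgue_on X. rot3 (W x) = 0}"
  have GL: "G \<in> L2 X" by (rule grad_fields_L2[OF G])
  have NL: "W \<in> ?N \<Longrightarrow> W \<in> L2 X" for W using grad_fields_L2[of W X] by simp
  have "\<exists>Z\<in>?N. \<forall>W\<in>?N. l2_inner X Z W = l2_inner X G W"
  proof (rule riesz_closed[OF Xl, where M="(l2_norm X G)\<^sup>2"])
    show "?N \<subseteq> L2 X" using NL by blast
    have "jac (\<lambda>x::real^3. 0) x = 0" for x by (simp add: jac_def pd_zero vec_eq_iff)
    then have "jac (\<lambda>x. 0) \<in> ?N" using jac_grad_fields[OF test_fields_zero Xl] by (simp add: r.zero)
    then show "?N \<noteq> {}" by blast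
    show "(\<lambda>x. a *\<^sub>R f x + b *\<^sub>R g x) \<in> ?N" if "f \<in> ?N" "g \<in> ?N" for a b f g
      using that grad_fields_comb[OF Xl, of f g a b] by (auto simp: r.add r.scale)
    show "g \<in> ?N" if f: "\<And>k::nat. f k \<in> ?N" and g: "g \<in> L2 X"
      and lim: "(\<lambda>k. l2_norm X (\<lambda>x. f k x - g x)) \<longlonglongrightarrow> 0" for f g
    proof -
      have fg: "f k \<in> grad_fields X" for k using f by blast
      have fL: "f k \<in> L2 X" for k by (rule NL[OF f])
      have gg: "g \<in> grad_fields X" by (rule grad_fields_closed[OF Xl fg g lim])
      note rf = L2_bounded_linear[OF rot3.bounded_linear_s fL] and rg = L2_bounded_linear[OF rot3.bounded_linear_s g]
      have "(\<lambda>k. l2_norm X (\<lambda>x. rot3 (f k x))) \<longlonglongrightarrow> l2_norm X (\<lambda>x. rot3 (g x))"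
        by (rule tendsto_l2_norm[OF rf rg tendsto_l2_bounded_linear[OF rot3.bounded_linear_s fL g lim]])
      moreover have "l2_norm X (\<lambda>x. rot3 (f k x)) = 0" for k using l2_norm_eq_0_iff[OF rf] f by blast
      ultimately have "l2_norm X (\<lambda>x. rot3 (g x)) = 0" using LIMSEQ_unique[OF tendsto_const] by fastforce
      then show ?thesis using gg l2_norm_eq_0_iff[OF rg] by simp
    qed
    show "l2_inner X G (\<lambda>x. a *\<^sub>R f x + b *\<^sub>R g x) = a * l2_inner X G f + b * l2_inner X G g"
      if "f \<in> ?N" "g \<in> ?N" for a b f g
      by (rule L2.B_comb_right[OF NL[OF that(1)] NL[OF that(2)] GL])
    show "(l2_inner X G f)\<^sup>2 \<le> (l2_norm X G)\<^sup>2 * (l2_norm X f)\<^sup>2" if "f \<in> ?N" for f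
      using power_mono[OF l2_inner_le[OF GL NL[OF that]] abs_ge_zero, of 2] by (simp add: power_mult_distrib)
  qed
  then obtain Z where Z: "Z \<in> ?N" "\<forall>W\<in>?N. l2_inner X Z W = l2_inner X G W" by blast
  show thesis
  proof (rule that[of "\<lambda>x. 1 *\<^sub>R G x + (-1) *\<^sub>R Z x"])
    show "(\<lambda>x. 1 *\<^sub>R G x + (-1) *\<^sub>R Z x) \<in> grad_fields X" using grad_fields_comb[OF Xl G] Z(1) by blast
    have "AE x in lebesgue_on X. rot3 (Z x) = 0" using Z(1) by blast
    then show "AE x in lebesgue_on X. rot3 (1 *\<^sub>R G x + (-1) *\<^sub>R Z x) = rot3 (G x)"
      by eventually_elim (simp add: r.diff)
    show "\<forall>W\<in>grad_fields X. (AE x in lebesgue_on X. rot3 (W x) = 0) \<longrightarrow> l2_inner X (\<lambda>x. 1 *\<^sub>R G x + (-1) *\<^sub>R Z x) W = 0"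
    proof (intro ballI impI)
      fix W assume "W \<in> grad_fields X" "AE x in lebesgue_on X. rot3 (W x) = 0"
      then have W: "W \<in> ?N" by simp
      show "l2_inner X (\<lambda>x. 1 *\<^sub>R G x + (-1) *\<^sub>R Z x) W = 0"
        unfolding L2.B_comb[OF GL NL[OF Z(1)] NL[OF W]] using Z(2) W by simp
    qed
  qed
qed

section \<open>The rotation inequalities\<close>

lemma friedrichs_velte_second_mono:
  assumes "friedrichs_velte_second X C" "C \<le> D" shows "friedrichs_velte_second X D"
  unfolding friedrichs_velte_second_def
proof (intro ballI impI)
  fix u v assume uv: "u \<in> L2 X" "v \<in> L2_ker_rot_orth X" "conj_harmonic3 X u v"
  have "C * (l2_norm X u)\<^sup>2 \<le> D * (l2_norm X u)\<^sup>2" by (rule mult_right_mono[OF assms(2)]) simp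
  moreover have "(l2_norm X v)\<^sup>2 \<le> C * (l2_norm X u)\<^sup>2"
    by (rule assms(1)[unfolded friedrichs_velte_second_def, rule_format, OF uv])
  ultimately show "(l2_norm X v)\<^sup>2 \<le> D * (l2_norm X u)\<^sup>2" by linarith
qed

lemma friedrichs_velte_second_closed:
  assumes "\<And>n::nat. friedrichs_velte_second X (C + 1 / (real n + 1))" shows "friedrichs_velte_second X C"
  unfolding friedrichs_velte_second_def
proof (intro ballI impI)
  fix u v assume uv: "u \<in> L2 X" "v \<in> L2_ker_rot_orth X" "conj_harmonic3 X u v"
  show "(l2_norm X v)\<^sup>2 \<le> C * (l2_norm X u)\<^sup>2"
    by (rule le_mult_limit) (rule assms[unfolded friedrichs_velte_second_def, rule_format, OF uv])
qed

lemma improved_poincare_rot_mono: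
  assumes "improved_poincare_rot X C" "C \<le> D" shows "improved_poincare_rot X D"
  unfolding improved_poincare_rot_def
proof (intro ballI allI impI)
  fix v r assume v: "v \<in> L2_ker_rot_orth X"
    and r: "is_function X (distr_rot X v) r \<and> (\<lambda>x. bdist X x *\<^sub>R r x) \<in> L2 X"
  let ?d = "(l2_norm X (\<lambda>x. bdist X x *\<^sub>R r x))\<^sup>2"
  have "C * ?d \<le> D * ?d" by (rule mult_right_mono[OF assms(2)]) simp
  moreover have "(l2_norm X v)\<^sup>2 \<le> C * ?d"
    by (rule assms(1)[unfolded improved_poincare_rot_def, rule_format, OF v r])
  ultimately show "(l2_norm X v)\<^sup>2 \<le> D * ?d" by linarith
qed

lemma improved_poincare_rot_closed:
  assumes "\<And>n::nat. improved_poincare_rot X (C + 1 / (real n + 1))" shows "improved_poincare_rot X C"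
  unfolding improved_poincare_rot_def
proof (intro ballI allI impI)
  fix v r assume v: "v \<in> L2_ker_rot_orth X"
    and r: "is_function X (distr_rot X v) r \<and> (\<lambda>x. bdist X x *\<^sub>R r x) \<in> L2 X"
  show "(l2_norm X v)\<^sup>2 \<le> C * (l2_norm X (\<lambda>x. bdist X x *\<^sub>R r x))\<^sup>2"
    by (rule le_mult_limit) (rule assms[unfolded improved_poincare_rot_def, rule_format, OF v r])
qed

locale rot_domain =
  fixes X :: "(real^3) set"
  assumes dom: "bounded_domain X" and sup: "supports (hardy X)"
begin

lemma o: "open X" "bounded X" and Xl: "X \<in> lmeasurable"
  using dom by (auto simp: bounded_domain_def lmeasurable_open)

lemma L2_ker_rot_orth_L2: "v \<in> L2_ker_rot_orth X \<Longrightarrow> v \<in> L2 X"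
  by (simp add: L2_ker_rot_orth_def)

lemma trace_L2: "G \<in> grad_fields X \<Longrightarrow> (\<lambda>x. trace (G x)) \<in> L2 X"
  by (rule L2_bounded_linear[OF rot3.bounded_linear_trace grad_fields_L2])

lemma friedrichs_velte_second_nonneg:
  assumes "friedrichs_velte_second X \<Gamma>" shows "0 \<le> \<Gamma>"
proof -
  have "(\<lambda>x. 0) \<in> L2_ker_rot_orth X" by (simp add: L2_ker_rot_orth_def) (simp add: l2_inner_def)
  with assms conj_harmonic3_const[OF o, of 1 0] L2_const[OF Xl, of "1::real"]
  have "(l2_norm X (\<lambda>x. 0 :: real^3))\<^sup>2 \<le> \<Gamma> * (l2_norm X (\<lambda>x. 1 :: real))\<^sup>2"
    unfolding friedrichs_velte_second_def by blast
  then have "0 \<le> \<Gamma> * measure lebesgue X" by (simp add: l2_norm_const[OF Xl])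
  then show ?thesis using bounded_domain_measure_pos[OF dom] by (simp add: zero_le_mult_iff)
qed

lemma friedrichs_velte_second_surjective:
  assumes FV: "friedrichs_velte_second X \<Gamma>" and f: "f \<in> L2_ker_rot_orth X"
  shows "\<exists>G\<in>grad_fields X. (AE x in lebesgue_on X. rot3 (G x) = f x) \<and>
    (l2_norm X G)\<^sup>2 \<le> (1 + \<Gamma>) * (l2_norm X f)\<^sup>2"
proof (rule conjugate_estimate_imp_surjective[OF Xl rot3.bounded_linear_s rot3.bounded_linear_trace _
      _ L2_ker_rot_orth_comb rot3_grad_fields_orth[OF o] friedrichs_velte_second_nonneg[OF FV] _ f])
  show "(l2_norm X G)\<^sup>2 = (l2_norm X (\<lambda>x. rot3 (G x)))\<^sup>2 + (l2_norm X (\<lambda>x. trace (G x)))\<^sup>2"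
    if "G \<in> grad_fields X" for G
    using rot3.norm_grad_fields[OF o that] by simp
  show "L2_ker_rot_orth X \<subseteq> L2 X" using L2_ker_rot_orth_L2 by blast
  fix v G assume v: "v \<in> L2_ker_rot_orth X" and G: "G \<in> grad_fields X"
    and K: "\<And>K. K \<in> grad_fields X \<Longrightarrow> l2_inner X v (\<lambda>x. rot3 (K x)) = l2_inner X (\<lambda>x. trace (G x)) (\<lambda>x. trace (K x))"
  have "conjugate_on X trace rot3 (\<lambda>x. trace (G x)) v"
    unfolding conjugate_on_def using K[OF jac_grad_fields[OF _ Xl]] by simp
  then have "conj_harmonic3 X (\<lambda>x. trace (G x)) v" using conj_harmonic3_iff[OF o trace_L2[OF G] v] by simp
  then show "(l2_norm X v)\<^sup>2 \<le> \<Gamma> * (l2_norm X (\<lambda>x. trace (G x)))\<^sup>2"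
    by (rule FV[unfolded friedrichs_velte_second_def, rule_format, OF trace_L2[OF G] v])
qed

lemma friedrichs_velte_second_imp_babuska_aziz:
  assumes FV: "friedrichs_velte_second X \<Gamma>" shows "babuska_aziz_rot X (1 + \<Gamma>)"
  unfolding babuska_aziz_rot_def
proof
  fix v assume "v \<in> H10_ker_rot_orth X"
  then have v: "v \<in> H10_vec X" and orth: "\<And>w. w \<in> H10_vec X \<Longrightarrow> w \<in> ker_rot X \<Longrightarrow> h1_inner X v w = 0"
    by (auto simp: H10_ker_rot_orth_def)
  interpret r: linear rot3 by (rule rot3.lin)
  let ?V = "grad_mat X v" and ?f = "\<lambda>x. rot3 (grad_mat X v x)"
  have V: "?V \<in> grad_fields X" "?V \<in> L2 X" by (rule grad_mat_grad_fields[OF o v], rule grad_mat_L2[OF o(1) v])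
  obtain G where G: "G \<in> grad_fields X" "AE x in lebesgue_on X. rot3 (G x) = ?f x"
    "(l2_norm X G)\<^sup>2 \<le> (1 + \<Gamma>) * (l2_norm X ?f)\<^sup>2"
    using friedrichs_velte_second_surjective[OF FV rot3_grad_fields_orth[OF o V(1)]] by blast
  have GL: "G \<in> L2 X" by (rule grad_fields_L2[OF G(1)])
  obtain H where H: "hardy X H" using sup by (auto simp: supports_def)
  obtain w where w: "w \<in> H10_vec X" "AE x in lebesgue_on X. grad_mat X w x = G x"
    by (rule grad_fields_H10_vec[OF o H G(1)]) (rule that, assumption+)
  let ?z = "\<lambda>x. 1 *\<^sub>R v x + (-1) *\<^sub>R w x"
  have z: "?z \<in> H10_vec X" by (rule H10_vec_comb(1)[OF o v w(1)])
  have zG: "AE x in lebesgue_on X. grad_mat X ?z x = 1 *\<^sub>R ?V x + (-1) *\<^sub>R G x"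
    using H10_vec_comb(2)[OF o v w(1), of 1 "-1"] w(2) by eventually_elim simp
  have "AE x in lebesgue_on X. rot3 (grad_mat X ?z x) = 0"
    using zG G(2) by eventually_elim (simp add: r.diff)
  then have "h1_inner X v ?z = 0" using orth[OF z] H10_vec_ker_rot_iff[OF o z] by blast
  then have "0 = l2_inner X (grad_mat X ?z) ?V"
    using h1_inner_eq[OF o(1) v z] L2.B_sym[OF grad_mat_L2[OF o(1) z] V(2)] by simp
  also have "\<dots> = l2_inner X (\<lambda>x. 1 *\<^sub>R ?V x + (-1) *\<^sub>R G x) ?V"
    by (rule l2_inner_cong_AE[OF zG L2_measurable[OF grad_mat_L2[OF o(1) z]] L2_measurable[OF L2_comb[OF V(2) GL]]
          L2_measurable[OF V(2)]])
  also have "\<dots> = 1 * l2_inner X ?V ?V + (-1) * l2_inner X G ?V" by (rule L2.B_comb[OF V(2) GL V(2)])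
  finally have "l2_norm X ?V * l2_norm X ?V \<le> l2_norm X G * l2_norm X ?V"
    using l2_inner_le[OF GL V(2)] l2_norm_square[of X ?V] by (simp add: power2_eq_square)
  then have "l2_norm X ?V \<le> l2_norm X G"
  proof (cases "l2_norm X ?V = 0")
    case False
    then have "0 < l2_norm X ?V" using l2_norm_nonneg[of X ?V] by linarith
    with \<open>l2_norm X ?V * l2_norm X ?V \<le> _\<close> show ?thesis by (rule mult_right_le_imp_le)
  qed simp
  then have "(l2_norm X ?V)\<^sup>2 \<le> (l2_norm X G)\<^sup>2" by (rule power_mono) simp
  then show "(h1_norm X v)\<^sup>2 \<le> (1 + \<Gamma>) * (l2_norm X (wrot X v))\<^sup>2"
    unfolding h1_norm_eq[OF o(1) v] l2_norm_wrot[OF o v] using G(3) by (rule order_trans)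
qed

lemma babuska_aziz_rot_grad_fields:
  assumes BA: "babuska_aziz_rot X C" and G: "G \<in> grad_fields X"
    and orth: "\<forall>W\<in>grad_fields X. (AE x in lebesgue_on X. rot3 (W x) = 0) \<longrightarrow> l2_inner X G W = 0"
  shows "(l2_norm X G)\<^sup>2 \<le> C * (l2_norm X (\<lambda>x. rot3 (G x)))\<^sup>2"
proof -
  obtain H where H: "hardy X H" using sup by (auto simp: supports_def)
  obtain v where v: "v \<in> H10_vec X" "AE x in lebesgue_on X. grad_mat X v x = G x"
    by (rule grad_fields_H10_vec[OF o H G]) (rule that, assumption+)
  note m = L2_measurable[OF grad_mat_L2[OF o(1) v(1)]] L2_measurable[OF grad_fields_L2[OF G]]
  have "h1_inner X v w = 0" if w: "w \<in> H10_vec X" "w \<in> ker_rot X" for w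
  proof -
    have "h1_inner X v w = l2_inner X G (grad_mat X w)"
      unfolding h1_inner_eq[OF o(1) v(1) w(1)]
      by (rule l2_inner_cong_AE[OF v(2) m L2_measurable[OF grad_mat_L2[OF o(1) w(1)]]])
    also have "\<dots> = 0"
      using orth grad_mat_grad_fields[OF o w(1)] w(2) H10_vec_ker_rot_iff[OF o w(1)] by blast
    finally show ?thesis .
  qed
  then have "v \<in> H10_ker_rot_orth X" using v(1) by (simp add: H10_ker_rot_orth_def)
  then have "(h1_norm X v)\<^sup>2 \<le> C * (l2_norm X (wrot X v))\<^sup>2" using BA by (simp add: babuska_aziz_rot_def)
  moreover have "l2_norm X (\<lambda>x. rot3 (grad_mat X v x)) = l2_norm X (\<lambda>x. rot3 (G x))"
    by (rule l2_norm_cong_AE[OF _ L2_measurable[OF L2_bounded_linear[OF rot3.bounded_linear_s grad_mat_L2[OF o(1) v(1)]]]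
          L2_measurable[OF L2_bounded_linear[OF rot3.bounded_linear_s grad_fields_L2[OF G]]]])
      (use v(2) in \<open>eventually_elim, simp\<close>)
  ultimately show ?thesis
    using l2_norm_cong_AE[OF v(2) m] by (simp add: h1_norm_eq[OF o(1) v(1)] l2_norm_wrot[OF o v(1)])
qed

lemma babuska_aziz_rot_imp_friedrichs_velte_second:
  assumes BA: "babuska_aziz_rot X C" shows "friedrichs_velte_second X \<bar>C\<bar>"
  unfolding friedrichs_velte_second_def
proof (intro ballI impI)
  fix u v assume u: "u \<in> L2 X" and v: "v \<in> L2_ker_rot_orth X" and uv: "conj_harmonic3 X u v"
  have vL: "v \<in> L2 X" by (rule L2_ker_rot_orth_L2[OF v])
  have c: "conjugate_on X trace rot3 u v" using conj_harmonic3_iff[OF o u v] uv by simp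
  let ?n = "(l2_norm X v)\<^sup>2" and ?m = "(l2_norm X u)\<^sup>2"
  obtain S where S: "\<forall>k::nat. S k \<in> grad_fields X" and lim: "(\<lambda>k. l2_norm X (\<lambda>x. rot3 (S k x) - v x)) \<longlonglongrightarrow> 0"
    by (rule rot3_dense[OF o v]) (rule that, assumption+)
  have rS: "(\<lambda>x. rot3 (S k x)) \<in> L2 X" for k
    by (rule L2_bounded_linear[OF rot3.bounded_linear_s grad_fields_L2[OF S[rule_format]]])
  have le: "(l2_inner X (\<lambda>x. rot3 (S k x)) v)\<^sup>2 \<le> ?m * (\<bar>C\<bar> * (l2_norm X (\<lambda>x. rot3 (S k x)))\<^sup>2)" for k
  proof -
    obtain K where K: "K \<in> grad_fields X" "AE x in lebesgue_on X. rot3 (K x) = rot3 (S k x)"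
      "\<forall>W\<in>grad_fields X. (AE x in lebesgue_on X. rot3 (W x) = 0) \<longrightarrow> l2_inner X K W = 0"
      by (rule grad_fields_projection[OF o S[rule_format]]) (rule that, assumption+)
    have rK: "(\<lambda>x. rot3 (K x)) \<in> L2 X" by (rule L2_bounded_linear[OF rot3.bounded_linear_s grad_fields_L2[OF K(1)]])
    have "l2_inner X (\<lambda>x. rot3 (S k x)) v = l2_inner X v (\<lambda>x. rot3 (K x))"
      using l2_inner_cong_AE[OF K(2) L2_measurable[OF rK] L2_measurable[OF rS] L2_measurable[OF vL]] L2.B_sym[OF rK vL] by simp
    also have "\<dots> = l2_inner X u (\<lambda>x. trace (K x))"
      by (rule conjugate_on_grad_fields[OF Xl rot3.bounded_linear_trace rot3.bounded_linear_s c u vL K(1), symmetric])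
    finally have "(l2_inner X (\<lambda>x. rot3 (S k x)) v)\<^sup>2 \<le> ?m * (l2_norm X (\<lambda>x. trace (K x)))\<^sup>2"
      using power_mono[OF l2_inner_le[OF u trace_L2[OF K(1)]] abs_ge_zero, of 2] by (simp add: power_mult_distrib)
    also have "\<dots> \<le> ?m * (\<bar>C\<bar> * (l2_norm X (\<lambda>x. rot3 (S k x)))\<^sup>2)"
    proof (rule mult_left_mono)
      have "(l2_norm X (\<lambda>x. trace (K x)))\<^sup>2 \<le> (l2_norm X K)\<^sup>2" using rot3.norm_grad_fields[OF o K(1)] by simp
      also have "\<dots> \<le> C * (l2_norm X (\<lambda>x. rot3 (K x)))\<^sup>2" by (rule babuska_aziz_rot_grad_fields[OF BA K(1,3)])
      also have "\<dots> \<le> \<bar>C\<bar> * (l2_norm X (\<lambda>x. rot3 (K x)))\<^sup>2" by (intro mult_right_mono) auto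
      also have "l2_norm X (\<lambda>x. rot3 (K x)) = l2_norm X (\<lambda>x. rot3 (S k x))"
        by (rule l2_norm_cong_AE[OF K(2) L2_measurable[OF rK] L2_measurable[OF rS]])
      finally show "(l2_norm X (\<lambda>x. trace (K x)))\<^sup>2 \<le> \<bar>C\<bar> * (l2_norm X (\<lambda>x. rot3 (S k x)))\<^sup>2" .
    qed simp
    finally show ?thesis .
  qed
  have "(\<lambda>k. (l2_inner X (\<lambda>x. rot3 (S k x)) v)\<^sup>2) \<longlonglongrightarrow> (l2_inner X v v)\<^sup>2"
    by (rule tendsto_power[OF tendsto_l2_inner[OF rS vL vL lim]])
  moreover have "(\<lambda>k. ?m * (\<bar>C\<bar> * (l2_norm X (\<lambda>x. rot3 (S k x)))\<^sup>2)) \<longlonglongrightarrow> ?m * (\<bar>C\<bar> * ?n)"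
    by (rule tendsto_mult_left[OF tendsto_mult_left[OF tendsto_power[OF tendsto_l2_norm[OF rS vL lim]]]])
  ultimately have "(l2_inner X v v)\<^sup>2 \<le> ?m * (\<bar>C\<bar> * ?n)"
    by (rule LIMSEQ_le) (use le in auto)
  then have le': "?n * ?n \<le> ?n * (\<bar>C\<bar> * ?m)" unfolding l2_norm_square[symmetric] by (simp add: power2_eq_square mult_ac)
  show "?n \<le> \<bar>C\<bar> * ?m"
  proof (cases "?n = 0")
    case False
    then have "0 < ?n" by simp
    with le' show ?thesis by (rule mult_left_le_imp_le)
  qed simp
qed

lemma improved_poincare_rot_nonneg:
  assumes IP: "improved_poincare_rot X P" shows "0 \<le> P"
proof (rule ccontr)
  assume neg: "\<not> 0 \<le> P"
  obtain \<phi> where \<phi>: "\<phi> \<in> test_functions X" "\<forall>i. \<not> (AE x in lebesgue_on X. pd i \<phi> x = 0)"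
    by (rule nontrivial_test_function[OF dom]) (rule that, assumption, blast)
  let ?\<Psi> = "single_field 1 \<phi> :: real^3 \<Rightarrow> real^3"
  have \<Psi>: "?\<Psi> \<in> test_fields X" by (rule single_field_test[OF \<phi>(1)])
  let ?v = "\<lambda>x. rot3 (jac ?\<Psi> x)"
  have v: "?v \<in> L2_ker_rot_orth X" by (rule rot3_grad_fields_orth[OF o jac_grad_fields[OF \<Psi> Xl]])
  have "(\<lambda>x. ?v x $ i) \<in> test_functions X" for i
    using smooth_linear_jac[OF rot3.lin \<Psi>, of "axis i 1"] by (simp add: cart_eq_inner_axis)
  then have "?v \<in> test_fields X" by (simp add: test_fields_def)
  then have vH: "?v \<in> H10_vec X" by (rule test_field_H10_vec[OF o])
  let ?r = "\<lambda>x. - rot3 (grad_mat X ?v x)"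
  have r: "is_function X (distr_rot X ?v) ?r" by (rule distr_rot_is_function[OF o vH])
  have "?r \<in> L2 X" by (rule L2_bounded_linear[OF bounded_linear_minus[OF rot3.bounded_linear_s] grad_mat_L2[OF o(1) vH]])
  note dr = L2_bdist_scaleR[OF o(2) this]
  have "(l2_norm X ?v)\<^sup>2 \<le> P * (l2_norm X (\<lambda>x. bdist X x *\<^sub>R ?r x))\<^sup>2"
    by (rule IP[unfolded improved_poincare_rot_def, rule_format, OF v conjI[OF r dr]])
  also have "\<dots> \<le> 0" using neg by (intro mult_nonpos_nonneg) auto
  finally have "l2_norm X ?v = 0" by simp
  then have "AE x in lebesgue_on X. ?v x = 0" using l2_norm_eq_0_iff[OF L2_ker_rot_orth_L2[OF v]] by blast
  then have "AE x in lebesgue_on X. pd 2 \<phi> x = 0"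
  proof eventually_elim
    case (elim x)
    have "?v x $ 3 = pd 2 \<phi> x" by (simp add: rot3_nth jac_def single_field_nth pd_zero)
    then show ?case unfolding elim zero_index by simp
  qed
  then show False using \<phi>(2) by blast
qed

lemma improved_poincare_rot_imp_friedrichs_velte_second:
  assumes IP: "improved_poincare_rot X P" shows "friedrichs_velte_second X (4 * P)"
  unfolding friedrichs_velte_second_def
proof (intro ballI impI)
  fix u v assume u: "u \<in> L2 X" and v: "v \<in> L2_ker_rot_orth X" and uv: "conj_harmonic3 X u v"
  have c: "conjugate_on X trace rot3 u v" using conj_harmonic3_iff[OF o u v] uv by simp
  obtain g where g: "is_function X (distr_grad X u) g" "(\<lambda>x. bdist X x *\<^sub>R g x) \<in> L2 X"
    "(l2_norm X (\<lambda>x. bdist X x *\<^sub>R g x))\<^sup>2 \<le> 4 * (l2_norm X u)\<^sup>2"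
    by (rule conjugate_weak_gradient[OF dom rot3.antisymmetric_part_axioms c u L2_ker_rot_orth_L2[OF v]])
      (rule that, assumption+)
  have "is_function X (distr_rot X v) g"
    using g(1) uv by (simp add: conj_harmonic3_def is_function_def distr_eq_def)
  then have "(l2_norm X v)\<^sup>2 \<le> P * (l2_norm X (\<lambda>x. bdist X x *\<^sub>R g x))\<^sup>2"
    using IP[unfolded improved_poincare_rot_def, rule_format, OF v conjI[OF _ g(2)]] by blast
  also have "\<dots> \<le> P * (4 * (l2_norm X u)\<^sup>2)"
    by (rule mult_left_mono[OF g(3) improved_poincare_rot_nonneg[OF IP]])
  finally show "(l2_norm X v)\<^sup>2 \<le> 4 * P * (l2_norm X u)\<^sup>2" by simp
qed

lemma friedrichs_velte_second_imp_improved_poincare_rot: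
  assumes FV: "friedrichs_velte_second X \<Gamma>" and H: "hardy X H" shows "improved_poincare_rot X (H * (1 + \<Gamma>))"
  unfolding improved_poincare_rot_def
proof (intro ballI allI impI)
  fix v r assume v: "v \<in> L2_ker_rot_orth X"
    and r: "is_function X (distr_rot X v) r \<and> (\<lambda>x. bdist X x *\<^sub>R r x) \<in> L2 X"
  have vL: "v \<in> L2 X" by (rule L2_ker_rot_orth_L2[OF v])
  obtain G where G: "G \<in> grad_fields X" "AE x in lebesgue_on X. rot3 (G x) = v x"
    "(l2_norm X G)\<^sup>2 \<le> (1 + \<Gamma>) * (l2_norm X v)\<^sup>2"
    using friedrichs_velte_second_surjective[OF FV v] by blast
  show "(l2_norm X v)\<^sup>2 \<le> H * (1 + \<Gamma>) * (l2_norm X (\<lambda>x. bdist X x *\<^sub>R r x))\<^sup>2"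
  proof (rule improved_poincare_core[OF dom H rot3.bounded_linear_s vL conjunct2[OF r] _ G])
    show "l2_inner X v (\<lambda>x. rot3 (jac \<Psi> x)) = - (\<integral>x. r x \<bullet> \<Psi> x \<partial>lebesgue_on X)" if "\<Psi> \<in> test_fields X" for \<Psi>
      using distr_rot_field[OF o vL that] is_function_field[OF o(1) conjunct1[OF r] that] by simp
  qed (use friedrichs_velte_second_nonneg[OF FV] in simp)
qed

theorem rotation_equivalence:
  "(supports (friedrichs_velte_second X) \<longleftrightarrow> supports (babuska_aziz_rot X)) \<and>
   (supports (friedrichs_velte_second X) \<longleftrightarrow> supports (improved_poincare_rot X)) \<and>
   (supports (improved_poincare_rot X) \<longrightarrow>
     1 / 4 * least_constant (friedrichs_velte_second X) \<le> least_constant (improved_poincare_rot X) \<and>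
     least_constant (improved_poincare_rot X)
       \<le> least_constant (hardy X) * (1 + least_constant (friedrichs_velte_second X)))"
proof (intro conjI)
  note H = hardy_least[OF dom sup]
  note FP = friedrichs_velte_second_imp_improved_poincare_rot[OF _ H]
    and PF = improved_poincare_rot_imp_friedrichs_velte_second
  show "supports (friedrichs_velte_second X) \<longleftrightarrow> supports (babuska_aziz_rot X)"
    using friedrichs_velte_second_imp_babuska_aziz babuska_aziz_rot_imp_friedrichs_velte_second
    unfolding supports_def by blast
  show eq: "supports (friedrichs_velte_second X) \<longleftrightarrow> supports (improved_poincare_rot X)"
    using FP PF unfolding supports_def by blast
  show "supports (improved_poincare_rot X) \<longrightarrow>
     1 / 4 * least_constant (friedrichs_velte_second X) \<le> least_constant (improved_poincare_rot X) \<and>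
     least_constant (improved_poincare_rot X)
       \<le> least_constant (hardy X) * (1 + least_constant (friedrichs_velte_second X))"
  proof
    assume P: "supports (improved_poincare_rot X)"
    have F: "supports (friedrichs_velte_second X)" using eq P by blast
    show "1 / 4 * least_constant (friedrichs_velte_second X) \<le> least_constant (improved_poincare_rot X) \<and>
       least_constant (improved_poincare_rot X)
         \<le> least_constant (hardy X) * (1 + least_constant (friedrichs_velte_second X))"
      by (rule least_constant_comparison[where F="friedrichs_velte_second X" and P="improved_poincare_rot X"])
        (fact F friedrichs_velte_second_nonneg friedrichs_velte_second_closed friedrichs_velte_second_mono
          P improved_poincare_rot_nonneg improved_poincare_rot_closed improved_poincare_rot_mono PF FP)+
  qed
qed

end

theorem theorem3p13:
  shows
  "(\<forall>\<Omega> :: (real^2) set. bounded_domain \<Omega> \<and> supports (hardy \<Omega>) \<longrightarrow>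
      (supports (friedrichs_velte conj_harmonic2 \<Omega>) \<longleftrightarrow> supports (babuska_aziz_div \<Omega>)) \<and>
      (supports (friedrichs_velte conj_harmonic2 \<Omega>) \<longleftrightarrow> supports (improved_poincare \<Omega>)) \<and>
      (supports (improved_poincare \<Omega>) \<longrightarrow>
         1 / 4 * least_constant (friedrichs_velte conj_harmonic2 \<Omega>)
           \<le> least_constant (improved_poincare \<Omega>) \<and>
         least_constant (improved_poincare \<Omega>)
           \<le> least_constant (hardy \<Omega>) *
              (1 + least_constant (friedrichs_velte conj_harmonic2 \<Omega>))))
   \<and>
   (\<forall>\<Omega> :: (real^3) set. bounded_domain \<Omega> \<and> supports (hardy \<Omega>) \<longrightarrow>
      ((supports (friedrichs_velte conj_harmonic3 \<Omega>) \<longleftrightarrow> supports (babuska_aziz_div \<Omega>)) \<and>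
       (supports (friedrichs_velte conj_harmonic3 \<Omega>) \<longleftrightarrow> supports (improved_poincare \<Omega>)) \<and>
       (supports (improved_poincare \<Omega>) \<longrightarrow>
          1 / 4 * least_constant (friedrichs_velte conj_harmonic3 \<Omega>)
            \<le> least_constant (improved_poincare \<Omega>) \<and>
          least_constant (improved_poincare \<Omega>)
            \<le> least_constant (hardy \<Omega>) *
               (1 + least_constant (friedrichs_velte conj_harmonic3 \<Omega>)))) \<and>
      ((supports (friedrichs_velte_second \<Omega>) \<longleftrightarrow> supports (babuska_aziz_rot \<Omega>)) \<and>
       (supports (friedrichs_velte_second \<Omega>) \<longleftrightarrow> supports (improved_poincare_rot \<Omega>)) \<and>
       (supports (improved_poincare_rot \<Omega>) \<longrightarrow>
          1 / 4 * least_constant (friedrichs_velte_second \<Omega>)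
            \<le> least_constant (improved_poincare_rot \<Omega>) \<and>
          least_constant (improved_poincare_rot \<Omega>)
            \<le> least_constant (hardy \<Omega>) *
               (1 + least_constant (friedrichs_velte_second \<Omega>)))))"
proof (rule conjI; intro allI impI)
  fix \<Omega> :: "(real^2) set" assume "bounded_domain \<Omega> \<and> supports (hardy \<Omega>)"
  then show "(supports (friedrichs_velte conj_harmonic2 \<Omega>) \<longleftrightarrow> supports (babuska_aziz_div \<Omega>)) \<and>
      (supports (friedrichs_velte conj_harmonic2 \<Omega>) \<longleftrightarrow> supports (improved_poincare \<Omega>)) \<and>
      (supports (improved_poincare \<Omega>) \<longrightarrow>
         1 / 4 * least_constant (friedrichs_velte conj_harmonic2 \<Omega>)
           \<le> least_constant (improved_poincare \<Omega>) \<and>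
         least_constant (improved_poincare \<Omega>)
           \<le> least_constant (hardy \<Omega>) *
              (1 + least_constant (friedrichs_velte conj_harmonic2 \<Omega>)))"
    by (intro conjugate_domain.divergence_equivalence[OF conjugate_domain_rot2]) auto
next
  fix \<Omega> :: "(real^3) set" assume \<Omega>: "bounded_domain \<Omega> \<and> supports (hardy \<Omega>)"
  have c: "conjugate_domain rot3 \<Omega> conj_harmonic3" using \<Omega> conjugate_domain_rot3 by blast
  have r: "rot_domain \<Omega>" using \<Omega> by (simp add: rot_domain_def)
  show "((supports (friedrichs_velte conj_harmonic3 \<Omega>) \<longleftrightarrow> supports (babuska_aziz_div \<Omega>)) \<and>
       (supports (friedrichs_velte conj_harmonic3 \<Omega>) \<longleftrightarrow> supports (improved_poincare \<Omega>)) \<and>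
       (supports (improved_poincare \<Omega>) \<longrightarrow>
          1 / 4 * least_constant (friedrichs_velte conj_harmonic3 \<Omega>)
            \<le> least_constant (improved_poincare \<Omega>) \<and>
          least_constant (improved_poincare \<Omega>)
            \<le> least_constant (hardy \<Omega>) *
               (1 + least_constant (friedrichs_velte conj_harmonic3 \<Omega>)))) \<and>
      ((supports (friedrichs_velte_second \<Omega>) \<longleftrightarrow> supports (babuska_aziz_rot \<Omega>)) \<and>
       (supports (friedrichs_velte_second \<Omega>) \<longleftrightarrow> supports (improved_poincare_rot \<Omega>)) \<and>
       (supports (improved_poincare_rot \<Omega>) \<longrightarrow>
          1 / 4 * least_constant (friedrichs_velte_second \<Omega>)
            \<le> least_constant (improved_poincare_rot \<Omega>) \<and>
          least_constant (improved_poincare_rot \<Omega>)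
            \<le> least_constant (hardy \<Omega>) *
               (1 + least_constant (friedrichs_velte_second \<Omega>))))"
    by (rule conjI[OF conjugate_domain.divergence_equivalence[OF c] rot_domain.rotation_equivalence[OF r]])
qed

end
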